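(* Let $\Omega \subseteq \mathbb{R}^d$ be a (Lebesgue measurable) set of finite measure $|\Omega|$. For every $\varepsilon > 0$, there exists a countable set $\Lambda \subseteq \mathbb{R}^d$ satisfying $D^-(\Lambda) \ge (1-\varepsilon)|\Omega|$ and such that $\{ e^{2\pi i \lambda \cdot x}\, \mathbf{1}_\Omega(x) \}_{\lambda \in \Lambda}$ (as functions of $x$) is a Riesz sequence in $L^2(\Omega)$. Moreover, the Riesz bounds (lower and upper, respectively) can be chosen as $c_1(\varepsilon)|\Omega|$ and $c_2|\Omega|$ for constants $c_1(\varepsilon), c_2 > 0$, where $c_1(\varepsilon)$ only depends on $\varepsilon$.
   Context: The lower Beurling density of $\Lambda \subseteq \mathbb{R}^d$ is $$D^-(\Lambda) = \liminf_{r\to\infty} \inf_{x \in \mathbb{R}^d} \frac{\#(\Lambda \cap B_r(x))}{|B_r(x)|},$$ where $B_r(x)$ is the open Euclidean ball and $|\cdot|$ is Lebesgue measure. $\mathbf{1}_\Omega$ is the indicator function of $\Omega$. A countable family $\{g_i\}_{i\in I}$ in a Hilbert space is a Riesz sequence with Riesz bounds $A,B$ (lower and upper) if $A\|c\|^2 \le \|\sum_{i\in I} c_i g_i\|^2 \le B\|c\|^2$ for all $c \in \ell^2(I)$. *)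

theory Defs
  imports "HOL-Analysis.Analysis"
begin

text \<open>
  Euclidean space of dimension \<open>d\<close> is modelled on the carrier \<open>{..<d} \<rightarrow>\<^sub>E UNIV\<close> rather than on a
  type, so that \<open>d\<close> can be quantified inside a formula and constants can be required not to
  depend on \<open>d\<close>.
\<close>

definition lebesgue_dim :: "nat \<Rightarrow> (nat \<Rightarrow> real) measure" where
  "lebesgue_dim d = completion (Pi\<^sub>M {..<d} (\<lambda>_. lborel))"

definition inner_dim :: "nat \<Rightarrow> (nat \<Rightarrow> real) \<Rightarrow> (nat \<Rightarrow> real) \<Rightarrow> real" where
  "inner_dim d x y = (\<Sum>i<d. x i * y i)"

definition ball_dim :: "nat \<Rightarrow> (nat \<Rightarrow> real) \<Rightarrow> real \<Rightarrow> (nat \<Rightarrow> real) set" where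
  "ball_dim d x r = {y \<in> {..<d} \<rightarrow>\<^sub>E UNIV. L2_set (\<lambda>i. y i - x i) {..<d} < r}"

text \<open>
  Points are counted with the counting measure, which, unlike \<open>card\<close>, is infinite on infinite sets.
\<close>

definition lower_beurling_density :: "nat \<Rightarrow> (nat \<Rightarrow> real) set \<Rightarrow> ennreal" where
  "lower_beurling_density d \<Lambda> =
     Liminf at_top (\<lambda>r::real. INF x\<in>{..<d} \<rightarrow>\<^sub>E UNIV.
       emeasure (count_space UNIV) (\<Lambda> \<inter> ball_dim d x r) / emeasure (lebesgue_dim d) (ball_dim d x r))"

text \<open>
  Elements of \<open>L\<^sup>2(M)\<close> are represented by functions, not by classes modulo null sets.
\<close>

definition L2_space :: "'a measure \<Rightarrow> ('a \<Rightarrow> complex) set" where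
  "L2_space M = {f \<in> borel_measurable M. integrable M (\<lambda>x. (cmod (f x))\<^sup>2)}"

definition L2_norm :: "'a measure \<Rightarrow> ('a \<Rightarrow> complex) \<Rightarrow> real" where
  "L2_norm M f = sqrt (\<integral>x. (cmod (f x))\<^sup>2 \<partial>M)"

text \<open>
  Unconditional convergence in \<open>L\<^sup>2(M)\<close>; the sum is unique only up to equality almost everywhere.
\<close>

definition has_L2_sum :: "'a measure \<Rightarrow> ('i \<Rightarrow> 'a \<Rightarrow> complex) \<Rightarrow> 'i set \<Rightarrow> ('a \<Rightarrow> complex) \<Rightarrow> bool" where
  "has_L2_sum M h I f \<longleftrightarrow>
     f \<in> L2_space M \<and>
     ((\<lambda>F. L2_norm M (\<lambda>x. (\<Sum>i\<in>F. h i x) - f x)) \<longlongrightarrow> 0) (finite_subsets_at_top I)"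

text \<open>
  The bounds are not required to be positive here, since a bound proportional to the measure
  of a set vanishes on null sets; positivity is part of \<open>riesz_sequence\<close>.
\<close>

definition riesz_bounds ::
    "'a measure \<Rightarrow> ('i \<Rightarrow> 'a \<Rightarrow> complex) \<Rightarrow> 'i set \<Rightarrow> real \<Rightarrow> real \<Rightarrow> bool" where
  "riesz_bounds M g I A B \<longleftrightarrow>
     countable I \<and> (\<forall>i\<in>I. g i \<in> L2_space M) \<and>
     (\<forall>c::'i \<Rightarrow> complex. (\<lambda>i. (cmod (c i))\<^sup>2) summable_on I \<longrightarrow>
        (\<exists>f. has_L2_sum M (\<lambda>i x. c i * g i x) I f \<and>
             A * (\<Sum>\<^sub>\<infinity>i\<in>I. (cmod (c i))\<^sup>2) \<le> (L2_norm M f)\<^sup>2 \<and>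
             (L2_norm M f)\<^sup>2 \<le> B * (\<Sum>\<^sub>\<infinity>i\<in>I. (cmod (c i))\<^sup>2)))"

definition riesz_sequence :: "'a measure \<Rightarrow> ('i \<Rightarrow> 'a \<Rightarrow> complex) \<Rightarrow> 'i set \<Rightarrow> bool" where
  "riesz_sequence M g I \<longleftrightarrow> (\<exists>A>0. \<exists>B>0. riesz_bounds M g I A B)"

definition exponential_on ::
    "nat \<Rightarrow> (nat \<Rightarrow> real) set \<Rightarrow> (nat \<Rightarrow> real) \<Rightarrow> (nat \<Rightarrow> real) \<Rightarrow> complex" where
  "exponential_on d \<Omega> \<xi> x = exp (2 * of_real pi * \<i> * of_real (inner_dim d \<xi> x)) * indicator \<Omega> x"

end

theory Submission
 imports Defs "HOL-Analysis.Analysis" "HOL-Computational_Algebra.Fundamental_Theorem_Algebra"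
  "Jordan_Normal_Form.Determinant" "HOL-Library.Diagonal_Subsequence"
begin

text \<open>
  A bounded grid set \<open>J\<close> approximating \<open>\<Omega>\<close> turns exponentials into the tight frame of vectors
  \<open>e(\<nu> \<bullet> j / q)\<close> on \<open>J\<close>, where \<open>\<nu>\<close> runs over the box \<open>{0..<q}^d\<close>. Repeated use of the
  Marcus-Spielman-Srivastava theorem (proved by the barrier method) thins this frame to frequencies
  \<open>L\<close> that still form a frame, with bounds in an absolute ratio. Among the subsets of \<open>L\<close>, one that
  maximizes a regularized Gram determinant is almost spanning, and no vector of it is nearly dependent on
  the others; pairing nearby frequencies and colouring the pairs by the same theorem gives a Riesz
  sequence with lower bound depending on \<open>\<epsilon>\<close> only, at the cost of a small proportion of points.
  Since the kernel of \<open>J\<close> decays away from the diagonal on average, the dimension count can be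
  localized, so every tile of fixed size keeps at least \<open>(1 - \<epsilon>) |\<Omega>|\<close> points per unit volume. Keeping
  the same number of points in each tile makes compactness trivial: as the grid is refined, the points
  converge along a diagonal subsequence, and the finite Riesz inequalities pass to the limit and
  show that the limit points are distinct.
\<close>

text \<open>The lower bound may depend on neither d nor \<Omega>, so every loss that reaches it must
  be dimension free. What depends on d and on the shape of \<Omega> is pushed into auxiliary scales:
  \<epsilon> alone determines the number l of halvings, the accuracy e and the regularization
  \<gamma>; only then come the admissible leakage \<tau>, the length 1/\<rho> on which \<Omega>
  looks translation invariant, the tile size r and finally the mesh. The regularization has two
  uses: approximate expansions in the chosen vectors get coefficients bounded in l2, and a lower
  Riesz bound becomes the statement that the identity stays strictly below I + Gram/\<gamma>. Each
  round of pairing keeps a quarter of that slack and leaves about half of the points undecided, so l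
  rounds lose a fraction 2^(-l) of the points and a factor 4^(-l) in the bound. For a general
  \<Omega> the Fourier kernel has no pointwise decay. A short translation changes \<Omega> little,
  though, and this bounds the mass of the squared kernel away from the diagonal. Counting points per
  tile is therefore done with traces, which such averages control.\<close>

abbreviation vecs :: "nat => (nat => 'a) set" where
 "vecs d \<equiv> {..<d} \<rightarrow>\<^sub>E UNIV"

section \<open>Matrices over finite index sets\<close>

text \<open>The matrices of \<open>Jordan_Normal_Form\<close> are indexed by initial segments of the
  naturals. A fixed arbitrary enumeration carries their determinant over to any finite index set, so
  that subsets and products of index sets need no renumbering later.\<close>

definition enum :: "'i set => nat => 'i" where
 "enum I = (SOME e. bij_betw e {..<card I} I)"

lemma enum_bij: "finite I ==> bij_betw (enum I) {..<card I} I"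
 unfolding enum_def lessThan_atLeast0
 by (rule someI_ex[of "%e. bij_betw e {0..<card I} I"]) (rule ex_bij_betw_nat_finite)

definition fmat :: "'i set => ('i => 'i => complex) => complex mat" where
 "fmat I H = Matrix.mat (card I) (card I) (%(a,b). H (enum I a) (enum I b))"

definition fdet :: "'i set => ('i => 'i => complex) => complex" where
 "fdet I H = Determinant.det (fmat I H)"

lemma fmat_carrier [simp]: "fmat I H \<in> carrier_mat (card I) (card I)"
 by (simp add: fmat_def)

lemma enum_in: "finite I ==> a < card I ==> enum I a \<in> I"
 using enum_bij bij_betwE by fastforce

lemma enum_eq_iff: "finite I ==> a < card I ==> b < card I ==> enum I a = enum I b \<longleftrightarrow> a = b"
 using enum_bij[of I] by (auto simp: bij_betw_def inj_on_def)

lemma enum_surj: "finite I ==> i \<in> I ==> \<exists>a<card I. i = enum I a"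
 using bij_betw_imp_surj_on[OF enum_bij[of I]] by blast

lemma fdet_cong:
 assumes "finite I" "\<And>i j. i \<in> I ==> j \<in> I ==> H i j = K i j"
 shows "fdet I H = fdet I K"
proof -
 have "fmat I H = fmat I K"
  unfolding fmat_def by (rule eq_matI) (auto simp: enum_in assms)
 then show ?thesis by (simp add: fdet_def)
qed

lemma sum_enum: "finite I ==> (\<Sum>a<card I. g (enum I a)) = (\<Sum>i\<in>I. g i)"
 by (rule sum.reindex_bij_betw[OF enum_bij])

lemma fdet_leibniz:
 "fdet I H = (\<Sum>p | p permutes {..<card I}. signof p * (\<Prod>a<card I. H (enum I a) (enum I (p a))))"
proof -
 have *: "a < card I ==> p permutes {..<card I} ==> p a < card I" for a p
  using permutes_in_image by fastforce
 show ?thesis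
  unfolding fdet_def det_def'[OF fmat_carrier] atLeast0LessThan
  by (intro sum.cong refl arg_cong2[of _ _ _ _ "(*)"] prod.cong) (simp_all add: fmat_def *)
qed

lemma fmat_mult_index:
 assumes "finite I" "a < card I"
 shows "vec_index (fmat I H *\<^sub>v Matrix.vec (card I) (%b. c (enum I b))) a =
  (\<Sum>j\<in>I. H (enum I a) j * c j)"
proof -
 have "vec_index (fmat I H *\<^sub>v Matrix.vec (card I) (%b. c (enum I b))) a =
  (\<Sum>b<card I. H (enum I a) (enum I b) * c (enum I b))"
  unfolding fmat_def mult_mat_vec_def scalar_prod_def using assms(2) by (simp add: atLeast0LessThan)
 also have "... = (\<Sum>j\<in>I. H (enum I a) j * c j)"
  by (rule sum_enum[OF assms(1), of "%j. H (enum I a) j * c j"])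
 finally show ?thesis .
qed

lemma fdet_mult_vec:
 assumes "finite I"
 shows "fmat I H *\<^sub>v Matrix.vec (card I) (%b. c (enum I b)) =
  Matrix.vec (card I) (%a. \<Sum>j\<in>I. H (enum I a) j * c j)" (is "?l = ?r")
proof (rule eq_vecI)
 show "vec_index ?l a = vec_index ?r a" if "a < dim_vec ?r" for a
 proof -
  have a: "a < card I" using that by simp
  show ?thesis unfolding index_vec[OF a] by (rule fmat_mult_index[OF assms a])
 qed
 show "dim_vec ?l = dim_vec ?r" unfolding fmat_def by simp
qed

lemma vec_as_enum:
 assumes I: "finite I" and v: "v \<in> carrier_vec (card I)"
 shows "\<exists>c. v = Matrix.vec (card I) (%b. c (enum I b))"
proof -
 have "v = Matrix.vec (card I) (%b. vec_index v (inv_into {..<card I} (enum I) (enum I b)))" (is "v = ?w")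
 proof (rule eq_vecI)
  show "dim_vec v = dim_vec ?w" using v by (simp only: carrier_vecD dim_vec)
  fix a assume "a < dim_vec ?w"
  then have a: "a < card I" by simp
  have "inv_into {..<card I} (enum I) (enum I a) = a"
   by (rule bij_betw_inv_into_left[OF enum_bij[OF I]]) (use a in simp)
  then show "vec_index v a = vec_index ?w a" unfolding index_vec[OF a] by (simp only:)
 qed
 then show ?thesis by (rule exI[of _ "%i. vec_index v (inv_into {..<card I} (enum I) i)"])
qed

lemma fdet_0_iff:
 assumes "finite I"
 shows "fdet I H = 0 \<longleftrightarrow> (\<exists>c. (\<exists>i\<in>I. c i \<noteq> 0) \<and> (\<forall>i\<in>I. (\<Sum>j\<in>I. H i j * c j) = 0))"
proof -
 have vz: "Matrix.vec (card I) (%b. g (enum I b)) = 0\<^sub>v (card I) \<longleftrightarrow> (\<forall>i\<in>I. g i = 0)" for g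
 proof -
  have "Matrix.vec (card I) (%b. g (enum I b)) = 0\<^sub>v (card I) \<longleftrightarrow> (\<forall>b<card I. g (enum I b) = 0)"
   by (subst Matrix.vec_eq_iff) auto
  also have "... \<longleftrightarrow> (\<forall>i\<in>I. g i = 0)"
   using enum_surj[OF assms] enum_in[OF assms] by blast
  finally show ?thesis .
 qed
 show ?thesis
  unfolding fdet_def det_0_iff_vec_prod_zero_field[OF fmat_carrier]
 proof safe
  fix v assume v: "v \<in> carrier_vec (card I)" "v \<noteq> 0\<^sub>v (card I)" "fmat I H *\<^sub>v v = 0\<^sub>v (card I)"
  obtain c where c: "v = Matrix.vec (card I) (%b. c (enum I b))"
   using vec_as_enum[OF assms v(1)] by blast
  show "\<exists>c. (\<exists>i\<in>I. c i \<noteq> 0) \<and> (\<forall>i\<in>I. (\<Sum>j\<in>I. H i j * c j) = 0)"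
   using v(2,3)[unfolded c fdet_mult_vec[OF assms] vz[of c] vz[of "%i. \<Sum>j\<in>I. H i j * c j"]] by blast
 next
  fix c i assume c: "\<forall>i\<in>I. (\<Sum>j\<in>I. H i j * c j) = 0" "i \<in> I" "c i \<noteq> 0"
  show "\<exists>v. v \<in> carrier_vec (card I) \<and> v \<noteq> 0\<^sub>v (card I) \<and> fmat I H *\<^sub>v v = 0\<^sub>v (card I)"
   by (rule exI[of _ "Matrix.vec (card I) (%b. c (enum I b))"])
    (unfold fdet_mult_vec[OF assms] vz[of c] vz[of "%i. \<Sum>j\<in>I. H i j * c j"], use c in auto)
 qed
qed

lemma linear_solve:
 fixes H :: "'i => 'i => complex"
 assumes "finite I"
  and ker: "\<And>c. (\<And>i. i \<in> I ==> (\<Sum>j\<in>I. H i j * c j) = 0) ==> \<forall>i\<in>I. c i = 0"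
 obtains y where "\<And>i. i \<in> I ==> (\<Sum>j\<in>I. H i j * y j) = b i"
proof -
 have "fdet I H \<noteq> 0"
 proof
  assume "fdet I H = 0"
  then obtain c i where "i \<in> I" "c i \<noteq> 0" "\<forall>i\<in>I. (\<Sum>j\<in>I. H i j * c j) = 0"
   unfolding fdet_0_iff[OF assms(1)] by blast
  then show False using ker[of c] by simp
 qed
 then have "fmat I H \<in> Units (ring_mat TYPE(complex) (card I) ())"
  unfolding fdet_def by (intro det_non_zero_imp_unit) auto
 then obtain B where B: "B \<in> carrier_mat (card I) (card I)" "fmat I H * B = 1\<^sub>m (card I)"
  unfolding Units_def ring_mat_simps by blast
 let ?b = "Matrix.vec (card I) (%a. b (enum I a))"
 have 1: "fmat I H *\<^sub>v (B *\<^sub>v ?b) = ?b"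
  using assoc_mult_mat_vec[OF fmat_carrier[of I H] B(1) vec_carrier[of "card I" "%a. b (enum I a)"]]
  unfolding B(2) one_mult_mat_vec[OF vec_carrier] by (rule sym)
 obtain y where y: "B *\<^sub>v ?b = Matrix.vec (card I) (%a. y (enum I a))"
  using vec_as_enum[OF assms(1) mult_mat_vec_carrier[OF B(1) vec_carrier]] by blast
 have 2: "Matrix.vec (card I) (%a. \<Sum>j\<in>I. H (enum I a) j * y j) = ?b"
  using 1 unfolding y fdet_mult_vec[OF assms(1)] .
 show ?thesis
 proof (rule that[of y])
  fix i assume "i \<in> I"
  from enum_surj[OF assms(1) this] obtain a where a: "a < card I" "i = enum I a" by iprover
  show "(\<Sum>j\<in>I. H i j * y j) = b i"
   using arg_cong[OF 2, of "%v. vec_index v a"] unfolding index_vec[OF a(1)] a(2) .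
 qed
qed

text \<open>Every Leibniz term contains exactly one entry of row k. This linearity is the source
  both of the affine dependence of \<open>dpoly\<close> on each variable and of the recursion for
  the minors \<open>vol\<close>.\<close>

lemma fdet_row_affine:
 assumes I: "finite I" "k \<in> I"
 shows "fdet I (H(k := %j. a j + t * b j)) = fdet I (H(k := a)) + t * fdet I (H(k := b))"
proof -
 obtain ka where ka: "ka < card I" "enum I ka = k"
  using enum_surj[OF I] by metis
 have *: "(\<Prod>x<card I. (H(k := r)) (enum I x) (enum I (p x))) =
   r (enum I (p ka)) * (\<Prod>x\<in>{..<card I} - {ka}. H (enum I x) (enum I (p x)))" for r and p :: "nat => nat"
 proof -
  have "(\<Prod>x\<in>{..<card I} - {ka}. (H(k := r)) (enum I x) (enum I (p x))) =
   (\<Prod>x\<in>{..<card I} - {ka}. H (enum I x) (enum I (p x)))"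
  proof (rule prod.cong[OF refl])
   fix x assume "x \<in> {..<card I} - {ka}"
   then have "enum I x \<noteq> k" using enum_eq_iff[OF I(1), of x ka] ka by auto
   then show "(H(k := r)) (enum I x) (enum I (p x)) = H (enum I x) (enum I (p x))" by simp
  qed
  moreover have "(\<Prod>x<card I. (H(k := r)) (enum I x) (enum I (p x))) = (H(k := r)) (enum I ka) (enum I (p ka)) *
   (\<Prod>x\<in>{..<card I} - {ka}. (H(k := r)) (enum I x) (enum I (p x)))"
   by (rule prod.remove) (use ka(1) in simp_all)
  ultimately show ?thesis using ka(2) by (simp only: fun_upd_same)
 qed
 have **: "signof p * (\<Prod>x<card I. (H(k := %j. a j + t * b j)) (enum I x) (enum I (p x))) =
  signof p * (\<Prod>x<card I. (H(k := a)) (enum I x) (enum I (p x))) +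
  t * (signof p * (\<Prod>x<card I. (H(k := b)) (enum I x) (enum I (p x))))" for p :: "nat => nat"
  unfolding * by (simp only: distrib_left distrib_right mult.assoc mult.left_commute)
 show ?thesis
  unfolding fdet_leibniz sum_distrib_left sum.distrib[symmetric] ** ..
qed

lemma fdet_one: "finite I ==> fdet I (%i j. if i = j then 1 else 0) = 1"
proof -
 assume I: "finite I"
 have "fmat I (%i j. if i = j then 1 else 0) = 1\<^sub>m (card I)"
  unfolding fmat_def by (rule eq_matI) (auto simp: enum_eq_iff[OF I])
 then show ?thesis by (simp add: fdet_def)
qed

lemma fdet_transpose: "fdet I (%i j. H j i) = fdet I H"
proof -
 have "fmat I (%i j. H j i) = transpose_mat (fmat I H)"
  unfolding fmat_def by (rule eq_matI) auto
 then show ?thesis by (simp add: fdet_def det_transpose[OF fmat_carrier])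
qed

lemma fdet_cnj: "fdet I (%i j. cnj (H i j)) = cnj (fdet I H)"
proof -
 have "cnj (of_int (sign p)) = of_int (sign p)" for p :: "nat => nat" by simp
 then show ?thesis unfolding fdet_leibniz by simp
qed

lemma coeff_prod_linear:
 fixes a b :: "nat => complex"
 shows "degree (\<Prod>i<n. [:a i, b i:]) <= n \<and> Polynomial.coeff (\<Prod>i<n. [:a i, b i:]) n = (\<Prod>i<n. b i)"
proof (induction n)
 case (Suc n)
 let ?P = "\<Prod>i<n. [:a i, b i:]"
 have "degree (?P * [:a n, b n:]) <= degree ?P + degree [:a n, b n:]" by (rule degree_mult_le)
 also have "degree [:a n, b n:] <= 1" by simp
 finally have 1: "degree (?P * [:a n, b n:]) <= Suc n" using Suc by simp
 have "Polynomial.coeff ?P (Suc n) = 0" using Suc by (simp add: coeff_eq_0)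
 then have "Polynomial.coeff (?P * [:a n, b n:]) (Suc n) = (\<Prod>i<Suc n. b i)"
  using Suc by (simp add: mult.commute)
 with 1 show ?case by simp
qed simp

text \<open>Each Leibniz term is a product of \<open>card I\<close> factors linear in t, and the top
  coefficients add up to the determinant of the direction B. This controls the growth of stable
  polynomials along lines.\<close>

lemma fdet_pencil_poly:
 "\<exists>p. Polynomial.degree p <= card I \<and> Polynomial.coeff p (card I) = fdet I B \<and>
   (\<forall>t. fdet I (%i j. A i j + t * B i j) = poly p t)"
proof -
 let ?n = "card I"
 define q where "q p = Polynomial.smult (signof p) (\<Prod>x<?n. [:A (enum I x) (enum I (p x)), B (enum I x) (enum I (p x)):])"
  for p :: "nat => nat"
 have d: "degree (q p) <= ?n" for p
  unfolding q_def by (rule order_trans[OF degree_smult_le]) (simp only: coeff_prod_linear)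
 define P where "P = (\<Sum>p | p permutes {..<?n}. q p)"
 show ?thesis
 proof (intro exI[of _ P] conjI allI)
  show "degree P <= ?n" unfolding P_def by (rule degree_sum_le) (auto simp: d finite_permutations)
  show "Polynomial.coeff P ?n = fdet I B"
   unfolding P_def coeff_sum fdet_leibniz q_def coeff_smult
   by (rule sum.cong[OF refl]) (simp only: coeff_prod_linear)
  show "fdet I (%i j. A i j + t * B i j) = poly P t" for t
   unfolding P_def poly_sum fdet_leibniz q_def poly_smult poly_prod
   by (simp only: poly_pCons poly_0 mult_zero_right add_0_right)
 qed
qed

section \<open>Hermitian forms\<close>

text \<open>Conjugate linear in the first argument, so that \<open>ip J (u i) f\<close> is the
  analysis coefficient of f at the frame vector \<open>u i\<close>.\<close>

definition ip :: "'j set => ('j => complex) => ('j => complex) => complex" where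
 "ip J x f = (\<Sum>j\<in>J. cnj (x j) * f j)"

definition nsq :: "'j set => ('j => complex) => real" where
 "nsq J f = (\<Sum>j\<in>J. (cmod (f j))^2)"

definition mv :: "'j set => ('j => 'j => complex) => ('j => complex) => 'j => complex" where
 "mv J H f i = (\<Sum>j\<in>J. H i j * f j)"

definition hermitian :: "'j set => ('j => 'j => complex) => bool" where
 "hermitian J H \<longleftrightarrow> (\<forall>i\<in>J. \<forall>j\<in>J. H j i = cnj (H i j))"

definition qf :: "'j set => ('j => 'j => complex) => ('j => complex) => real" where
 "qf J H f = Re (ip J f (mv J H f))"

definition psd :: "'j set => ('j => 'j => complex) => bool" where
 "psd J H \<longleftrightarrow> hermitian J H \<and> (\<forall>f. qf J H f \<ge> 0)"

definition pd :: "'j set => ('j => 'j => complex) => bool" where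
 "pd J H \<longleftrightarrow> hermitian J H \<and> (\<forall>f. (\<exists>j\<in>J. f j \<noteq> 0) \<longrightarrow> qf J H f > 0)"

lemma ip_add_right: "ip J x (%j. f j + g j) = ip J x f + ip J x g"
 unfolding ip_def distrib_left sum.distrib ..

lemma ip_diff_right: "ip J x (%j. f j - g j) = ip J x f - ip J x g"
 unfolding ip_def right_diff_distrib sum_subtractf ..

lemma ip_scale_right: "ip J x (%j. a * f j) = a * ip J x f"
 unfolding ip_def sum_distrib_left by (rule sum.cong[OF refl]) (simp only: mult.left_commute)

lemma ip_cnj: "cnj (ip J x f) = ip J f x"
 unfolding ip_def cnj_sum complex_cnj_mult complex_cnj_cnj by (simp only: mult.commute)

lemma ip_add_left: "ip J (%j. f j + g j) x = ip J f x + ip J g x"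
 by (metis ip_add_right ip_cnj complex_cnj_add)

lemma ip_diff_left: "ip J (%j. f j - g j) x = ip J f x - ip J g x"
 by (metis ip_diff_right ip_cnj complex_cnj_diff)

lemma ip_scale_left: "ip J (%j. a * f j) x = cnj a * ip J f x"
 by (metis ip_scale_right ip_cnj complex_cnj_mult)

lemma ip_sum_right: "ip J x (%j. \<Sum>k\<in>K. f k j) = (\<Sum>k\<in>K. ip J x (f k))"
 unfolding ip_def sum_distrib_left by (rule sum.swap)

lemma ip_sum_left: "ip J (%j. \<Sum>k\<in>K. f k j) x = (\<Sum>k\<in>K. ip J (f k) x)"
proof -
 have "ip J (%j. \<Sum>k\<in>K. f k j) x = cnj (\<Sum>k\<in>K. ip J x (f k))"
  unfolding ip_sum_right[symmetric] ip_cnj ..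
 then show ?thesis unfolding cnj_sum ip_cnj .
qed

lemma ip_zero_right [simp]: "ip J x (%_. 0) = 0"
 unfolding ip_def by simp

lemma ip_cong: "(\<And>j. j \<in> J ==> x j = x' j) ==> (\<And>j. j \<in> J ==> f j = f' j) ==> ip J x f = ip J x' f'"
 unfolding ip_def by (rule sum.cong) auto

lemma ip_self: "ip J f f = of_real (nsq J f)"
 unfolding ip_def nsq_def of_real_sum
 by (rule sum.cong[OF refl]) (simp only: complex_norm_square mult.commute)

lemma nsq_nonneg: "nsq J f \<ge> 0"
 unfolding nsq_def by (rule sum_nonneg) simp

lemma nsq_eq_0: "finite J ==> nsq J f = 0 \<longleftrightarrow> (\<forall>j\<in>J. f j = 0)"
 unfolding nsq_def by (subst sum_nonneg_eq_0_iff) auto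

lemma nsq_pos: "finite J ==> j \<in> J ==> f j \<noteq> 0 ==> nsq J f > 0"
 using nsq_eq_0[of J f] nsq_nonneg[of J f] by force

lemma nsq_scale: "nsq J (%j. a * f j) = (cmod a)^2 * nsq J f"
 unfolding nsq_def norm_mult power_mult_distrib sum_distrib_left ..

lemma mv_add: "mv J H (%j. f j + g j) i = mv J H f i + mv J H g i"
 unfolding mv_def distrib_left sum.distrib ..

lemma mv_scale: "mv J H (%j. a * f j) i = a * mv J H f i"
 unfolding mv_def sum_distrib_left by (rule sum.cong[OF refl]) (simp only: mult.left_commute)

lemma mv_sum: "mv J H (%j. \<Sum>k\<in>K. f k j) i = (\<Sum>k\<in>K. mv J H (f k) i)"
 unfolding mv_def sum_distrib_left by (rule sum.swap)

lemma ip_mv_double: "ip J f (mv J H g) = (\<Sum>i\<in>J. \<Sum>j\<in>J. cnj (f i) * H i j * g j)"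
 unfolding ip_def mv_def sum_distrib_left by (intro sum.cong refl) (simp only: mult.assoc)

lemma hermitian_ip:
 assumes "hermitian J H"
 shows "ip J f (mv J H g) = cnj (ip J g (mv J H f))"
proof -
 have "cnj (ip J g (mv J H f)) = (\<Sum>i\<in>J. \<Sum>j\<in>J. g i * cnj (H i j) * cnj (f j))"
  unfolding ip_mv_double cnj_sum complex_cnj_mult complex_cnj_cnj ..
 also have "... = (\<Sum>j\<in>J. \<Sum>i\<in>J. g i * cnj (H i j) * cnj (f j))"
  by (rule sum.swap)
 also have "... = (\<Sum>j\<in>J. \<Sum>i\<in>J. cnj (f j) * H j i * g i)"
 proof (intro sum.cong refl)
  fix i j assume "i \<in> J" "j \<in> J"
  then have h: "H j i = cnj (H i j)" using assms unfolding hermitian_def by blast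
  show "g i * cnj (H i j) * cnj (f j) = cnj (f j) * H j i * g i"
   unfolding h by (simp only: mult.assoc mult.commute mult.left_commute)
 qed
 finally show ?thesis unfolding ip_mv_double by (rule sym)
qed

lemma hermitian_adj: "hermitian J H ==> ip J f (mv J H g) = ip J (mv J H f) g"
 by (metis hermitian_ip ip_cnj)

lemma ip_mv_qf: "hermitian J H ==> ip J f (mv J H f) = of_real (qf J H f)"
 unfolding qf_def using hermitian_ip[of J H f f]
 by (metis Reals_cnj_iff of_real_Re)

lemma qf_scale: "qf J H (%j. a * f j) = (cmod a)^2 * qf J H f"
proof -
 have "mv J H (%j. a * f j) = (%i. a * mv J H f i)" by (rule ext) (rule mv_scale)
 then have "ip J (%j. a * f j) (mv J H (%j. a * f j)) = of_real ((cmod a)^2) * ip J f (mv J H f)"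
  by (simp add: ip_scale_left ip_scale_right complex_norm_square mult_ac flip: of_real_power)
 then show ?thesis unfolding qf_def by simp
qed

lemma qf_add:
 assumes "hermitian J H"
 shows "qf J H (%j. f j + g j) = qf J H f + qf J H g + 2 * Re (ip J f (mv J H g))"
proof -
 have "mv J H (%j. f j + g j) = (%i. mv J H f i + mv J H g i)" by (rule ext) (rule mv_add)
 then show ?thesis
  unfolding qf_def using hermitian_ip[OF assms, of g f] by (simp add: ip_add_left ip_add_right)
qed

lemma psd_hermitian: "psd J H ==> hermitian J H" unfolding psd_def by simp
lemma psd_qf: "psd J H ==> qf J H f \<ge> 0" unfolding psd_def by simp

lemma pd_psd: assumes "pd J H" shows "psd J H"
proof -
 have "qf J H f \<ge> 0" for f
 proof (cases "\<exists>j\<in>J. f j \<noteq> 0")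
  case True then show ?thesis using assms unfolding pd_def by (simp add: less_imp_le)
 next
  case False
  then have "ip J f (mv J H f) = 0" unfolding ip_def by simp
  then show ?thesis unfolding qf_def by simp
 qed
 then show ?thesis using assms unfolding psd_def pd_def by simp
qed

text \<open>With b = \<open>ip J f (mv J H g)\<close>, the form is nonnegative at t b f + g for
  every real t; the result is the discriminant condition of this quadratic in t.\<close>

lemma psd_cauchy:
 assumes "psd J H"
 shows "(cmod (ip J f (mv J H g)))^2 <= qf J H f * qf J H g"
proof -
 define b where "b = ip J f (mv J H g)"
 define B where "B = (cmod b)^2"
 note h = psd_hermitian[OF assms]
 have q: "0 <= t^2 * B * qf J H f + qf J H g + 2 * (t * B)" for t :: real
 proof -
  have 1: "Re (cnj (of_real t * b) * b) = t * B"
   unfolding B_def cmod_power2 by (simp add: algebra_simps power2_eq_square)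
  have "0 <= qf J H (%j. (of_real t * b) * f j + g j)" by (rule psd_qf[OF assms])
  also have "... = (cmod (of_real t * b))^2 * qf J H f + qf J H g + 2 * Re (cnj (of_real t * b) * b)"
   unfolding qf_add[OF h] qf_scale ip_scale_left b_def ..
  finally show ?thesis unfolding 1 norm_mult power_mult_distrib B_def by simp
 qed
 have B0: "B \<ge> 0" unfolding B_def by simp
 have g0: "qf J H f \<ge> 0" by (rule psd_qf[OF assms])
 have "B <= qf J H f * qf J H g"
 proof (cases "qf J H f = 0 \<or> B = 0")
  case True
  have "B = 0"
  proof (rule ccontr)
   assume n: "B \<noteq> 0"
   \<comment> \<open>Here the quadratic has no square term, so a sufficiently negative t contradicts
     nonnegativity.\<close>
   with True have "0 <= qf J H g + 2 * ((- (qf J H g + 1) / (2 * B)) * B)"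
    using q[of "- (qf J H g + 1) / (2 * B)"] by simp
   moreover have "(- (qf J H g + 1) / (2 * B)) * B = - (qf J H g + 1) / 2" using n by simp
   moreover have "qf J H g \<ge> 0" by (rule psd_qf[OF assms])
   ultimately show False by simp
  qed
  then show ?thesis using psd_qf[OF assms, of g] g0 by simp
 next
  case False
  then have p: "qf J H f > 0" "B > 0" using B0 g0 by auto
  have "0 <= (1 / qf J H f)^2 * B * qf J H f + qf J H g + 2 * ((- 1 / qf J H f) * B)"
   using q[of "- 1 / qf J H f"] by simp
  also have "... = qf J H g - B / qf J H f"
   using p by (simp add: power2_eq_square field_simps)
  finally show ?thesis using p by (simp add: field_simps)
 qed
 then show ?thesis unfolding B_def b_def .
qed

text \<open>By Cauchy-Schwarz H g is orthogonal to every f, in particular to itself: isotropic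
  vectors of a semidefinite form lie in its kernel.\<close>

lemma psd_qf0:
 assumes "psd J H" "qf J H g = 0" "finite J" "i \<in> J"
 shows "mv J H g i = 0"
proof -
 have "(cmod (ip J f (mv J H g)))^2 <= 0" for f
  using psd_cauchy[OF assms(1), of f g] assms(2) by simp
 then have "ip J (mv J H g) (mv J H g) = 0" by simp
 then have "nsq J (mv J H g) = 0" unfolding ip_self by simp
 then show ?thesis using nsq_eq_0 assms(3,4) by blast
qed

definition idm :: "'j => 'j => complex" where "idm i j = (if i = j then 1 else 0)"

lemma mv_idm: "finite J ==> i \<in> J ==> mv J idm f i = f i"
 unfolding mv_def idm_def by (simp add: if_distrib[of "%x. x * _"] cong: if_cong)

lemma qf_idm: "finite J ==> qf J idm f = nsq J f"
 unfolding qf_def by (subst ip_cong[where x'=f and f'=f]) (simp_all add: mv_idm ip_self)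

lemma psd_idm: "finite J ==> psd J idm"
 unfolding psd_def using qf_idm[of J] nsq_nonneg[of J] by (simp add: hermitian_def idm_def)

lemma ip_cauchy:
 assumes "finite J"
 shows "(cmod (ip J f g))^2 <= nsq J f * nsq J g"
proof -
 have "ip J f (mv J idm g) = ip J f g" by (rule ip_cong) (auto simp: mv_idm assms)
 then show ?thesis using psd_cauchy[OF psd_idm[OF assms], of f g] by (simp add: qf_idm assms)
qed

lemma pd_solve:
 assumes "finite J" "pd J H"
 shows "\<exists>y. \<forall>i\<in>J. mv J H y i = b i"
proof -
 have ker: "\<forall>i\<in>J. c i = 0" if "\<And>i. i \<in> J ==> (\<Sum>j\<in>J. H i j * c j) = 0" for c
 proof (rule ccontr)
  assume "\<not> (\<forall>i\<in>J. c i = 0)"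
  then have "qf J H c > 0" using assms(2) unfolding pd_def by blast
  moreover have "ip J c (mv J H c) = 0" unfolding ip_def mv_def using that by simp
  ultimately show False unfolding qf_def by simp
 qed
 obtain y where "\<And>i. i \<in> J ==> (\<Sum>j\<in>J. H i j * y j) = b i"
  using linear_solve[OF assms(1), of H b] ker by blast
 then show ?thesis unfolding mv_def by blast
qed

section \<open>Logarithmic derivatives and root locations of complex polynomials\<close>

text \<open>The two quotients are P'/P and -(P'/P)' at 0, so the right-hand sides are the usual sums
  over the roots r i.\<close>

lemma logderiv_prod:
 fixes r :: "nat => complex"
 assumes "\<And>i. i < n ==> r i \<noteq> 0"
 defines "P \<equiv> \<Prod>i<n. [:- r i, 1:]"
 shows "poly P 0 \<noteq> 0"
  and "poly (pderiv P) 0 / poly P 0 = (\<Sum>i<n. - (1 / r i))"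
  and "((poly (pderiv P) 0)^2 - poly P 0 * poly (pderiv (pderiv P)) 0) / (poly P 0)^2 = (\<Sum>i<n. 1 / (r i)^2)"
proof -
 have "poly P 0 \<noteq> 0 \<and> poly (pderiv P) 0 / poly P 0 = (\<Sum>i<n. - (1 / r i)) \<and>
  ((poly (pderiv P) 0)^2 - poly P 0 * poly (pderiv (pderiv P)) 0) / (poly P 0)^2 = (\<Sum>i<n. 1 / (r i)^2)"
  using assms(1) unfolding P_def
 proof (induction n)
  case (Suc n)
  let ?Q = "\<Prod>i<n. [:- r i, 1:]"
  define a b c where "a = poly ?Q 0" and "b = poly (pderiv ?Q) 0" and "c = poly (pderiv (pderiv ?Q)) 0"
  have IH: "a \<noteq> 0" "b / a = (\<Sum>i<n. - (1 / r i))" "(b^2 - a * c) / a^2 = (\<Sum>i<n. 1 / (r i)^2)"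
   unfolding a_def b_def c_def using Suc by auto
  have s: "r n \<noteq> 0" using Suc.prems by simp
  have P: "(\<Prod>i<Suc n. [:- r i, 1:]) = ?Q * [:- r n, 1:]" by simp
  have 1: "poly (?Q * [:- r n, 1:]) 0 = - r n * a"
   unfolding a_def poly_mult by simp
  have 2: "poly (pderiv (?Q * [:- r n, 1:])) 0 = a - r n * b"
   unfolding a_def b_def pderiv_mult by (simp add: pderiv_pCons)
  have 3: "poly (pderiv (pderiv (?Q * [:- r n, 1:]))) 0 = 2 * b - r n * c"
   unfolding b_def c_def pderiv_mult pderiv_add by (simp add: pderiv_pCons pderiv_mult pderiv_add)
  have "(a - r n * b) / (- r n * a) = b / a + - (1 / r n)"
   using IH(1) s by (simp add: field_simps)
  moreover have "((a - r n * b)\<^sup>2 - (- r n * a) * (2 * b - r n * c)) / (- r n * a)\<^sup>2 = (b\<^sup>2 - a * c) / a\<^sup>2 + 1 / (r n)\<^sup>2"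
   using IH(1) s by (simp add: field_simps power2_eq_square)
  ultimately show ?case unfolding P 1 2 3 IH(2,3) sum.lessThan_Suc using IH(1) s by simp
 qed simp
 then show "poly P 0 \<noteq> 0"
  and "poly (pderiv P) 0 / poly P 0 = (\<Sum>i<n. - (1 / r i))"
  and "((poly (pderiv P) 0)^2 - poly P 0 * poly (pderiv (pderiv P)) 0) / (poly P 0)^2 = (\<Sum>i<n. 1 / (r i)^2)"
  by blast+
qed

lemma poly_logderiv:
 fixes p :: "complex poly"
 assumes "poly p 0 \<noteq> 0"
 obtains n :: nat and r :: "nat => complex" where "\<And>i. i < n ==> poly p (r i) = 0" "\<And>i. i < n ==> r i \<noteq> (0::complex)"
  "poly (pderiv p) 0 / poly p 0 = (\<Sum>i<n. - (1 / r i))"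
  "((poly (pderiv p) 0)^2 - poly p 0 * poly (pderiv (pderiv p)) 0) / (poly p 0)^2 = (\<Sum>i<n. 1 / (r i)^2)"
proof -
 obtain r where r: "Polynomial.smult (lead_coeff p) (\<Prod>i<degree p. [:- r i, 1:]) = p"
  by (rule complex_poly_decompose')
 let ?P = "\<Prod>i<degree p. [:- r i, 1:]"
 define l where "l = lead_coeff p"
 have l: "l \<noteq> 0" unfolding l_def using assms by auto
 have p: "p = Polynomial.smult l ?P" using r unfolding l_def by simp
 have root: "poly p (r i) = 0" if "i < degree p" for i
 proof -
  have "poly ?P (r i) = 0" unfolding poly_prod by (rule prod_zero) (use that in auto)
  then show ?thesis by (subst p) simp
 qed
 have nz: "r i \<noteq> 0" if "i < degree p" for i using root[OF that] assms by auto
 note L = logderiv_prod[OF nz]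
 have e: "poly p 0 = l * poly ?P 0" "poly (pderiv p) 0 = l * poly (pderiv ?P) 0"
  "poly (pderiv (pderiv p)) 0 = l * poly (pderiv (pderiv ?P)) 0"
  by (subst p, simp add: pderiv_smult)+
 have "poly (pderiv p) 0 / poly p 0 = (\<Sum>i<degree p. - (1 / r i))"
  unfolding e using l L(2) by simp
 moreover have "((poly (pderiv p) 0)^2 - poly p 0 * poly (pderiv (pderiv p)) 0) / (poly p 0)^2 = (\<Sum>i<degree p. 1 / (r i)^2)"
 proof -
  have "((l * B)^2 - l * A * (l * C)) / (l * A)^2 = (B^2 - A * C) / A^2" for A B C
  proof -
   have "(l * B)^2 - l * A * (l * C) = l^2 * (B^2 - A * C)" by (simp add: power2_eq_square algebra_simps)
   then show ?thesis using l by (simp add: power_mult_distrib)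
  qed
  then show ?thesis unfolding e using L(3) by simp
 qed
 ultimately show ?thesis using that[of "degree p" r] root nz by blast
qed

text \<open>A root r contributes -1/r to p'/p and 1/r^2 to -(p'/p)'. For Re r < 0 and Im r <= 0 both
  have nonpositive imaginary part, the second because Im (r^2) = 2 Re r Im r is nonnegative.\<close>

lemma poly_third_quadrant:
 fixes p :: "complex poly"
 assumes "\<And>t. poly p t = 0 ==> Re t < 0 \<and> Im t <= 0"
 shows "Im (poly (pderiv p) 0 / poly p 0) <= 0"
  and "Im (((poly (pderiv p) 0)^2 - poly p 0 * poly (pderiv (pderiv p)) 0) / (poly p 0)^2) <= 0"
proof -
 have 0: "poly p 0 \<noteq> 0" using assms[of 0] by auto
 obtain n :: nat and r :: "nat => complex" where r: "\<And>i. i < n ==> poly p (r i) = 0" "\<And>i. i < n ==> r i \<noteq> (0::complex)"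
  "poly (pderiv p) 0 / poly p 0 = (\<Sum>i<n. - (1 / r i))"
  "((poly (pderiv p) 0)^2 - poly p 0 * poly (pderiv (pderiv p)) 0) / (poly p 0)^2 = (\<Sum>i<n. 1 / (r i)^2)"
  using poly_logderiv[OF 0] by blast
 have 1: "Im (- (1 / z)) <= 0" "Im (1 / z\<^sup>2) <= 0" if "Re z < 0" "Im z <= 0" for z
 proof -
  have "Im (- (1 / z)) = Im z / ((Re z)\<^sup>2 + (Im z)\<^sup>2)" by (simp add: Im_divide)
  then show "Im (- (1 / z)) <= 0" using that by (simp add: divide_nonpos_nonneg)
  have "Im (1 / z\<^sup>2) = - (2 * (Re z * Im z)) / ((Re (z\<^sup>2))\<^sup>2 + (Im (z\<^sup>2))\<^sup>2)"
   by (simp add: Im_divide Im_power2)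
  moreover have "Re z * Im z \<ge> 0" using that by (simp add: mult_nonpos_nonpos)
  ultimately show "Im (1 / z^2) <= 0" by (simp add: divide_nonpos_nonneg)
 qed
 show "Im (poly (pderiv p) 0 / poly p 0) <= 0"
  unfolding r(3) Im_sum by (rule sum_nonpos) (use 1 assms r(1) in auto)
 show "Im (((poly (pderiv p) 0)^2 - poly p 0 * poly (pderiv (pderiv p)) 0) / (poly p 0)^2) <= 0"
  unfolding r(4) Im_sum by (rule sum_nonpos) (use 1 assms r(1) in auto)
qed

lemma poly_upper_bound:
 fixes q :: "complex poly"
 assumes "degree q <= n"
 obtains K where "K > 0" "\<And>t. cmod (poly q t) <= K * (1 + cmod t) ^ n"
proof
 let ?K = "1 + (\<Sum>i\<le>degree q. cmod (Polynomial.coeff q i))"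
 show "?K > 0" by (rule add_pos_nonneg) (auto intro: sum_nonneg)
 fix t
 have "cmod (poly q t) <= (\<Sum>i\<le>degree q. cmod (Polynomial.coeff q i * t ^ i))"
  unfolding poly_altdef by (rule norm_sum)
 also have "... <= (\<Sum>i\<le>degree q. cmod (Polynomial.coeff q i) * (1 + cmod t) ^ n)"
 proof (rule sum_mono)
  fix i assume i: "i \<in> {..degree q}"
  have "cmod t ^ i <= (1 + cmod t) ^ i" by (rule power_mono) auto
  also have "... <= (1 + cmod t) ^ n" by (rule power_increasing) (use i assms in auto)
  finally show "cmod (Polynomial.coeff q i * t ^ i) <= cmod (Polynomial.coeff q i) * (1 + cmod t) ^ n"
   unfolding norm_mult norm_power by (intro mult_left_mono) auto
 qed
 also have "... = (\<Sum>i\<le>degree q. cmod (Polynomial.coeff q i)) * (1 + cmod t) ^ n"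
  unfolding sum_distrib_right ..
 also have "... <= ?K * (1 + cmod t) ^ n"
  by (rule mult_right_mono) auto
 finally show "cmod (poly q t) <= ?K * (1 + cmod t) ^ n" .
qed

text \<open>Each factor t - r with Re r < 0 dominates a multiple of 1 + |t| on the closed right half
  plane. Together with \<open>poly_upper_bound\<close> this bounds q/p there if deg q <= deg p, so a
  small multiple of q added to p creates no zeros in that half plane.\<close>

lemma poly_lower_bound:
 fixes p :: "complex poly"
 assumes "\<And>t. Re t \<ge> 0 ==> poly p t \<noteq> 0"
 obtains K where "K > 0" "\<And>t. Re t \<ge> 0 ==> (1 + cmod t) ^ degree p <= K * cmod (poly p t)"
proof -
 obtain r where r: "Polynomial.smult (lead_coeff p) (\<Prod>i<degree p. [:- r i, 1:]) = p"
  by (rule complex_poly_decompose')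
 define l where "l = lead_coeff p"
 have l: "l \<noteq> 0" unfolding l_def using assms[of 0] by auto
 have p: "poly p t = l * (\<Prod>i<degree p. t - r i)" for t
  using arg_cong[OF r, of "%q. poly q t"] unfolding l_def by (simp add: poly_prod algebra_simps)
 have rn: "Re (r i) < 0" if "i < degree p" for i
 proof (rule ccontr)
  assume "\<not> Re (r i) < 0"
  then have "poly p (r i) \<noteq> 0" using assms by simp
  moreover have "(\<Prod>k<degree p. r i - r k) = 0" by (rule prod_zero) (use that in auto)
  ultimately show False unfolding p by simp
 qed
 define k where "k i = 1 + (1 + cmod (r i)) / (- Re (r i))" for i
 have kk: "1 + cmod t <= k i * cmod (t - r i)" and kp: "k i > 0" if "i < degree p" "Re t \<ge> 0" for i t
 proof -
  have a: "- Re (r i) > 0" using rn[OF that(1)] by simp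
  have "- Re (r i) <= Re (t - r i)" using that(2) by simp
  also have "... <= cmod (t - r i)" by (rule complex_Re_le_cmod)
  finally have "- Re (r i) <= cmod (t - r i)" .
  then have "(1 + cmod (r i)) / (- Re (r i)) * (- Re (r i)) <= (1 + cmod (r i)) / (- Re (r i)) * cmod (t - r i)"
   by (rule mult_left_mono) (intro divide_nonneg_pos a, simp)
  then have b: "1 + cmod (r i) <= (1 + cmod (r i)) / (- Re (r i)) * cmod (t - r i)"
   using a by simp
  have "cmod t <= cmod (t - r i) + cmod (r i)" using norm_triangle_ineq[of "t - r i" "r i"] by simp
  with b show "1 + cmod t <= k i * cmod (t - r i)" unfolding k_def by (simp add: algebra_simps)
  show "k i > 0" unfolding k_def using a by (intro add_pos_nonneg divide_nonneg_pos) auto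
 qed
 show ?thesis
 proof (rule that[of "(\<Prod>i<degree p. k i) / cmod l"])
  show "(\<Prod>i<degree p. k i) / cmod l > 0" using l kp[of _ 0] by (auto intro!: divide_pos_pos prod_pos)
  fix t :: complex assume t: "Re t \<ge> 0"
  have "(1 + cmod t) ^ degree p = (\<Prod>i<degree p. 1 + cmod t)" by simp
  also have "... <= (\<Prod>i<degree p. k i * cmod (t - r i))"
   by (rule prod_mono) (use kk t in auto)
  also have "... = (\<Prod>i<degree p. k i) * (\<Prod>i<degree p. cmod (t - r i))" by (rule prod.distrib)
  also have "... = (\<Prod>i<degree p. k i) / cmod l * cmod (poly p t)"
   unfolding p norm_mult prod_norm[symmetric] using l by simp
  finally show "(1 + cmod t) ^ degree p <= (\<Prod>i<degree p. k i) / cmod l * cmod (poly p t)" .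
 qed
qed

lemma linear_limit_nonpos:
 fixes A B e0 :: real
 assumes "e0 > 0" "\<And>e. 0 < e ==> e < e0 ==> A + e^2 * B <= 0"
 shows "A <= 0"
proof (rule ccontr)
 assume "\<not> A <= 0"
 have "((%e. A + e^2 * B) \<longlongrightarrow> A + 0^2 * B) (at_right 0)" by (intro tendsto_intros)
 moreover have "\<forall>\<^sub>F e in at_right 0. A + e^2 * B <= 0"
  unfolding eventually_at_right_field using assms by blast
 ultimately have "A + 0^2 * B <= 0"
  using tendsto_upperbound[of _ _ "at_right (0::real)"] by fastforce
 with \<open>\<not> A <= 0\<close> show False by simp
qed

lemma mult_le0_D: "e > 0 ==> e * X <= 0 ==> X <= (0::real)"
 by (simp add: mult_le_0_iff)

text \<open>The conclusions say that q/p has nonpositive first and nonnegative second derivative at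
  0. For small e > 0 all roots of h = p + i e q satisfy Re < 0, by comparing growth, and Im <= 0, by
  H1; the sign lemma for logarithmic derivatives then applies to h. Its imaginary parts are odd in
  e, and the term linear in e is the mixed expression in p and q that is wanted.\<close>

lemma interlacing_signs:
 fixes p q :: "complex poly" and p0 p1 p2 q0 q1 q2 :: real
 assumes deg: "degree q <= degree p"
  and H1: "\<And>t y. Im t > 0 ==> Im y \<ge> 0 ==> poly p t + y * poly q t \<noteq> 0"
  and H2: "\<And>t. Re t \<ge> 0 ==> poly p t \<noteq> 0"
  and p: "poly p 0 = of_real p0" "poly (pderiv p) 0 = of_real p1" "poly (pderiv (pderiv p)) 0 = of_real p2"
  and q: "poly q 0 = of_real q0" "poly (pderiv q) 0 = of_real q1" "poly (pderiv (pderiv q)) 0 = of_real q2"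
  and pos: "p0 > 0"
 shows "q1 * p0 - p1 * q0 <= 0"
  and "p0^2 * q2 - 2 * p0 * p1 * q1 - p0 * p2 * q0 + 2 * p1^2 * q0 \<ge> 0"
proof -
 obtain K1 where K1: "K1 > 0" "\<And>t. cmod (poly q t) <= K1 * (1 + cmod t) ^ degree p"
  using poly_upper_bound[OF deg] by blast
 obtain K2 where K2: "K2 > 0" "\<And>t. Re t \<ge> 0 ==> (1 + cmod t) ^ degree p <= K2 * cmod (poly p t)"
  using poly_lower_bound[OF H2] by blast
 \<comment> \<open>Below this threshold e |q| < |p| on the closed right half plane.\<close>
 define e0 where "e0 = 1 / (K1 * K2)"
 have e0: "e0 > 0" unfolding e0_def using K1 K2 by simp
 have main: "q1 * p0 - p1 * q0 <= 0 \<and>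
   (p0^2 * (2*p1*q1 - p0*q2 - q0*p2) - 2*p0*q0*(p1^2 - p0*p2))
   + e\<^sup>2 * (- q0\<^sup>2 * (2*p1*q1 - p0*q2 - q0*p2) + 2*p0*q0*(q1\<^sup>2 - q0*q2)) <= 0" if e: "0 < e" "e < e0" for e
 proof -
  define h where "h = p + Polynomial.smult (\<i> * of_real e) q"
  have ht: "poly h t = poly p t + (\<i> * of_real e) * poly q t" for t unfolding h_def by simp
  have roots: "Re t < 0 \<and> Im t <= 0" if t: "poly h t = 0" for t
  proof
   show "Im t <= 0"
   proof (rule ccontr)
    assume "\<not> Im t <= 0"
    then show False using H1[of t "\<i> * of_real e"] t e unfolding ht by simp
   qed
   show "Re t < 0"
   proof (rule ccontr)
    assume "\<not> Re t < 0"
    then have re: "Re t \<ge> 0" by simp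
    have "poly p t = - ((\<i> * of_real e) * poly q t)" using t unfolding ht by (rule eq_neg_iff_add_eq_0[THEN iffD2])
    then have "cmod (poly p t) = e * cmod (poly q t)" using e by (simp add: norm_mult)
    also have "... <= e * (K1 * (1 + cmod t) ^ degree p)" by (rule mult_left_mono[OF K1(2)]) (use e in simp)
    also have "... <= e * (K1 * (K2 * cmod (poly p t)))"
     by (intro mult_left_mono K2(2) re) (use e K1 in auto)
    also have "... = (e * (K1 * K2)) * cmod (poly p t)" by simp
    also have "... < 1 * cmod (poly p t)"
    proof (rule mult_strict_right_mono)
     show "e * (K1 * K2) < 1" using e(2) K1(1) K2(1) unfolding e0_def by (simp add: field_simps)
     show "0 < cmod (poly p t)" using H2[OF re] by simp
    qed
    finally show False by simp
   qed
  qed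
  have h0: "poly h 0 = Complex p0 (e * q0)" unfolding ht p q by (simp add: complex_eq_iff)
  have h1: "poly (pderiv h) 0 = Complex p1 (e * q1)"
   unfolding h_def pderiv_add pderiv_smult poly_add poly_smult p q by (simp add: complex_eq_iff)
  have h2: "poly (pderiv (pderiv h)) 0 = Complex p2 (e * q2)"
   unfolding h_def pderiv_add pderiv_smult poly_add poly_smult p q by (simp add: complex_eq_iff)
  have pos2: "p0^2 + (e * q0)^2 > 0" using pos by (simp add: add_pos_nonneg)
  have "Im (Complex p1 (e * q1) / Complex p0 (e * q0)) <= 0"
   using poly_third_quadrant(1)[of h] roots unfolding h0 h1 by blast
  then have "(e * q1 * p0 - p1 * (e * q0)) / (p0^2 + (e * q0)^2) <= 0"
   by (simp add: Im_divide)
  then have "e * (q1 * p0 - p1 * q0) <= 0" using pos2 by (simp add: divide_le_0_iff algebra_simps)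
  then have 1: "q1 * p0 - p1 * q0 <= 0" using e by (simp add: mult_le_0_iff)
  define N where "N = (Complex p1 (e * q1))^2 - Complex p0 (e * q0) * Complex p2 (e * q2)"
  define D where "D = (Complex p0 (e * q0))^2"
  have "Complex p0 (e * q0) \<noteq> 0" using pos by (simp add: complex_eq_iff)
  then have "D \<noteq> 0" unfolding D_def by simp
  then have Dp: "(Re D)^2 + (Im D)^2 > 0" by (simp add: complex_neq_0)
  have "Im (N / D) <= 0"
   using poly_third_quadrant(2)[of h] roots unfolding h0 h1 h2 N_def D_def by blast
  then have "(Im N * Re D - Re N * Im D) / ((Re D)^2 + (Im D)^2) <= 0" unfolding Im_divide .
  then have "Im N * Re D - Re N * Im D <= 0" using Dp unfolding divide_le_0_iff by linarith
  \<comment> \<open>Dividing by e leaves a constant term plus a multiple of e^2; letting e tend to 0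
    isolates the constant term.\<close>
  moreover have "Im N * Re D - Re N * Im D = e * ((p0^2 * (2*p1*q1 - p0*q2 - q0*p2) - 2*p0*q0*(p1^2 - p0*p2))
   + e\<^sup>2 * (- q0\<^sup>2 * (2*p1*q1 - p0*q2 - q0*p2) + 2*p0*q0*(q1\<^sup>2 - q0*q2)))"
   unfolding N_def D_def by (simp add: power2_eq_square algebra_simps)
  ultimately have X: "e * ((p0^2 * (2*p1*q1 - p0*q2 - q0*p2) - 2*p0*q0*(p1^2 - p0*p2))
   + e\<^sup>2 * (- q0\<^sup>2 * (2*p1*q1 - p0*q2 - q0*p2) + 2*p0*q0*(q1\<^sup>2 - q0*q2))) <= 0" by (simp only:)
  show ?thesis using 1 mult_le0_D[OF e(1) X] by blast
 qed
 show "q1 * p0 - p1 * q0 <= 0" using main[of "e0 / 2"] e0 by simp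
 have "p0^2 * (2*p1*q1 - p0*q2 - q0*p2) - 2*p0*q0*(p1^2 - p0*p2) <= 0"
  by (rule linear_limit_nonpos[OF e0]) (use main in blast)
 also have "p0^2 * (2*p1*q1 - p0*q2 - q0*p2) - 2*p0*q0*(p1^2 - p0*p2) =
  - p0 * (p0^2 * q2 - 2 * p0 * p1 * q1 - p0 * p2 * q0 + 2 * p1^2 * q0)"
  by (simp add: power2_eq_square algebra_simps)
 also have "... = p0 * - (p0\<^sup>2 * q2 - 2 * p0 * p1 * q1 - p0 * p2 * q0 + 2 * p1\<^sup>2 * q0)"
  by (simp only: mult_minus_left mult_minus_right)
 finally show "p0^2 * q2 - 2 * p0 * p1 * q1 - p0 * p2 * q0 + 2 * p1^2 * q0 \<ge> 0"
  using mult_le0_D[OF pos] neg_le_0_iff_le by blast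
qed

lemma has_derivative_Re_poly:
 fixes p :: "complex poly"
 shows "((%t. Re (poly p (of_real t))) has_real_derivative Re (poly (pderiv p) (of_real t))) (at t)"
  and "((%t. Im (poly p (of_real t))) has_real_derivative Im (poly (pderiv p) (of_real t))) (at t)"
proof -
 have "(poly p has_field_derivative poly (pderiv p) (of_real t)) (at (of_real t))"
  by (rule poly_DERIV)
 then have v: "((%t. poly p (of_real t)) has_vector_derivative poly (pderiv p) (of_real t)) (at t)"
  by (rule has_vector_derivative_real_field)
 show "((%t. Re (poly p (of_real t))) has_real_derivative Re (poly (pderiv p) (of_real t))) (at t)"
  using bounded_linear.has_vector_derivative[OF bounded_linear_Re v]
  by (simp add: has_real_derivative_iff_has_vector_derivative)
 show "((%t. Im (poly p (of_real t))) has_real_derivative Im (poly (pderiv p) (of_real t))) (at t)"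
  using bounded_linear.has_vector_derivative[OF bounded_linear_Im v]
  by (simp add: has_real_derivative_iff_has_vector_derivative)
qed

lemma pderiv_real:
 assumes "\<And>t. Im (poly p (of_real t)) = 0"
 shows "Im (poly (pderiv p) (of_real t)) = 0"
proof -
 have "((%t. 0) has_real_derivative Im (poly (pderiv p) (of_real t))) (at t)"
  using has_derivative_Re_poly(2)[of p t] assms by simp
 then show ?thesis using DERIV_const DERIV_unique by blast
qed

lemma Im0_of_real: "Im z = 0 ==> z = of_real (Re z)"
 by (simp add: complex_eq_iff)

section \<open>Barriers\<close>

definition rv :: "(complex => ('i => complex) => complex) => real => ('i => real) => real" where
 "rv f x z = Re (f (of_real x) (%i. of_real (z i)))"

text \<open>For functions affine in the variable c this difference is exactly the partial derivative
  in that variable, so several-variable calculus stays algebraic.\<close>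

definition del :: "'i => (complex => ('i => complex) => complex) => complex => ('i => complex) => complex" where
 "del c f x z = f x (z(c := z c + 1)) - f x z"

text \<open>The barrier function of Marcus, Spielman and Srivastava: the logarithmic derivative of f
  in the variable c.\<close>

definition ph :: "(complex => ('i => complex) => complex) => 'i => real => ('i => real) => real" where
 "ph f c x z = rv (del c f) x z / rv f x z"

text \<open>The point (x, z) lies above the zeros of f, in the sense of the barrier method: the
  whole orthant over it is free of zeros and f is positive there.\<close>

definition above :: "'i set => (complex => ('i => complex) => complex) => real => ('i => real) => bool" where
 "above I f x z \<longleftrightarrow> (\<forall>x' z'. x <= x' \<longrightarrow> (\<forall>i\<in>I. z i <= z' i) \<longrightarrow> 0 < rv f x' z')"

text \<open>L is the homogeneous top part shared by all polynomials of the argument: averaging over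
  shifts leaves it unchanged. Its nonvanishing on directions with positive x-part and nonnegative
  z-part forces restrictions to such lines to have degree exactly \<open>card I\<close>.\<close>

locale pencil =
 fixes I :: "'i set" and L :: "complex => ('i => complex) => complex"
 assumes fin: "finite I"
  and L1: "L 1 (%_. 0) = 1"
  and Lnz: "\<And>\<xi> w. 0 < \<xi> ==> (\<And>i. i \<in> I ==> 0 <= w i) ==> L (of_real \<xi>) (%i. of_real (w i)) \<noteq> 0"
begin

definition stab :: "(complex => ('i => complex) => complex) => bool" where
 "stab f \<longleftrightarrow>
  (\<forall>x z \<xi> w. \<exists>p. degree p <= card I \<and> Polynomial.coeff p (card I) = L \<xi> w \<and>
    (\<forall>t. f (x + t * \<xi>) (%i. z i + t * w i) = poly p t)) \<and>
  (\<forall>c\<in>I. \<forall>x z t. f x (z(c := z c + t)) = f x z + t * del c f x z) \<and>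
  (\<forall>x z. f (cnj x) (%i. cnj (z i)) = cnj (f x z)) \<and>
  (\<forall>x z. Im x > 0 \<longrightarrow> (\<forall>i\<in>I. Im (z i) \<ge> 0) \<longrightarrow> f x z \<noteq> 0)"

lemma stab_poly:
 assumes "stab f"
 obtains p where "degree p <= card I" "Polynomial.coeff p (card I) = L \<xi> w"
  "\<And>t. f (x + t * \<xi>) (%i. z i + t * w i) = poly p t"
 using assms unfolding stab_def by blast

lemma stab_affine: "stab f ==> c \<in> I ==> f x (z(c := z c + t)) = f x z + t * del c f x z"
 unfolding stab_def by blast

lemma stab_cnj: "stab f ==> f (cnj x) (%i. cnj (z i)) = cnj (f x z)"
 unfolding stab_def by blast

lemma stab_nz: "stab f ==> Im x > 0 ==> (\<And>i. i \<in> I ==> Im (z i) \<ge> 0) ==> f x z \<noteq> 0"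
 unfolding stab_def by blast

lemma stab_real: "stab f ==> f (of_real x) (%i. of_real (z i)) = of_real (rv f x z)"
 unfolding rv_def using stab_cnj[of f "of_real x" "%i. of_real (z i)"]
 by (intro Im0_of_real) (simp add: complex_eq_iff)

lemma upd_real: "(%i. complex_of_real (z i))(c := complex_of_real (z c) + 1) = (%i. of_real ((z(c := z c + 1)) i))"
 by (rule ext) simp

lemma rv_del: "rv (del c f) x z = rv f x (z(c := z c + 1)) - rv f x z"
 unfolding rv_def del_def upd_real minus_complex.simps ..

lemma del_real: "stab f ==> del c f (of_real x) (%i. of_real (z i)) = of_real (rv (del c f) x z)"
 unfolding rv_del unfolding del_def upd_real stab_real by simp

lemma rv_affine:
 assumes "stab f" "c \<in> I"
 shows "rv f x (z(c := z c + t)) = rv f x z + t * rv (del c f) x z"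
proof -
 have "(%i. complex_of_real ((z(c := z c + t)) i)) = (%i. of_real (z i))(c := of_real (z c) + of_real t)"
  by (rule ext) simp
 then have "complex_of_real (rv f x (z(c := z c + t))) = of_real (rv f x z) + of_real t * of_real (rv (del c f) x z)"
  unfolding stab_real[OF assms(1), symmetric] del_real[OF assms(1), symmetric]
  using stab_affine[OF assms, of "of_real x" "%i. of_real (z i)" "of_real t"] by simp
 then show ?thesis by (simp flip: of_real_mult of_real_add)
qed

lemma aboveD: "above I f x z ==> x <= x' ==> (\<And>i. i \<in> I ==> z i <= z' i) ==> 0 < rv f x' z'"
 unfolding above_def by blast

lemma above_mono: "above I f x z ==> x <= x' ==> (\<And>i. i \<in> I ==> z i <= z' i) ==> above I f x' z'"
 unfolding above_def by (meson order_trans)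

text \<open>On the line, f and its difference in direction c become polynomials p and q. By affinity
  p + y q is f with z c moved by y, so stability is precisely the hypothesis H1 of
  \<open>interlacing_signs\<close>. The second inequality is convexity, comparing the slopes of the
  secants over [0, s] and [s, s + h].\<close>

lemma ph_path:
 assumes S: "stab f" and A: "above I f x z" and xi: "\<xi> > 0" and w: "\<And>i. i \<in> I ==> 0 <= w i"
  and c: "c \<in> I" and s: "0 <= s"
 defines "g \<equiv> %t. ph f c (x + t * \<xi>) (%i. z i + t * w i)"
 shows "g s <= g 0" and "0 < h ==> h * (g s - g 0) <= s * (g (s + h) - g s)"
proof -
 let ?x = "complex_of_real x" and ?z = "%i. complex_of_real (z i)" and ?xi = "complex_of_real \<xi>"
  and ?w = "%i. complex_of_real (w i)"
 obtain p where p: "degree p <= card I" "Polynomial.coeff p (card I) = L ?xi ?w"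
  "\<And>t. f (?x + t * ?xi) (%i. ?z i + t * ?w i) = poly p t"
  using stab_poly[OF S, where x = ?x and z = ?z and \<xi> = ?xi and w = ?w] by blast
 obtain q' where q': "degree q' <= card I" "Polynomial.coeff q' (card I) = L ?xi ?w"
  "\<And>t. f (?x + t * ?xi) (%i. (?z(c := ?z c + 1)) i + t * ?w i) = poly q' t"
  using stab_poly[OF S, where x = ?x and z = "?z(c := ?z c + 1)" and \<xi> = ?xi and w = ?w] by blast
 define q where "q = q' - p"
 \<comment> \<open>The direction is positive, so L does not vanish on it and the degree does not
   drop. This is what puts deg q <= deg p.\<close>
 have degp: "degree p = card I"
  using p(1,2) Lnz[OF xi, of w] w le_degree[of p "card I"] by fastforce
 have degq: "degree q <= degree p" unfolding q_def degp by (rule degree_diff_le) (use p q' in auto)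
 have q: "del c f (?x + t * ?xi) (%i. ?z i + t * ?w i) = poly q t" for t
 proof -
  have "(%i. ?z i + t * ?w i)(c := ?z c + t * ?w c + 1) = (%i. (?z(c := ?z c + 1)) i + t * ?w i)"
   by (rule ext) simp
  then show ?thesis unfolding del_def q_def poly_diff p(3)[symmetric] q'(3)[symmetric] by simp
 qed
 have pc: "poly p (cnj t) = cnj (poly p t)" for t
  using stab_cnj[OF S, of "?x + t * ?xi" "%i. ?z i + t * ?w i"] unfolding p(3)[symmetric] by simp
 have pr: "poly p (of_real t) = of_real (rv f (x + t * \<xi>) (%i. z i + t * w i))" for t
  unfolding p(3)[symmetric] stab_real[OF S, symmetric] by simp
 have qr: "poly q (of_real t) = of_real (rv (del c f) (x + t * \<xi>) (%i. z i + t * w i))" for t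
  unfolding q[symmetric] del_real[OF S, symmetric] by simp
 have ppos: "rv f (x + t * \<xi>) (%i. z i + t * w i) > 0" if "t \<ge> 0" for t
  by (rule aboveD[OF A]) (use that xi w in auto)
 have H1: "poly p t + y * poly q t \<noteq> 0" if "Im t > 0" "Im y \<ge> 0" for t y
 proof -
  have "f (?x + t * ?xi) ((%i. ?z i + t * ?w i)(c := (?z c + t * ?w c) + y)) \<noteq> 0"
   by (rule stab_nz[OF S]) (use that xi w c in auto)
  then show ?thesis using stab_affine[OF S c, of "?x + t * ?xi" "%i. ?z i + t * ?w i" y]
   unfolding p(3) q by simp
 qed
 have H2: "poly p t \<noteq> 0" if "Re t \<ge> 0" for t
 proof -
  consider "Im t > 0" | "Im t < 0" | "Im t = 0" by linarith
  then show ?thesis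
  proof cases
   case 1 then show ?thesis using H1[of t 0] by simp
  next
   case 2 then show ?thesis using H1[of "cnj t" 0] pc[of t] by simp
  next
   case 3
   then show ?thesis using pr[of "Re t"] ppos[OF that] Im0_of_real[of t] by simp
  qed
 qed
 define P P1 P2 Q Q1 Q2 where "P = (%t. Re (poly p (of_real t)))"
  and "P1 = (%t. Re (poly (pderiv p) (of_real t)))" and "P2 = (%t. Re (poly (pderiv (pderiv p)) (of_real t)))"
  and "Q = (%t. Re (poly q (of_real t)))"
  and "Q1 = (%t. Re (poly (pderiv q) (of_real t)))" and "Q2 = (%t. Re (poly (pderiv (pderiv q)) (of_real t)))"
 have p0: "Im (poly p (of_real t)) = 0" and q0: "Im (poly q (of_real t)) = 0" for t
  unfolding pr qr by simp_all
 note p1 = pderiv_real[OF p0] and q1 = pderiv_real[OF q0]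
 note p2 = pderiv_real[OF p1] and q2 = pderiv_real[OF q1]
 have Ppos: "P t > 0" if "t \<ge> 0" for t unfolding P_def pr using ppos[OF that] by simp
 have g: "g t = Q t / P t" for t unfolding g_def ph_def P_def Q_def pr qr by simp
 have signs: "Q1 t * P t - P1 t * Q t <= 0"
  "(P t)^2 * Q2 t - 2 * P t * P1 t * Q1 t - P t * P2 t * Q t + 2 * (P1 t)^2 * Q t \<ge> 0" if t: "t \<ge> 0" for t
 proof -
  \<comment> \<open>The sign lemma speaks about 0; translation of the argument brings the point t
    there.\<close>
  define sh where "sh r = pcompose r [:complex_of_real t, 1:]" for r
  have sh: "poly (sh r) u = poly r (of_real t + u)" for r u
   unfolding sh_def poly_pcompose by simp
  have shd: "pderiv (sh r) = sh (pderiv r)" for r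
   unfolding sh_def pderiv_pcompose by (simp add: pderiv_pCons)
  have dg: "degree (sh r) = degree r" for r unfolding sh_def degree_pcompose by simp
  have d: "degree (sh q) <= degree (sh p)" unfolding dg by (rule degq)
  have h1: "poly (sh p) u + y * poly (sh q) u \<noteq> 0" if "Im u > 0" "Im y \<ge> 0" for u y
   unfolding sh by (rule H1) (use that in auto)
  have h2: "poly (sh p) u \<noteq> 0" if "Re u \<ge> 0" for u
   unfolding sh by (rule H2) (use that t in auto)
  have e: "poly (sh p) 0 = of_real (P t)" "poly (pderiv (sh p)) 0 = of_real (P1 t)" "poly (pderiv (pderiv (sh p))) 0 = of_real (P2 t)"
   "poly (sh q) 0 = of_real (Q t)" "poly (pderiv (sh q)) 0 = of_real (Q1 t)" "poly (pderiv (pderiv (sh q))) 0 = of_real (Q2 t)"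
   unfolding shd sh P_def P1_def P2_def Q_def Q1_def Q2_def add_0_right
   by (intro Im0_of_real p0 p1 p2 q0 q1 q2)+
  note I = interlacing_signs[OF d h1 h2 e Ppos[OF t]]
  show "Q1 t * P t - P1 t * Q t <= 0" by (rule I(1))
  show "(P t)^2 * Q2 t - 2 * P t * P1 t * Q1 t - P t * P2 t * Q t + 2 * (P1 t)^2 * Q t \<ge> 0" by (rule I(2))
 qed
 have dP: "(P has_real_derivative P1 t) (at t)" "(P1 has_real_derivative P2 t) (at t)"
  "(Q has_real_derivative Q1 t) (at t)" "(Q1 has_real_derivative Q2 t) (at t)" for t
  unfolding P_def P1_def P2_def Q_def Q1_def Q2_def by (rule has_derivative_Re_poly(1))+
 define g1 where "g1 t = (Q1 t * P t - P1 t * Q t) / (P t)^2" for t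
 define g2 where "g2 t = ((P t)^2 * Q2 t - 2 * P t * P1 t * Q1 t - P t * P2 t * Q t + 2 * (P1 t)^2 * Q t) / (P t) ^ 3" for t
 have dg: "(g has_real_derivative g1 t) (at t)" if "t \<ge> 0" for t
 proof -
  have "((%t. Q t / P t) has_real_derivative (Q1 t * P t - Q t * P1 t) / (P t * P t)) (at t)"
   by (rule DERIV_divide[OF dP(3,1)]) (use Ppos[OF that] in simp)
  then show ?thesis unfolding g[abs_def] g1_def by (simp add: power2_eq_square mult.commute)
 qed
 have dg1: "(g1 has_real_derivative g2 t) (at t)" if "t \<ge> 0" for t
 proof -
  have n: "P t \<noteq> 0" using Ppos[OF that] by simp
  have "((%t. Q1 t * P t - P1 t * Q t) has_real_derivative (Q2 t * P t + P1 t * Q1 t - (P2 t * Q t + Q1 t * P1 t))) (at t)"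
   by (rule DERIV_diff[OF DERIV_mult[OF dP(4,1)] DERIV_mult[OF dP(2,3)]])
  then have "((%t. Q1 t * P t - P1 t * Q t) has_real_derivative (Q2 t * P t - P2 t * Q t)) (at t)"
   by (simp only: mult.commute[of "P1 t" "Q1 t"] add_diff_cancel_right)
  moreover have "((%t. (P t)^2) has_real_derivative (2 * P t * P1 t)) (at t)"
   using DERIV_mult[OF dP(1,1), of t] by (simp only: power2_eq_square mult_2 mult.commute[of "P1 t"] distrib_right)
  ultimately have "((%t. (Q1 t * P t - P1 t * Q t) / (P t)^2) has_real_derivative
   ((Q2 t * P t - P2 t * Q t) * (P t)^2 - (Q1 t * P t - P1 t * Q t) * (2 * P t * P1 t)) / ((P t)^2 * (P t)^2)) (at t)"
   by (rule DERIV_divide) (use n in simp)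
  moreover have "((Q2 t * P t - P2 t * Q t) * (P t)^2 - (Q1 t * P t - P1 t * Q t) * (2 * P t * P1 t)) / ((P t)^2 * (P t)^2) = g2 t"
  proof -
   define X where "X = (P t)^2 * Q2 t - 2 * P t * P1 t * Q1 t - P t * P2 t * Q t + 2 * (P1 t)^2 * Q t"
   have "(Q2 t * P t - P2 t * Q t) * (P t)^2 - (Q1 t * P t - P1 t * Q t) * (2 * P t * P1 t) = P t * X"
    unfolding X_def by (simp add: power2_eq_square algebra_simps)
   moreover have "(P t)^2 * (P t)^2 = P t * (P t) ^ 3" by (simp only: power2_eq_square power3_eq_cube mult.assoc)
   ultimately show ?thesis unfolding g2_def X_def[symmetric] using n by simp
  qed
  ultimately show ?thesis unfolding g1_def[abs_def] by simp
 qed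
 have g1le: "g1 t <= 0" if "t \<ge> 0" for t
  unfolding g1_def using signs(1)[OF that] by (intro divide_nonpos_nonneg) auto
 have g2ge: "g2 t \<ge> 0" if "t \<ge> 0" for t
  unfolding g2_def using signs(2)[OF that] Ppos[OF that] by (intro divide_nonneg_nonneg) auto
 have g1mono: "g1 a <= g1 b" if "0 <= a" "a <= b" for a b
  by (rule DERIV_nonneg_imp_nondecreasing[OF that(2)]) (meson dg1 g2ge that order_trans)
 show "g s <= g 0"
  by (rule DERIV_nonpos_imp_nonincreasing[OF s]) (use dg g1le in blast)
 show "h * (g s - g 0) <= s * (g (s + h) - g s)" if h: "0 < h"
 proof (cases "s = 0")
  case False
  then have s0: "0 < s" using s by simp
  obtain a where a: "0 < a" "a < s" "g s - g 0 = (s - 0) * g1 a"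
   using MVT2[OF s0, of g g1] dg by auto
  obtain b where b: "s < b" "b < s + h" "g (s + h) - g s = (s + h - s) * g1 b"
   using MVT2[of s "s + h" g g1] dg h s0 by auto
  have "g1 a <= g1 b" by (rule g1mono) (use a b in auto)
  then have "h * s * g1 a <= h * s * g1 b" by (rule mult_left_mono) (use h s0 in simp)
  then show ?thesis unfolding a(3) b(3) by (simp add: mult_ac)
 qed simp
qed

end

context pencil
begin

lemma stab_poly_x:
 assumes "stab f"
 obtains p where "\<And>t. f t z = poly p t" "Polynomial.coeff p (card I) = 1" "degree p <= card I"
proof -
 obtain p where p: "degree p <= card I" "Polynomial.coeff p (card I) = L 1 (%_. 0)"
  "\<And>t. f (0 + t * 1) (%i. z i + t * 0) = poly p t"
  using stab_poly[OF assms, where x = 0 and z = z and \<xi> = 1 and w = "%_. 0"] by blast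
 show ?thesis by (rule that[of p]) (use p L1 in auto)
qed

lemma isCont_rv:
 assumes "stab f"
 shows "isCont (%x. rv f x z) x"
proof -
 obtain p where p: "\<And>t. f t (%i. of_real (z i)) = poly p t"
  using stab_poly_x[OF assms, of "%i. of_real (z i)"] by blast
 show ?thesis unfolding rv_def p
  by (rule DERIV_isCont[OF has_derivative_Re_poly(1)])
qed

lemma isCont_rv_del: "stab f ==> isCont (%x. rv (del c f) x z) x"
 unfolding rv_del by (intro continuous_intros isCont_rv)

lemma isCont_ph: "stab f ==> rv f x z \<noteq> 0 ==> isCont (%x. ph f c x z) x"
 unfolding ph_def by (intro continuous_intros isCont_rv isCont_rv_del)

lemma ph_tendsto:
 assumes "stab f" "rv f x z \<noteq> 0"
 shows "((%e. ph f c (x + s * e) z) \<longlongrightarrow> ph f c x z) (at_right 0)"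
proof (rule isCont_tendsto_compose[OF isCont_ph[OF assms]])
 have "((%e. x + s * e) \<longlongrightarrow> x + s * 0) (at_right 0)" by (intro tendsto_intros)
 then show "((%e. x + s * e) \<longlongrightarrow> x) (at_right 0)" by simp
qed

text \<open>A direction w without x-part is the limit of the directions (e, w) as e tends to 0 from
  above, and the inequalities survive limits. The detour is forced because stability requires Im x >
  0.\<close>

lemma ph_dir:
 assumes S: "stab f" and A: "above I f x z" and w: "\<And>i. i \<in> I ==> 0 <= w i"
  and c: "c \<in> I" and s: "0 <= s"
 defines "g \<equiv> %t. ph f c x (%i. z i + t * w i)"
 shows "g s <= g 0" and "0 < h ==> h * (g s - g 0) <= s * (g (s + h) - g s)"
proof -
 have nz: "rv f x (%i. z i + t * w i) \<noteq> 0" if "t \<ge> 0" for t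
  using aboveD[OF A order_refl, of "%i. z i + t * w i"] w that by simp
 define G where "G e t = ph f c (x + t * e) (%i. z i + t * w i)" for e t
 have lim: "((%e. G e t) \<longlongrightarrow> g t) (at_right 0)" if "t \<ge> 0" for t
  unfolding G_def g_def by (rule ph_tendsto[OF S nz[OF that]])
 have pos: "\<forall>\<^sub>F e in at_right (0::real). e > 0"
  by (simp add: eventually_at_right_less)
 show "g s <= g 0"
 proof (rule tendsto_le[OF _ lim lim])
  show "\<forall>\<^sub>F e in at_right 0. G e s <= G e 0"
   using pos unfolding G_def by (rule eventually_mono) (rule ph_path(1)[OF S A _ w c s])
 qed (use s in auto)
 show "h * (g s - g 0) <= s * (g (s + h) - g s)" if h: "0 < h"
 proof (rule tendsto_le)
  show "((%e. s * (G e (s + h) - G e s)) \<longlongrightarrow> s * (g (s + h) - g s)) (at_right 0)"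
   by (intro tendsto_intros lim) (use s h in auto)
  show "((%e. h * (G e s - G e 0)) \<longlongrightarrow> h * (g s - g 0)) (at_right 0)"
   by (intro tendsto_intros lim) (use s h in auto)
  show "\<forall>\<^sub>F e in at_right 0. h * (G e s - G e 0) <= s * (G e (s + h) - G e s)"
   using pos unfolding G_def by (rule eventually_mono) (rule ph_path(2)[OF S A _ w c s h])
 qed simp
qed

lemma ph_mono:
 assumes S: "stab f" and A: "above I f x z" and c: "c \<in> I" and x: "x <= x'" and z: "\<And>i. i \<in> I ==> z i <= z' i"
 shows "ph f c x' z' <= ph f c x z"
proof (cases "x = x'")
 case True
 show ?thesis using ph_dir(1)[OF S A, of "%i. z' i - z i" c 1] z c True by simp
next
 case False
 then show ?thesis using ph_path(1)[OF S A, of "x' - x" "%i. z' i - z i" c 1] z c x by simp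
qed

section \<open>Averaging over a pair and shifting the barrier\<close>

text \<open>Expectation over choosing a or b with probability 1/2, where a choice lowers its
  variable by 1. On functions affine in both variables it is the operator 1 - (d/dz_a +
  d/dz_b)/2.\<close>

definition tw :: "'i => 'i => (complex => ('i => complex) => complex) => complex => ('i => complex) => complex" where
 "tw a b f x z = (f x (z(a := z a - 1)) + f x (z(b := z b - 1))) / 2"

lemma shift_commute:
 fixes z :: "'i => 'v::ab_group_add"
 shows "(z(c := z c + t))(a := (z(c := z c + t)) a + u) = (z(a := z a + u))(c := (z(a := z a + u)) c + t)"
 by (rule ext) (simp add: algebra_simps)

lemma tw_eq:
 assumes "stab f" "a \<in> I" "b \<in> I"
 shows "tw a b f x z = f x z - (del a f x z + del b f x z) / 2"
proof -
 have 1: "f x (z(a := z a - 1)) = f x z - del a f x z" using stab_affine[OF assms(1,2), of x z "-1"] by simp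
 have 2: "f x (z(b := z b - 1)) = f x z - del b f x z" using stab_affine[OF assms(1,3), of x z "-1"] by simp
 show ?thesis unfolding tw_def 1 2 by (simp add: field_simps)
qed

lemma biaffine:
 assumes S: "stab f" and ab: "a \<in> I" "b \<in> I" "a \<noteq> b"
 shows "f x (%i. z i + t * (if i = a \<or> i = b then 1/2 else 0)) =
  f x z + t * ((del a f x z + del b f x z) / 2) + t^2 * ((del a f x (z(b := z b + 1)) - del a f x z) / 4)"
proof -
 define y where "y = z(a := z a + t / 2)"
 have 1: "(%i. z i + t * (if i = a \<or> i = b then 1/2 else 0)) = y(b := y b + t / 2)"
  unfolding y_def using ab by (intro ext) auto
 have 2: "f x y = f x z + t / 2 * del a f x z" unfolding y_def by (rule stab_affine[OF S ab(1)])
 have 3: "y(b := y b + 1) = (z(b := z b + 1))(a := (z(b := z b + 1)) a + t / 2)"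
  unfolding y_def using ab by (intro ext) auto
 have 4: "f x (y(b := y b + 1)) = f x (z(b := z b + 1)) + t / 2 * del a f x (z(b := z b + 1))"
  unfolding 3 by (rule stab_affine[OF S ab(1)])
 have 5: "f x (y(b := y b + t / 2)) = f x y + t / 2 * (f x (y(b := y b + 1)) - f x y)"
  using stab_affine[OF S ab(2), of x y "t / 2"] unfolding del_def .
 have 6: "f x (z(b := z b + 1)) = f x z + del b f x z" unfolding del_def by simp
 show ?thesis unfolding 1 5 4 2 6
  by (simp add: field_simps power2_eq_square)
qed

text \<open>Along z + t (e_a + e_b)/2 the function f is a polynomial p(t) without roots in Im t >=
  0. So p'/p at 0 has negative imaginary part, or is 0 for constant p; in either case it is not 1,
  and the average equals p(0) - p'(0).\<close>

lemma stab_tw: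
 assumes S: "stab f" and ab: "a \<in> I" "b \<in> I" "a \<noteq> b"
 shows "stab (tw a b f)"
 unfolding stab_def
proof (intro conjI allI ballI impI)
 fix x \<xi> :: complex and z w :: "'i => complex"
 have e: "(%i. z i + t * w i)(c := z c + t * w c - 1) = (%i. (z(c := z c - 1)) i + t * w i)" for c t
  by (rule ext) (simp add: algebra_simps)
 obtain p1 where p1: "degree p1 <= card I" "Polynomial.coeff p1 (card I) = L \<xi> w"
  "\<And>t. f (x + t * \<xi>) (%i. (z(a := z a - 1)) i + t * w i) = poly p1 t"
  using stab_poly[OF S, where x = x and z = "z(a := z a - 1)" and \<xi> = \<xi> and w = w] by blast
 obtain p2 where p2: "degree p2 <= card I" "Polynomial.coeff p2 (card I) = L \<xi> w"
  "\<And>t. f (x + t * \<xi>) (%i. (z(b := z b - 1)) i + t * w i) = poly p2 t"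
  using stab_poly[OF S, where x = x and z = "z(b := z b - 1)" and \<xi> = \<xi> and w = w] by blast
 show "\<exists>p. degree p <= card I \<and> Polynomial.coeff p (card I) = L \<xi> w \<and>
    (\<forall>t. tw a b f (x + t * \<xi>) (%i. z i + t * w i) = poly p t)"
 proof (intro exI[of _ "Polynomial.smult (1/2) (p1 + p2)"] conjI allI)
  show "degree (Polynomial.smult (1/2) (p1 + p2)) <= card I"
   using degree_add_le[OF p1(1) p2(1)] by simp
  show "Polynomial.coeff (Polynomial.smult (1/2) (p1 + p2)) (card I) = L \<xi> w"
   using p1(2) p2(2) by simp
  show "tw a b f (x + t * \<xi>) (%i. z i + t * w i) = poly (Polynomial.smult (1/2) (p1 + p2)) t" for t
   unfolding tw_def e p1(3) p2(3) by simp
 qed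
next
 fix c x t and z :: "'i => complex" assume c: "c \<in> I"
 have e: "(z(c := z c + t))(d := (z(c := z c + t)) d - 1) = (z(d := z d - 1))(c := (z(d := z d - 1)) c + t)" for d t
  using shift_commute[of z c t d "-1"] by simp
 have "f x ((z(c := z c + t))(d := (z(c := z c + t)) d - 1)) =
  f x (z(d := z d - 1)) + t * (f x ((z(c := z c + 1))(d := (z(c := z c + 1)) d - 1)) - f x (z(d := z d - 1)))" for d
  unfolding e stab_affine[OF S c, of x "z(d := z d - 1)" t] unfolding del_def ..
 note h = this
 have al: "(u1 + t * (v1 - u1) + (u2 + t * (v2 - u2))) / 2 = (u1 + u2) / 2 + t * ((v1 + v2) / 2 - (u1 + u2) / 2)"
  for u1 v1 u2 v2 :: complex by (simp add: field_simps)
 show "tw a b f x (z(c := z c + t)) = tw a b f x z + t * del c (tw a b f) x z"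
  unfolding del_def[of c] tw_def h[of a] h[of b] by (rule al)
next
 fix x and z :: "'i => complex"
 have e: "(%i. cnj (z i))(c := cnj (z c) - 1) = (%i. cnj ((z(c := z c - 1)) i))" for c by (rule ext) simp
 show "tw a b f (cnj x) (%i. cnj (z i)) = cnj (tw a b f x z)"
  unfolding tw_def e stab_cnj[OF S] by (simp only: complex_cnj_divide complex_cnj_add complex_cnj_numeral)
next
 fix x and z :: "'i => complex" assume x: "Im x > 0" and z: "\<forall>i\<in>I. Im (z i) \<ge> 0"
 define p where "p = [: f x z, (del a f x z + del b f x z) / 2, (del a f x (z(b := z b + 1)) - del a f x z) / 4 :]"
 have pt: "poly p t = f x (%i. z i + t * (if i = a \<or> i = b then 1/2 else 0))" for t
  unfolding p_def biaffine[OF S ab] by (simp add: power2_eq_square algebra_simps)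
 have nz: "poly p t \<noteq> 0" if "Im t \<ge> 0" for t
  unfolding pt by (rule stab_nz[OF S x]) (use z that in \<open>auto\<close>)
 have p0: "poly p 0 \<noteq> 0" by (rule nz) simp
 obtain n :: nat and r :: "nat => complex" where r': "\<And>i. i < n ==> poly p (r i) = 0"
  "\<And>i. i < n ==> r i \<noteq> 0"
  "poly (pderiv p) 0 / poly p 0 = (\<Sum>i<n. - (1 / r i))"
  "((poly (pderiv p) 0)^2 - poly p 0 * poly (pderiv (pderiv p)) 0) / (poly p 0)^2 = (\<Sum>i<n. 1 / (r i)^2)"
  using poly_logderiv[OF p0] by blast
 note r = r'(1) r'(3)
 have "poly (pderiv p) 0 / poly p 0 \<noteq> 1"
 proof (cases "n = 0")
  case True then show ?thesis unfolding r(2) by simp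
 next
  case False
  have "Im (- (1 / r i)) < 0" if i: "i < n" for i
  proof -
   have neg: "Im (r i) < 0" using nz[of "r i"] r(1)[OF i] by force
   have "Im (- (1 / r i)) = Im (r i) / ((Re (r i))\<^sup>2 + (Im (r i))\<^sup>2)" by (simp add: Im_divide)
   moreover have "(Re (r i))^2 + (Im (r i))^2 > 0" using neg by (simp add: add_nonneg_pos)
   ultimately show ?thesis using neg by (simp add: divide_neg_pos)
  qed
  then have "Im (\<Sum>i<n. - (1 / r i)) < 0" unfolding Im_sum by (intro sum_strict_mono[of "{..<n}" _ "%_. 0", simplified]) (use False in auto)
  then show ?thesis unfolding r(2) by (metis less_irrefl one_complex.sel(2))
 qed
 then have "poly (pderiv p) 0 \<noteq> poly p 0" using p0 by auto
 moreover have "poly (pderiv p) 0 = (del a f x z + del b f x z) / 2" unfolding p_def by (simp add: pderiv_pCons)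
 moreover have "poly p 0 = f x z" unfolding p_def by simp
 ultimately show "tw a b f x z \<noteq> 0" unfolding tw_eq[OF S ab(1,2)] by simp
qed

lemma rv_tw:
 assumes "stab f" "a \<in> I" "b \<in> I"
 shows "rv (tw a b f) x z = rv f x z - (rv (del a f) x z + rv (del b f) x z) / 2"
 unfolding rv_def tw_eq[OF assms] by simp

lemma rv_biaffine:
 assumes S: "stab f" and ab: "a \<in> I" "b \<in> I" "a \<noteq> b"
 shows "rv f x (%i. z i + t * (if i = a \<or> i = b then 1/2 else 0)) =
  rv f x z + t * ((rv (del a f) x z + rv (del b f) x z) / 2) +
   t^2 * ((rv (del a f) x (z(b := z b + 1)) - rv (del a f) x z) / 4)"
proof -
 have e: "(%i. complex_of_real (z i + t * (if i = a \<or> i = b then 1/2 else 0))) =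
  (%i. of_real (z i) + of_real t * (if i = a \<or> i = b then 1/2 else 0))"
  by (rule ext) simp
 have "complex_of_real (rv f x (%i. z i + t * (if i = a \<or> i = b then 1/2 else 0))) =
  of_real (rv f x z + t * ((rv (del a f) x z + rv (del b f) x z) / 2) +
   t^2 * ((rv (del a f) x (z(b := z b + 1)) - rv (del a f) x z) / 4))"
  unfolding stab_real[OF S, symmetric] e biaffine[OF S ab]
  unfolding upd_real unfolding del_real[OF S] stab_real[OF S]
  by (simp only: of_real_add of_real_mult of_real_divide of_real_diff of_real_power of_real_numeral)
 then show ?thesis by (simp only: of_real_eq_iff)
qed

lemma rv_has_derivative:
 fixes z :: "'i => real"
 assumes S: "stab f" and ab: "a \<in> I" "b \<in> I" "a \<noteq> b"
 defines "p \<equiv> %t. (%i. z i + t * (if i = a \<or> i = b then 1/2 else 0))"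
 shows "((%t. rv f x (p t)) has_real_derivative ((rv (del a f) x (p s) + rv (del b f) x (p s)) / 2)) (at s)"
proof -
 let ?D = "(rv (del a f) x (p s) + rv (del b f) x (p s)) / 2"
 let ?X = "(rv (del a f) x ((p s)(b := p s b + 1)) - rv (del a f) x (p s)) / 4"
 have eq: "rv f x (p t) = rv f x (p s) + (t - s) * ?D + (t - s)^2 * ?X" for t
 proof -
  have "p t = (%i. p s i + (t - s) * (if i = a \<or> i = b then 1/2 else 0))"
   unfolding p_def by (rule ext) (simp add: algebra_simps)
  then show ?thesis using rv_biaffine[OF S ab, of x "p s" "t - s"] by simp
 qed
 have d: "((%t. c + (t - s) * D + (t - s)^2 * X) has_real_derivative D) (at s)" for c D X :: real
  by (auto intro!: derivative_eq_intros)
 have eq2: "(%t. rv f x (p t)) = (%t. rv f x (p s) + (t - s) * ?D + (t - s)^2 * ?X)"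
  by (rule ext) (rule eq)
 show ?thesis unfolding eq2 by (rule d)
qed

lemma right_quotient_le:
 fixes g :: "real => real"
 assumes "(g has_real_derivative D) (at s)" "\<And>h. h > 0 ==> K <= (g (s + h) - g s) / h"
 shows "K <= D"
proof (rule tendsto_lowerbound)
 show "((%h. (g (s + h) - g s) / h) \<longlongrightarrow> D) (at_right 0)"
  by (rule tendsto_within_subset[OF DERIV_D[OF assms(1)]]) simp
 show "\<forall>\<^sub>F h in at_right 0. K <= (g (s + h) - g s) / h"
  using eventually_at_right_less[of "0::real"] by (rule eventually_mono) (rule assms(2))
qed simp

text \<open>A shift by s along (e_a + e_b)/2 pays for one averaging. Let u(t) be the barrier of c
  after a shift by t, and \<phi> the mean barrier of a and b at time s. The new barrier is u(s) -
  u'(s)/(1 - \<phi>). Monotonicity and the hypothesis give 1/(1 - \<phi>) <= s, and since u' <= 0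
  convexity finishes: u(s) - s u'(s) <= u(0).\<close>

lemma barrier_step:
 assumes S: "stab f" and ab: "a \<in> I" "b \<in> I" "a \<noteq> b" and A: "above I f x z"
  and s: "s > 0" and le: "(ph f a x z + ph f b x z) / 2 <= 1 - 1 / s"
 defines "z1 \<equiv> %i. z i + s * (if i = a \<or> i = b then 1/2 else 0)"
 shows "above I (tw a b f) x z1" and "c \<in> I - {a, b} ==> ph (tw a b f) c x z1 <= ph f c x z"
proof -
 have z1: "z i <= z1 i" for i unfolding z1_def using s by simp
 define r where "r = 1 / s"
 have s1: "0 < r" using s unfolding r_def by simp
 have le': "(ph f a x z + ph f b x z) / 2 <= 1 - r" using le unfolding r_def .
 have tw: "rv (tw a b f) x' z' = rv f x' z' * (1 - (ph f a x' z' + ph f b x' z') / 2)"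
  if "rv f x' z' > 0" for x' z'
  unfolding rv_tw[OF S ab(1,2)] ph_def using that by (simp add: field_simps)
 show "above I (tw a b f) x z1" unfolding above_def
 proof (intro allI impI)
  fix x' z' assume x': "x <= x'" and z': "\<forall>i\<in>I. z1 i <= z' i"
  have z'': "z i <= z' i" if "i \<in> I" for i using z1[of i] z' that order_trans by blast
  have p: "rv f x' z' > 0" by (rule aboveD[OF A x' z''])
  have "ph f a x' z' <= ph f a x z" by (rule ph_mono[OF S A ab(1) x' z''])
  moreover have "ph f b x' z' <= ph f b x z" by (rule ph_mono[OF S A ab(2) x' z''])
  ultimately have "(ph f a x' z' + ph f b x' z') / 2 < 1" using le' s1 by simp
  then show "0 < rv (tw a b f) x' z'" unfolding tw[OF p] using p by simp
 qed
 assume c: "c \<in> I - {a, b}"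
 define p where "p t = (%i. z i + t * (if i = a \<or> i = b then 1/2 else 0))" for t
 have z1p: "z1 = p s" unfolding z1_def p_def ..
 define u where "u t = ph f c x (p t)" for t
 have c': "c \<in> I" "c \<noteq> a" "c \<noteq> b" using c by auto
 define f0 where "f0 t = rv f x (p t)" for t
 define fc where "fc t = rv (del c f) x (p t)" for t
 define D0 where "D0 = (rv (del a f) x (p s) + rv (del b f) x (p s)) / 2"
 let ?pc = "(p s)(c := p s c + 1)"
 define D1 where "D1 = (rv (del a f) x ?pc + rv (del b f) x ?pc) / 2 - D0"
 have f0pos: "f0 s > 0" unfolding f0_def z1p[symmetric] by (rule aboveD[OF A]) (use z1 in auto)
 have d0: "(f0 has_real_derivative D0) (at s)"
  using rv_has_derivative[OF S ab, of x z s] unfolding f0_def[abs_def] D0_def p_def .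
 have pc: "(p t)(c := p t c + 1) = (%i. (z(c := z c + 1)) i + t * (if i = a \<or> i = b then 1/2 else 0))" for t
  unfolding p_def using c' by (intro ext) auto
 have dc: "(fc has_real_derivative D1) (at s)"
 proof -
  have "((%t. rv f x ((p t)(c := p t c + 1))) has_real_derivative ((rv (del a f) x ?pc + rv (del b f) x ?pc) / 2)) (at s)"
   unfolding pc by (rule rv_has_derivative[OF S ab])
  from DERIV_diff[OF this d0] show ?thesis unfolding fc_def[abs_def] rv_del[of c] f0_def D1_def .
 qed
 define u1 where "u1 = (D1 * f0 s - fc s * D0) / (f0 s * f0 s)"
 have du: "(u has_real_derivative u1) (at s)"
  using DERIV_divide[OF dc d0] f0pos unfolding u_def[abs_def] ph_def fc_def f0_def u1_def by simp
 have dirs: "0 <= (if i = a \<or> i = b then 1/2 else (0::real))" for i by simp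
 have "(u s - u 0) / s <= u1"
 proof (rule right_quotient_le[OF du])
  fix h :: real assume h: "h > 0"
  have "h * (u s - u 0) <= s * (u (s + h) - u s)"
   unfolding u_def p_def by (rule ph_dir(2)[OF S A dirs c'(1)]) (use s h in auto)
  then show "(u s - u 0) / s <= (u (s + h) - u s) / h" using s h by (simp add: field_simps)
 qed
 \<comment> \<open>Convexity: the tangent at s lies below the graph at 0.\<close>
 then have tang: "u s - s * u1 <= u 0" using s by (simp add: field_simps)
 have u1le: "u1 <= 0"
 proof -
  have dm: "((%t. - u t) has_real_derivative - u1) (at s)" by (rule DERIV_minus[OF du])
  have "0 <= - u1"
  proof (rule right_quotient_le[OF dm])
   fix h :: real assume h: "h > 0"
   have "u (s + h) <= u s" unfolding u_def
    by (rule ph_mono[OF S _ c'(1) order_refl, of x "p s"], rule above_mono[OF A order_refl])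
     (use s h in \<open>auto simp: p_def\<close>)
   then show "0 <= (- u (s + h) - - u s) / h" using h by simp
  qed
  then show ?thesis by simp
 qed
 define \<phi> where "\<phi> = D0 / f0 s"
 have phi: "\<phi> <= 1 - r"
 proof -
  have "ph f a x z1 <= ph f a x z" by (rule ph_mono[OF S A ab(1) order_refl z1])
  moreover have "ph f b x z1 <= ph f b x z" by (rule ph_mono[OF S A ab(2) order_refl z1])
  moreover have "\<phi> = (ph f a x z1 + ph f b x z1) / 2"
   unfolding \<phi>_def D0_def ph_def f0_def z1p by (simp add: add_divide_distrib)
  ultimately show ?thesis using le' by simp
 qed
 have pos: "1 - \<phi> > 0" using phi s1 by simp
 have ps: "1 / (1 - \<phi>) <= s" using phi s pos unfolding r_def by (simp add: field_simps)
 have twc: "rv (del c (tw a b f)) x z1 = fc s - D1"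
  unfolding rv_del[of c] rv_tw[OF S ab(1,2)] z1p fc_def D1_def D0_def by (simp add: field_simps)
 have tw0: "rv (tw a b f) x z1 = f0 s * (1 - \<phi>)"
  unfolding rv_tw[OF S ab(1,2)] z1p \<phi>_def f0_def[symmetric] D0_def[symmetric] using f0pos by (simp add: field_simps)
 have "ph (tw a b f) c x z1 = (fc s - D1) / (f0 s * (1 - \<phi>))" unfolding ph_def twc tw0 ..
 also have "... = u s + (- u1) * (1 / (1 - \<phi>))"
 proof -
  have "D1 = f0 s * u1 + fc s * \<phi>" unfolding u1_def \<phi>_def using f0pos by (simp add: field_simps)
  moreover have "u s = fc s / f0 s" unfolding u_def ph_def fc_def f0_def ..
  ultimately show ?thesis using f0pos pos by (simp add: field_simps)
 qed
 also have "... <= u s + (- u1) * s"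
  by (intro add_left_mono mult_left_mono ps) (use u1le in simp)
 also have "... <= u 0" using tang by (simp add: mult.commute)
 also have "u 0 = ph f c x z" unfolding u_def p_def by simp
 finally show "ph (tw a b f) c x z1 <= ph f c x z" .
qed

end

section \<open>From averaged polynomials back to single choices\<close>

context pencil
begin

lemma rv_pos_large:
 assumes "stab f"
 shows "\<exists>X. \<forall>x\<ge>X. rv f x z > 0"
proof -
 obtain p where p: "\<And>t. f t (%i. of_real (z i)) = poly p t" "Polynomial.coeff p (card I) = 1" "degree p <= card I"
  using stab_poly_x[OF assms, of "%i. of_real (z i)"] by blast
 have dp: "degree p = card I" using le_degree[of p "card I"] p by fastforce
 define r where "r = (\<Sum>i\<le>card I. monom (Re (Polynomial.coeff p i)) i)"
 have r: "poly r t = rv f t z" for t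
 proof -
  have "Re (Polynomial.coeff p i * (of_real t) ^ i) = Re (Polynomial.coeff p i) * t ^ i" for i
   by (metis Re_complex_of_real mult.commute of_real_power scaleR_complex.sel(1) scaleR_conv_of_real)
  then show ?thesis unfolding r_def poly_sum poly_monom rv_def p(1) poly_altdef[of p] dp Re_sum by simp
 qed
 have cr: "Polynomial.coeff r (card I) = 1" unfolding r_def coeff_sum coeff_monom using p(2) by simp
 have "degree r <= card I" unfolding r_def by (rule degree_sum_le) (auto intro: order_trans[OF degree_monom_le])
 then have "degree r = card I" using le_degree[of r "card I"] cr by fastforce
 then have "lead_coeff r = 1" using cr by simp
 then obtain n where n: "\<And>x. x \<ge> n ==> poly r x \<ge> 1" using poly_pinfty_gt_lc[of r] by auto
 show ?thesis
 proof (intro exI[of _ n] allI impI)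
  fix x assume "x \<ge> n"
  then show "rv f x z > 0" using n[of x] unfolding r by simp
 qed
qed

text \<open>In x alone f is monic, hence positive for large x; the intermediate value theorem
  carries the sign down to x.\<close>

lemma rv_pos_no_zero:
 assumes S: "stab f" and nz: "\<And>x'. x <= x' ==> rv f x' z \<noteq> 0"
 shows "rv f x z > 0"
proof (rule ccontr)
 assume "\<not> rv f x z > 0"
 then have n: "rv f x z <= 0" by simp
 obtain X where X: "\<And>x. x \<ge> X ==> rv f x z > 0" using rv_pos_large[OF S] by blast
 have "\<exists>y\<ge>x. y <= max x X \<and> rv f y z = 0"
  by (rule IVT[of "%x. rv f x z", OF n]) (use X isCont_rv[OF S] in \<open>auto intro: less_imp_le\<close>)
 then show False using nz by blast
qed

text \<open>Otherwise let xs be the last point at or beyond x1 where P(x) = f x z1 is not positive;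
  there P = 0. The average is positive at xs, so some partial derivative Q = \<open>del c f\<close>
  is negative near xs. The number y = -P/Q solving f x (z1 + y e_c) = 0 vanishes at xs and is
  positive to the right, so its derivative is positive at some xh. Moving x from xh slightly into
  the upper half plane then makes Im y > 0, a zero that stability forbids.\<close>

lemma tw_above_imp_above:
 assumes S: "stab f" and ab: "a \<in> I" "b \<in> I" "a \<noteq> b" and A: "above I (tw a b f) x z"
 shows "above I f x z"
 unfolding above_def
proof (intro allI impI)
 fix x1 z1 assume x1: "x <= x1" and z1: "\<forall>i\<in>I. z i <= z1 i"
 define P where "P t = rv f t z1" for t
 obtain X where X: "\<And>t. t \<ge> X ==> P t > 0" using rv_pos_large[OF S] unfolding P_def by blast
 have cP: "isCont P t" for t unfolding P_def by (rule isCont_rv[OF S])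
 show "0 < rv f x1 z1"
 proof (rule ccontr)
  assume "\<not> 0 < rv f x1 z1"
  then have x1n: "P x1 <= 0" unfolding P_def by simp
  define Z where "Z = {t. x1 <= t \<and> P t <= 0}"
  have bdd: "bdd_above Z" unfolding Z_def bdd_above_def using X by (metis (mono_tags) linorder_le_cases mem_Collect_eq not_less)
  have x1Z: "x1 \<in> Z" unfolding Z_def using x1n by simp
  have clZ: "closed Z"
  proof -
   have "closed ({x1..} \<inter> P -` {..0})"
    by (intro closed_Int closed_vimage closed_atLeast closed_atMost continuous_at_imp_continuous_on) (use cP in auto)
   moreover have "Z = {x1..} \<inter> P -` {..0}" unfolding Z_def by auto
   ultimately show ?thesis by simp
  qed
  define xs where "xs = Sup Z"
  have xsZ: "xs \<in> Z" unfolding xs_def by (rule closed_contains_Sup[OF _ bdd clZ]) (use x1Z in auto)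
  have xs1: "x1 <= xs" and Pxs: "P xs <= 0" using xsZ unfolding Z_def by auto
  have Ppos: "P t > 0" if "t > xs" for t
  proof (rule ccontr)
   assume "\<not> P t > 0"
   then have "t \<in> Z" unfolding Z_def using that xs1 by auto
   then have "t <= xs" unfolding xs_def by (rule cSup_upper[OF _ bdd])
   then show False using that by simp
  qed
  have Pxs0: "P xs = 0"
  proof -
   have "0 <= P xs"
   proof (rule tendsto_lowerbound)
    show "(P \<longlongrightarrow> P xs) (at_right xs)" using cP[of xs] unfolding isCont_def by (rule tendsto_within_subset) simp
    show "\<forall>\<^sub>F t in at_right xs. 0 <= P t"
     using eventually_at_right_less[of xs] by (rule eventually_mono) (use Ppos in \<open>auto intro: less_imp_le\<close>)
   qed simp
   then show ?thesis using Pxs by simp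
  qed
  have "0 < rv (tw a b f) xs z1" by (rule aboveD[OF A]) (use x1 xs1 z1 in auto)
  then have "rv (del a f) xs z1 < 0 \<or> rv (del b f) xs z1 < 0"
   unfolding rv_tw[OF S ab(1,2)] using Pxs0 unfolding P_def by auto
  then obtain c where c: "c \<in> I" "rv (del c f) xs z1 < 0" using ab by blast
  define Q where "Q t = rv (del c f) t z1" for t
  have cQ: "isCont Q t" for t unfolding Q_def by (rule isCont_rv_del[OF S])
  obtain d where d: "d > 0" "\<And>t. \<bar>t - xs\<bar> < d ==> Q t < 0"
  proof -
   have "\<forall>\<^sub>F t in at xs. Q t < 0"
    using cQ[of xs] c(2) unfolding isCont_def Q_def by (rule order_tendstoD(2))
   then obtain d where d: "d > 0" "\<And>t. t \<noteq> xs ==> dist t xs < d ==> Q t < 0"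
    unfolding eventually_at by auto
   have "Q t < 0" if "\<bar>t - xs\<bar> < d" for t
    using d(2)[of t] that c(2) unfolding Q_def dist_real_def by (cases "t = xs") auto
   then show ?thesis using that d(1) by blast
  qed
  obtain p where p: "\<And>t. f t (%i. of_real (z1 i)) = poly p t"
   using stab_poly_x[OF S, of "%i. of_real (z1 i)"] by blast
  obtain q' where q': "\<And>t. f t (%i. of_real ((z1(c := z1 c + 1)) i)) = poly q' t"
   using stab_poly_x[OF S, of "%i. of_real ((z1(c := z1 c + 1)) i)"] by blast
  define q where "q = q' - p"
  have q: "del c f t (%i. of_real (z1 i)) = poly q t" for t
   unfolding del_def upd_real q_def p q' by simp
  have pr: "poly p (of_real t) = of_real (P t)" for t unfolding p[symmetric] P_def by (rule stab_real[OF S])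
  have qr: "poly q (of_real t) = of_real (Q t)" for t unfolding q[symmetric] Q_def by (rule del_real[OF S])
  \<comment> \<open>The root in the variable z c as a holomorphic function of x, wherever q does not
    vanish.\<close>
  define F where "F w = - poly p w / poly q w" for w
  define F1 where "F1 t = (- poly (pderiv p) t * poly q t + poly p t * poly (pderiv q) t) / (poly q t * poly q t)" for t
  have dF: "(F has_field_derivative F1 w) (at w)" if "poly q w \<noteq> 0" for w
  proof -
   have "((%w. - poly p w / poly q w) has_field_derivative
     (- poly (pderiv p) w * poly q w - (- poly p w) * poly (pderiv q) w) / (poly q w * poly q w)) (at w)"
    by (rule DERIV_divide[OF DERIV_minus[OF poly_DERIV] poly_DERIV that])
   then show ?thesis unfolding F_def[abs_def] F1_def by simp
  qed
  define R where "R t = - P t / Q t" for t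
  have FR: "F (of_real t) = of_real (R t)" for t unfolding F_def R_def pr qr by simp
  have dR: "(R has_real_derivative Re (F1 (of_real t))) (at t)" if "\<bar>t - xs\<bar> < d" for t
  proof -
   have "poly q (of_real t) \<noteq> 0" unfolding qr using d(2)[OF that] by simp
   from has_vector_derivative_real_field[OF dF[OF this]]
   have "((%t. complex_of_real (R t)) has_vector_derivative F1 (of_real t)) (at t)" unfolding FR .
   from bounded_linear.has_vector_derivative[OF bounded_linear_Re this]
   show ?thesis by (simp add: has_real_derivative_iff_has_vector_derivative)
  qed
  have R0: "R xs = 0" unfolding R_def Pxs0 by simp
  have "R (xs + d/2) > 0"
   unfolding R_def using divide_pos_neg[OF Ppos[of "xs + d/2"] d(2)[of "xs + d/2"]] d(1) by simp
  moreover obtain xh where xh: "xs < xh" "xh < xs + d/2" "R (xs + d/2) - R xs = (xs + d/2 - xs) * Re (F1 (of_real xh))"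
   using MVT2[of xs "xs + d/2" R "%t. Re (F1 (of_real t))"] dR d(1) by auto
  ultimately have pos: "Re (F1 (of_real xh)) > 0" using R0 d(1) zero_less_mult_pos[of "d / 2" "Re (F1 (of_real xh))"] by simp
  have xhd: "\<bar>xh - xs\<bar> < d" using xh d(1) by auto
  have qx: "poly q (of_real xh) \<noteq> 0" unfolding qr using d(2)[OF xhd] by simp
  define g where "g h = of_real xh + \<i> * of_real h" for h :: real
  have "((%h. Im (F (g h))) has_real_derivative Re (F1 (of_real xh))) (at 0)"
  proof -
   have g0: "g 0 = of_real xh" unfolding g_def by simp
   have dg: "(g has_vector_derivative \<i>) (at 0)" unfolding g_def by (auto intro!: derivative_eq_intros)
   have "(F has_field_derivative F1 (of_real xh)) (at (g 0))" unfolding g0 by (rule dF[OF qx])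
   from field_vector_diff_chain_at[OF dg this]
   have "((F \<circ> g) has_vector_derivative \<i> * F1 (of_real xh)) (at 0)" .
   from bounded_linear.has_vector_derivative[OF bounded_linear_Im this]
   show ?thesis by (simp add: has_real_derivative_iff_has_vector_derivative o_def)
  qed
  from DERIV_pos_inc_right[OF this pos]
  obtain d' where d': "d' > 0" "\<And>h. h > 0 ==> h < d' ==> Im (F (g 0)) < Im (F (g h))" by auto
  define h where "h = d' / 2"
  have h: "h > 0" "h < d'" unfolding h_def using d'(1) by auto
  have F0: "Im (F (g 0)) = 0" unfolding g_def using FR[of xh] by simp
  have im: "Im (F (g h)) > 0" using d'(2)[OF h] F0 by simp
  have qg: "poly q (g h) \<noteq> 0" using im unfolding F_def by auto
  have "f (g h) ((%i. of_real (z1 i))(c := of_real (z1 c) + F (g h))) \<noteq> 0"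
   by (rule stab_nz[OF S]) (use h im in \<open>auto simp: g_def\<close>)
  moreover have "f (g h) ((%i. of_real (z1 i))(c := of_real (z1 c) + F (g h))) = poly p (g h) + F (g h) * poly q (g h)"
   using stab_affine[OF S c(1), of "g h" "%i. of_real (z1 i)" "F (g h)"] unfolding p q .
  moreover have "poly p (g h) + F (g h) * poly q (g h) = 0" unfolding F_def using qg by simp
  ultimately show False by simp
 qed
qed

text \<open>Positivity of f (1 - (\<open>ph\<close> a + \<open>ph\<close> b)/2) leaves one barrier
  below 1. Barriers do not increase upwards, so f with z c lowered by 1, which equals f (1 -
  \<open>ph\<close> c), stays positive on the whole orthant.\<close>

lemma selection_step:
 assumes S: "stab f" and ab: "a \<in> I" "b \<in> I" "a \<noteq> b" and A: "above I (tw a b f) x z"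
 shows "\<exists>c\<in>{a, b}. above I f x (z(c := z c - 1))"
proof -
 have Af: "above I f x z" by (rule tw_above_imp_above[OF assms])
 have p: "rv f x z > 0" by (rule aboveD[OF Af]) auto
 have "0 < rv (tw a b f) x z" by (rule aboveD[OF A]) auto
 then have "rv (del a f) x z < rv f x z \<or> rv (del b f) x z < rv f x z"
  unfolding rv_tw[OF S ab(1,2)] by auto
 then have "ph f a x z < 1 \<or> ph f b x z < 1" unfolding ph_def using p by simp
 then obtain c where c: "c \<in> {a, b}" "ph f c x z < 1" by blast
 then have cI: "c \<in> I" using ab by auto
 have "above I f x (z(c := z c - 1))" unfolding above_def
 proof (intro allI impI)
  fix x' z' assume x': "x <= x'" and z': "\<forall>i\<in>I. (z(c := z c - 1)) i <= z' i"
  define y where "y = z'(c := z' c + 1)"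
  have y: "z i <= y i" if "i \<in> I" for i using z' that unfolding y_def by (cases "i = c") auto
  have py: "rv f x' y > 0" by (rule aboveD[OF Af x' y])
  have "ph f c x' y < 1" using ph_mono[OF S Af cI x' y] c(2) by simp
  then have "rv (del c f) x' y < rv f x' y" unfolding ph_def using py by simp
  moreover have "z' = y(c := y c + (-1))" unfolding y_def by simp
  then have "rv f x' z' = rv f x' y + (-1) * rv (del c f) x' y" using rv_affine[OF S cI, of x' y "-1"] by (simp only:)
  ultimately show "0 < rv f x' z'" by simp
 qed
 then show ?thesis using c by blast
qed

end

section \<open>Spectral bounds for finite Hermitian forms\<close>

text \<open>The coordinate c k is the pairing of c with H y for the k-th column y of the inverse;
  Cauchy-Schwarz for the form H bounds it. This gives a spectral gap by algebra alone.\<close>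

lemma pd_nsq_bound:
 assumes T: "finite T" and pd: "pd T H"
 obtains K where "K > 0" "\<And>c. nsq T c <= K * qf T H c"
proof -
 note h = psd_hermitian[OF pd_psd[OF pd]]
 have "\<exists>y. \<forall>i\<in>T. mv T H y i = idm k i" for k by (rule pd_solve[OF T pd])
 then obtain y where y: "\<And>k i. i \<in> T ==> mv T H (y k) i = idm k i" by metis
 have b: "(cmod (c k))^2 <= qf T H (y k) * qf T H c" if k: "k \<in> T" for c k
 proof -
  have "ip T (y k) (mv T H c) = ip T (mv T H (y k)) c" by (rule hermitian_adj[OF h])
  also have "... = ip T (idm k) c" by (rule ip_cong) (use y in auto)
  also have "... = (\<Sum>j\<in>T. if k = j then c j else 0)"
   unfolding ip_def idm_def by (rule sum.cong) auto
  also have "... = c k" using T k by simp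
  finally show ?thesis using psd_cauchy[OF pd_psd[OF pd], of "y k" c] by simp
 qed
 show ?thesis
 proof (rule that[of "1 + (\<Sum>k\<in>T. qf T H (y k))"])
  have s0: "(\<Sum>k\<in>T. qf T H (y k)) \<ge> 0" by (rule sum_nonneg) (rule psd_qf[OF pd_psd[OF pd]])
  then show "1 + (\<Sum>k\<in>T. qf T H (y k)) > 0" by simp
  fix c
  have "nsq T c <= (\<Sum>k\<in>T. qf T H (y k) * qf T H c)" unfolding nsq_def by (rule sum_mono) (rule b)
  also have "... = (\<Sum>k\<in>T. qf T H (y k)) * qf T H c" by (rule sum_distrib_right[symmetric])
  also have "... <= (1 + (\<Sum>k\<in>T. qf T H (y k))) * qf T H c"
   by (rule mult_right_mono) (use psd_qf[OF pd_psd[OF pd]] in auto)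
  finally show "nsq T c <= (1 + (\<Sum>k\<in>T. qf T H (y k))) * qf T H c" .
 qed
qed

lemma qf_le_bound: "finite T ==> qf T G c <= (\<Sum>i\<in>T. \<Sum>j\<in>T. cmod (G i j)) * nsq T c"
proof -
 assume T: "finite T"
 have m: "cmod (c i) * cmod (c j) <= nsq T c" if ij: "i \<in> T" "j \<in> T" for i j
 proof -
  have l: "(cmod (c k))^2 <= nsq T c" if "k \<in> T" for k
   unfolding nsq_def by (rule member_le_sum) (use that T in auto)
  have "2 * (cmod (c i) * cmod (c j)) <= (cmod (c i))^2 + (cmod (c j))^2"
   using sum_squares_bound[of "cmod (c i)" "cmod (c j)"] by simp
  then show ?thesis using l[OF ij(1)] l[OF ij(2)] by linarith
 qed
 have "qf T G c <= cmod (ip T c (mv T G c))" unfolding qf_def by (rule complex_Re_le_cmod)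
 also have "... <= (\<Sum>i\<in>T. \<Sum>j\<in>T. cmod (cnj (c i) * G i j * c j))"
  unfolding ip_mv_double by (intro order_trans[OF norm_sum] sum_mono norm_sum)
 also have "... <= (\<Sum>i\<in>T. \<Sum>j\<in>T. cmod (G i j) * nsq T c)"
 proof (intro sum_mono)
  fix i j assume ij: "i \<in> T" "j \<in> T"
  have "cmod (cnj (c i) * G i j * c j) = cmod (G i j) * (cmod (c i) * cmod (c j))" by (simp add: norm_mult)
  also have "... <= cmod (G i j) * nsq T c" by (rule mult_left_mono[OF m[OF ij]]) simp
  finally show "cmod (cnj (c i) * G i j * c j) <= cmod (G i j) * nsq T c" .
 qed
 also have "... = (\<Sum>i\<in>T. \<Sum>j\<in>T. cmod (G i j)) * nsq T c" by (simp only: sum_distrib_right)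
 finally show ?thesis .
qed

text \<open>Let l be the smallest number at least x that bounds the form. Then l - G is
  semidefinite, and even definite since l is not an eigenvalue; its spectral gap would permit a
  smaller bound unless l = x.\<close>

lemma qf_le_of_no_eigenvalue:
 assumes T: "finite T" and h: "hermitian T G"
  and ker: "\<And>l c. x <= l ==> (\<And>i. i \<in> T ==> mv T G c i = of_real l * c i) ==> \<forall>i\<in>T. c i = 0"
 shows "qf T G c <= x * nsq T c"
proof -
 define S where "S = {l. x <= l \<and> (\<forall>c. qf T G c <= l * nsq T c)}"
 define M where "M = max x (\<Sum>i\<in>T. \<Sum>j\<in>T. cmod (G i j))"
 have "qf T G c <= M * nsq T c" for c
  by (rule order_trans[OF qf_le_bound[OF T]], rule mult_right_mono) (auto simp: M_def nsq_nonneg)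
 then have MS: "M \<in> S" unfolding S_def M_def by simp
 have bdd: "bdd_below S" unfolding S_def bdd_below_def by blast
 define l where "l = Inf S"
 have xl: "x <= l" unfolding l_def by (rule cInf_greatest) (use MS in \<open>auto simp: S_def\<close>)
 have lS: "qf T G c <= l * nsq T c" for c
 proof (cases "nsq T c = 0")
  case True
  then have "\<forall>j\<in>T. c j = 0" using nsq_eq_0[OF T] by blast
  then have "ip T c (mv T G c) = 0" unfolding ip_def by simp
  then show ?thesis unfolding qf_def True by simp
 next
  case False
  then have n: "nsq T c > 0" using nsq_nonneg[of T c] by simp
  have "qf T G c / nsq T c <= l" unfolding l_def
  proof (rule cInf_greatest)
   show "S \<noteq> {}" using MS by blast
   fix m assume "m \<in> S"
   then have "qf T G c <= m * nsq T c" unfolding S_def by blast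
   then show "qf T G c / nsq T c <= m" using n by (simp add: field_simps)
  qed
  then show ?thesis using n by (simp add: field_simps)
 qed
 define N where "N i j = of_real l * idm i j - G i j" for i j
 have hN: "hermitian T N" unfolding hermitian_def
 proof (intro ballI)
  fix i j assume "i \<in> T" "j \<in> T"
  then have e: "G j i = cnj (G i j)" using h unfolding hermitian_def by blast
  show "N j i = cnj (N i j)" unfolding N_def idm_def e by simp
 qed
 have mvN: "mv T N c i = of_real l * c i - mv T G c i" if "i \<in> T" for c i
 proof -
  have "mv T N c i = of_real l * mv T idm c i - mv T G c i"
   unfolding mv_def N_def left_diff_distrib sum_subtractf sum_distrib_left by (simp only: mult.assoc)
  then show ?thesis unfolding mv_idm[OF T that] .
 qed
 have qN: "qf T N c = l * nsq T c - qf T G c" for c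
 proof -
  have "ip T c (mv T N c) = ip T c (%i. of_real l * c i - mv T G c i)"
   by (rule ip_cong) (auto simp: mvN)
  also have "... = of_real l * of_real (nsq T c) - ip T c (mv T G c)"
   unfolding ip_diff_right ip_scale_right ip_self ..
  finally show ?thesis unfolding qf_def by simp
 qed
 have psN: "psd T N" unfolding psd_def using hN lS by (simp add: qN)
 have "pd T N" unfolding pd_def
 proof (intro conjI hN allI impI)
  fix f :: "_ => complex" assume f: "\<exists>j\<in>T. f j \<noteq> 0"
  show "qf T N f > 0"
  proof (rule ccontr)
   assume "\<not> qf T N f > 0"
   then have "qf T N f = 0" using psd_qf[OF psN, of f] by simp
   then have "mv T N f i = 0" if "i \<in> T" for i using psd_qf0[OF psN _ T that] by blast
   then have "mv T G f i = of_real l * f i" if "i \<in> T" for i using mvN[OF that, of f] that by simp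
   then show False using ker[OF xl, of f] f by blast
  qed
 qed
 then obtain K where K: "K > 0" "\<And>c. nsq T c <= K * qf T N c" using pd_nsq_bound[OF T] by blast
 have "max x (l - 1 / K) \<in> S" unfolding S_def
 proof (intro CollectI conjI allI)
  fix c
  have "qf T G c <= (l - 1 / K) * nsq T c" using K(2)[of c] K(1) unfolding qN by (simp add: field_simps)
  also have "... <= max x (l - 1 / K) * nsq T c" by (rule mult_right_mono) (auto simp: nsq_nonneg)
  finally show "qf T G c <= max x (l - 1 / K) * nsq T c" .
 qed simp
 then have "l <= max x (l - 1 / K)" unfolding l_def using bdd by (rule cInf_lower)
 then have "l <= x" using K(1) by (auto simp: max_def split: if_splits)
 then have "l = x" using xl by simp
 then show ?thesis using lS by simp
qed

section \<open>The theorem of Marcus, Spielman and Srivastava\<close>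

text \<open>det (x + Z G) with Z = diag z. If G is the Gram matrix of vectors v_i, this is det (x +
  sum z_i v_i v_i^H) up to a power of x. Working with G fixes the degree in x to be
  \<open>card I\<close>, whatever space the vectors live in.\<close>

definition dpoly :: "'i set => ('i => 'i => complex) => complex => ('i => complex) => complex" where
 "dpoly I G x z = fdet I (%i j. (if i = j then x else 0) + z i * G i j)"

text \<open>A kernel vector satisfies x c = - Z G c, and pairing with G c gives the identity. If the
  form vanished at c, then G c = 0 and hence x c = 0.\<close>

lemma dpoly_null:
 assumes I: "finite I" and G: "psd I G" and x: "x \<noteq> 0" and z: "dpoly I G x z = 0"
 shows "\<exists>c. qf I G c > 0 \<and> x * of_real (qf I G c) + (\<Sum>i\<in>I. z i * of_real ((cmod (mv I G c i))^2)) = 0"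
proof -
 obtain c where c: "\<exists>i\<in>I. c i \<noteq> 0" "\<And>i. i \<in> I ==> (\<Sum>j\<in>I. ((if i = j then x else 0) + z i * G i j) * c j) = 0"
  using z unfolding dpoly_def fdet_0_iff[OF I] by blast
 have e: "x * c i + z i * mv I G c i = 0" if i: "i \<in> I" for i
 proof -
  have "(\<Sum>j\<in>I. ((if i = j then x else 0) + z i * G i j) * c j) =
   (\<Sum>j\<in>I. (if i = j then x * c j else 0)) + z i * mv I G c i"
   unfolding mv_def sum_distrib_left sum.distrib[symmetric] by (rule sum.cong) (auto simp: algebra_simps)
  also have "(\<Sum>j\<in>I. (if i = j then x * c j else 0)) = x * c i" using I i by simp
  finally show ?thesis using c(2)[OF i] by simp
 qed
 have h: "hermitian I G" by (rule psd_hermitian[OF G])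
 have "ip I (mv I G c) c = of_real (qf I G c)"
  using hermitian_adj[OF h, of c c] ip_mv_qf[OF h, of c] by simp
 then have q: "(\<Sum>i\<in>I. cnj (mv I G c i) * c i) = of_real (qf I G c)" unfolding ip_def .
 have "0 = (\<Sum>i\<in>I. cnj (mv I G c i) * (x * c i + z i * mv I G c i))" using e by simp
 also have "... = x * (\<Sum>i\<in>I. cnj (mv I G c i) * c i) + (\<Sum>i\<in>I. z i * (mv I G c i * cnj (mv I G c i)))"
  unfolding sum_distrib_left sum.distrib[symmetric] by (rule sum.cong) (auto simp: algebra_simps)
 finally have main: "x * of_real (qf I G c) + (\<Sum>i\<in>I. z i * of_real ((cmod (mv I G c i))^2)) = 0"
  unfolding q complex_norm_square by simp
 have "qf I G c > 0"
 proof (rule ccontr)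
  assume "\<not> qf I G c > 0"
  then have "qf I G c = 0" using psd_qf[OF G, of c] by simp
  then have "mv I G c i = 0" if "i \<in> I" for i using psd_qf0[OF G _ I that] by blast
  then have "c i = 0" if "i \<in> I" for i using e[OF that] x that by simp
  then show False using c(1) by blast
 qed
 then show ?thesis using main by blast
qed

lemma dpoly_nz_upper:
 assumes I: "finite I" and G: "psd I G" and x: "Im x > 0" and z: "\<And>i. i \<in> I ==> Im (z i) \<ge> 0"
 shows "dpoly I G x z \<noteq> 0"
proof
 assume "dpoly I G x z = 0"
 moreover have "x \<noteq> 0" using x by auto
 ultimately obtain c where c: "qf I G c > 0" "x * of_real (qf I G c) + (\<Sum>i\<in>I. z i * of_real ((cmod (mv I G c i))^2)) = 0"
  using dpoly_null[OF I G] by blast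
 have "Im (x * of_real (qf I G c) + (\<Sum>i\<in>I. z i * of_real ((cmod (mv I G c i))^2))) =
  Im x * qf I G c + (\<Sum>i\<in>I. Im (z i) * (cmod (mv I G c i))^2)"
  by simp
 moreover have "Im x * qf I G c > 0" using x c(1) by simp
 moreover have "(\<Sum>i\<in>I. Im (z i) * (cmod (mv I G c i))^2) \<ge> 0" by (rule sum_nonneg) (use z in simp)
 ultimately show False unfolding c(2) by simp
qed

text \<open>The hypothesis on z says that - sum z_i v_i v_i^H is at most \<theta> on the span of the
  vectors, expressed through G. So zeros of the polynomial are at most \<theta>.\<close>

lemma dpoly_nz_real:
 assumes I: "finite I" and G: "psd I G" and x: "x > \<theta>" "x > 0"
  and z: "\<And>c. (\<Sum>i\<in>I. - z i * (cmod (mv I G c i))^2) <= \<theta> * qf I G c"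
 shows "dpoly I G (of_real x) (%i. of_real (z i)) \<noteq> 0"
proof
 assume a: "dpoly I G (of_real x) (%i. of_real (z i)) = 0"
 have "complex_of_real x \<noteq> 0" using x by simp
 from dpoly_null[OF I G this a]
 obtain c where c: "qf I G c > 0" "of_real x * of_real (qf I G c) + (\<Sum>i\<in>I. complex_of_real (z i) * of_real ((cmod (mv I G c i))^2)) = 0"
  by blast
 have "x * qf I G c + (\<Sum>i\<in>I. z i * (cmod (mv I G c i))^2) = 0"
  using arg_cong[OF c(2), of Re] by (simp add: Re_sum)
 then have "x * qf I G c <= \<theta> * qf I G c" using z[of c] by (simp add: sum_negf)
 then show False using c(1) x(1) by simp
qed

text \<open>Weighting columns instead of rows changes no Leibniz term: a permutation maps its
  nonfixed points onto themselves, and at fixed points both weights agree. Combined with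
  transposition this makes the polynomial real.\<close>

lemma dpoly_swap:
 assumes I: "finite I"
 shows "fdet I (%i j. (if i = j then x else 0) + z j * G i j) = dpoly I G x z"
proof -
 let ?n = "card I" and ?e = "enum I"
 have "(\<Prod>a<?n. (if ?e a = ?e (p a) then x else 0) + z (?e (p a)) * G (?e a) (?e (p a))) =
  (\<Prod>a<?n. (if ?e a = ?e (p a) then x else 0) + z (?e a) * G (?e a) (?e (p a)))"
  if p: "p permutes {..<?n}" for p
 proof -
  let ?N = "{a \<in> {..<?n}. ?e (p a) \<noteq> ?e a}" and ?E = "{a \<in> {..<?n}. ?e (p a) = ?e a}"
  have split: "(\<Prod>a<?n. h a) = (\<Prod>a\<in>?E. h a) * (\<Prod>a\<in>?N. h a)" for h :: "nat => complex"
   by (subst prod.union_disjoint[symmetric]) (auto intro!: prod.cong)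
  have N: "(\<Prod>a\<in>?N. z (?e (p a))) = (\<Prod>a\<in>?N. z (?e a))"
  proof -
   have bij: "bij_betw p ?N ?N"
   proof (rule bij_betw_byWitness[where f' = "inv_into UNIV p"])
    show "\<forall>a\<in>?N. inv_into UNIV p (p a) = a" using permutes_inverses(2)[OF p] by simp
    show "\<forall>a'\<in>?N. p (inv_into UNIV p a') = a'" using permutes_inverses(1)[OF p] by simp
    have inj: "?e a = ?e b \<longleftrightarrow> a = b" if "a < ?n" "b < ?n" for a b
     by (rule enum_eq_iff[OF I that])
    have pin: "p a < ?n \<longleftrightarrow> a < ?n" for a using permutes_in_image[OF p, of a] by simp
    have ipin: "inv_into UNIV p a < ?n \<longleftrightarrow> a < ?n" for a using permutes_in_image[OF permutes_inv[OF p], of a] by simp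
    have iff: "a \<in> ?N \<longleftrightarrow> a < ?n \<and> p a \<noteq> a" for a using inj[of "p a" a] pin[of a] by blast
    show "p ` ?N \<subseteq> ?N"
    proof
     fix b assume "b \<in> p ` ?N"
     then obtain a where a: "a \<in> ?N" "b = p a" by blast
     have "p b \<noteq> b" using a permutes_inj[OF p] unfolding iff by (auto dest: injD)
     then show "b \<in> ?N" using a pin unfolding iff by blast
    qed
    show "inv_into UNIV p ` ?N \<subseteq> ?N"
    proof
     fix b assume "b \<in> inv_into UNIV p ` ?N"
     then obtain a where a: "a \<in> ?N" "b = inv_into UNIV p a" by blast
     have "p b = a" unfolding a(2) using permutes_inverses(1)[OF p] by simp
     moreover have "a \<noteq> b" using a(1) calculation unfolding iff by auto
     ultimately show "b \<in> ?N" using a ipin unfolding iff by auto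
    qed
   qed
   show ?thesis using prod.reindex_bij_betw[OF bij, of "%a. z (?e a)"] .
  qed
  have "(\<Prod>a\<in>?N. (if ?e a = ?e (p a) then x else 0) + z (?e (p a)) * G (?e a) (?e (p a))) =
   (\<Prod>a\<in>?N. z (?e (p a))) * (\<Prod>a\<in>?N. G (?e a) (?e (p a)))"
   unfolding prod.distrib[symmetric] by (rule prod.cong) auto
  also have "... = (\<Prod>a\<in>?N. (if ?e a = ?e (p a) then x else 0) + z (?e a) * G (?e a) (?e (p a)))"
   unfolding N prod.distrib[symmetric] by (rule prod.cong) auto
  finally have 1: "(\<Prod>a\<in>?N. (if ?e a = ?e (p a) then x else 0) + z (?e (p a)) * G (?e a) (?e (p a))) =
   (\<Prod>a\<in>?N. (if ?e a = ?e (p a) then x else 0) + z (?e a) * G (?e a) (?e (p a)))" .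
  have 2: "(\<Prod>a\<in>?E. (if ?e a = ?e (p a) then x else 0) + z (?e (p a)) * G (?e a) (?e (p a))) =
   (\<Prod>a\<in>?E. (if ?e a = ?e (p a) then x else 0) + z (?e a) * G (?e a) (?e (p a)))"
   by (rule prod.cong) auto
  show ?thesis unfolding split[of "%a. (if ?e a = ?e (p a) then x else 0) + z (?e (p a)) * G (?e a) (?e (p a))"]
    split[of "%a. (if ?e a = ?e (p a) then x else 0) + z (?e a) * G (?e a) (?e (p a))"] 1 2 ..
 qed
 then show ?thesis unfolding dpoly_def fdet_leibniz by (intro sum.cong refl) simp
qed

lemma pencil_dpoly:
 assumes I: "finite I" and G: "psd I G"
 shows "pencil I (dpoly I G)"
proof
 show "finite I" by (rule I)
 show "dpoly I G 1 (%_. 0) = 1" unfolding dpoly_def using fdet_one[OF I] by simp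
 fix \<xi> :: real and w :: "_ => real" assume "0 < \<xi>" and w: "\<And>i. i \<in> I ==> 0 <= w i"
 then show "dpoly I G (of_real \<xi>) (%i. of_real (w i)) \<noteq> 0"
  by (intro dpoly_nz_real[OF I G, where \<theta> = 0]) (auto intro!: sum_nonpos simp: mult_nonpos_nonneg)
qed

lemma stab_dpoly:
 assumes I: "finite I" and G: "psd I G"
 shows "pencil.stab I (dpoly I G) (dpoly I G)"
 unfolding pencil.stab_def[OF pencil_dpoly[OF I G]]
proof (intro conjI allI ballI impI)
 fix x \<xi> :: complex and z w :: "'a => complex"
 have "\<exists>p. degree p <= card I \<and> Polynomial.coeff p (card I) = fdet I (%i j. (if i = j then \<xi> else 0) + w i * G i j) \<and>
   (\<forall>t. fdet I (%i j. ((if i = j then x else 0) + z i * G i j) + t * ((if i = j then \<xi> else 0) + w i * G i j)) = poly p t)"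
  by (rule fdet_pencil_poly)
 moreover have "fdet I (%i j. ((if i = j then x else 0) + z i * G i j) + t * ((if i = j then \<xi> else 0) + w i * G i j)) =
  dpoly I G (x + t * \<xi>) (%i. z i + t * w i)" for t
  unfolding dpoly_def by (rule fdet_cong[OF I]) (simp add: algebra_simps)
 ultimately show "\<exists>p. degree p <= card I \<and> Polynomial.coeff p (card I) = dpoly I G \<xi> w \<and>
    (\<forall>t. dpoly I G (x + t * \<xi>) (%i. z i + t * w i) = poly p t)"
  unfolding dpoly_def[of I G \<xi> w] by (simp only:)
next
 fix c x t and z :: "'a => complex" assume c: "c \<in> I"
 define H where "H i j = (if i = j then x else 0) + z i * G i j" for i j
 have e: "dpoly I G x (z(c := z c + t)) = fdet I (H(c := H c)) + t * fdet I (H(c := G c))" for t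
 proof -
  have "dpoly I G x (z(c := z c + t)) = fdet I (H(c := %j. H c j + t * G c j))"
   unfolding dpoly_def H_def by (rule fdet_cong[OF I]) (simp add: algebra_simps)
  then show ?thesis unfolding fdet_row_affine[OF I c] .
 qed
 have e0: "dpoly I G x z = fdet I (H(c := H c))" using e[of 0] by simp
 show "dpoly I G x (z(c := z c + t)) = dpoly I G x z + t * del c (dpoly I G) x z"
  unfolding del_def e e0 by simp
next
 fix x and z :: "'a => complex"
 have "cnj (dpoly I G x z) = fdet I (%i j. cnj ((if i = j then x else 0) + z i * G i j))"
  unfolding dpoly_def fdet_cnj ..
 also have "... = fdet I (%i j. (if j = i then cnj x else 0) + cnj (z i) * G j i)"
 proof (rule fdet_cong[OF I])
  fix i j assume "i \<in> I" "j \<in> I"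
  then have g: "G j i = cnj (G i j)" using psd_hermitian[OF G] unfolding hermitian_def by blast
  show "cnj ((if i = j then x else 0) + z i * G i j) = (if j = i then cnj x else 0) + cnj (z i) * G j i"
   unfolding g by simp
 qed
 also have "... = fdet I (%i j. (if i = j then cnj x else 0) + cnj (z j) * G i j)"
  using fdet_transpose[of I "%i j. (if i = j then cnj x else 0) + cnj (z j) * G i j"] .
 also have "... = dpoly I G (cnj x) (%i. cnj (z i))" by (rule dpoly_swap[OF I])
 finally show "dpoly I G (cnj x) (%i. cnj (z i)) = cnj (dpoly I G x z)" by (rule sym)
next
 fix x and z :: "'a => complex" assume "0 < Im x" "\<forall>i\<in>I. 0 <= Im (z i)"
 then show "dpoly I G x z \<noteq> 0" by (intro dpoly_nz_upper[OF I G]) auto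
qed

text \<open>Expected polynomial while the pairs in the list are undecided. The head of the list is
  averaged last, so it is the first pair to be decided.\<close>

fun mixed :: "('k \<times> bool) set => ('k \<times> bool => 'k \<times> bool => complex) => 'k list =>
  complex => ('k \<times> bool => complex) => complex" where
 "mixed I G [] = dpoly I G"
| "mixed I G (k # ks) = pencil.tw (k, True) (k, False) (mixed I G ks)"

text \<open>
 The two-point, Gram-matrix form of the theorem of Marcus, Spielman and Srivastava. Instead of
 interlacing families, the selection step keeps the point \<open>(x, - chosen indicators)\<close> above the
 zeros of the successively less averaged polynomial.
\<close>

theorem mss_gram:
 fixes G :: "'k \<times> bool => 'k \<times> bool => complex"
 assumes K: "finite K" and G: "psd (K \<times> UNIV) G" and d: "\<delta> > 0"
  and G2: "\<And>c. qf (K \<times> UNIV) G c <= 2 * nsq (K \<times> UNIV) c"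
  and Gd: "\<And>c i. i \<in> K \<times> UNIV ==> (cmod (mv (K \<times> UNIV) G c i))^2 <= \<delta> * qf (K \<times> UNIV) G c"
 shows "\<exists>\<sigma>. \<forall>c. qf ((%k. (k, \<sigma> k)) ` K) G c <= (1 + sqrt \<delta>)^2 * nsq ((%k. (k, \<sigma> k)) ` K) c"
proof -
 define I where "I = K \<times> (UNIV :: bool set)"
 have I: "finite I" unfolding I_def using K by simp
 note G = G[folded I_def] and G2 = G2[folded I_def] and Gd = Gd[folded I_def]
 interpret pencil I "dpoly I G" by (rule pencil_dpoly[OF I G])
 note S0 = stab_dpoly[OF I G]
 \<comment> \<open>s is the shift paid per pair, t the initial distance above the zeros, x their
   sum. The constraint \<delta> / t = 1 - 1 / s is what \<open>barrier_step\<close> asks for, and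
   this choice minimizes s + t under it.\<close>
 define s t x where "s = 1 + sqrt \<delta>" and "t = \<delta> + sqrt \<delta>" and "x = (1 + sqrt \<delta>)^2"
 have sd: "sqrt \<delta> > 0" using d by simp
 have spos: "s > 0" and tpos: "t > 0" using sd d unfolding s_def t_def by (intro add_pos_pos; simp)+
 have xst: "x = s + t" unfolding x_def s_def t_def using d by (simp add: power2_eq_square algebra_simps)
 have dt: "\<delta> / t = 1 - 1 / s"
 proof -
  have "t = sqrt \<delta> * s" unfolding t_def s_def using d by (simp add: algebra_simps)
  then have "\<delta> / t = (sqrt \<delta> * sqrt \<delta>) / (sqrt \<delta> * s)" using d by simp
  also have "... = sqrt \<delta> / s" by (rule mult_divide_mult_cancel_left) (use sd in simp)
  also have "... = 1 - 1 / s" using spos unfolding s_def by (simp add: field_simps)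
  finally show ?thesis .
 qed
 have Gnsq: "nsq I (mv I G c) <= 2 * qf I G c" for c
 proof -
  define N where "N = nsq I (mv I G c)"
  have N0: "N \<ge> 0" unfolding N_def by (rule nsq_nonneg)
  have "ip I (mv I G c) (mv I G c) = of_real N" unfolding N_def by (rule ip_self)
  then have "N^2 <= qf I G (mv I G c) * qf I G c"
   using psd_cauchy[OF G, of "mv I G c" c] by simp
  also have "... <= 2 * N * qf I G c"
   unfolding N_def by (rule mult_right_mono[OF G2 psd_qf[OF G]])
  finally have "N * N <= N * (2 * qf I G c)" by (simp add: power2_eq_square mult_ac)
  then show ?thesis unfolding N_def[symmetric] using N0 psd_qf[OF G, of c]
   by (cases "N = 0") auto
 qed
 \<comment> \<open>At z = - s / 2 the weighted form is at most s because the whole form is at most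
   2; lowering the coordinate c further by \<tau> adds at most \<tau> \<delta>. So x = s + t is
   still above the zeros as long as \<tau> \<delta> < t.\<close>
 have start: "rv (dpoly I G) x' z' > 0"
  if c: "c \<in> I" and tau: "0 <= \<tau>" "\<tau> * \<delta> < t" and x': "x <= x'" and z': "\<And>i. i \<in> I ==> - (s / 2) - (if i = c then \<tau> else 0) <= z' i"
  for c \<tau> x' z'
 proof (rule rv_pos_no_zero[OF S0])
  fix y assume y: "x' <= y"
  have "dpoly I G (of_real y) (%i. of_real (z' i)) \<noteq> 0"
  proof (rule dpoly_nz_real[OF I G])
   show "s + \<tau> * \<delta> < y" using y x' xst tau by simp
   show "0 < y" using y x' xst spos tpos by simp
   fix e
   have "(\<Sum>i\<in>I. - z' i * (cmod (mv I G e i))^2) <= (\<Sum>i\<in>I. (s / 2) * (cmod (mv I G e i))^2 + (if i = c then \<tau> * (cmod (mv I G e i))^2 else 0))"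
   proof (rule sum_mono)
    fix i assume i: "i \<in> I"
    have "- z' i * (cmod (mv I G e i))\<^sup>2 <= (s / 2 + (if i = c then \<tau> else 0)) * (cmod (mv I G e i))\<^sup>2"
     by (rule mult_right_mono) (use z'[OF i] in auto)
    then show "- z' i * (cmod (mv I G e i))\<^sup>2 <= (s / 2) * (cmod (mv I G e i))\<^sup>2 + (if i = c then \<tau> * (cmod (mv I G e i))\<^sup>2 else 0)"
     by (simp add: distrib_right split: if_splits)
   qed
   also have "... = (s / 2) * nsq I (mv I G e) + \<tau> * (cmod (mv I G e c))^2"
    unfolding sum.distrib sum_distrib_left[symmetric] nsq_def using I c by simp
   also have "... <= (s / 2) * (2 * qf I G e) + \<tau> * (\<delta> * qf I G e)"
    by (intro add_mono mult_left_mono Gnsq Gd c tau) (use spos in simp)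
   also have "... = (s + \<tau> * \<delta>) * qf I G e" by (simp add: algebra_simps)
   finally show "(\<Sum>i\<in>I. - z' i * (cmod (mv I G e i))^2) <= (s + \<tau> * \<delta>) * qf I G e" .
  qed
  then show "rv (dpoly I G) y z' \<noteq> 0" using stab_real[OF S0, of y z'] by simp
 qed
 \<comment> \<open>Pairs already averaged have been raised from - s / 2 to 0.\<close>
 define zz where "zz ks i = (if fst i \<in> set ks then 0 else - (s / 2))" for ks and i :: "'k \<times> bool"
 have stabm: "stab (mixed I G ks)" if "set ks \<subseteq> K" for ks
  using that
 proof (induction ks)
  case (Cons k ks)
  then have "(k, True) \<in> I" "(k, False) \<in> I" "stab (mixed I G ks)" unfolding I_def by auto
  then show ?case unfolding mixed.simps by (intro stab_tw) simp_all
 qed (simp add: S0)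
 have barrier: "above I (mixed I G ks) x (zz ks) \<and> (\<forall>c\<in>I. fst c \<notin> set ks \<longrightarrow> ph (mixed I G ks) c x (zz ks) <= \<delta> / t)"
  if "set ks \<subseteq> K" "distinct ks" for ks
  using that
 proof (induction ks)
  case Nil
  show ?case
  \<comment> \<open>\<open>start\<close> is phrased with a distinguished coordinate c, so the empty
    index set is treated apart.\<close>
  proof (cases "I = {}")
   case True
   have "above I (dpoly I G) x (zz [])" unfolding above_def
   proof (intro allI impI rv_pos_no_zero[OF S0])
    fix x' z' y assume "x <= x'" "x' <= y"
    then have "dpoly I G (of_real y) (%i. of_real (z' i)) \<noteq> 0"
     by (intro dpoly_nz_real[OF I G, where \<theta> = 0]) (use xst spos tpos in \<open>auto simp: True qf_def ip_def\<close>)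
    then show "rv (dpoly I G) y z' \<noteq> 0" using stab_real[OF S0, of y z'] by simp
   qed
   then show ?thesis using True by simp
  next
   case False
   then obtain c0 where c0: "c0 \<in> I" by blast
   have A: "above I (dpoly I G) x (zz [])" unfolding above_def
   proof (intro allI impI)
    fix x' z' assume "x <= x'" "\<forall>i\<in>I. zz [] i <= z' i"
    then show "0 < rv (dpoly I G) x' z'"
     by (intro start[OF c0, of 0]) (use tpos in \<open>auto simp: zz_def\<close>)
   qed
   \<comment> \<open>A barrier p > \<delta> / t would put a zero at z c - 1/p, by affinity, although
     \<open>start\<close> gives positivity for a lowering by 1/p.\<close>
   have "ph (dpoly I G) c x (zz []) <= \<delta> / t" if c: "c \<in> I" for c
   proof (rule ccontr)
    assume n: "\<not> ph (dpoly I G) c x (zz []) <= \<delta> / t"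
    define p where "p = ph (dpoly I G) c x (zz [])"
    have p: "p > \<delta> / t" using n unfolding p_def by simp
    then have pp: "p > 0" using d tpos by (meson divide_pos_pos less_trans)
    have "1 / p * \<delta> < t" using p pp tpos by (simp add: field_simps)
    then have "rv (dpoly I G) x ((zz [])(c := zz [] c + (- (1 / p)))) > 0"
     by (intro start[OF c, of "1 / p"]) (use pp in \<open>auto simp: zz_def\<close>)
    moreover have "rv (dpoly I G) x ((zz [])(c := zz [] c + (- (1 / p)))) = rv (dpoly I G) x (zz []) * (1 - (1 / p) * p)"
     unfolding rv_affine[OF S0 c] p_def ph_def using aboveD[OF A order_refl, of "zz []"] by (simp add: algebra_simps)
    ultimately show False using pp by simp
   qed
   then show ?thesis using A by simp
  qed
 next
  case (Cons k ks)
  let ?a = "(k, True)" and ?b = "(k, False)" and ?f = "mixed I G ks"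
  have ab: "?a \<in> I" "?b \<in> I" "?a \<noteq> ?b" using Cons.prems unfolding I_def by auto
  have IH: "above I ?f x (zz ks)" "\<And>c. c \<in> I ==> fst c \<notin> set ks ==> ph ?f c x (zz ks) <= \<delta> / t"
   using Cons by auto
  have S: "stab ?f" using stabm Cons.prems by simp
  have "ph ?f ?a x (zz ks) <= \<delta> / t" "ph ?f ?b x (zz ks) <= \<delta> / t" using IH(2) ab Cons.prems by auto
  moreover have "(p + q) / 2 <= u" if "p <= u" "q <= u" for p q u :: real using that by simp
  ultimately have le: "(ph ?f ?a x (zz ks) + ph ?f ?b x (zz ks)) / 2 <= 1 - 1 / s" unfolding dt[symmetric] by blast
  have z1: "(%i. zz ks i + s * (if i = ?a \<or> i = ?b then 1/2 else 0)) = zz (k # ks)"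
  proof (rule ext)
   fix i :: "'k \<times> bool"
   obtain j b where i: "i = (j, b)" by (cases i)
   show "zz ks i + s * (if i = ?a \<or> i = ?b then 1/2 else 0) = zz (k # ks) i"
    unfolding i zz_def using Cons.prems by (cases b) auto
  qed
  note B = barrier_step[OF S ab IH(1) spos le, unfolded z1]
  show ?case
  proof (intro conjI ballI impI)
   show "above I (mixed I G (k # ks)) x (zz (k # ks))" using B(1) by simp
   fix c assume c: "c \<in> I" "fst c \<notin> set (k # ks)"
   have "ph (tw ?a ?b ?f) c x (zz (k # ks)) <= ph ?f c x (zz ks)" by (rule B(2)) (use c in auto)
   then show "ph (mixed I G (k # ks)) c x (zz (k # ks)) <= \<delta> / t" using IH(2)[OF c(1)] c(2) by simp
  qed
 qed
 have select: "\<exists>\<sigma>. above I (dpoly I G) x (%i. z i - (if fst i \<in> set ks \<and> snd i = \<sigma> (fst i) then 1 else 0))"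
  if "set ks \<subseteq> K" "distinct ks" "above I (mixed I G ks) x z" for ks z
  using that
 proof (induction ks arbitrary: z)
  case Nil
  then show ?case by simp
 next
  case (Cons k ks)
  let ?a = "(k, True)" and ?b = "(k, False)" and ?f = "mixed I G ks"
  have ab: "?a \<in> I" "?b \<in> I" "?a \<noteq> ?b" using Cons.prems unfolding I_def by auto
  have S: "stab ?f" using stabm Cons.prems by simp
  have "above I (tw ?a ?b ?f) x z" using Cons.prems(3) by simp
  from selection_step[OF S ab this] obtain c where c: "c \<in> {?a, ?b}" "above I ?f x (z(c := z c - 1))" by blast
  have "\<exists>\<sigma>. above I (dpoly I G) x (%i. (z(c := z c - 1)) i - (if fst i \<in> set ks \<and> snd i = \<sigma> (fst i) then 1 else 0))"
   by (rule Cons.IH[OF _ _ c(2)]) (use Cons.prems in auto)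
  then obtain \<sigma> where \<sigma>: "above I (dpoly I G) x (%i. (z(c := z c - 1)) i - (if fst i \<in> set ks \<and> snd i = \<sigma> (fst i) then 1 else 0))"
   by (rule exE)
  have "(%i. (z(c := z c - 1)) i - (if fst i \<in> set ks \<and> snd i = \<sigma> (fst i) then 1 else 0)) =
   (%i. z i - (if fst i \<in> set (k # ks) \<and> snd i = (\<sigma>(k := snd c)) (fst i) then 1 else 0))"
   using c(1) Cons.prems(2) by (intro ext) auto
  with \<sigma> have "above I (dpoly I G) x (%i. z i - (if fst i \<in> set (k # ks) \<and> snd i = (\<sigma>(k := snd c)) (fst i) then 1 else 0))"
   by (simp only:)
  then show ?case by (rule exI[of _ "\<sigma>(k := snd c)"])
 qed
 obtain ks where ks: "set ks = K" "distinct ks" using finite_distinct_list[OF K] by blast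
 have "above I (mixed I G ks) x (zz ks)" using barrier[of ks] ks by blast
 then have "\<exists>\<sigma>. above I (dpoly I G) x (%i. zz ks i - (if fst i \<in> set ks \<and> snd i = \<sigma> (fst i) then 1 else 0))"
  by (intro select) (use ks in simp_all)
 then obtain \<sigma> where \<sigma>: "above I (dpoly I G) x (%i. zz ks i - (if fst i \<in> set ks \<and> snd i = \<sigma> (fst i) then 1 else 0))"
  by (rule exE)
 define T where "T = (%k. (k, \<sigma> k)) ` K"
 have TI: "T \<subseteq> I" unfolding T_def I_def by auto
 have T: "finite T" unfolding T_def using K by simp
 have above: "rv (dpoly I G) y (%i. - (if i \<in> T then 1 else 0)) > 0" if "x <= y" for y
  by (rule aboveD[OF \<sigma> that]) (use ks in \<open>auto simp: zz_def T_def I_def\<close>)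
 have hT: "hermitian T G" using psd_hermitian[OF G] TI unfolding hermitian_def by blast
 have "qf T G c <= x * nsq T c" for c
 proof (rule qf_le_of_no_eigenvalue[OF T hT])
  fix l c assume l: "x <= l" and e: "\<And>i. i \<in> T ==> mv T G c i = of_real l * c i"
  \<comment> \<open>Extended by 0, an eigenvector of the selected block is a kernel vector of l -
    1_T G: rows outside T only read l c'.\<close>
  define c' where "c' i = (if i \<in> T then c i else 0)" for i
  have mvc: "mv I G c' i = mv T G c i" for i
   unfolding mv_def c'_def using TI I by (intro sum.mono_neutral_cong_right) auto
  have nz: "dpoly I G (of_real l) (%i. of_real (- (if i \<in> T then 1 else 0))) \<noteq> 0"
   using above[OF l] stab_real[OF S0, of l "%i. - (if i \<in> T then 1 else 0)"] by simp
  show "\<forall>i\<in>T. c i = 0"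
  proof (rule ccontr)
   assume "\<not> (\<forall>i\<in>T. c i = 0)"
   then have ne: "\<exists>i\<in>I. c' i \<noteq> 0" using TI unfolding c'_def by auto
   have "(\<Sum>j\<in>I. ((if i = j then of_real l else 0) + of_real (- (if i \<in> T then 1 else 0)) * G i j) * c' j) = 0" if i: "i \<in> I" for i
   proof -
    have "(\<Sum>j\<in>I. ((if i = j then of_real l else 0) + of_real (- (if i \<in> T then 1 else 0)) * G i j) * c' j) =
     (\<Sum>j\<in>I. (if i = j then of_real l * c' j else 0)) + of_real (- (if i \<in> T then 1 else 0)) * mv I G c' i"
     unfolding mv_def sum_distrib_left sum.distrib[symmetric] by (rule sum.cong) (auto simp: algebra_simps)
    also have "(\<Sum>j\<in>I. (if i = j then of_real l * c' j else 0)) = of_real l * c' i" using I i by simp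
    finally show ?thesis unfolding mvc using e[of i] by (simp add: c'_def)
   qed
   then have "dpoly I G (of_real l) (%i. of_real (- (if i \<in> T then 1 else 0))) = 0"
    unfolding dpoly_def fdet_0_iff[OF I] using ne by blast
   then show False using nz by simp
  qed
 qed
 then show ?thesis unfolding T_def x_def by blast
qed

section \<open>From Gram matrices to vectors and two-colourings\<close>

lemma pd_pos: "pd J H ==> j \<in> J ==> f j \<noteq> 0 ==> qf J H f > 0"
 unfolding pd_def by blast

lemma sum_times_bool:
 "(\<Sum>p\<in>J \<times> (UNIV::bool set). h p) = (\<Sum>j\<in>J. h (j, True) + h (j, False))"
proof -
 have "(\<Sum>p\<in>J \<times> (UNIV::bool set). h p) = (\<Sum>j\<in>J. \<Sum>s\<in>(UNIV::bool set). h (j, s))"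
  using sum.cartesian_product[of "%j s. h (j, s)" "UNIV :: bool set" J] by simp
 also have "... = (\<Sum>j\<in>J. h (j, True) + h (j, False))"
  by (simp add: UNIV_bool add.commute)
 finally show ?thesis .
qed

text \<open>The form X plays the role of the inner product: with X y_l = x_l, the numbers
  \<open>ip J (x i) (y l)\<close> are the Gram matrix of the vectors normalized by X, so no square
  root of X has to be taken. The factor 2 in G makes the expected form over random selections at
  most 1; it explains both 2 \<kappa> and the division by 2 in the bound.\<close>

lemma mss_form:
 fixes X :: "'j => 'j => complex" and x :: "'k \<times> bool => 'j => complex"
 assumes K: "finite K" and J: "finite J" and X: "pd J X" and kap: "\<kappa> > 0"
  and tot: "\<And>f. (\<Sum>i\<in>K \<times> UNIV. (cmod (ip J (x i) f))^2) <= qf J X f"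
  and each: "\<And>i f. i \<in> K \<times> UNIV ==> (cmod (ip J (x i) f))^2 <= \<kappa> * qf J X f"
 shows "\<exists>\<sigma>. \<forall>f. (\<Sum>k\<in>K. (cmod (ip J (x (k, \<sigma> k)) f))^2) <= (1 + sqrt (2 * \<kappa>))^2 / 2 * qf J X f"
proof -
 note pX = pd_psd[OF X] and hX = psd_hermitian[OF pd_psd[OF X]]
 define I where "I = K \<times> (UNIV :: bool set)"
 have I: "finite I" unfolding I_def using K by simp
 have "\<exists>y. \<forall>j\<in>J. mv J X y j = x i j" for i by (rule pd_solve[OF J X])
 then obtain y where y: "\<And>i j. j \<in> J ==> mv J X (y i) j = x i j" by metis
 define G where "G i l = 2 * ip J (x i) (y l)" for i l
 define Y where "Y T c j = (\<Sum>l\<in>T. c l * y l j)" for T c j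
 have XY: "mv J X (Y T c) j = (\<Sum>l\<in>T. c l * x l j)" if "j \<in> J" for T c j
  unfolding Y_def mv_sum mv_scale y[OF that] ..
 have ipY: "ip J (mv J X (Y T c)) f = (\<Sum>l\<in>T. cnj (c l) * ip J (x l) f)" for T c f
 proof -
  have "ip J (mv J X (Y T c)) f = ip J (%j. \<Sum>l\<in>T. c l * x l j) f"
   by (rule ip_cong) (auto simp: XY)
  then show ?thesis unfolding ip_sum_left ip_scale_left .
 qed
 have mvG: "mv T G c i = 2 * ip J (x i) (Y T c)" for T c i
 proof -
  have "ip J (x i) (Y T c) = (\<Sum>l\<in>T. ip J (x i) (%j. c l * y l j))" unfolding Y_def by (rule ip_sum_right)
  also have "... = (\<Sum>l\<in>T. c l * ip J (x i) (y l))" unfolding ip_scale_right ..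
  finally have e: "ip J (x i) (Y T c) = (\<Sum>l\<in>T. c l * ip J (x i) (y l))" .
  show ?thesis unfolding e mv_def G_def sum_distrib_left by (rule sum.cong) (auto simp: mult_ac)
 qed
 have ipG: "ip T c (mv T G c) = of_real (2 * qf J X (Y T c))" for T c
 proof -
  have "ip T c (mv T G c) = 2 * ip J (mv J X (Y T c)) (Y T c)"
   unfolding ipY ip_def[of T] mvG sum_distrib_left by (simp add: mult_ac)
  also have "ip J (mv J X (Y T c)) (Y T c) = of_real (qf J X (Y T c))"
   using hermitian_adj[OF hX, of "Y T c" "Y T c"] ip_mv_qf[OF hX, of "Y T c"] by simp
  finally show ?thesis by simp
 qed
 have qG: "qf T G c = 2 * qf J X (Y T c)" for T c unfolding qf_def[of T] ipG by simp
 have hG: "hermitian T G" for T unfolding hermitian_def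
 proof (intro ballI)
  fix i l
  have "ip J (x l) (y i) = ip J (mv J X (y l)) (y i)" by (rule ip_cong) (auto simp: y)
  also have "... = ip J (y l) (mv J X (y i))" by (rule hermitian_adj[OF hX, symmetric])
  also have "... = ip J (y l) (x i)" by (rule ip_cong) (auto simp: y)
  also have "... = cnj (ip J (x i) (y l))" by (rule ip_cnj[symmetric])
  finally show "G l i = cnj (G i l)" unfolding G_def by simp
 qed
 have pG: "psd I G" unfolding psd_def using hG psd_qf[OF pX] by (simp add: qG)
 have "\<exists>\<sigma>. \<forall>c. qf ((%k. (k, \<sigma> k)) ` K) G c <= (1 + sqrt (2 * \<kappa>))^2 * nsq ((%k. (k, \<sigma> k)) ` K) c"
 proof (rule mss_gram[OF K])
  show "psd (K \<times> UNIV) G" using pG unfolding I_def .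
  show "2 * \<kappa> > 0" using kap by simp
  fix c
  show "qf (K \<times> UNIV) G c <= 2 * nsq (K \<times> UNIV) c"
  proof -
   define q where "q = qf J X (Y I c)"
   have q0: "q \<ge> 0" unfolding q_def by (rule psd_qf[OF pX])
   have "ip I c (%i. ip J (x i) (Y I c)) = of_real q"
   proof -
    have "ip I c (%i. ip J (x i) (Y I c)) = ip J (mv J X (Y I c)) (Y I c)" unfolding ipY ip_def[of I] ..
    then show ?thesis unfolding q_def using hermitian_adj[OF hX, of "Y I c" "Y I c"] ip_mv_qf[OF hX, of "Y I c"] by simp
   qed
   then have "q^2 <= nsq I c * nsq I (%i. ip J (x i) (Y I c))"
    using ip_cauchy[OF I, of c "%i. ip J (x i) (Y I c)"] by simp
   also have "... <= nsq I c * q"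
    by (rule mult_left_mono[OF _ nsq_nonneg]) (use tot[of "Y I c"] in \<open>simp add: nsq_def q_def I_def\<close>)
   finally have "q * q <= nsq I c * q" by (simp add: power2_eq_square)
   then have "q <= nsq I c" using q0 nsq_nonneg[of I c] by (cases "q = 0") auto
   then show ?thesis using qG[of I c] unfolding q_def I_def by simp
  qed
  fix i assume i: "i \<in> K \<times> (UNIV :: bool set)"
  show "(cmod (mv (K \<times> UNIV) G c i))^2 <= 2 * \<kappa> * qf (K \<times> UNIV) G c"
   unfolding mvG qG using each[OF i, of "Y (K \<times> UNIV) c"] by (simp add: norm_mult power_mult_distrib)
 qed
 then obtain \<sigma> where \<sigma>: "\<And>c. qf ((%k. (k, \<sigma> k)) ` K) G c <= (1 + sqrt (2 * \<kappa>))^2 * nsq ((%k. (k, \<sigma> k)) ` K) c"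
  by blast
 define T where "T = (%k. (k, \<sigma> k)) ` K"
 have "(\<Sum>k\<in>K. (cmod (ip J (x (k, \<sigma> k)) f))^2) <= (1 + sqrt (2 * \<kappa>))^2 / 2 * qf J X f" for f
 proof -
  define c where "c l = ip J (x l) f" for l
  define N where "N = nsq T c"
  have N0: "N \<ge> 0" unfolding N_def by (rule nsq_nonneg)
  have N: "(\<Sum>k\<in>K. (cmod (ip J (x (k, \<sigma> k)) f))^2) = N"
   unfolding N_def nsq_def T_def c_def by (subst sum.reindex) (auto simp: inj_on_def)
  \<comment> \<open>Duality: c consists of the analysis coefficients of f, so N is both |c|^2 and
    the X-pairing of their synthesis with f. This turns the Gram bound on c into a bound on the
    analysis of f.\<close>
  have "ip J (Y T c) (mv J X f) = of_real N"
   unfolding hermitian_adj[OF hX] ipY N_def ip_self[symmetric] unfolding ip_def[of T] c_def ..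
  then have "N^2 <= qf J X (Y T c) * qf J X f" using psd_cauchy[OF pX, of "Y T c" f] by simp
  also have "... <= ((1 + sqrt (2 * \<kappa>))^2 / 2 * N) * qf J X f"
   by (rule mult_right_mono[OF _ psd_qf[OF pX]]) (use \<sigma>[of c] in \<open>simp add: qG T_def[symmetric] N_def\<close>)
  finally have "N * N <= N * ((1 + sqrt (2 * \<kappa>))^2 / 2 * qf J X f)" by (simp add: power2_eq_square mult_ac)
  then have "N <= (1 + sqrt (2 * \<kappa>))^2 / 2 * qf J X f"
   using N0 psd_qf[OF pX, of f] by (cases "N = 0") auto
  then show ?thesis unfolding N .
 qed
 then show ?thesis by blast
qed

text \<open>Each i yields a pair: x i placed in the first or the second of two orthogonal copies of
  J. Choosing one member of each pair is a two-colouring, and testing the doubled form on vectors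
  living in one copy bounds one colour class.\<close>

lemma mss_coloring:
 fixes X :: "'j => 'j => complex" and x :: "'i => 'j => complex"
 assumes I: "finite I" and J: "finite J" and X: "pd J X" and kap: "\<kappa> > 0"
  and tot: "\<And>f. (\<Sum>i\<in>I. (cmod (ip J (x i) f))^2) <= qf J X f"
  and each: "\<And>i f. i \<in> I ==> (cmod (ip J (x i) f))^2 <= \<kappa> * qf J X f"
 shows "\<exists>S\<subseteq>I. \<forall>f. (\<Sum>i\<in>S. (cmod (ip J (x i) f))^2) <= (1 + sqrt (2 * \<kappa>))^2 / 2 * qf J X f \<and>
  (\<Sum>i\<in>I - S. (cmod (ip J (x i) f))^2) <= (1 + sqrt (2 * \<kappa>))^2 / 2 * qf J X f"
proof -
 define J2 where "J2 = J \<times> (UNIV :: bool set)"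
 have J2: "finite J2" unfolding J2_def using J by simp
 define X2 where "X2 p q = (if snd p = snd q then X (fst p) (fst q) else 0)" for p q :: "'j \<times> bool"
 define x2 where "x2 k p = (if snd k = snd p then x (fst k) (fst p) else 0)" for k :: "'i \<times> bool" and p :: "'j \<times> bool"
 have ipx: "ip J2 (x2 (i, s)) f = ip J (x i) (%j. f (j, s))" for i s f
  unfolding ip_def J2_def sum_times_bool x2_def by (rule sum.cong) (cases s; simp)+
 have mvX: "mv J2 X2 f (j, s) = mv J X (%j. f (j, s)) j" for f j s
  unfolding mv_def J2_def sum_times_bool X2_def by (rule sum.cong) (cases s; simp)+
 have qX: "qf J2 X2 f = qf J X (%j. f (j, True)) + qf J X (%j. f (j, False))" for f
  unfolding qf_def ip_def J2_def sum_times_bool unfolding J2_def[symmetric] mvX sum.distrib by simp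
 note pX = pd_psd[OF X]
 have pd2: "pd J2 X2" unfolding pd_def
 proof (intro conjI allI impI)
  show "hermitian J2 X2" unfolding hermitian_def
  proof (intro ballI)
   fix p q assume "p \<in> J2" "q \<in> J2"
   then have "X (fst q) (fst p) = cnj (X (fst p) (fst q))"
    using psd_hermitian[OF pX] unfolding hermitian_def J2_def by auto
   then show "X2 q p = cnj (X2 p q)" unfolding X2_def by simp
  qed
  fix f :: "_ => complex" assume "\<exists>p\<in>J2. f p \<noteq> 0"
  then obtain j s where js: "j \<in> J" "f (j, s) \<noteq> 0" unfolding J2_def by auto
  have "qf J X (%j. f (j, s)) > 0" by (rule pd_pos[OF X js(1)]) (rule js(2))
  then show "qf J2 X2 f > 0" unfolding qX
   using psd_qf[OF pX, of "%j. f (j, True)"] psd_qf[OF pX, of "%j. f (j, False)"] by (cases s) auto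
 qed
 have "\<exists>\<sigma>. \<forall>f. (\<Sum>k\<in>I. (cmod (ip J2 (x2 (k, \<sigma> k)) f))^2) <= (1 + sqrt (2 * \<kappa>))^2 / 2 * qf J2 X2 f"
 proof (rule mss_form[OF I J2 pd2 kap])
  fix f
  show "(\<Sum>i\<in>I \<times> UNIV. (cmod (ip J2 (x2 i) f))^2) <= qf J2 X2 f"
   unfolding sum_times_bool ipx qX sum.distrib by (rule add_mono; rule tot)
  fix i :: "'i \<times> bool" assume i: "i \<in> I \<times> UNIV"
  obtain k s where k: "i = (k, s)" by (cases i)
  have "(cmod (ip J2 (x2 i) f))^2 <= \<kappa> * qf J X (%j. f (j, s))" unfolding k ipx by (rule each) (use i k in auto)
  also have "... <= \<kappa> * qf J2 X2 f"
   by (rule mult_left_mono) (use kap psd_qf[OF pX] in \<open>cases s; simp add: qX\<close>)+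
  finally show "(cmod (ip J2 (x2 i) f))^2 <= \<kappa> * qf J2 X2 f" .
 qed
 then obtain \<sigma> where \<sigma>: "\<And>f. (\<Sum>k\<in>I. (cmod (ip J2 (x2 (k, \<sigma> k)) f))^2) <= (1 + sqrt (2 * \<kappa>))^2 / 2 * qf J2 X2 f"
  by blast
 define S where "S = {k \<in> I. \<sigma> k}"
 have q0: "qf J X (%j. 0) = 0" unfolding qf_def ip_def by simp
 have A: "(\<Sum>i\<in>{k \<in> I. \<sigma> k = s}. (cmod (ip J (x i) f))^2) <= (1 + sqrt (2 * \<kappa>))^2 / 2 * qf J X f" for s f
 proof -
  let ?f = "%p. if snd p = s then f (fst p) else 0"
  have "(\<Sum>i\<in>{k \<in> I. \<sigma> k = s}. (cmod (ip J (x i) f))^2) = (\<Sum>k\<in>I. (cmod (ip J2 (x2 (k, \<sigma> k)) ?f))^2)"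
   unfolding ipx by (rule sum.mono_neutral_cong_left) (use I in auto)
  also have "... <= (1 + sqrt (2 * \<kappa>))^2 / 2 * qf J2 X2 ?f" by (rule \<sigma>)
  also have "qf J2 X2 ?f = qf J X f" unfolding qX using q0 by (cases s) auto
  finally show ?thesis .
 qed
 have e: "I - S = {k \<in> I. \<sigma> k = False}" "S = {k \<in> I. \<sigma> k = True}" unfolding S_def by auto
 show ?thesis
 proof (intro exI[of _ S] conjI allI)
  show "S \<subseteq> I" unfolding S_def by blast
  show "(\<Sum>i\<in>S. (cmod (ip J (x i) f))^2) <= (1 + sqrt (2 * \<kappa>))^2 / 2 * qf J X f" for f
   unfolding e(2) by (rule A)
  show "(\<Sum>i\<in>I - S. (cmod (ip J (x i) f))^2) <= (1 + sqrt (2 * \<kappa>))^2 / 2 * qf J X f" for f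
   unfolding e(1) by (rule A)
 qed
qed

section \<open>Thinning a tight frame\<close>

definition fop :: "'i set => ('i => 'j => complex) => 'j => 'j => complex" where
 "fop I u j j' = (\<Sum>i\<in>I. u i j * cnj (u i j'))"

definition fsum :: "'j set => 'i set => ('i => 'j => complex) => ('j => complex) => real" where
 "fsum J I u f = (\<Sum>i\<in>I. (cmod (ip J (u i) f))^2)"

lemma mv_fop: "mv J (fop I u) f j = (\<Sum>i\<in>I. ip J (u i) f * u i j)"
proof -
 have "mv J (fop I u) f j = (\<Sum>j'\<in>J. \<Sum>i\<in>I. u i j * cnj (u i j') * f j')"
  unfolding mv_def fop_def sum_distrib_right ..
 also have "... = (\<Sum>i\<in>I. \<Sum>j'\<in>J. u i j * cnj (u i j') * f j')" by (rule sum.swap)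
 also have "... = (\<Sum>i\<in>I. ip J (u i) f * u i j)"
  unfolding ip_def sum_distrib_right by (intro sum.cong refl) (simp add: mult_ac)
 finally show ?thesis .
qed

lemma hermitian_fop: "hermitian J (fop I u)"
 unfolding hermitian_def fop_def by (auto simp: mult.commute)

lemma qf_fop: "qf J (fop I u) f = fsum J I u f"
proof -
 have "ip J f (mv J (fop I u) f) = ip J f (%j. \<Sum>i\<in>I. ip J (u i) f * u i j)"
  by (rule ip_cong) (auto simp: mv_fop)
 also have "... = (\<Sum>i\<in>I. ip J (u i) f * ip J f (u i))" unfolding ip_sum_right ip_scale_right ..
 also have "... = (\<Sum>i\<in>I. of_real ((cmod (ip J (u i) f))^2))"
  by (intro sum.cong refl) (simp add: complex_norm_square ip_cnj del: of_real_power)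
 finally show ?thesis unfolding qf_def fsum_def of_real_sum[symmetric] by simp
qed

text \<open>The frame operator itself is taken as the form; relative to it every vector has size at
  most 1/a. Both classes are bounded from above and add up to the whole, so each is also bounded
  from below.\<close>

lemma halve_frame:
 assumes I: "finite I" and J: "finite J" and u: "\<And>i. i \<in> I ==> nsq J (u i) <= 1" and a: "a > 0"
  and lo: "\<And>f. a * nsq J f <= fsum J I u f" and up: "\<And>f. fsum J I u f <= b * nsq J f"
  and k: "(1 + sqrt (2 / a))^2 / 2 <= k" "k <= 1"
 shows "\<exists>S\<subseteq>I. \<forall>f. (1 - k) * a * nsq J f <= fsum J S u f \<and> fsum J S u f <= k * b * nsq J f"
proof -
 define X where "X = fop I u"
 have qX: "qf J X f = fsum J I u f" for f unfolding X_def by (rule qf_fop)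
 have pd: "pd J X" unfolding pd_def
 proof (intro conjI allI impI)
  show "hermitian J X" unfolding X_def by (rule hermitian_fop)
  fix f :: "_ => complex" assume "\<exists>j\<in>J. f j \<noteq> 0"
  then have "nsq J f > 0" using nsq_pos[OF J] by blast
  then have "a * nsq J f > 0" using a by simp
  then show "qf J X f > 0" unfolding qX using lo[of f] by linarith
 qed
 have "\<exists>S\<subseteq>I. \<forall>f. (\<Sum>i\<in>S. (cmod (ip J (u i) f))^2) <= (1 + sqrt (2 * (1 / a)))^2 / 2 * qf J X f \<and>
  (\<Sum>i\<in>I - S. (cmod (ip J (u i) f))^2) <= (1 + sqrt (2 * (1 / a)))^2 / 2 * qf J X f"
 proof (rule mss_coloring[OF I J pd])
  show "1 / a > 0" using a by simp
  fix f
  show "(\<Sum>i\<in>I. (cmod (ip J (u i) f))^2) <= qf J X f" unfolding qX fsum_def by simp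
  fix i assume i: "i \<in> I"
  have "(cmod (ip J (u i) f))^2 <= nsq J (u i) * nsq J f" by (rule ip_cauchy[OF J])
  also have "... <= 1 * nsq J f" by (rule mult_right_mono[OF u[OF i] nsq_nonneg])
  also have "... <= 1 / a * qf J X f" using lo[of f] a unfolding qX by (simp add: field_simps)
  finally show "(cmod (ip J (u i) f))^2 <= 1 / a * qf J X f" .
 qed
 then have "\<exists>S\<subseteq>I. \<forall>f. fsum J S u f <= (1 + sqrt (2 / a))^2 / 2 * fsum J I u f \<and>
  fsum J (I - S) u f <= (1 + sqrt (2 / a))^2 / 2 * fsum J I u f"
  unfolding qX fsum_def times_divide_eq_right mult_1_right .
 then obtain S where S: "S \<subseteq> I" and b: "\<And>f. fsum J S u f <= (1 + sqrt (2 / a))^2 / 2 * fsum J I u f"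
  "\<And>f. fsum J (I - S) u f <= (1 + sqrt (2 / a))^2 / 2 * fsum J I u f"
  by blast
 have f0: "fsum J I u f \<ge> 0" for f unfolding fsum_def by (simp add: sum_nonneg)
 have "(1 - k) * a * nsq J f <= fsum J S u f \<and> fsum J S u f <= k * b * nsq J f" for f
 proof
  have "fsum J (I - S) u f <= k * fsum J I u f"
   by (rule order_trans[OF b(2) mult_right_mono[OF k(1) f0]])
  moreover have "fsum J I u f = fsum J (I - S) u f + fsum J S u f"
   unfolding fsum_def by (rule sum.subset_diff[OF S I])
  moreover have "(1 - k) * (a * nsq J f) <= (1 - k) * fsum J I u f"
   by (rule mult_left_mono[OF lo]) (use k(2) in simp)
  ultimately show "(1 - k) * a * nsq J f <= fsum J S u f" by (simp add: algebra_simps)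
  have "0 <= (1 + sqrt (2 / a))^2 / 2" by simp
  then have "k \<ge> 0" using k(1) by linarith
  have "fsum J S u f <= k * fsum J I u f"
   by (rule order_trans[OF b(1) mult_right_mono[OF k(1) f0]])
  also have "... <= k * (b * nsq J f)" by (rule mult_left_mono[OF up \<open>k \<ge> 0\<close>])
  finally show "fsum J S u f <= k * b * nsq J f" by (simp add: mult.assoc)
 qed
 then show ?thesis using S by blast
qed

text \<open>With r = 1 / sqrt a the class bound is 1/2 + sqrt 2 r + r^2, which is below 1/2 +
  143/100 r when r <= 1/100. The invariant b <= a (1 + 40 r) persists because a roughly halves and r
  grows by at least 1414/1000, so the relative errors of the rounds form a geometric series
  dominated by the last one; 5656/100 is 40 times 1414/1000.\<close>

lemma frame_sparsify_step:
 fixes a r :: real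
 assumes a: "a \<ge> 10000" and r: "r > 0" "a * r^2 = 1"
 defines "k \<equiv> 1/2 + 143/100 * r" and "a' \<equiv> (1/2 - 143/100 * r) * a"
 shows "(1 + sqrt (2 / a))^2 / 2 <= k" "k <= 1" "4000 <= a'" "a' <= a / 2"
  and "r' > 0 ==> a' * r'^2 = 1 ==> b <= a * (1 + 40 * r) ==> k * b <= a' * (1 + 40 * r')"
proof -
 have rle: "r <= 1/100"
 proof (rule power2_le_imp_le)
  have "10000 * r^2 <= a * r^2" by (rule mult_right_mono[OF a]) simp
  then show "r^2 <= (1/100)^2" unfolding r(2) by (simp add: power2_eq_square)
 qed simp
 have sq: "sqrt (2 / a) <= 14143/10000 * r"
 proof (rule real_le_lsqrt)
  show "0 <= 14143/10000 * r" using r by simp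
  have "2 / a = 2 * r^2" using r a by (simp add: field_simps)
  also have "... <= (14143/10000 * r)^2" by (simp add: power2_eq_square)
  finally show "2 / a <= (14143/10000 * r)^2" .
 qed
 have rr: "r * r <= 1/100 * r" using rle r by (intro mult_right_mono) auto
 have "(1 + sqrt (2 / a))^2 <= (1 + 14143/10000 * r)^2"
  by (rule power_mono) (use sq a in auto)
 also have "... = 1 + 2 * (14143/10000) * r + (14143/10000)^2 * (r * r)" by (simp add: power2_eq_square algebra_simps)
 also have "... <= 2 * k"
 proof -
  have e: "(14143/10000)^2 = (200024449/100000000 :: real)" by (simp add: power2_eq_square)
  define w where "w = r * r"
  have "w <= 1/100 * r" unfolding w_def by (rule rr)
  then have "1 + 2 * (14143/10000) * r + 200024449/100000000 * w <= 2 * (1/2 + 143/100 * r)"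
   using r(1) by (simp add: field_simps)
  then show ?thesis unfolding k_def e w_def .
 qed
 finally show "(1 + sqrt (2 / a))^2 / 2 <= k" by simp
 show "k <= 1" unfolding k_def using rle by simp
 have "(485/1000) * a <= a'" unfolding a'_def by (rule mult_right_mono) (use rle a in auto)
 then show a'4: "4000 <= a'" using a by simp
 have "a' <= (1/2) * a" unfolding a'_def by (rule mult_right_mono) (use r a in auto)
 then show a'2: "a' <= a / 2" by simp
 assume r': "r' > 0" "a' * r'^2 = 1" and b: "b <= a * (1 + 40 * r)"
 have "1414/1000 * r <= r'"
 proof (rule power2_le_imp_le)
  have "1 <= a / 2 * r'^2" unfolding r'(2)[symmetric] by (rule mult_right_mono[OF a'2]) simp
  then have "a * (2 * r^2) <= a * r'^2" using r(2) by simp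
  then have "2 * r^2 <= r'^2" using a by simp
  moreover have "(1414/1000 * r)^2 <= 2 * r^2" by (simp add: power2_eq_square)
  ultimately show "(1414/1000 * r)^2 <= r'^2" by linarith
 qed (use r' in simp)
 then have "1 + 5656/100 * r <= 1 + 40 * r'" by simp
 then have "a' * (1 + 5656/100 * r) <= a' * (1 + 40 * r')" using a'4 by simp
 moreover have "k * b <= k * (a * (1 + 40 * r))" by (rule mult_left_mono[OF b]) (use r in \<open>simp add: k_def\<close>)
 moreover have "k * (a * (1 + 40 * r)) <= a' * (1 + 5656/100 * r)"
 proof -
  have "(1/2 + 143/100 * r) * (1 + 40 * r) <= (1/2 - 143/100 * r) * (1 + 5656/100 * r)"
  proof -
   have "(1/2 + 143/100 * r) * (1 + 40 * r) = 1/2 + 2143/100 * r + 5720/100 * (r * r)" by (simp add: field_simps)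
   moreover have "(1/2 - 143/100 * r) * (1 + 5656/100 * r) = 1/2 + 2685/100 * r - 808808/10000 * (r * r)"
    by (simp add: field_simps)
   ultimately show ?thesis using rr r(1) by linarith
  qed
  then have "a * ((1/2 + 143/100 * r) * (1 + 40 * r)) <= a * ((1/2 - 143/100 * r) * (1 + 5656/100 * r))"
   using a by simp
  then show ?thesis unfolding k_def a'_def by (simp only: mult_ac)
 qed
 ultimately show "k * b <= a' * (1 + 40 * r')" by linarith
qed

text \<open>n measures termination: a at least halves, so a <= n passes to a' <= n - 1. Halving
  stops at the first a < 10000. Then still a >= 4000, whence r <= 1/60 and b <= 20000; this is where
  the absolute constant of the upper Riesz bound comes from.\<close>

lemma frame_sparsify_aux:
 assumes J: "finite J"
 shows "finite I ==> (\<And>i. i \<in> I ==> nsq J (u i) <= 1) ==> a \<ge> 4000 ==> a <= real n ==> r > 0 ==> a * r^2 = 1 ==>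
  b <= a * (1 + 40 * r) ==> (\<And>f. a * nsq J f <= fsum J I u f) ==> (\<And>f. fsum J I u f <= b * nsq J f) ==>
  \<exists>S\<subseteq>I. \<forall>f. nsq J f <= fsum J S u f \<and> fsum J S u f <= 20000 * nsq J f"
proof (induction n arbitrary: I a b r rule: less_induct)
 case (less n)
 show ?case
 proof (cases "a < 10000")
  case True
  have "r <= 1/60"
  proof (rule power2_le_imp_le)
   have "4000 * r^2 <= a * r^2" by (rule mult_right_mono[OF less.prems(3)]) simp
   then show "r^2 <= (1/60)^2" unfolding less.prems(6) by (simp add: power2_eq_square)
  qed simp
  have "a * (1 + 40 * r) <= 10000 * 2"
   by (rule mult_mono) (use True \<open>r <= 1/60\<close> less.prems(5) in auto)
  then have b: "b <= 20000" using less.prems(7) by linarith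
  have "nsq J f <= fsum J I u f \<and> fsum J I u f <= 20000 * nsq J f" for f
  proof
   have "1 * nsq J f <= a * nsq J f" by (rule mult_right_mono[OF _ nsq_nonneg]) (use less.prems(3) in simp)
   then show "nsq J f <= fsum J I u f" using less.prems(8)[of f] by linarith
   show "fsum J I u f <= 20000 * nsq J f"
    by (rule order_trans[OF less.prems(9) mult_right_mono[OF b nsq_nonneg]])
  qed
  then show ?thesis by blast
 next
  case False
  then have a: "a \<ge> 10000" by simp
  define k a' where "k = 1/2 + 143/100 * r" and "a' = (1/2 - 143/100 * r) * a"
  note st = frame_sparsify_step[OF a less.prems(5,6), folded k_def a'_def]
  have "\<exists>S\<subseteq>I. \<forall>f. (1 - k) * a * nsq J f <= fsum J S u f \<and> fsum J S u f <= k * b * nsq J f"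
   by (rule halve_frame[OF less.prems(1) J less.prems(2) _ less.prems(8,9) st(1,2)]) (use a in auto)
  moreover have "(1 - k) * a = a'" unfolding k_def a'_def by simp
  ultimately obtain S where S: "S \<subseteq> I" "\<And>f. a' * nsq J f <= fsum J S u f" "\<And>f. fsum J S u f <= k * b * nsq J f"
   by auto
  define r' where "r' = 1 / sqrt a'"
  have r': "r' > 0" "a' * r'^2 = 1" unfolding r'_def using st(3) by (auto simp: power_divide)
  have n1: "n - 1 < n" using less.prems(3,4) by (cases n) auto
  have "real (n - 1) = real n - 1" using n1 by simp
  then have an: "a' <= real (n - 1)" using st(4) less.prems(3,4) by linarith
  have "\<exists>S'\<subseteq>S. \<forall>f. nsq J f <= fsum J S' u f \<and> fsum J S' u f <= 20000 * nsq J f"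
   by (rule less.IH[OF n1 finite_subset[OF S(1) less.prems(1)] _ st(3) an r' st(5)[OF r' less.prems(7)] S(2,3)])
    (use S(1) less.prems(2) in blast)
  then show ?thesis using S(1) by blast
 qed
qed

lemma frame_sparsify:
 assumes I: "finite I" and J: "finite J" and u: "\<And>i. i \<in> I ==> nsq J (u i) <= 1" and R: "R \<ge> 1"
  and tight: "\<And>f. fsum J I u f = R * nsq J f"
 shows "\<exists>S\<subseteq>I. \<forall>f. nsq J f <= fsum J S u f \<and> fsum J S u f <= 20000 * nsq J f"
\<comment> \<open>A tight frame of small redundancy is kept whole; it already satisfies both
  bounds.\<close>
proof (cases "R < 4000")
 case True
 have "nsq J f <= fsum J I u f \<and> fsum J I u f <= 20000 * nsq J f" for f
 proof
  have "1 * nsq J f <= R * nsq J f" by (rule mult_right_mono[OF R nsq_nonneg])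
  then show "nsq J f <= fsum J I u f" using tight[of f] by simp
  have "R * nsq J f <= 20000 * nsq J f" by (rule mult_right_mono[OF _ nsq_nonneg]) (use True in simp)
  then show "fsum J I u f <= 20000 * nsq J f" using tight[of f] by simp
 qed
 then show ?thesis by (intro exI[of _ I]) simp
next
 case False
 show ?thesis
 proof (rule frame_sparsify_aux[OF J I u, where a = R and n = "nat \<lceil>R\<rceil>" and r = "1 / sqrt R" and b = R])
  show "4000 <= R" using False by simp
  show "R <= real (nat \<lceil>R\<rceil>)" by (rule real_nat_ceiling_ge)
  show "0 < 1 / sqrt R" "R * (1 / sqrt R)^2 = 1" using R by (auto simp: power_divide)
  show "R <= R * (1 + 40 * (1 / sqrt R))" using R by (simp add: algebra_simps)
 qed (simp_all add: tight)
qed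

section \<open>Determinant maximization\<close>

text \<open>
  The principal minor of \<open>H\<close> on \<open>T\<close>, written as a determinant over all of \<open>I\<close> so that the
  index set does not change.
\<close>

definition vol :: "'i set => ('i => 'i => complex) => 'i set => complex" where
 "vol I H T = fdet I (%i j. if i \<in> T then H i j else idm i j)"

lemma vol_empty: "finite I ==> vol I H {} = 1"
 unfolding vol_def idm_def by (simp add: fdet_one)

text \<open>\<rho> is the Schur complement of j in T. Subtracting \<rho> times the unit row from row
  j makes c, extended by 0, a kernel vector, and linearity in row j gives the quotient of the two
  minors.\<close>

lemma vol_remove:
 assumes I: "finite I" and T: "T \<subseteq> I" and j: "j \<in> T" and cj: "c j = 1"
  and c: "\<And>i. i \<in> T ==> mv T H c i = \<rho> * idm j i"
 shows "vol I H T = \<rho> * vol I H (T - {j})"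
proof -
 define A where "A = (%i k. if i \<in> T then H i k else idm i k)"
 have jI: "j \<in> I" using T j by blast
 have 1: "vol I H T = fdet I (A(j := H j))" unfolding vol_def A_def
  by (rule fdet_cong[OF I]) (use j in auto)
 have 2: "vol I H (T - {j}) = fdet I (A(j := idm j))" unfolding vol_def A_def
  by (rule fdet_cong[OF I]) auto
 have "fdet I (A(j := %k. H j k + (- \<rho>) * idm j k)) = 0"
  unfolding fdet_0_iff[OF I]
 proof (intro exI[of _ "%i. if i \<in> T then c i else 0"] conjI ballI)
  show "\<exists>i\<in>I. (if i \<in> T then c i else 0) \<noteq> 0" using jI j cj by (intro bexI[of _ j]) auto
  fix i assume i: "i \<in> I"
  have restr: "(\<Sum>k\<in>I. K k * (if k \<in> T then c k else 0)) = (\<Sum>k\<in>T. K k * c k)" for K :: "_ => complex"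
   by (rule sum.mono_neutral_cong_right) (use I T in auto)
  show "(\<Sum>k\<in>I. (A(j := %k. H j k + (- \<rho>) * idm j k)) i k * (if k \<in> T then c k else 0)) = 0"
  proof (cases "i = j")
   case True
   have fT: "finite T" using I T finite_subset by blast
   have "(\<Sum>k\<in>T. (H j k + (- \<rho>) * idm j k) * c k) = mv T H c j - \<rho> * mv T idm c j"
    unfolding mv_def sum_distrib_left sum_subtractf[symmetric] by (rule sum.cong) (auto simp: algebra_simps)
   also have "... = 0" unfolding c[OF j] mv_idm[OF fT j] cj by (simp add: idm_def)
   finally show ?thesis unfolding restr True by simp
  next
   case False
   show ?thesis
   proof (cases "i \<in> T")
    case True
    then show ?thesis unfolding restr using False c[OF True] by (simp add: A_def mv_def idm_def)
   next
    case iT: False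
    have "(\<Sum>k\<in>T. idm i k * c k) = 0" by (rule sum.neutral) (use iT in \<open>auto simp: idm_def\<close>)
    then show ?thesis unfolding restr using False iT by (simp add: A_def)
   qed
  qed
 qed
 then have "fdet I (A(j := H j)) + (- \<rho>) * fdet I (A(j := idm j)) = 0"
  unfolding fdet_row_affine[OF I jI] .
 then show ?thesis unfolding 1 2 by simp
qed

lemma pd_subset: "pd I H ==> finite I ==> T \<subseteq> I ==> pd T H"
proof -
 assume pd: "pd I H" and I: "finite I" and T: "T \<subseteq> I"
 show "pd T H" unfolding pd_def
 proof (intro conjI allI impI)
  show "hermitian T H" using pd T unfolding pd_def hermitian_def by blast
  fix f :: "_ => complex" assume "\<exists>j\<in>T. f j \<noteq> 0"
  then obtain j where j: "j \<in> T" "f j \<noteq> 0" by blast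
  let ?g = "%i. if i \<in> T then f i else 0"
  have "qf I H ?g > 0" by (rule pd_pos[OF pd, of j]) (use j T in auto)
  moreover have "ip I ?g (mv I H ?g) = ip T f (mv T H f)"
  proof -
   have "mv I H ?g i = mv T H f i" for i unfolding mv_def
    by (rule sum.mono_neutral_cong_right) (use I T in auto)
   then show ?thesis unfolding ip_def by (intro sum.mono_neutral_cong_right) (use I T in auto)
  qed
  ultimately show "qf T H f > 0" unfolding qf_def by simp
 qed
qed

text \<open>c is the j-th column of the inverse scaled to c j = 1, and \<rho> the reciprocal of the
  diagonal entry of the inverse. It is the squared distance, in the metric of H, from the j-th unit
  vector to the span of the others; the final inequality expresses this minimality.\<close>

lemma pd_schur:
 assumes T: "finite T" and pd: "pd T H" and j: "j \<in> T"
 obtains c and \<rho> :: real where "\<rho> > 0" "c j = 1" "\<And>i. i \<in> T ==> mv T H c i = of_real \<rho> * idm j i"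
  "qf T H c = \<rho>" "\<And>f. (cmod (f j))^2 <= qf T H f / \<rho>"
proof -
 note pT = pd_psd[OF pd] and hT = psd_hermitian[OF pd_psd[OF pd]]
 obtain y where y: "\<And>i. i \<in> T ==> mv T H y i = idm j i" using pd_solve[OF T pd, of "idm j"] by blast
 have ipe: "ip T (idm j) f = f j" for f
 proof -
  have "ip T (idm j) f = (\<Sum>i\<in>T. if j = i then f i else 0)" unfolding ip_def idm_def by (rule sum.cong) auto
  then show ?thesis using T j by simp
 qed
 have ipy: "ip T y (mv T H f) = f j" for f
 proof -
  have "ip T (mv T H y) f = ip T (idm j) f" by (rule ip_cong) (auto simp: y)
  then show ?thesis using hermitian_adj[OF hT, of y f] ipe by simp
 qed
 have yq: "y j = of_real (qf T H y)" using ipy[of y] ip_mv_qf[OF hT, of y] by simp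
 have "\<exists>i\<in>T. y i \<noteq> 0"
 proof (rule ccontr)
  assume "\<not> ?thesis"
  then have "mv T H y j = 0" unfolding mv_def by (intro sum.neutral) auto
  then show False using y[OF j] by (simp add: idm_def)
 qed
 then have qy: "qf T H y > 0" using pd unfolding pd_def by blast
 define \<rho> where "\<rho> = 1 / qf T H y"
 have r: "\<rho> > 0" unfolding \<rho>_def using qy by simp
 have cm: "cmod (of_real \<rho>) = \<rho>" using r by simp
 have Qr: "qf T H y = 1 / \<rho>" unfolding \<rho>_def by simp
 show ?thesis
 proof (rule that[of \<rho> "%i. of_real \<rho> * y i"])
  show "\<rho> > 0" by (rule r)
  show "of_real \<rho> * y j = 1" unfolding yq Qr using r by simp
  show "mv T H (%i. of_real \<rho> * y i) i = of_real \<rho> * idm j i" if "i \<in> T" for i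
   unfolding mv_scale y[OF that] ..
  show "qf T H (%i. of_real \<rho> * y i) = \<rho>" unfolding qf_scale cm Qr using r by (simp add: power2_eq_square)
  show "(cmod (f j))^2 <= qf T H f / \<rho>" for f
   using psd_cauchy[OF pT, of y f] unfolding ipy Qr by simp
 qed
qed

text \<open>S maximizes E^|T| det H_T. Adding i multiplies this weight by E \<rho>, so \<rho> <= 1/E
  outside S; removing j divides it by E \<rho>, so \<rho> >= 1/E inside. One threshold thus gives
  approximate spanning and quantitative independence at once.\<close>

lemma optimal_subset:
 assumes L: "finite L" and pd: "pd L H" and E: "E > 0"
 shows "\<exists>S\<subseteq>L. (\<forall>i\<in>L - S. \<exists>c. c i = 1 \<and> qf (insert i S) H c <= 1 / E) \<and>
  (\<forall>j\<in>S. \<forall>c. (cmod (c j))^2 <= E * qf S H c)"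
proof -
 have pdT: "pd T H" if "T \<subseteq> L" for T by (rule pd_subset[OF pd L that])
 have fT: "finite T" if "T \<subseteq> L" for T using that L finite_subset by blast
 define v where "v T = Re (vol L H T)" for T
 have step: "\<exists>\<rho>>0. vol L H T = of_real \<rho> * vol L H (T - {j}) \<and> (\<exists>c. c j = 1 \<and> qf T H c = \<rho>) \<and>
   (\<forall>f. (cmod (f j))^2 <= qf T H f / \<rho>)" if T: "T \<subseteq> L" and j: "j \<in> T" for T j
  by (rule pd_schur[OF fT[OF T] pdT[OF T] j], intro exI conjI allI, assumption,
    rule vol_remove[OF L T j], assumption+)
 have vpos: "v T > 0 \<and> vol L H T = of_real (v T)" if "T \<subseteq> L" for T
  using fT[OF that] that
 proof (induction T rule: finite_induct)
  case empty
  then show ?case unfolding v_def vol_empty[OF L] by simp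
 next
  case (insert j T)
  obtain \<rho> :: real where r: "\<rho> > 0" "vol L H (insert j T) = of_real \<rho> * vol L H (insert j T - {j})"
   using step[OF insert.prems, of j] by blast
  have "insert j T - {j} = T" using insert.hyps by simp
  then have e: "vol L H (insert j T) = of_real (\<rho> * v T)" using r(2) insert by simp
  then have "v (insert j T) = \<rho> * v T" unfolding v_def[of "insert j T"] by simp
  then show ?case using e r(1) insert by simp
 qed
 define W where "W T = E ^ card T * v T" for T
 have fP: "finite (W ` Pow L)" "W ` Pow L \<noteq> {}" using L by auto
 obtain S where S0: "S \<in> Pow L" "W S = Max (W ` Pow L)" using Max_in[OF fP] by (metis imageE)
 have S: "S \<subseteq> L" using S0(1) by simp
 have Smax: "W T <= W S" if "T \<subseteq> L" for T
  unfolding S0(2) by (rule Max_ge[OF fP(1)]) (use that in simp)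
 show ?thesis
 proof (intro exI[of _ S] conjI ballI allI)
  show "S \<subseteq> L" by (rule S)
  fix i assume i: "i \<in> L - S"
  have iT: "insert i S \<subseteq> L" using i S by blast
  obtain \<rho> :: real where r: "\<rho> > 0" "vol L H (insert i S) = of_real \<rho> * vol L H (insert i S - {i})"
   "\<exists>c. c i = 1 \<and> qf (insert i S) H c = \<rho>"
   using step[OF iT, of i] by blast
  have "insert i S - {i} = S" using i by simp
  then have "v (insert i S) = \<rho> * v S" using r(2) vpos[OF S] unfolding v_def[of "insert i S"] by simp
  then have vS: "v (insert i S) = \<rho> * v S" .
  have "card (insert i S) = Suc (card S)" using i fT[OF S] by simp
  then have "W (insert i S) = E ^ card S * v S * (E * \<rho>)"
   unfolding W_def vS by (simp only: power_Suc mult_ac)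
  then have "E ^ card S * v S * (E * \<rho>) <= E ^ card S * v S * 1"
   using Smax[OF iT] unfolding W_def[of S] by (simp only: mult_1_right)
  moreover have "E ^ card S * v S > 0" using E vpos[OF S] by simp
  ultimately have "E * \<rho> <= 1" by (simp only: mult_le_cancel_left_pos)
  then have "\<rho> <= 1 / E" using E by (simp add: field_simps)
  then show "\<exists>c. c i = 1 \<and> qf (insert i S) H c <= 1 / E" using r(3) by blast
 next
  fix j c assume j: "j \<in> S"
  obtain \<rho> :: real where r: "\<rho> > 0" "vol L H S = of_real \<rho> * vol L H (S - {j})" "\<And>f. (cmod (f j))^2 <= qf S H f / \<rho>"
   using step[OF S j] by blast
  have sj: "S - {j} \<subseteq> L" using S by blast
  have "v S = \<rho> * v (S - {j})" using r(2) vpos[OF sj] unfolding v_def[of S] by simp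
  then have vS: "v S = \<rho> * v (S - {j})" .
  have "card S = Suc (card (S - {j}))" by (rule card.remove[OF fT[OF S] j])
  then have "W S = E ^ card (S - {j}) * v (S - {j}) * (E * \<rho>)"
   unfolding W_def vS by (simp only: power_Suc mult_ac)
  then have "E ^ card (S - {j}) * v (S - {j}) * 1 <= E ^ card (S - {j}) * v (S - {j}) * (E * \<rho>)"
   using Smax[OF sj] unfolding W_def[of "S - {j}"] by (simp only: mult_1_right)
  moreover have "E ^ card (S - {j}) * v (S - {j}) > 0" using E vpos[OF sj] by simp
  ultimately have "1 <= E * \<rho>" by (simp only: mult_le_cancel_left_pos)
  then have "1 / \<rho> <= E" using r(1) by (simp add: field_simps)
  have "(cmod (c j))^2 <= 1 / \<rho> * qf S H c" using r(3)[of c] by simp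
  also have "... <= E * qf S H c"
   by (rule mult_right_mono[OF \<open>1 / \<rho> <= E\<close> psd_qf[OF pd_psd[OF pdT[OF S]]]])
  finally show "(cmod (c j))^2 <= E * qf S H c" .
 qed
qed

section \<open>Pairing inside tiles and repeated halving\<close>

lemma pairing_exists:
 assumes A: "finite A"
 shows "\<exists>P \<phi>. P \<subseteq> A \<and> inj_on \<phi> P \<and> \<phi> ` P \<subseteq> A - P \<and> card A <= 2 * card P + 1"
proof -
 have "card A div 2 <= card A" by simp
 then obtain P where P: "P \<subseteq> A" "card P = card A div 2" "finite P"
  by (rule obtain_subset_with_card_n)
 have "card (A - P) = card A - card A div 2" using card_Diff_subset[OF P(3,1)] P(2) by simp
 then have "card P <= card (A - P)" using P(2) by simp
 then have "\<exists>\<phi>. \<phi> ` P \<subseteq> A - P \<and> inj_on \<phi> P"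
  by (intro card_le_inj P(3)) (use A in simp_all)
 then obtain \<phi> where p: "\<phi> ` P \<subseteq> A - P" "inj_on \<phi> P" by (elim exE conjE)
 have c: "card A <= 2 * card P + 1" unfolding P(2) by simp
 show ?thesis by (rule exI[of _ P], rule exI[of _ \<phi>]) (intro conjI P(1) p(1) p(2) c)
qed

text \<open>Pairs are formed within each block separately, so that a selection halves every block up
  to one leftover point. Disjointness of the blocks makes the combined partner map
  injective.\<close>

lemma pairing_family:
 assumes "finite \<B>" and "finite R"
 shows "disjoint \<B> ==> \<exists>K \<phi>. K \<subseteq> R \<inter> \<Union>\<B> \<and> inj_on \<phi> K \<and> \<phi> ` K \<inter> K = {} \<and>
  (\<forall>B\<in>\<B>. \<phi> ` (K \<inter> B) \<subseteq> R \<inter> B \<and> card (R \<inter> B) <= 2 * card (K \<inter> B) + 1)"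
 using assms(1)
proof (induction \<B> rule: finite_induct)
 case empty
 then show ?case by (intro exI[of _ "{}"]) auto
next
 case (insert B \<B>)
 have dB: "disjoint \<B>" using insert.prems by (auto simp: disjoint_def)
 obtain K \<phi> where K: "K \<subseteq> R \<inter> \<Union>\<B>" "inj_on \<phi> K" "\<phi> ` K \<inter> K = {}"
  and K45: "\<forall>B\<in>\<B>. \<phi> ` (K \<inter> B) \<subseteq> R \<inter> B \<and> card (R \<inter> B) <= 2 * card (K \<inter> B) + 1"
  using insert.IH[OF dB] by (elim exE conjE)
 have K4: "\<phi> ` (K \<inter> B) \<subseteq> R \<inter> B" and K5: "card (R \<inter> B) <= 2 * card (K \<inter> B) + 1" if "B \<in> \<B>" for B
  using bspec[OF K45 that] by (rule conjunct1, rule conjunct2)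
 have "finite (R \<inter> B)" using assms(2) by simp
 from pairing_exists[OF this]
 obtain P \<psi> where P: "P \<subseteq> R \<inter> B" "inj_on \<psi> P" "\<psi> ` P \<subseteq> R \<inter> B - P" "card (R \<inter> B) <= 2 * card P + 1"
  by (elim exE conjE)
 have BB: "B' \<inter> B = {}" if "B' \<in> \<B>" for B'
 proof -
  have "B' \<noteq> B" using insert.hyps(2) that by blast
  then show ?thesis using disjointD[OF insert.prems, of B' B] that by blast
 qed
 have UB: "\<Union>\<B> \<inter> B = {}" using BB by blast
 have phU: "\<phi> ` K \<subseteq> R \<inter> \<Union>\<B>"
 proof
  fix y assume "y \<in> \<phi> ` K"
  then obtain k where k: "k \<in> K" "y = \<phi> k" by (elim imageE)
  obtain B' where B': "B' \<in> \<B>" "k \<in> B'" using K(1) k(1) by blast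
  have "\<phi> k \<in> \<phi> ` (K \<inter> B')" using k(1) B'(2) by (intro imageI) simp
  then have "\<phi> k \<in> R \<inter> B'" using K4[OF B'(1)] by (rule subsetD[rotated])
  then show "y \<in> R \<inter> \<Union>\<B>" using k(2) B'(1) by blast
 qed
 define th where "th k = (if k \<in> P then \<psi> k else \<phi> k)" for k
 have KP: "K \<inter> P = {}" using K(1) P(1) UB by blast
 have cP: "th ` P = \<psi> ` P" unfolding th_def by auto
 have cK: "th k = \<phi> k" if "k \<in> K" for k using that KP unfolding th_def by auto
 have cKi: "th ` A = \<phi> ` A" if "A \<subseteq> K" for A using that cK by (intro image_cong) auto
 show ?case
 proof (intro exI[of _ "K \<union> P"] exI[of _ th] conjI ballI)
  show "K \<union> P \<subseteq> R \<inter> \<Union>(insert B \<B>)" using K(1) P(1) by blast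
  show "inj_on th (K \<union> P)"
  proof (rule inj_on_Un[THEN iffD2], intro conjI)
   show "inj_on th K" using K(2) cK by (simp add: inj_on_def)
   show "inj_on th P" using P(2) unfolding th_def by (simp add: inj_on_def)
   show "th ` (K - P) \<inter> th ` (P - K) = {}"
    using cKi[of "K - P"] cP phU P(3) UB by blast
  qed
  show "th ` (K \<union> P) \<inter> (K \<union> P) = {}"
   unfolding image_Un cKi[OF order_refl] cP using K(1,3) phU P(1,3) UB by blast
  fix B' assume B': "B' \<in> insert B \<B>"
  show "th ` ((K \<union> P) \<inter> B') \<subseteq> R \<inter> B'"
  proof (cases "B' = B")
   case True
   then have "(K \<union> P) \<inter> B' = P" using K(1) P(1) UB by blast
   then show ?thesis using cP P(3) True by blast
  next
   case False
   then have m: "B' \<in> \<B>" using B' by blast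
   then have "(K \<union> P) \<inter> B' = K \<inter> B'" using P(1) BB by blast
   then show ?thesis using cKi[of "K \<inter> B'"] K4[OF m] by simp
  qed
  show "card (R \<inter> B') <= 2 * card ((K \<union> P) \<inter> B') + 1"
  proof (cases "B' = B")
   case True
   then have "(K \<union> P) \<inter> B' = P" using K(1) P(1) UB by blast
   then show ?thesis using P(4) True by simp
  next
   case False
   then have m: "B' \<in> \<B>" using B' by blast
   then have "(K \<union> P) \<inter> B' = K \<inter> B'" using P(1) BB by blast
   then show ?thesis using K5[OF m] by simp
  qed
 qed
qed

lemma ip_idm: "finite S ==> k \<in> S ==> ip S (idm k) c = c k"
proof -
 assume S: "finite S" "k \<in> S"
 have "ip S (idm k) c = (\<Sum>i\<in>S. if k = i then c i else 0)" unfolding ip_def idm_def by (rule sum.cong) auto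
 then show ?thesis using S by simp
qed

text \<open>S' holds the points already accepted and R = S - S' the undecided ones. The form Y,
  obtained from \<open>Y0\<close> by subtracting |c j|^2 for j in S', keeps at least 4^(-l) of
  \<open>Y0\<close>, so an undecided point has relative size at most \<kappa> 4^l in Y. Selecting
  one point of each pair costs at most 3/4 of Y. In the application \<open>Y0\<close> is the
  identity plus Gram/\<gamma>, and the conclusion is then a Riesz bound in disguise.\<close>

lemma thinning:
 assumes S: "finite S" and pd: "pd S Y0" and Y0: "\<And>c. nsq S c <= qf S Y0 c" and \<B>: "finite \<B>" "disjoint \<B>"
  and kap: "\<kappa> > 0" and each: "\<And>j c. j \<in> S ==> (cmod (c j))^2 <= \<kappa> * qf S Y0 c"
 shows "\<kappa> * 4 ^ l <= 1 / 50 ==> \<exists>S'\<subseteq>S. (\<forall>c. nsq S' c <= (1 - 1 / 4 ^ l) * qf S Y0 c) \<and>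
  (\<forall>B\<in>\<B>. real (card ((S - S') \<inter> B)) <= real (card (S \<inter> B)) / 2 ^ l + 1)"
proof (induction l)
 case 0
 show ?case by (intro exI[of _ "{}"]) (simp add: nsq_def)
next
 case (Suc l)
 have k4: "\<kappa> * 4 ^ l <= 1 / 50" using Suc.prems kap by simp
 obtain S' where S': "S' \<subseteq> S" "\<And>c. nsq S' c <= (1 - 1 / 4 ^ l) * qf S Y0 c"
  "\<And>B. B \<in> \<B> ==> real (card ((S - S') \<inter> B)) <= real (card (S \<inter> B)) / 2 ^ l + 1"
  using Suc.IH[OF k4] by blast
 define R where "R = S - S'"
 have R: "finite R" "R \<subseteq> S" unfolding R_def using S by auto
 define Y where "Y i j = Y0 i j - (if i \<in> S' then idm i j else 0)" for i j
 note p0 = pd_psd[OF pd]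
 have nsub: "nsq S c = nsq S' c + nsq R c" for c
  unfolding nsq_def R_def using sum.subset_diff[OF S'(1) S] by (simp add: add.commute)
 have qY: "qf S Y c = qf S Y0 c - nsq S' c" for c
 proof -
  have "mv S Y c i = mv S Y0 c i - (if i \<in> S' then c i else 0)" if i: "i \<in> S" for i
  proof -
   have "mv S Y c i = mv S Y0 c i - (if i \<in> S' then mv S idm c i else 0)"
    unfolding mv_def Y_def left_diff_distrib sum_subtractf by simp
   then show ?thesis unfolding mv_idm[OF S i] .
  qed
  then have "ip S c (mv S Y c) = ip S c (%i. mv S Y0 c i - (if i \<in> S' then c i else 0))"
   by (intro ip_cong) auto
  also have "... = ip S c (mv S Y0 c) - ip S' c c"
   unfolding ip_diff_right
  proof -
   have "ip S c (%i. if i \<in> S' then c i else 0) = ip S' c c"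
    unfolding ip_def by (rule sum.mono_neutral_cong_right) (use S S' in auto)
   then show "ip S c (mv S Y0 c) - ip S c (%i. if i \<in> S' then c i else 0) = ip S c (mv S Y0 c) - ip S' c c" by simp
  qed
  finally show ?thesis unfolding qf_def ip_self by simp
 qed
 have Ylow: "1 / 4 ^ l * qf S Y0 c <= qf S Y c" for c unfolding qY using S'(2)[of c] by (simp add: algebra_simps)
 have pdY: "pd S Y" unfolding pd_def
 proof (intro conjI allI impI)
  show "hermitian S Y" unfolding hermitian_def
  proof (intro ballI)
   fix i j assume "i \<in> S" "j \<in> S"
   then have e: "Y0 j i = cnj (Y0 i j)" using psd_hermitian[OF p0] unfolding hermitian_def by blast
   show "Y j i = cnj (Y i j)" unfolding Y_def idm_def e by simp
  qed
  fix f :: "_ => complex" assume "\<exists>j\<in>S. f j \<noteq> 0"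
  then have "qf S Y0 f > 0" using pd unfolding pd_def by blast
  then have "1 / 4 ^ l * qf S Y0 f > 0" by simp
  then show "qf S Y f > 0" using Ylow[of f] by linarith
 qed
 obtain K \<phi> where K: "K \<subseteq> R \<inter> \<Union>\<B>" "inj_on \<phi> K" "\<phi> ` K \<inter> K = {}"
  and K45: "\<forall>B\<in>\<B>. \<phi> ` (K \<inter> B) \<subseteq> R \<inter> B \<and> card (R \<inter> B) <= 2 * card (K \<inter> B) + 1"
  using pairing_family[OF \<B>(1) R(1) \<B>(2)] by (elim exE conjE)
 have K4: "\<phi> ` (K \<inter> B) \<subseteq> R \<inter> B" and K5: "card (R \<inter> B) <= 2 * card (K \<inter> B) + 1" if "B \<in> \<B>" for B
  using bspec[OF K45 that] by (rule conjunct1, rule conjunct2)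
 have fK: "finite K" using K(1) R(1) finite_subset by blast
 have phR: "\<phi> k \<in> R" if k: "k \<in> K" for k
 proof -
  obtain B' where B': "B' \<in> \<B>" "k \<in> B'" using K(1) k by blast
  have "\<phi> k \<in> \<phi> ` (K \<inter> B')" using k B'(2) by (intro imageI) simp
  then have "\<phi> k \<in> R \<inter> B'" using K4[OF B'(1)] by (rule subsetD[rotated])
  then show "\<phi> k \<in> R" by simp
 qed
 define x where "x = (%(k, s). idm (if s then k else \<phi> k) :: _ => complex)"
 have xip: "ip S (x (k, s)) c = c (if s then k else \<phi> k)" if "k \<in> K" for k s c
  unfolding x_def using ip_idm[OF S, of "if s then k else \<phi> k" c] phR[OF that] R(2) K(1) that by auto
 have "\<exists>\<sigma>. \<forall>f. (\<Sum>k\<in>K. (cmod (ip S (x (k, \<sigma> k)) f))^2) <= (1 + sqrt (2 * (\<kappa> * 4 ^ l)))^2 / 2 * qf S Y f"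
 proof (rule mss_form[OF fK S pdY])
  show "\<kappa> * 4 ^ l > 0" using kap by simp
  fix f
  show "(\<Sum>i\<in>K \<times> UNIV. (cmod (ip S (x i) f))^2) <= qf S Y f"
  proof -
   have "(\<Sum>i\<in>K \<times> UNIV. (cmod (ip S (x i) f))^2) = (\<Sum>k\<in>K. (cmod (f k))^2 + (cmod (f (\<phi> k)))^2)"
    unfolding sum_times_bool by (rule sum.cong) (auto simp: xip)
   also have "... = (\<Sum>k\<in>K. (cmod (f k))^2) + (\<Sum>k\<in>\<phi> ` K. (cmod (f k))^2)"
    unfolding sum.distrib sum.reindex[OF K(2)] by simp
   also have "... = (\<Sum>k\<in>K \<union> \<phi> ` K. (cmod (f k))^2)"
    by (rule sum.union_disjoint[symmetric]) (use fK K(3) in auto)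
   also have "... <= nsq R f" unfolding nsq_def
    by (rule sum_mono2) (use R K(1) phR in auto)
   also have "... <= qf S Y f" unfolding qY using Y0[of f] nsub[of f] by simp
   finally show ?thesis .
  qed
  fix i assume i: "i \<in> K \<times> (UNIV::bool set)"
  obtain k s where ks: "i = (k, s)" "k \<in> K" using i by auto
  have "(cmod (ip S (x i) f))^2 <= \<kappa> * qf S Y0 f"
   unfolding ks(1) xip[OF ks(2)] by (rule each) (use phR[OF ks(2)] ks(2) K(1) R(2) in auto)
  also have "... <= \<kappa> * (4 ^ l * qf S Y f)"
   by (rule mult_left_mono) (use Ylow[of f] kap in \<open>auto simp: field_simps\<close>)
  finally show "(cmod (ip S (x i) f))^2 <= \<kappa> * 4 ^ l * qf S Y f" by (simp add: mult.assoc)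
 qed
 then obtain \<sigma> where \<sigma>: "\<And>f. (\<Sum>k\<in>K. (cmod (ip S (x (k, \<sigma> k)) f))^2) <= (1 + sqrt (2 * (\<kappa> * 4 ^ l)))^2 / 2 * qf S Y f"
  by blast
 \<comment> \<open>The bound 1/50 gives (1 + 1/5)^2 / 2 = 18/25, below 3/4.\<close>
 have sq: "sqrt (2 * (\<kappa> * 4 ^ l)) <= 1/5"
  by (rule real_le_lsqrt) (use k4 kap in \<open>auto simp: power2_eq_square\<close>)
 have "(1 + sqrt (2 * (\<kappa> * 4 ^ l)))^2 <= (1 + 1/5)^2"
  by (rule power_mono) (use sq kap in auto)
 then have k34: "(1 + sqrt (2 * (\<kappa> * 4 ^ l)))^2 / 2 <= 3/4" by (simp add: power2_eq_square)
 define ch where "ch k = (if \<sigma> k then k else \<phi> k)" for k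
 have inj: "inj_on ch K"
 proof (rule inj_onI)
  fix k k' assume kk: "k \<in> K" "k' \<in> K" "ch k = ch k'"
  have "\<phi> k \<notin> K" "\<phi> k' \<notin> K" using K(3) kk by auto
  then show "k = k'" using kk K(2) unfolding ch_def by (auto split: if_splits dest: inj_onD)
 qed
 define U where "U = ch ` K"
 have UR: "U \<subseteq> R" unfolding U_def ch_def using K(1) phR by auto
 have U: "nsq U c <= 3/4 * qf S Y c" for c
 proof -
  have "nsq U c = (\<Sum>k\<in>K. (cmod (ip S (x (k, \<sigma> k)) c))^2)"
   unfolding nsq_def U_def sum.reindex[OF inj] by (rule sum.cong) (auto simp: xip ch_def)
  also have "... <= (1 + sqrt (2 * (\<kappa> * 4 ^ l)))^2 / 2 * qf S Y c" by (rule \<sigma>)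
  also have "... <= 3/4 * qf S Y c" by (rule mult_right_mono[OF k34 psd_qf[OF pd_psd[OF pdY]]])
  finally show ?thesis .
 qed
 show ?case
 proof (intro exI[of _ "S' \<union> U"] conjI allI ballI)
  show "S' \<union> U \<subseteq> S" using S'(1) UR R(2) by blast
  fix c
  have fin: "finite S'" "finite U" using finite_subset[OF S'(1) S] finite_subset[OF UR R(1)] .
  have dj: "S' \<inter> U = {}" using UR unfolding R_def by blast
  have "nsq (S' \<union> U) c = nsq S' c + nsq U c" unfolding nsq_def
   by (rule sum.union_disjoint[OF fin dj])
  also have "... <= qf S Y0 c - 1/4 * qf S Y c" using U[of c] qY[of c] by linarith
  also have "... <= qf S Y0 c - 1/4 * (1 / 4 ^ l * qf S Y0 c)" using Ylow[of c] by linarith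
  also have "... = (1 - 1 / 4 ^ Suc l) * qf S Y0 c" by (simp add: algebra_simps)
  finally show "nsq (S' \<union> U) c <= (1 - 1 / 4 ^ Suc l) * qf S Y0 c" .
 next
  fix B assume B: "B \<in> \<B>"
  have KB: "ch ` (K \<inter> B) \<subseteq> U \<inter> B" unfolding U_def using K4[OF B] by (auto simp: ch_def)
  have "card (K \<inter> B) = card (ch ` (K \<inter> B))" by (rule card_image[symmetric]) (rule inj_on_subset[OF inj], blast)
  also have "... <= card (U \<inter> B)" by (rule card_mono[OF _ KB]) (use UR R(1) finite_subset in blast)
  finally have cK: "card (K \<inter> B) <= card (U \<inter> B)" .
  have "(S - (S' \<union> U)) \<inter> B = (R \<inter> B) - (U \<inter> B)" unfolding R_def by blast
  moreover have "card ((R \<inter> B) - (U \<inter> B)) = card (R \<inter> B) - card (U \<inter> B)"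
   by (rule card_Diff_subset) (use UR R(1) finite_subset in blast)+
  \<comment> \<open>The 1 on the right is the unpaired leftover. With n / 2^l + 1 undecided points
    before the round, at most (n / 2^l + 2) / 2 remain, so the additive 1 reproduces itself.\<close>
  ultimately have "2 * card ((S - (S' \<union> U)) \<inter> B) <= card (R \<inter> B) + 1" using K5[OF B] cK by simp
  then have "2 * real (card ((S - (S' \<union> U)) \<inter> B)) <= real (card (R \<inter> B)) + 1" by linarith
  also have "... <= real (card (S \<inter> B)) / 2 ^ l + 2" using S'(3)[OF B] unfolding R_def by simp
  finally show "real (card ((S - (S' \<union> U)) \<inter> B)) <= real (card (S \<inter> B)) / 2 ^ Suc l + 1" by (simp add: field_simps)
 qed
qed

section \<open>Deflation: counting constraints by traces\<close>

lemma nsq_project: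
 assumes "nsq b q = 1"
 shows "nsq b (%i. g i - q i * ip b q g) = nsq b g - (cmod (ip b q g))^2"
proof -
 define z where "z = ip b q g"
 have gq: "ip b g q = cnj z" unfolding z_def by (rule ip_cnj[symmetric])
 have 1: "ip b (%i. g i - z * q i) (%i. g i - z * q i) =
   ip b g g - z * ip b g q - cnj z * (ip b q g - z * ip b q q)"
  unfolding ip_diff_left ip_diff_right ip_scale_left ip_scale_right by (simp add: algebra_simps)
 have "complex_of_real (nsq b (%i. g i - z * q i)) = of_real (nsq b g - (cmod z)^2)"
  using 1 unfolding ip_self gq assms z_def[symmetric] of_real_diff complex_norm_square by simp
 then have "nsq b (%i. g i - z * q i) = nsq b g - (cmod z)^2" unfolding of_real_eq_iff .
 then show ?thesis unfolding z_def by (simp add: mult.commute)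
qed

text \<open>The family \<beta> is read as the contraction f -> (<\<beta> i, f>)_i. Projecting its
  values orthogonally to the normalized image q of v annihilates v and lowers the squared
  Hilbert-Schmidt norm by |w|^2, where w is the adjoint applied to q; contractivity gives |w| <= 1.
  Vectors annihilated before stay annihilated, so the step can be repeated.\<close>

lemma deflate_step:
 fixes \<beta> :: "'i => 'j => complex"
 assumes b: "finite b" and J: "finite J" and contr: "\<And>f. fsum J b \<beta> f <= nsq J f"
 shows "\<exists>\<beta>'. (\<forall>f. fsum J b \<beta>' f <= fsum J b \<beta> f) \<and> (\<forall>i\<in>b. ip J (\<beta>' i) v = 0) \<and>
  (\<forall>f. (\<forall>i\<in>b. ip J (\<beta> i) f = 0) \<longrightarrow> (\<forall>i\<in>b. ip J (\<beta>' i) f = 0)) \<and>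
  (\<Sum>i\<in>b. nsq J (\<beta> i)) <= (\<Sum>i\<in>b. nsq J (\<beta>' i)) + 1"
proof (cases "nsq b (%i. ip J (\<beta> i) v) = 0")
 case True
 then have z: "\<forall>i\<in>b. ip J (\<beta> i) v = 0" unfolding nsq_eq_0[OF b] .
 show ?thesis by (rule exI[of _ \<beta>]) (use z in simp)
next
 case False
 define s where "s = sqrt (nsq b (%i. ip J (\<beta> i) v))"
 have s: "s > 0" unfolding s_def using False nsq_nonneg[of b "%i. ip J (\<beta> i) v"] by simp
 have s2: "nsq b (%i. ip J (\<beta> i) v) = s^2" unfolding s_def using nsq_nonneg[of b "%i. ip J (\<beta> i) v"] by simp
 define q where "q i = of_real (1 / s) * ip J (\<beta> i) v" for i
 have cs: "cmod (of_real (1 / s)) = 1 / s" using s by (simp add: norm_divide)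
 have q1: "nsq b q = 1" unfolding q_def nsq_scale s2 cs using s by (simp add: power_divide)
 have vq: "ip J (\<beta> i) v = of_real s * q i" for i unfolding q_def using s by simp
 define w where "w j = (\<Sum>k\<in>b. q k * \<beta> k j)" for j
 have ipw: "ip J w f = ip b q (%k. ip J (\<beta> k) f)" for f
  unfolding w_def ip_sum_left ip_scale_left by (simp add: ip_def)
 define \<beta>' where "\<beta>' i j = \<beta> i j - cnj (q i) * w j" for i j
 have ipb: "ip J (\<beta>' i) f = ip J (\<beta> i) f - q i * ip b q (%k. ip J (\<beta> k) f)" for i f
  unfolding \<beta>'_def ip_diff_left ip_scale_left ipw by simp
 have fs: "fsum J b \<beta> f = nsq b (%i. ip J (\<beta> i) f)" for \<beta> :: "'i => 'j => complex" and f
  unfolding fsum_def nsq_def ..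
 have w1: "nsq J w <= 1"
 proof -
  have "(nsq J w)^2 <= nsq b q * nsq b (%k. ip J (\<beta> k) w)"
   using ip_cauchy[OF b, of q "%k. ip J (\<beta> k) w"] ip_self[of J w] unfolding ipw by simp
  also have "... <= nsq J w" using contr[of w] unfolding fs q1 by simp
  finally have "nsq J w * nsq J w <= nsq J w * 1" by (simp add: power2_eq_square)
  then show ?thesis using nsq_nonneg[of J w] by (cases "nsq J w = 0") auto
 qed
 have tr: "(\<Sum>i\<in>b. nsq J (\<beta>' i)) = (\<Sum>i\<in>b. nsq J (\<beta> i)) - nsq J w"
 proof -
  have col: "(\<Sum>i\<in>b. (cmod (\<beta>' i j))^2) = (\<Sum>i\<in>b. (cmod (\<beta> i j))^2) - (cmod (w j))^2" for j
  proof -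
   have e: "ip b q (%i. cnj (\<beta> i j)) = cnj (w j)" unfolding ip_def w_def by simp
   have "cmod (\<beta>' i j) = cmod (cnj (\<beta> i j) - q i * ip b q (%i. cnj (\<beta> i j)))" for i
   proof -
    have "cnj (\<beta>' i j) = cnj (\<beta> i j) - q i * ip b q (%i. cnj (\<beta> i j))" unfolding e \<beta>'_def by simp
    then have "cmod (cnj (\<beta>' i j)) = cmod (cnj (\<beta> i j) - q i * ip b q (%i. cnj (\<beta> i j)))" by (rule arg_cong)
    then show ?thesis unfolding complex_mod_cnj .
   qed
   then have "(\<Sum>i\<in>b. (cmod (\<beta>' i j))^2) = nsq b (%i. cnj (\<beta> i j) - q i * ip b q (%i. cnj (\<beta> i j)))"
    unfolding nsq_def by (simp only:)
   also have "... = nsq b (%i. cnj (\<beta> i j)) - (cmod (w j))^2" unfolding nsq_project[OF q1] unfolding e by simp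
   finally show ?thesis unfolding nsq_def by simp
  qed
  have "(\<Sum>i\<in>b. nsq J (\<beta>' i)) = (\<Sum>j\<in>J. \<Sum>i\<in>b. (cmod (\<beta>' i j))^2)" unfolding nsq_def by (rule sum.swap)
  also have "... = (\<Sum>j\<in>J. \<Sum>i\<in>b. (cmod (\<beta> i j))^2) - nsq J w" unfolding col sum_subtractf nsq_def ..
  also have "(\<Sum>j\<in>J. \<Sum>i\<in>b. (cmod (\<beta> i j))^2) = (\<Sum>i\<in>b. nsq J (\<beta> i))" unfolding nsq_def by (rule sum.swap)
  finally show ?thesis .
 qed
 show ?thesis
 proof (rule exI[of _ \<beta>'], intro conjI allI ballI impI)
  show "fsum J b \<beta>' f <= fsum J b \<beta> f" for f
   unfolding fs ipb nsq_project[OF q1, of "%i. ip J (\<beta> i) f"] by simp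
  have "ip b q (%k. ip J (\<beta> k) v) = of_real s"
   unfolding vq ip_scale_right ip_self q1 by simp
  then show "ip J (\<beta>' i) v = 0" for i unfolding ipb vq by simp
  show "ip J (\<beta>' i) f = 0" if f: "\<forall>i\<in>b. ip J (\<beta> i) f = 0" and i: "i \<in> b" for f i
  proof -
   have "ip b q (%k. ip J (\<beta> k) f) = 0" unfolding ip_def[of b] using f by simp
   then show ?thesis unfolding ipb using f i by simp
  qed
  show "(\<Sum>i\<in>b. nsq J (\<beta> i)) <= (\<Sum>i\<in>b. nsq J (\<beta>' i)) + 1" unfolding tr using w1 by simp
 qed
qed

text \<open>Each annihilated vector costs at most 1 of the trace. This is a robust substitute for
  dimension counting, applicable to operators that are only approximately projections.\<close>

lemma deflate:
 fixes \<beta> :: "'i => 'j => complex"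
 assumes b: "finite b" and J: "finite J" and contr: "\<And>f. fsum J b \<beta> f <= nsq J f"
 shows "finite N ==> \<exists>\<beta>'. (\<forall>f. fsum J b \<beta>' f <= fsum J b \<beta> f) \<and> (\<forall>n\<in>N. \<forall>i\<in>b. ip J (\<beta>' i) (v n) = 0) \<and>
  (\<Sum>i\<in>b. nsq J (\<beta> i)) <= (\<Sum>i\<in>b. nsq J (\<beta>' i)) + real (card N)"
proof (induction N rule: finite_induct)
 case empty
 show ?case by (rule exI[of _ \<beta>]) simp
next
 case (insert n N)
 obtain \<beta>1 where 1: "\<forall>f. fsum J b \<beta>1 f <= fsum J b \<beta> f" "\<forall>n\<in>N. \<forall>i\<in>b. ip J (\<beta>1 i) (v n) = 0"
  "(\<Sum>i\<in>b. nsq J (\<beta> i)) <= (\<Sum>i\<in>b. nsq J (\<beta>1 i)) + real (card N)"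
  using insert.IH by (elim exE conjE)
 have c1: "fsum J b \<beta>1 f <= nsq J f" for f using spec[OF 1(1), of f] contr[of f] by linarith
 obtain \<beta>2 where 2: "\<forall>f. fsum J b \<beta>2 f <= fsum J b \<beta>1 f" "\<forall>i\<in>b. ip J (\<beta>2 i) (v n) = 0"
  "\<forall>f. (\<forall>i\<in>b. ip J (\<beta>1 i) f = 0) \<longrightarrow> (\<forall>i\<in>b. ip J (\<beta>2 i) f = 0)"
  "(\<Sum>i\<in>b. nsq J (\<beta>1 i)) <= (\<Sum>i\<in>b. nsq J (\<beta>2 i)) + 1"
  using deflate_step[OF b J c1, of "v n"] by (elim exE conjE)
 show ?case
 proof (rule exI[of _ \<beta>2], intro conjI allI ballI)
  show "fsum J b \<beta>2 f <= fsum J b \<beta> f" for f using spec[OF 1(1), of f] spec[OF 2(1), of f] by linarith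
  fix n' i assume n': "n' \<in> insert n N" and i: "i \<in> b"
  show "ip J (\<beta>2 i) (v n') = 0"
  proof (cases "n' = n")
   case True
   then show ?thesis using 2(2) i by simp
  next
   case False
   then have "\<forall>i\<in>b. ip J (\<beta>1 i) (v n') = 0" using 1(2) n' by simp
   then show ?thesis using spec[OF 2(3), of "v n'"] i by simp
  qed
 next
  show "(\<Sum>i\<in>b. nsq J (\<beta> i)) <= (\<Sum>i\<in>b. nsq J (\<beta>2 i)) + real (card (insert n N))"
   using 1(3) 2(4) insert.hyps by simp
 qed
qed

section \<open>Local dimension counting\<close>

definition syn :: "'i set => ('i => 'j => complex) => ('i => complex) => 'j => complex" where
 "syn S u c j = (\<Sum>l\<in>S. c l * u l j)"

text \<open>Gram matrix plus \<gamma>: a small value of its form is an approximate linear dependence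
  whose coefficients are controlled as well.\<close>

definition rgram :: "'j set => ('i => 'j => complex) => real => 'i => 'i => complex" where
 "rgram J u \<gamma> i l = ip J (u i) (u l) + of_real \<gamma> * idm i l"

lemma ip_syn_left: "ip J (syn S u c) x = ip S c (%l. ip J (u l) x)"
 unfolding syn_def ip_sum_left ip_scale_left by (simp add: ip_def)

lemma ip_syn_right: "ip J x (syn S u c) = (\<Sum>l\<in>S. c l * ip J x (u l))"
 unfolding syn_def ip_sum_right ip_scale_right ..

lemma mv_rgram: "finite S ==> i \<in> S ==> mv S (rgram J u \<gamma>) c i = ip J (u i) (syn S u c) + of_real \<gamma> * c i"
proof -
 assume S: "finite S" "i \<in> S"
 have "mv S (rgram J u \<gamma>) c i = (\<Sum>l\<in>S. c l * ip J (u i) (u l)) + of_real \<gamma> * mv S idm c i"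
  unfolding mv_def rgram_def sum_distrib_left sum.distrib[symmetric] by (rule sum.cong) (simp_all add: algebra_simps)
 then show ?thesis unfolding mv_idm[OF S] ip_syn_right .
qed

lemma qf_rgram: "finite S ==> qf S (rgram J u \<gamma>) c = nsq J (syn S u c) + \<gamma> * nsq S c"
proof -
 assume S: "finite S"
 have "ip S c (mv S (rgram J u \<gamma>) c) = ip S c (%i. ip J (u i) (syn S u c) + of_real \<gamma> * c i)"
  by (rule ip_cong) (auto simp: mv_rgram[OF S])
 also have "... = of_real (nsq J (syn S u c) + \<gamma> * nsq S c)"
  unfolding ip_add_right ip_scale_right ip_self ip_syn_left[symmetric] by simp
 finally show ?thesis unfolding qf_def by simp
qed

lemma pd_rgram: "finite S ==> \<gamma> > 0 ==> pd S (rgram J u \<gamma>)"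
 unfolding pd_def
proof (intro conjI allI impI)
 assume S: "finite S" and g: "\<gamma> > 0"
 show "hermitian S (rgram J u \<gamma>)" unfolding hermitian_def
 proof (intro ballI)
  fix i l
  have "ip J (u l) (u i) = cnj (ip J (u i) (u l))" by (rule ip_cnj[symmetric])
  then show "rgram J u \<gamma> l i = cnj (rgram J u \<gamma> i l)" unfolding rgram_def idm_def by simp
 qed
 fix f :: "_ => complex" assume "\<exists>j\<in>S. f j \<noteq> 0"
 then obtain j where "j \<in> S" "f j \<noteq> 0" by blast
 then have "nsq S f > 0" by (rule nsq_pos[OF S])
 then have "\<gamma> * nsq S f > 0" using g by simp
 then show "qf S (rgram J u \<gamma>) f > 0" unfolding qf_rgram[OF S] using nsq_nonneg[of J "syn S u f"] by linarith
qed

text \<open>Ridge regression: a x minimizes |x - sum c u|^2 + \<gamma> |c|^2 and is found by solving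
  with \<open>rgram\<close>. The second clause states in dual form that x -> a x is linear with norm
  at most \<gamma>^(-1/2): every functional of a x is the pairing with a vector y of controlled
  norm.\<close>

lemma ridge:
 fixes u :: "'i => 'j => complex"
 assumes S: "finite S" and g: "\<gamma> > 0"
 shows "\<exists>a. (\<forall>x c. nsq J (%j. x j - syn S u (a x) j) <= nsq J (%j. x j - syn S u c j) + \<gamma> * nsq S c) \<and>
  (\<forall>w. \<exists>y. (\<forall>x. (\<Sum>j\<in>S. a x j * w j) = ip J y x) \<and> nsq J y <= nsq S w / \<gamma>)"
proof -
 define H where "H = rgram J u \<gamma>"
 have pd: "pd S H" unfolding H_def by (rule pd_rgram[OF S g])
 note pH = pd_psd[OF pd] and hH = psd_hermitian[OF pd_psd[OF pd]]
 have "\<forall>h. \<exists>y. \<forall>i\<in>S. mv S H y i = h i" by (rule allI) (rule pd_solve[OF S pd])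
 from choice[OF this] obtain sol where "\<forall>h. \<forall>i\<in>S. mv S H (sol h) i = h i" by (elim exE)
 then have inv: "mv S H (sol h) i = h i" if "i \<in> S" for h i using that by simp
 define a where "a x = sol (%k. ip J (u k) x)" for x
 have val: "nsq J (%j. x j - syn S u c j) + \<gamma> * nsq S c = nsq J x - 2 * Re (ip S c (%k. ip J (u k) x)) + qf S H c" for x c
 proof -
  have "ip J (%j. x j - syn S u c j) (%j. x j - syn S u c j) =
    ip J x x + ip J (syn S u c) (syn S u c) - ip J (syn S u c) x - cnj (ip J (syn S u c) x)"
   unfolding ip_diff_left ip_diff_right ip_cnj by simp
  then have "of_real (nsq J (%j. x j - syn S u c j)) = of_real (nsq J x + nsq J (syn S u c)) - (ip J (syn S u c) x + cnj (ip J (syn S u c) x))"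
   unfolding ip_self by simp
  also have "ip J (syn S u c) x + cnj (ip J (syn S u c) x) = of_real (2 * Re (ip J (syn S u c) x))"
   by (rule complex_add_cnj)
  finally have "nsq J (%j. x j - syn S u c j) = nsq J x + nsq J (syn S u c) - 2 * Re (ip J (syn S u c) x)"
   unfolding of_real_diff[symmetric] of_real_eq_iff .
  then show ?thesis unfolding H_def qf_rgram[OF S] ip_syn_left by simp
 qed
 show ?thesis
 proof (rule exI[of _ a], intro conjI allI)
  fix x :: "_ => complex" and c :: "_ => complex"
  define d where "d i = c i - a x i" for i
  have ce: "c = (%i. d i + a x i)" unfolding d_def by simp
  have Ha: "ip S f (mv S H (a x)) = ip S f (%k. ip J (u k) x)" for f
   by (rule ip_cong) (auto simp: a_def inv)
  have q: "qf S H c = qf S H d + qf S H (a x) + 2 * Re (ip S d (%k. ip J (u k) x))"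
   unfolding ce qf_add[OF hH] Ha ..
  have i: "ip S c (%k. ip J (u k) x) = ip S d (%k. ip J (u k) x) + ip S (a x) (%k. ip J (u k) x)"
   unfolding ce by (rule ip_add_left)
  have "\<gamma> * nsq S (a x) \<ge> 0" using g nsq_nonneg[of S "a x"] by simp
  then show "nsq J (%j. x j - syn S u (a x) j) <= nsq J (%j. x j - syn S u c j) + \<gamma> * nsq S c"
   using val[of x c] val[of x "a x"] q i psd_qf[OF pH, of d] by simp
 next
  fix w
  define z where "z = sol (%j. cnj (w j))"
  have Hz: "ip S f (mv S H z) = ip S f (%j. cnj (w j))" for f
   by (rule ip_cong) (auto simp: z_def inv)
  have 1: "(\<Sum>j\<in>S. a x j * w j) = ip J (syn S u z) x" for x
  proof -
   have "(\<Sum>j\<in>S. a x j * w j) = ip S (%j. cnj (w j)) (a x)" unfolding ip_def by (rule sum.cong) (auto simp: mult.commute)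
   also have "... = ip S (mv S H z) (a x)" by (rule ip_cong) (auto simp: z_def inv)
   also have "... = ip S z (mv S H (a x))" by (rule hermitian_adj[OF hH, symmetric])
   also have "... = ip S z (%k. ip J (u k) x)" by (rule ip_cong) (auto simp: a_def inv)
   finally show ?thesis unfolding ip_syn_left .
  qed
  define Q where "Q = qf S H z"
  have Qe: "Q = nsq J (syn S u z) + \<gamma> * nsq S z" unfolding Q_def H_def by (rule qf_rgram[OF S])
  have Q0: "Q \<ge> 0" unfolding Q_def by (rule psd_qf[OF pH])
  have w: "nsq S (%j. cnj (w j)) = nsq S w" unfolding nsq_def by simp
  have "ip S z (%j. cnj (w j)) = of_real Q" using Hz[of z] ip_mv_qf[OF hH, of z] unfolding Q_def by simp
  then have "Q^2 <= nsq S z * nsq S w" using ip_cauchy[OF S, of z "%j. cnj (w j)"] unfolding w by simp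
  also have "... <= Q / \<gamma> * nsq S w"
   by (rule mult_right_mono[OF _ nsq_nonneg]) (use g nsq_nonneg[of J "syn S u z"] in \<open>simp add: Qe field_simps\<close>)
  finally have "Q * Q <= Q * (nsq S w / \<gamma>)" by (simp add: power2_eq_square)
  moreover have "nsq S w / \<gamma> \<ge> 0" using nsq_nonneg[of S w] g by simp
  ultimately have "Q <= nsq S w / \<gamma>" using Q0 by (metis mult_le_cancel_left_pos less_eq_real_def)
  then have 2: "nsq J (syn S u z) <= nsq S w / \<gamma>" using Qe mult_nonneg_nonneg[of \<gamma> "nsq S z"] g nsq_nonneg[of S z] by linarith
  show "\<exists>y. (\<forall>x. (\<Sum>j\<in>S. a x j * w j) = ip J y x) \<and> nsq J y <= nsq S w / \<gamma>"
   by (rule exI[of _ "syn S u z"]) (intro conjI allI 1 2)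
 qed
qed

lemma nsq_add_le: "nsq J (%j. f j + g j) <= 2 * nsq J f + 2 * nsq J g"
proof -
 have "(cmod (x + y))^2 <= 2 * (cmod x)^2 + 2 * (cmod y)^2" for x y :: complex
 proof -
  have "(cmod (x + y))^2 <= (cmod x + cmod y)^2" by (rule power_mono[OF norm_triangle_ineq norm_ge_zero])
  also have "... <= 2 * (cmod x)^2 + 2 * (cmod y)^2" using sum_squares_bound[of "cmod x" "cmod y"] by (simp add: power2_sum)
  finally show ?thesis .
 qed
 then show ?thesis unfolding nsq_def sum_distrib_left sum.distrib[symmetric] by (rule sum_mono)
qed

text \<open>The vectors u i / sqrt R for i in b have trace card b / R. Deflating along u n for n in
  S \<inter> B leaves at least the difference on the left, and the lower frame bound of L measures
  this remainder by the vectors u l. Those with l outside B see only leakage. Those with l in B are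
  e-close to combinations from S, whose part in B is annihilated and whose part outside B is leakage
  again, amplified by the coefficient bound through C/\<gamma>.\<close>

lemma count_lemma:
 fixes u :: "'i => 'j => complex"
 assumes I: "finite I" and J: "finite J" and u: "\<And>i. i \<in> I ==> nsq J (u i) = 1" and R: "R > 0"
  and tight: "\<And>f. fsum J I u f = R * nsq J f"
  and L: "L \<subseteq> I" and low: "\<And>f. nsq J f <= fsum J L u f" and up: "\<And>f. fsum J L u f <= C * nsq J f"
  and S: "S \<subseteq> L" and g: "\<gamma> > 0" and C: "C \<ge> 0"
  and near: "\<And>i. i \<in> L ==> \<exists>c. nsq J (%j. u i j - syn S u c j) + \<gamma> * nsq S c <= e"
  and b: "b \<subseteq> B" "B \<subseteq> I"
 shows "real (card b) / R - real (card (S \<inter> B)) <=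
  (1 + 2 * C / \<gamma>) * ((\<Sum>l\<in>L - B. \<Sum>i\<in>b. (cmod (ip J (u i) (u l)))^2) / R) + 2 * e * real (card (L \<inter> B))"
proof -
 define LK where "LK = (\<Sum>l\<in>L - B. \<Sum>i\<in>b. (cmod (ip J (u i) (u l)))^2) / R"
 have fL: "finite L" and fS: "finite S" and fb: "finite b" using L S b I finite_subset by (metis order_trans)+
 define \<beta> where "\<beta> i j = of_real (1 / sqrt R) * u i j" for i j
 have cs: "(cmod (of_real (1 / sqrt R)))^2 = 1 / R" using R by (simp add: norm_divide power_divide)
 have fbe: "fsum J b \<beta> f = (\<Sum>i\<in>b. (cmod (ip J (u i) f))^2) / R" for f
 proof -
  have "(cmod (ip J (\<beta> i) f))^2 = (cmod (ip J (u i) f))^2 / R" for i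
   unfolding \<beta>_def ip_scale_left norm_mult power_mult_distrib complex_mod_cnj cs by simp
  then show ?thesis unfolding fsum_def by (simp add: sum_divide_distrib)
 qed
 have contr: "fsum J b \<beta> f <= nsq J f" for f
 proof -
  have "(\<Sum>i\<in>b. (cmod (ip J (u i) f))^2) <= fsum J I u f" unfolding fsum_def
   by (rule sum_mono2) (use I b in auto)
  then show ?thesis unfolding fbe tight using R by (simp add: field_simps)
 qed
 obtain \<beta>' where 1: "\<forall>f. fsum J b \<beta>' f <= fsum J b \<beta> f" "\<forall>n\<in>S \<inter> B. \<forall>i\<in>b. ip J (\<beta>' i) (u n) = 0"
  "(\<Sum>i\<in>b. nsq J (\<beta> i)) <= (\<Sum>i\<in>b. nsq J (\<beta>' i)) + real (card (S \<inter> B))"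
  using deflate[OF fb J contr finite_Int[OF disjI1[OF fS], of B], of u] by (elim exE conjE)
 have tr: "(\<Sum>i\<in>b. nsq J (\<beta> i)) = real (card b) / R"
 proof -
  have "nsq J (\<beta> i) = 1 / R" if "i \<in> b" for i
   unfolding \<beta>_def nsq_scale cs using u[of i] that b by auto
  then show ?thesis by simp
 qed
 obtain a where a1: "\<forall>x c. nsq J (%j. x j - syn S u (a x) j) <= nsq J (%j. x j - syn S u c j) + \<gamma> * nsq S c"
  and a2: "\<forall>w. \<exists>y. (\<forall>x. (\<Sum>j\<in>S. a x j * w j) = ip J y x) \<and> nsq J y <= nsq S w / \<gamma>"
  using ridge[OF fS g, of J u] by (elim exE conjE)
 have res: "nsq J (%j. u l j - syn S u (a (u l)) j) <= e" if l: "l \<in> L" for l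
 proof -
  obtain c where "nsq J (%j. u l j - syn S u c j) + \<gamma> * nsq S c <= e" using near[OF l] by (elim exE)
  then show ?thesis using spec[OF spec[OF a1, of "u l"], of c] by linarith
 qed
 have far: "fsum J b \<beta>' (u l) <= (\<Sum>i\<in>b. (cmod (ip J (u i) (u l)))^2) / R" for l
  using spec[OF 1(1), of "u l"] unfolding fbe .
 have sumfar: "(\<Sum>l\<in>L - B. fsum J b \<beta>' (u l)) <= LK"
  unfolding LK_def sum_divide_distrib[of _ "L - B"] by (rule sum_mono) (rule far)
 define w where "w i j = ip J (\<beta>' i) (u j)" for i j
 have wS: "(\<Sum>i\<in>b. nsq S (w i)) <= LK"
 proof -
  have "(\<Sum>i\<in>b. nsq S (w i)) = (\<Sum>j\<in>S. fsum J b \<beta>' (u j))" unfolding nsq_def w_def fsum_def by (rule sum.swap)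
  also have "... = (\<Sum>j\<in>S - B. fsum J b \<beta>' (u j))"
  proof (rule sum.mono_neutral_right[OF fS])
   show "\<forall>i\<in>S - (S - B). fsum J b \<beta>' (u i) = 0" using 1(2) unfolding fsum_def by simp
  qed auto
  also have "... <= (\<Sum>j\<in>L - B. fsum J b \<beta>' (u j))"
   by (rule sum_mono2) (use fL S in \<open>auto simp: fsum_def intro: sum_nonneg\<close>)
  finally show ?thesis using sumfar by linarith
 qed
 have close: "fsum J b \<beta>' (u l) <= 2 * e + 2 * (\<Sum>i\<in>b. (cmod (\<Sum>j\<in>S. a (u l) j * w i j))^2)" if l: "l \<in> L" for l
 proof -
  define r where "r j = u l j - syn S u (a (u l)) j" for j
  have ul: "u l = (%j. r j + syn S u (a (u l)) j)" unfolding r_def by simp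
  have "fsum J b \<beta>' (u l) = nsq b (%i. ip J (\<beta>' i) (u l))" unfolding fsum_def nsq_def ..
  also have "... = nsq b (%i. ip J (\<beta>' i) r + (\<Sum>j\<in>S. a (u l) j * w i j))"
  proof -
   have "ip J (\<beta>' i) (u l) = ip J (\<beta>' i) r + (\<Sum>j\<in>S. a (u l) j * w i j)" for i
    unfolding w_def ip_syn_right[symmetric] ip_add_right[symmetric] using ul by simp
   then show ?thesis by simp
  qed
  also have "... <= 2 * fsum J b \<beta>' r + 2 * (\<Sum>i\<in>b. (cmod (\<Sum>j\<in>S. a (u l) j * w i j))^2)"
   using nsq_add_le[of b "%i. ip J (\<beta>' i) r" "%i. \<Sum>j\<in>S. a (u l) j * w i j"] unfolding fsum_def nsq_def .
  also have "fsum J b \<beta>' r <= e"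
   using spec[OF 1(1), of r] contr[of r] res[OF l] unfolding r_def[symmetric] by linarith
  finally show ?thesis by simp
 qed
 \<comment> \<open>Summed over l, the functionals of a (u l) are the analysis coefficients of the
   single vector y, so the upper frame bound of L applies.\<close>
 have lin: "(\<Sum>l\<in>L. (cmod (\<Sum>j\<in>S. a (u l) j * w i j))^2) <= C / \<gamma> * nsq S (w i)" for i
 proof -
  obtain y where y: "\<forall>x. (\<Sum>j\<in>S. a x j * w i j) = ip J y x" "nsq J y <= nsq S (w i) / \<gamma>"
   using spec[OF a2, of "w i"] by (elim exE conjE)
  have "(\<Sum>l\<in>L. (cmod (\<Sum>j\<in>S. a (u l) j * w i j))^2) = (\<Sum>l\<in>L. (cmod (ip J (u l) y))^2)"
  proof (rule sum.cong[OF refl])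
   fix l
   have "(\<Sum>j\<in>S. a (u l) j * w i j) = cnj (ip J (u l) y)" unfolding ip_cnj using y(1) by simp
   then show "(cmod (\<Sum>j\<in>S. a (u l) j * w i j))^2 = (cmod (ip J (u l) y))^2" by simp
  qed
  also have "... <= C * nsq J y" using up[of y] unfolding fsum_def .
  also have "... <= C * (nsq S (w i) / \<gamma>)" by (rule mult_left_mono[OF y(2) C])
  finally show ?thesis by simp
 qed
 have nearsum: "(\<Sum>l\<in>L \<inter> B. fsum J b \<beta>' (u l)) <= 2 * e * real (card (L \<inter> B)) + 2 * (C / \<gamma> * LK)"
 proof -
  have "(\<Sum>l\<in>L \<inter> B. fsum J b \<beta>' (u l)) <= (\<Sum>l\<in>L \<inter> B. 2 * e + 2 * (\<Sum>i\<in>b. (cmod (\<Sum>j\<in>S. a (u l) j * w i j))^2))"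
   by (rule sum_mono) (use close in auto)
  also have "... = 2 * e * real (card (L \<inter> B)) + 2 * (\<Sum>l\<in>L \<inter> B. \<Sum>i\<in>b. (cmod (\<Sum>j\<in>S. a (u l) j * w i j))^2)"
   unfolding sum.distrib sum_distrib_left by simp
  also have "(\<Sum>l\<in>L \<inter> B. \<Sum>i\<in>b. (cmod (\<Sum>j\<in>S. a (u l) j * w i j))^2) <=
    (\<Sum>l\<in>L. \<Sum>i\<in>b. (cmod (\<Sum>j\<in>S. a (u l) j * w i j))^2)"
   by (rule sum_mono2) (use fL in \<open>auto intro: sum_nonneg\<close>)
  also have "... = (\<Sum>i\<in>b. \<Sum>l\<in>L. (cmod (\<Sum>j\<in>S. a (u l) j * w i j))^2)" by (rule sum.swap)
  also have "... <= (\<Sum>i\<in>b. C / \<gamma> * nsq S (w i))" by (rule sum_mono) (rule lin)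
  also have "... = C / \<gamma> * (\<Sum>i\<in>b. nsq S (w i))" by (rule sum_distrib_left[symmetric])
  also have "... <= C / \<gamma> * LK" by (rule mult_left_mono[OF wS]) (use C g in simp)
  finally show ?thesis by simp
 qed
 have "(\<Sum>i\<in>b. nsq J (\<beta>' i)) <= (\<Sum>i\<in>b. fsum J L u (\<beta>' i))" by (rule sum_mono) (rule low)
 also have "... = (\<Sum>l\<in>L. fsum J b \<beta>' (u l))"
 proof -
  have "cmod (ip J (u l) (\<beta>' i)) = cmod (ip J (\<beta>' i) (u l))" for l i
   using ip_cnj[of J "u l" "\<beta>' i"] by (metis complex_mod_cnj)
  then show ?thesis unfolding fsum_def by (subst sum.swap) simp
 qed
 also have "... = (\<Sum>l\<in>L \<inter> B. fsum J b \<beta>' (u l)) + (\<Sum>l\<in>L - B. fsum J b \<beta>' (u l))"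
  by (rule sum.Int_Diff[OF fL])
 finally show ?thesis using nearsum sumfar 1(3) unfolding tr LK_def[symmetric] by (simp add: algebra_simps)
qed

lemma syn_unit: "finite S ==> i \<in> S ==> syn S u (idm i) j = u i j"
proof -
 assume S: "finite S" "i \<in> S"
 have "syn S u (idm i) j = (\<Sum>l\<in>S. if i = l then u l j else 0)"
  unfolding syn_def idm_def by (rule sum.cong) auto
 then show ?thesis using S by simp
qed

lemma nsq_idm: "finite S ==> i \<in> S ==> nsq S (idm i) = 1"
proof -
 assume S: "finite S" "i \<in> S"
 have "nsq S (idm i) = (\<Sum>l\<in>S. if i = l then 1 else 0)"
  unfolding nsq_def idm_def by (rule sum.cong) auto
 then show ?thesis using S by simp
qed

lemma syn_upper:
 assumes S: "finite S" and J: "finite J" and C: "C \<ge> 0" and up: "\<And>f. fsum J S u f <= C * nsq J f"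
 shows "nsq J (syn S u c) <= C * nsq S c"
proof -
 define N where "N = nsq J (syn S u c)"
 have N0: "N \<ge> 0" unfolding N_def by (rule nsq_nonneg)
 have "of_real N = ip S c (%l. ip J (u l) (syn S u c))" unfolding N_def ip_self[symmetric] ip_syn_left ..
 then have "N^2 <= nsq S c * nsq S (%l. ip J (u l) (syn S u c))"
  using ip_cauchy[OF S, of c "%l. ip J (u l) (syn S u c)"] by (metis norm_of_real power2_abs)
 also have "... <= nsq S c * (C * N)"
  by (rule mult_left_mono[OF _ nsq_nonneg]) (use up[of "syn S u c"] in \<open>simp add: nsq_def fsum_def N_def\<close>)
 finally have "N * N <= N * (C * nsq S c)" by (simp add: power2_eq_square mult_ac)
 moreover have "C * nsq S c \<ge> 0" using C nsq_nonneg[of S c] by simp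
 ultimately have "N <= C * nsq S c" using N0 by (metis mult_le_cancel_left_pos less_eq_real_def)
 then show ?thesis unfolding N_def .
qed

section \<open>Choosing vectors in an abstract tight frame\<close>

text \<open>The optimal subset S is taken for the form \<open>rgram\<close> with E = 1/e; thinning
  runs on \<open>rgram\<close> divided by \<gamma>, with \<kappa> = \<gamma>/e. S and S' are both
  kept in the statement: the count comes from the spanning property of S, the Riesz bounds hold for
  S', and thinning compares the two per block.\<close>

lemma selection:
 fixes u :: "'i => 'j => complex"
 assumes I: "finite I" and J: "finite J" and u: "\<And>i. i \<in> I ==> nsq J (u i) = 1" and R: "R \<ge> 1"
  and tight: "\<And>f. fsum J I u f = R * nsq J f"
  and BB: "finite \<B>" "disjoint \<B>" and g: "\<gamma> > 0" "\<gamma> <= e" "\<gamma> / e * 4 ^ l <= 1 / 50"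
 shows "\<exists>L S S'. S' \<subseteq> S \<and> S \<subseteq> L \<and> L \<subseteq> I \<and> (\<forall>f. nsq J f <= fsum J L u f) \<and> (\<forall>f. fsum J L u f <= 20000 * nsq J f) \<and>
  (\<forall>c. \<gamma> / 4 ^ l * nsq S' c <= nsq J (syn S' u c)) \<and> (\<forall>c. nsq J (syn S' u c) <= 20000 * nsq S' c) \<and>
  (\<forall>B\<in>\<B>. real (card (S \<inter> B)) * (1 - 1 / 2 ^ l) - 1 <= real (card (S' \<inter> B))) \<and>
  (\<forall>b B. b \<subseteq> B \<longrightarrow> B \<subseteq> I \<longrightarrow> real (card b) / R - real (card (S \<inter> B)) <=
   (1 + 2 * 20000 / \<gamma>) * ((\<Sum>l\<in>L - B. \<Sum>i\<in>b. (cmod (ip J (u i) (u l)))^2) / R) + 2 * e * real (card (L \<inter> B)))"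
proof -
 have u1: "nsq J (u i) <= 1" if "i \<in> I" for i using u[OF that] by simp
 obtain L where L: "L \<subseteq> I" and LL: "\<forall>f. nsq J f <= fsum J L u f \<and> fsum J L u f <= 20000 * nsq J f"
 proof -
  have "\<exists>S\<subseteq>I. \<forall>f. nsq J f <= fsum J S u f \<and> fsum J S u f <= 20000 * nsq J f"
   by (rule frame_sparsify[OF I J _ R tight]) (rule u1)
  then show thesis using that by (elim exE conjE)
 qed
 have low: "nsq J f <= fsum J L u f" and up: "fsum J L u f <= 20000 * nsq J f" for f
  using spec[OF LL, of f] by (rule conjunct1, rule conjunct2)
 have fL: "finite L" using L I by (rule finite_subset)
 have e: "e > 0" using g by linarith
 define H where "H = rgram J u \<gamma>"
 have pdL: "pd L H" unfolding H_def by (rule pd_rgram[OF fL g(1)])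
 have e1: "1 / e > 0" using e by simp
 obtain S where S: "S \<subseteq> L" and S1: "\<forall>i\<in>L - S. \<exists>c. c i = 1 \<and> qf (insert i S) H c <= 1 / (1 / e)"
  and S2: "\<forall>j\<in>S. \<forall>c. (cmod (c j))^2 <= 1 / e * qf S H c"
  using optimal_subset[OF fL pdL e1] by (elim exE conjE)
 have fS: "finite S" using S fL by (rule finite_subset)
 have near: "\<exists>c. nsq J (%j. u i j - syn S u c j) + \<gamma> * nsq S c <= e" if i: "i \<in> L" for i
 proof (cases "i \<in> S")
  case True
  \<comment> \<open>For i in S the unit coefficient vector leaves no residual and costs only
    \<gamma> <= e.\<close>
  show ?thesis
   by (rule exI[of _ "idm i"], unfold syn_unit[OF fS True] nsq_idm[OF fS True])
    (use g in \<open>simp add: nsq_def\<close>)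
 next
  case False
  obtain c where c: "c i = 1" "qf (insert i S) H c <= 1 / (1 / e)" using bspec[OF S1, of i] i False by auto
  define c' where "c' j = - c j" for j
  have "syn (insert i S) u c j = u i j - syn S u c' j" for j
   unfolding syn_def c'_def using False fS c(1) by (simp add: sum_negf)
  then have s: "syn (insert i S) u c = (%j. u i j - syn S u c' j)" by (rule ext)
  have n: "nsq (insert i S) c = 1 + nsq S c'" unfolding nsq_def c'_def using False fS c(1) by simp
  have "nsq J (%j. u i j - syn S u c' j) + \<gamma> * (1 + nsq S c') <= e"
   using c(2) fS unfolding H_def by (simp add: qf_rgram s n)
  then have "nsq J (%j. u i j - syn S u c' j) + \<gamma> * nsq S c' <= e" using g(1) by (simp add: algebra_simps)
  then show ?thesis by (intro exI[of _ c'])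
 qed
 define Y0 where "Y0 i j = of_real (1 / \<gamma>) * H i j" for i j
 have mvY: "mv S Y0 c i = of_real (1 / \<gamma>) * mv S H c i" for c i
  unfolding mv_def Y0_def sum_distrib_left by (simp add: mult_ac)
 have qY: "qf S Y0 c = qf S H c / \<gamma>" for c
 proof -
  have "ip S c (mv S Y0 c) = of_real (1 / \<gamma>) * ip S c (mv S H c)"
   unfolding ip_scale_right[symmetric] by (rule ip_cong[OF refl]) (rule mvY)
  then show ?thesis unfolding qf_def Re_complex_of_real by (simp add: Re_divide_of_real)
 qed
 have pdS: "pd S H" unfolding H_def by (rule pd_rgram[OF fS g(1)])
 have pdY: "pd S Y0" unfolding pd_def
 proof (intro conjI allI impI)
  show "hermitian S Y0" unfolding hermitian_def
  proof (intro ballI)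
   fix i j assume "i \<in> S" "j \<in> S"
   then have "H j i = cnj (H i j)" using psd_hermitian[OF pd_psd[OF pdS]] unfolding hermitian_def by blast
   then show "Y0 j i = cnj (Y0 i j)" unfolding Y0_def by simp
  qed
  fix f :: "_ => complex" assume "\<exists>j\<in>S. f j \<noteq> 0"
  then have "qf S H f > 0" using pdS unfolding pd_def by blast
  then show "qf S Y0 f > 0" unfolding qY using g(1) by simp
 qed
 have qYe: "qf S Y0 c = nsq J (syn S u c) / \<gamma> + nsq S c" for c
  unfolding qY H_def qf_rgram[OF fS] using g(1) by (simp add: add_divide_distrib)
 have Ylow: "nsq S c <= qf S Y0 c" for c unfolding qYe using g(1) nsq_nonneg[of J "syn S u c"] by simp
 have each: "(cmod (c j))^2 <= \<gamma> / e * qf S Y0 c" if "j \<in> S" for j c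
  using spec[OF bspec[OF S2 that], of c] unfolding qY using g(1) by simp
 have ge: "\<gamma> / e > 0" using g(1) e by simp
 obtain S' where S': "S' \<subseteq> S" and S'1: "\<forall>c. nsq S' c <= (1 - 1 / 4 ^ l) * qf S Y0 c"
  and S'2: "\<forall>B\<in>\<B>. real (card ((S - S') \<inter> B)) <= real (card (S \<inter> B)) / 2 ^ l + 1"
 proof -
  have "\<exists>S'\<subseteq>S. (\<forall>c. nsq S' c <= (1 - 1 / 4 ^ l) * qf S Y0 c) \<and>
    (\<forall>B\<in>\<B>. real (card ((S - S') \<inter> B)) <= real (card (S \<inter> B)) / 2 ^ l + 1)"
   by (rule thinning[OF fS pdY Ylow BB ge _ g(3)]) (rule each)
  then show thesis using that by (elim exE conjE)
 qed
 have fS': "finite S'" using S' fS by (rule finite_subset)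
 have riesz: "\<gamma> / 4 ^ l * nsq S' c <= nsq J (syn S' u c)" for c
 proof -
  define c' where "c' j = (if j \<in> S' then c j else 0)" for j
  have s: "syn S u c' = syn S' u c" unfolding syn_def c'_def
   by (rule ext, rule sum.mono_neutral_cong_right) (use fS S' in auto)
  have n: "nsq S c' = nsq S' c" unfolding nsq_def c'_def
   by (rule sum.mono_neutral_cong_right) (use fS S' in auto)
  have n': "nsq S' c' = nsq S' c" unfolding nsq_def c'_def by simp
  define X where "X = nsq J (syn S' u c) / \<gamma>"
  have X0: "X \<ge> 0" unfolding X_def using g(1) nsq_nonneg[of J "syn S' u c"] by simp
  \<comment> \<open>On coefficients supported in S' the identity occurs on both sides of the
    thinning inequality. Cancelling it leaves 4^(-l) |c|^2 <= (1 - 4^(-l)) Gram/\<gamma>.\<close>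
  have "nsq S' c <= (1 - 1 / 4 ^ l) * (X + nsq S' c)"
   using spec[OF S'1, of c'] unfolding qYe s n n' X_def .
  then have "1 / 4 ^ l * nsq S' c <= (1 - 1 / 4 ^ l) * X" by (simp only: ring_distribs)
  also have "... <= 1 * X" by (rule mult_right_mono[OF _ X0]) simp
  finally have "1 / 4 ^ l * nsq S' c <= X" by simp
  then have "\<gamma> * (1 / 4 ^ l * nsq S' c) <= \<gamma> * X" by (rule mult_left_mono) (use g(1) in simp)
  then show ?thesis unfolding X_def using g(1) by simp
 qed
 have upper: "nsq J (syn S' u c) <= 20000 * nsq S' c" for c
 proof (rule syn_upper[OF fS' J])
  fix f
  have "fsum J S' u f <= fsum J L u f" unfolding fsum_def
   by (rule sum_mono2[OF fL]) (use S' S in auto)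
  then show "fsum J S' u f <= 20000 * nsq J f" using up[of f] by linarith
 qed simp
 have cnt: "real (card (S \<inter> B)) * (1 - 1 / 2 ^ l) - 1 <= real (card (S' \<inter> B))" if "B \<in> \<B>" for B
 proof -
  have "card (S \<inter> B) = card (S' \<inter> B) + card ((S - S') \<inter> B)"
   by (subst card_Un_disjoint[symmetric]) (use fS fS' S' in \<open>auto intro: arg_cong[where f = card]\<close>)
  then have "real (card (S \<inter> B)) = real (card (S' \<inter> B)) + real (card ((S - S') \<inter> B))" by simp
  moreover have "real (card (S \<inter> B)) * (1 - 1 / 2 ^ l) = real (card (S \<inter> B)) - real (card (S \<inter> B)) / 2 ^ l"
   by (simp add: right_diff_distrib)
  ultimately show ?thesis using bspec[OF S'2 that] by linarith
 qed
 have R0: "R > 0" using R by simp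
 have cl: "real (card b) / R - real (card (S \<inter> B)) <=
   (1 + 2 * 20000 / \<gamma>) * ((\<Sum>l\<in>L - B. \<Sum>i\<in>b. (cmod (ip J (u i) (u l)))^2) / R) + 2 * e * real (card (L \<inter> B))"
  if "b \<subseteq> B" "B \<subseteq> I" for b B
  by (rule count_lemma[OF I J _ R0 tight L low up S g(1) _ _ that]) (simp_all add: u near)
 show ?thesis
  by (rule exI[of _ L], rule exI[of _ S], rule exI[of _ S'])
   (intro conjI allI ballI impI S' S L low up riesz upper cnt cl)
qed

section \<open>Fourier vectors on a grid set\<close>

definition ch :: "real => complex" where "ch x = cis (2 * pi * x)"

lemma ch_0 [simp]: "ch 0 = 1"
 unfolding ch_def by simp

lemma ch_add: "ch (x + y) = ch x * ch y"
 unfolding ch_def cis_mult by (simp add: distrib_left)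

lemma ch_cnj: "cnj (ch x) = ch (- x)"
 unfolding ch_def cis_cnj by simp

lemma norm_ch [simp]: "cmod (ch x) = 1"
 unfolding ch_def by simp

lemma ch_of_int [simp]: "ch (of_int m) = 1"
 unfolding ch_def by (rule cis_multiple_2pi) simp

lemma ch_add_int [simp]: "ch (x + of_int m) = ch x"
 unfolding ch_add by simp

lemma ch_power: "ch x ^ s = ch (real s * x)"
 unfolding ch_def Complex.DeMoivre by (simp add: mult_ac)

lemma ch_sum: "finite A ==> ch (\<Sum>a\<in>A. f a) = (\<Prod>a\<in>A. ch (f a))"
 by (induction A rule: finite_induct) (simp_all add: ch_add)

lemma ch_eq_1: "ch x = 1 ==> \<exists>m::int. x = of_int m"
proof -
 assume "ch x = 1"
 then have "Re (cis (2 * pi * x)) = 1" unfolding ch_def by simp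
 then have "cos (2 * pi * x) = 1" by simp
 then obtain m :: int where "2 * pi * x = of_int m * 2 * pi" unfolding cos_one_2pi_int by blast
 then have "x = of_int m" by simp
 then show ?thesis by blast
qed

lemma sin_ge_chord:
 assumes "0 <= x" "x <= pi / 2"
 shows "sin x \<ge> 2 * x / pi"
proof -
 have cv: "convex_on {0..pi/2} (%x. - sin x)"
 proof (rule convex_on_realI)
  show "connected {0..pi/2}" by simp
  show "((%x. - sin x) has_real_derivative - cos x) (at x)" if "x \<in> {0..pi/2}" for x
   by (auto intro!: derivative_eq_intros)
  show "- cos x <= - cos y" if "x \<in> {0..pi/2}" "y \<in> {0..pi/2}" "x <= y" for x y
   using cos_monotone_0_pi_le[of x y] that by simp
 qed
 have t: "0 <= 2 * x / pi" "2 * x / pi <= 1" using assms by (auto simp: field_simps)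
 have "- sin ((1 - 2 * x / pi) *\<^sub>R 0 + (2 * x / pi) *\<^sub>R (pi / 2)) <=
   (1 - 2 * x / pi) * (- sin 0) + (2 * x / pi) * (- sin (pi / 2))"
  by (rule convex_onD[OF cv t]) auto
 then show ?thesis by simp
qed

text \<open>|ch \<theta> - 1| = 2 sin (pi \<theta>), and the chord bound for the sine applies to
  \<theta> or to 1 - \<theta>.\<close>

lemma ch_far:
 assumes "0 <= \<delta>" "\<delta> <= \<theta>" "\<theta> <= 1 - \<delta>"
 shows "cmod (ch \<theta> - 1) \<ge> 4 * \<delta>"
proof -
 have s: "sin (pi * \<theta>) \<ge> 2 * \<delta>"
 proof (cases "\<theta> <= 1/2")
  case True
  have "pi * \<theta> <= pi * (1/2)" by (rule mult_left_mono[OF True]) simp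
  then have "sin (pi * \<theta>) \<ge> 2 * (pi * \<theta>) / pi" using assms by (intro sin_ge_chord) auto
  then show ?thesis using assms by simp
 next
  case False
  then have "1 - \<theta> <= 1/2" by simp
  then have "pi * (1 - \<theta>) <= pi * (1/2)" by (rule mult_left_mono) simp
  then have "sin (pi * (1 - \<theta>)) \<ge> 2 * (pi * (1 - \<theta>)) / pi" using assms by (intro sin_ge_chord) auto
  moreover have "sin (pi * (1 - \<theta>)) = sin (pi * \<theta>)" by (simp add: right_diff_distrib sin_diff)
  ultimately show ?thesis using assms by simp
 qed
 have "(cmod (ch \<theta> - 1))^2 = (cos (2 * pi * \<theta>) - 1)^2 + (sin (2 * pi * \<theta>))^2"
  unfolding ch_def cmod_power2 by simp
 also have "... = 2 - 2 * cos (2 * pi * \<theta>)"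
  using sin_cos_squared_add[of "2 * pi * \<theta>"] by (simp add: power2_eq_square algebra_simps)
 also have "cos (2 * pi * \<theta>) = 1 - 2 * (sin (pi * \<theta>))^2"
  using cos_double_sin[of "pi * \<theta>"] by (simp add: mult_ac)
 finally have e: "(cmod (ch \<theta> - 1))^2 = (2 * sin (pi * \<theta>))^2" by (simp add: power_mult_distrib)
 have "(4 * \<delta>)^2 <= (cmod (ch \<theta> - 1))^2" unfolding e by (rule power_mono) (use s assms in auto)
 then show ?thesis by (rule power2_le_imp_le) simp
qed

text \<open>The geometric sum is at most 2 / |ch \<theta> - 1|; the gap 4/H is what halves the
  trivial bound H.\<close>

lemma ch_geometric:
 assumes "cmod (ch \<theta> - 1) \<ge> 4 / real H" "H > 0"
 shows "cmod (\<Sum>s<H. ch (real s * \<theta>)) <= real H / 2"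
proof -
 have n1: "ch \<theta> \<noteq> 1"
 proof
  assume "ch \<theta> = 1"
  then have "4 / real H <= 0" using assms(1) by simp
  then show False using assms(2) by (simp add: field_simps)
 qed
 then have pos: "cmod (ch \<theta> - 1) > 0" by simp
 have "(\<Sum>s<H. ch (real s * \<theta>)) = (\<Sum>s<H. ch \<theta> ^ s)" unfolding ch_power ..
 also have "... = (ch \<theta> ^ H - 1) / (ch \<theta> - 1)" by (rule geometric_sum[OF n1])
 finally have "cmod (\<Sum>s<H. ch (real s * \<theta>)) = cmod (ch \<theta> ^ H - 1) / cmod (ch \<theta> - 1)" by (simp add: norm_divide)
 also have "... <= 2 / cmod (ch \<theta> - 1)"
 proof (rule divide_right_mono)
  show "cmod (ch \<theta> ^ H - 1) <= 2" using norm_triangle_ineq4[of "ch \<theta> ^ H" 1] by (simp add: norm_power)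
 qed simp
 also have "... <= 2 / (4 / real H)"
  by (rule divide_left_mono[OF assms(1)]) (use pos assms(2) in auto)
 finally show ?thesis by simp
qed

section \<open>The Fourier frame of a finite set of integer points\<close>

definition dt :: "nat => (nat => int) => (nat => int) => int" where
 "dt d x y = (\<Sum>t<d. x t * y t)"

text \<open>The spread condition keeps the points of J distinct modulo q, so the q^d characters
  modulo q restrict to a tight frame on the n-dimensional space of functions on J. Its redundancy is
  R, and k is the normalized Fourier transform of J.\<close>

locale dft =
 fixes d q :: nat and J :: "(nat => int) set"
 assumes q: "q > 0" and J: "finite J" "J \<noteq> {}" "J \<subseteq> extensional {..<d}"
  and spread: "\<And>j j' t. j \<in> J ==> j' \<in> J ==> t < d ==> \<bar>j t - j' t\<bar> < int q"
begin

definition n :: nat where "n = card J"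
definition I :: "(nat => int) set" where "I = {..<d} \<rightarrow>\<^sub>E {0..<int q}"
definition k :: "(nat => int) => complex" where
 "k \<eta> = of_real (1 / n) * (\<Sum>j\<in>J. ch (dt d \<eta> j / q))"
definition u :: "(nat => int) => (nat => int) => complex" where
 "u \<nu> j = of_real (1 / sqrt n) * ch (dt d \<nu> j / q)"
definition R :: real where "R = real q ^ d / n"

lemma n_pos: "n > 0"
 unfolding n_def using J by (simp add: card_gt_0_iff)

lemma finI: "finite I"
 unfolding I_def by (intro finite_PiE) auto

lemma geo: "(\<Sum>x\<in>{0..<int q}. ch (of_int (x * m) / q)) = (if int q dvd m then of_nat q else 0)"
proof -
 have "(\<Sum>x\<in>{0..<int q}. ch (of_int (x * m) / q)) = (\<Sum>x<q. ch (of_int (int x * m) / q))"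
  by (rule sum.reindex_bij_witness[of _ int nat]) auto
 also have "... = (\<Sum>x<q. ch (of_int m / q) ^ x)" unfolding ch_power by simp
 also have "... = (if int q dvd m then of_nat q else 0)"
 proof (cases "int q dvd m")
  case True
  then obtain c where c: "m = int q * c" by (auto simp: dvd_def)
  have "of_int m / real q = of_int c" unfolding c using q by simp
  then show ?thesis using True by simp
 next
  case False
  have n1: "ch (of_int m / q) \<noteq> 1"
  proof
   assume "ch (of_int m / q) = 1"
   then obtain c :: int where "of_int m / real q = of_int c" using ch_eq_1 by blast
   then have "real_of_int m = real_of_int (int q * c)" using q by (simp add: field_simps)
   then have "m = int q * c" by (simp only: of_int_eq_iff)
   then show False using False by simp
  qed
  have "ch (of_int m / q) ^ q = 1" unfolding ch_power using q by simp
  then show ?thesis using False geometric_sum[OF n1, of q] by simp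
 qed
 finally show ?thesis .
qed

lemma orth0: "(\<Sum>\<nu>\<in>I. ch (dt d \<nu> m / q)) = (if \<forall>t<d. int q dvd m t then of_nat (q ^ d) else 0)"
proof -
 have "(\<Sum>\<nu>\<in>I. ch (dt d \<nu> m / q)) = (\<Sum>\<nu>\<in>I. \<Prod>t<d. ch (of_int (\<nu> t * m t) / q))"
  unfolding dt_def of_int_sum sum_divide_distrib ch_sum[OF finite_lessThan] ..
 also have "... = (\<Prod>t<d. \<Sum>x\<in>{0..<int q}. ch (of_int (x * m t) / q))"
  unfolding I_def by (rule prod_sum_PiE[symmetric]) auto
 also have "... = (\<Prod>t<d. if int q dvd m t then of_nat q else 0)" unfolding geo ..
 also have "... = (if \<forall>t<d. int q dvd m t then of_nat (q ^ d) else 0)"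
 proof (cases "\<forall>t<d. int q dvd m t")
  case True
  then have "(\<Prod>t<d. if int q dvd m t then of_nat q else 0) = (\<Prod>t<d. (of_nat q :: complex))"
   by (intro prod.cong) auto
  then show ?thesis using True by simp
 next
  case False
  then obtain t where t: "t < d" "\<not> int q dvd m t" by blast
  have "(\<Prod>t<d. if int q dvd m t then of_nat q else (0::complex)) = 0"
   by (rule prod_zero[OF finite_lessThan], rule bexI[of _ t]) (use t in simp_all)
  then show ?thesis unfolding if_not_P[OF False] .
 qed
 finally show ?thesis .
qed

lemma dt_diff: "dt d (%t. x t - y t) z = dt d x z - dt d y z"
 unfolding dt_def sum_subtractf[symmetric] by (simp add: left_diff_distrib)

lemma dt_diff_right: "dt d x (%t. y t - z t) = dt d x y - dt d x z"
 unfolding dt_def sum_subtractf[symmetric] by (simp add: right_diff_distrib)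

lemma ch_div_dvd: "int q dvd x ==> ch (of_int x / q) = 1"
proof -
 assume "int q dvd x"
 then obtain c where c: "x = int q * c" by (auto simp: dvd_def)
 have "of_int x / real q = of_int c" unfolding c using q by simp
 then show ?thesis by simp
qed

lemma orth: "(\<Sum>\<nu>\<in>I. ch (dt d (%t. \<nu> t - i t) m / q)) = (if \<forall>t<d. int q dvd m t then of_nat (q ^ d) else 0)"
proof -
 have "(\<Sum>\<nu>\<in>I. ch (dt d (%t. \<nu> t - i t) m / q)) = (\<Sum>\<nu>\<in>I. ch (dt d \<nu> m / q) * ch (- dt d i m / q))"
 proof (rule sum.cong[OF refl])
  fix \<nu>
  have "of_int (dt d (%t. \<nu> t - i t) m) / real q = dt d \<nu> m / real q + (- dt d i m / real q)"
   unfolding dt_diff by (simp add: diff_divide_distrib)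
  then show "ch (dt d (%t. \<nu> t - i t) m / q) = ch (dt d \<nu> m / q) * ch (- dt d i m / q)" by (simp only: ch_add)
 qed
 also have "... = (\<Sum>\<nu>\<in>I. ch (dt d \<nu> m / q)) * ch (- dt d i m / q)" by (rule sum_distrib_right[symmetric])
 also have "... = (if \<forall>t<d. int q dvd m t then of_nat (q ^ d) else 0)"
 proof (cases "\<forall>t<d. int q dvd m t")
  case True
  have "int q dvd - dt d i m" unfolding dt_def dvd_minus_iff by (rule dvd_sum) (use True in auto)
  then have "ch (of_int (- dt d i m) / q) = 1" by (rule ch_div_dvd)
  then show ?thesis unfolding orth0 using True by simp
 next
  case False
  then show ?thesis unfolding orth0 by auto
 qed
 finally show ?thesis .
qed

lemma ip_u: "ip J (u \<nu>) (u \<mu>) = k (%t. \<mu> t - \<nu> t)"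
proof -
 have "ip J (u \<nu>) (u \<mu>) = (\<Sum>j\<in>J. of_real (1 / n) * ch (dt d (%t. \<mu> t - \<nu> t) j / q))"
  unfolding ip_def
 proof (rule sum.cong[OF refl])
  fix j
  have "of_int (dt d (%t. \<mu> t - \<nu> t) j) / real q = - (dt d \<nu> j / q) + dt d \<mu> j / real q"
   unfolding dt_diff by (simp add: diff_divide_distrib)
  then have c: "ch (dt d (%t. \<mu> t - \<nu> t) j / q) = ch (- (dt d \<nu> j / q)) * ch (dt d \<mu> j / q)" by (simp only: ch_add)
  have s: "complex_of_real (1 / sqrt n) * of_real (1 / sqrt n) = of_real (1 / n)"
   unfolding of_real_mult[symmetric] by simp
  show "cnj (u \<nu> j) * u \<mu> j = of_real (1 / n) * ch (dt d (%t. \<mu> t - \<nu> t) j / q)"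
   unfolding c s[symmetric] u_def complex_cnj_mult ch_cnj complex_cnj_complex_of_real by (simp only: mult_ac)
 qed
 then show ?thesis unfolding k_def sum_distrib_left .
qed

lemma k_0: "k (%t. x t - x t) = 1"
 unfolding k_def dt_def using n_pos by (simp add: n_def)

lemma nsq_u: "nsq J (u \<nu>) = 1"
proof -
 have "complex_of_real (nsq J (u \<nu>)) = 1" unfolding ip_self[symmetric] ip_u by (rule k_0)
 then show ?thesis by simp
qed

lemma same_class:
 assumes "j \<in> J" "j' \<in> J"
 shows "(\<forall>t<d. int q dvd j t - j' t) \<longleftrightarrow> j = j'"
proof
 assume a: "\<forall>t<d. int q dvd j t - j' t"
 have "j t = j' t" if "t < d" for t
 proof -
  have "int q dvd j t - j' t" using a that by blast
  then show ?thesis using spread[OF assms that] dvd_imp_le_int[of "j t - j' t" "int q"] by linarith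
 qed
 then show "j = j'" using J(3) assms by (intro extensionalityI[of _ "{..<d}"]) auto
qed simp

lemma tight: "fsum J I u f = R * nsq J f"
proof -
 have "complex_of_real (fsum J I u f) = (\<Sum>\<nu>\<in>I. ip J f (u \<nu>) * ip J (u \<nu>) f)"
  unfolding fsum_def of_real_sum complex_norm_square ip_cnj by (simp only: mult.commute)
 also have "... = (\<Sum>\<nu>\<in>I. \<Sum>j\<in>J. \<Sum>j'\<in>J. of_real (1 / n) * (cnj (f j) * f j') * ch (dt d \<nu> (%t. j t - j' t) / q))"
 proof (rule sum.cong[OF refl])
  fix \<nu>
  have "of_int (dt d \<nu> (%t. j t - j' t)) / real q = dt d \<nu> j / q + - (dt d \<nu> j' / real q)" for j j'
   unfolding dt_diff_right by (simp add: diff_divide_distrib)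
  then have c: "ch (dt d \<nu> (%t. j t - j' t) / q) = ch (dt d \<nu> j / q) * ch (- (dt d \<nu> j' / q))" for j j'
   by (simp only: ch_add)
  have s: "complex_of_real (1 / sqrt n) * of_real (1 / sqrt n) = of_real (1 / n)"
   unfolding of_real_mult[symmetric] by simp
  show "ip J f (u \<nu>) * ip J (u \<nu>) f = (\<Sum>j\<in>J. \<Sum>j'\<in>J. of_real (1 / n) * (cnj (f j) * f j') * ch (dt d \<nu> (%t. j t - j' t) / q))"
   unfolding ip_def sum_product c s[symmetric] u_def complex_cnj_mult ch_cnj complex_cnj_complex_of_real
   by (simp only: mult_ac)
 qed
 also have "... = (\<Sum>j\<in>J. \<Sum>\<nu>\<in>I. \<Sum>j'\<in>J. of_real (1 / n) * (cnj (f j) * f j') * ch (dt d \<nu> (%t. j t - j' t) / q))"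
  by (rule sum.swap)
 also have "... = (\<Sum>j\<in>J. \<Sum>j'\<in>J. \<Sum>\<nu>\<in>I. of_real (1 / n) * (cnj (f j) * f j') * ch (dt d \<nu> (%t. j t - j' t) / q))"
  by (intro sum.cong refl sum.swap)
 also have "... = (\<Sum>j\<in>J. \<Sum>j'\<in>J. of_real (1 / n) * (cnj (f j) * f j') * (if j = j' then of_nat (q ^ d) else 0))"
  unfolding sum_distrib_left[symmetric] orth0 by (intro sum.cong refl) (simp add: same_class)
 also have "... = (\<Sum>j\<in>J. of_real (1 / n) * (cnj (f j) * f j) * of_nat (q ^ d))"
 proof (rule sum.cong[OF refl])
  fix j assume "j \<in> J"
  then show "(\<Sum>j'\<in>J. of_real (1 / n) * (cnj (f j) * f j') * (if j = j' then of_nat (q ^ d) else 0)) =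
    of_real (1 / n) * (cnj (f j) * f j) * of_nat (q ^ d)"
   using J(1) by (simp add: if_distrib[of "%x. _ * x"] cong: if_cong)
 qed
 also have "... = of_real R * ip J f f" unfolding ip_def R_def sum_distrib_left by (intro sum.cong refl) simp
 also have "... = of_real (R * nsq J f)" unfolding ip_self by simp
 finally show ?thesis unfolding of_real_eq_iff .
qed

lemma parseval: "(\<Sum>l\<in>I. (cmod (k (%t. l t - i t)))^2) = R"
proof -
 have "cmod (k (%t. l t - i t)) = cmod (ip J (u l) (u i))" for l
 proof -
  have "cmod (k (%t. l t - i t)) = cmod (ip J (u i) (u l))" unfolding ip_u ..
  also have "... = cmod (cnj (ip J (u l) (u i)))" unfolding ip_cnj ..
  also have "... = cmod (ip J (u l) (u i))" by (rule complex_mod_cnj)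
  finally show ?thesis .
 qed
 then have "(\<Sum>l\<in>I. (cmod (k (%t. l t - i t)))^2) = fsum J I u (u i)" unfolding fsum_def by (simp only:)
 also have "... = R" unfolding tight nsq_u by simp
 finally show ?thesis .
qed

text \<open>The transform of |k|^2 is the autocorrelation of J: summing over I counts the pairs with
  j + s e_t congruent to j' modulo q. The pairs of J that differ exactly by s e_t are among
  them.\<close>

lemma autocorr:
 assumes t: "t < d"
 shows "Re (\<Sum>l\<in>I. of_real ((cmod (k (%t. l t - i t)))^2) * ch (real s * ((l t - i t) / q))) \<ge>
  R / n * real (card {j \<in> J. j(t := j t + int s) \<in> J})"
proof -
 define m where "m j j' = (%r. (j(t := j t + int s)) r - j' r)" for j j' :: "nat => int"
 have m: "dt d \<eta> (m j j') = dt d \<eta> j - dt d \<eta> j' + int s * \<eta> t" for \<eta> j j'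
 proof -
  have "dt d \<eta> (m j j') = (\<Sum>r<d. (\<eta> r * j r - \<eta> r * j' r) + (if r = t then int s * \<eta> r else 0))"
   unfolding dt_def m_def by (rule sum.cong) (auto simp: algebra_simps)
  then show ?thesis unfolding dt_def sum.distrib sum_subtractf using t by simp
 qed
 define P where "P j j' = (\<forall>r<d. int q dvd m j j' r)" for j j'
 have "(\<Sum>l\<in>I. of_real ((cmod (k (%t. l t - i t)))^2) * ch (real s * ((l t - i t) / q))) =
   (\<Sum>l\<in>I. \<Sum>j\<in>J. \<Sum>j'\<in>J. of_real (1 / n) * of_real (1 / n) * ch (dt d (%t. l t - i t) (m j j') / q))"
 proof (rule sum.cong[OF refl])
  fix l
  define \<eta> where "\<eta> = (%t. l t - i t)"
  have "of_int (dt d \<eta> (m j j')) / real q = (dt d \<eta> j / q + - (dt d \<eta> j' / real q)) + real s * (\<eta> t / q)" for j j'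
   unfolding m by (simp add: diff_divide_distrib add_divide_distrib)
  then have c: "ch (dt d \<eta> (m j j') / q) = ch (dt d \<eta> j / q) * ch (- (dt d \<eta> j' / q)) * ch (real s * (\<eta> t / q))" for j j'
   by (simp only: ch_add)
  have p: "(\<Sum>j\<in>J. ch (dt d \<eta> j / q)) * (\<Sum>j\<in>J. ch (- (dt d \<eta> j / q))) =
    (\<Sum>j\<in>J. \<Sum>j'\<in>J. ch (dt d \<eta> j / q) * ch (- (dt d \<eta> j' / q)))" by (rule sum_product)
  have "of_real ((cmod (k \<eta>))^2) * ch (real s * (\<eta> t / q)) =
   of_real (1 / n) * of_real (1 / n) * ((\<Sum>j\<in>J. ch (dt d \<eta> j / q)) * (\<Sum>j\<in>J. ch (- (dt d \<eta> j / q)))) * ch (real s * (\<eta> t / q))"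
   unfolding complex_norm_square k_def complex_cnj_mult complex_cnj_complex_of_real cnj_sum ch_cnj by (simp only: mult_ac)
  also have "... = (\<Sum>j\<in>J. \<Sum>j'\<in>J. of_real (1 / n) * of_real (1 / n) * ch (dt d \<eta> (m j j') / q))"
   unfolding p unfolding sum_distrib_left sum_distrib_right c by (simp only: mult_ac)
  finally have "of_real ((cmod (k \<eta>))^2) * ch (real s * (\<eta> t / q)) =
   (\<Sum>j\<in>J. \<Sum>j'\<in>J. of_real (1 / n) * of_real (1 / n) * ch (dt d \<eta> (m j j') / q))" .
  then show "of_real ((cmod (k (%t. l t - i t)))^2) * ch (real s * ((l t - i t) / q)) =
   (\<Sum>j\<in>J. \<Sum>j'\<in>J. of_real (1 / n) * of_real (1 / n) * ch (dt d (%t. l t - i t) (m j j') / q))"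
   unfolding \<eta>_def by simp
 qed
 also have "... = (\<Sum>j\<in>J. \<Sum>l\<in>I. \<Sum>j'\<in>J. of_real (1 / n) * of_real (1 / n) * ch (dt d (%t. l t - i t) (m j j') / q))"
  by (rule sum.swap)
 also have "... = (\<Sum>j\<in>J. \<Sum>j'\<in>J. \<Sum>l\<in>I. of_real (1 / n) * of_real (1 / n) * ch (dt d (%t. l t - i t) (m j j') / q))"
  by (intro sum.cong refl sum.swap)
 also have "... = (\<Sum>j\<in>J. \<Sum>j'\<in>J. of_real (1 / n) * of_real (1 / n) * (if P j j' then of_nat (q ^ d) else 0))"
  unfolding sum_distrib_left[symmetric] orth P_def ..
 also have "... = of_real (\<Sum>j\<in>J. \<Sum>j'\<in>J. R / n * (if P j j' then 1 else 0))"
  unfolding of_real_sum R_def by (intro sum.cong refl) auto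
 finally have "Re (\<Sum>l\<in>I. of_real ((cmod (k (%t. l t - i t)))^2) * ch (real s * ((l t - i t) / q))) =
   (\<Sum>j\<in>J. \<Sum>j'\<in>J. R / n * (if P j j' then 1 else 0))" by (simp only: Re_complex_of_real)
 also have "... = R / n * (\<Sum>j\<in>J. \<Sum>j'\<in>J. if P j j' then 1 else 0)"
  unfolding sum_distrib_left ..
 also have "... \<ge> R / n * real (card {j \<in> J. j(t := j t + int s) \<in> J})"
 proof (rule mult_left_mono)
  show "0 <= R / n" unfolding R_def by simp
  have "real (card {j \<in> J. j(t := j t + int s) \<in> J}) = (\<Sum>j\<in>J. if j(t := j t + int s) \<in> J then 1 else 0)"
   using J(1) by (simp add: sum.If_cases Int_def)
  also have "... <= (\<Sum>j\<in>J. \<Sum>j'\<in>J. if P j j' then 1 else 0)"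
  proof (rule sum_mono)
   fix j assume "j \<in> J"
   show "(if j(t := j t + int s) \<in> J then 1 else 0) <= (\<Sum>j'\<in>J. if P j j' then 1 else (0::real))"
   proof (cases "j(t := j t + int s) \<in> J")
    case True
    have "P j (j(t := j t + int s))" unfolding P_def m_def by simp
    then have "(1::real) = (\<Sum>j'\<in>{j(t := j t + int s)}. if P j j' then 1 else 0)" by simp
    also have "... <= (\<Sum>j'\<in>J. if P j j' then 1 else 0)"
     by (rule sum_mono2) (use True J in auto)
    finally show ?thesis using True by simp
   qed (simp add: sum_nonneg)
  qed
  finally show "real (card {j \<in> J. j(t := j t + int s) \<in> J}) <= (\<Sum>j\<in>J. \<Sum>j'\<in>J. if P j j' then 1 else 0)" .
 qed
 finally show ?thesis .
qed

end

section \<open>Localization for sets nearly invariant under short shifts\<close>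

text \<open>The number H of admissible shifts and the frequency window w are dual scales, as q <= H
  w expresses. The bound 4 d \<tau> <= 1 ensures that at most half of the kernel mass lies outside
  the window.\<close>

locale dft_reg = dft +
 fixes \<tau> :: real and H w :: nat
 assumes H: "H > 0" and w: "w > 0" and Hw: "q <= H * w"
  and reg: "\<And>t s. t < d ==> s < H ==> (1 - \<tau>) * real n <= real (card {j \<in> J. j(t := j t + int s) \<in> J})"
  and tau: "0 <= \<tau>" "4 * real d * \<tau> <= 1"
begin

definition farc :: "int => bool" where
 "farc x \<longleftrightarrow> int w <= x mod int q \<and> x mod int q <= int q - int w"

definition near :: "(nat => int) => (nat => int) => bool" where
 "near x y \<longleftrightarrow> (\<forall>t<d. \<not> farc (y t - x t))"

lemma I_mem: "x \<in> I ==> t < d ==> 0 <= x t \<and> x t < int q"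
 unfolding I_def using PiE_mem[of x "{..<d}" "%_. {0..<int q}" t] by simp

lemma I_ext: "x \<in> I ==> x \<in> extensional {..<d}"
 unfolding I_def PiE_def by (rule IntD2)

lemma I_eqI:
 assumes x: "x \<in> I" and y: "y \<in> I" and e: "\<And>t. t < d ==> x t = y t"
 shows "x = y"
proof (rule extensionalityI[OF I_ext[OF x] I_ext[OF y]])
 fix t assume "t \<in> {..<d}"
 then show "x t = y t" using e by simp
qed

lemma R_pos: "R > 0"
 unfolding R_def using q n_pos by simp

lemma R_ge_1: "R \<ge> 1"
proof -
 define i where "i = (\<lambda>t\<in>{..<d}. (0::int))"
 have i: "i \<in> I" unfolding i_def I_def using q by auto
 have "1 = (\<Sum>l\<in>{i}. (cmod (k (%t. l t - i t)))^2)" using k_0[of i] by simp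
 also have "... <= (\<Sum>l\<in>I. (cmod (k (%t. l t - i t)))^2)" by (rule sum_mono2[OF finI]) (use i in auto)
 finally show ?thesis unfolding parseval .
qed

text \<open>Averaging \<open>autocorr\<close> over the H shifts weights |k|^2 by Dirichlet sums, of
  modulus at most H everywhere and at most H/2 at far frequencies. Regularity makes the weighted sum
  at least (1 - \<tau>) H R, almost the maximum, so the far mass is at most 2 \<tau> R.\<close>

lemma far_sum:
 assumes t: "t < d"
 shows "(\<Sum>l\<in>{l \<in> I. farc (l t - i t)}. (cmod (k (%t. l t - i t)))^2) <= 2 * \<tau> * R"
proof -
 define a where "a l = (cmod (k (%t. l t - i t)))^2" for l
 define z where "z l = (l t - i t) / real q" for l
 define G where "G l = (\<Sum>s<H. ch (real s * z l))" for l
 define F where "F = {l \<in> I. farc (l t - i t)}"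
 have a0: "a l \<ge> 0" for l unfolding a_def by simp
 have sumI: "(\<Sum>l\<in>I. a l) = R" unfolding a_def by (rule parseval)
 have "real H * (R * (1 - \<tau>)) = (\<Sum>s<H. R * (1 - \<tau>))" by simp
 also have "... <= (\<Sum>s<H. Re (\<Sum>l\<in>I. of_real (a l) * ch (real s * z l)))"
 proof (rule sum_mono)
  fix s assume s: "s \<in> {..<H}"
  have "R * (1 - \<tau>) = R / n * ((1 - \<tau>) * n)" using n_pos by simp
  also have "... <= R / n * real (card {j \<in> J. j(t := j t + int s) \<in> J})"
   by (rule mult_left_mono[OF reg[OF t]]) (use s R_pos in auto)
  also have "... <= Re (\<Sum>l\<in>I. of_real (a l) * ch (real s * z l))"
   using autocorr[OF t, of s i] unfolding a_def z_def by simp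
  finally show "R * (1 - \<tau>) <= Re (\<Sum>l\<in>I. of_real (a l) * ch (real s * z l))" .
 qed
 also have "... = Re (\<Sum>l\<in>I. of_real (a l) * G l)"
  unfolding Re_sum[symmetric] G_def sum_distrib_left by (subst sum.swap) (rule refl)
 also have "... = (\<Sum>l\<in>I. a l * Re (G l))" unfolding Re_sum by simp
 also have "... <= (\<Sum>l\<in>I. a l * (real H - (if l \<in> F then real H / 2 else 0)))"
 proof (rule sum_mono, rule mult_left_mono[OF _ a0])
  fix l assume l: "l \<in> I"
  show "Re (G l) <= real H - (if l \<in> F then real H / 2 else 0)"
  proof (cases "l \<in> F")
   case True
   define r where "r = (l t - i t) mod int q"
   have r: "int w <= r" "r <= int q - int w" using True unfolding F_def farc_def r_def by auto
   have e: "l t - i t = r + int q * ((l t - i t) div int q)" unfolding r_def by simp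
   have "real_of_int (l t - i t) = real_of_int r + real q * real_of_int ((l t - i t) div int q)"
    by (subst e) (simp del: of_int_diff)
   then have "z l = r / real q + of_int ((l t - i t) div int q)"
    unfolding z_def using q by (simp add: add_divide_distrib)
   then have cz: "ch (z l) = ch (r / real q)" by simp
   have "4 / real H <= 4 * (real w / real q)"
   proof -
    have "real q <= real H * real w" using Hw by (metis of_nat_le_iff of_nat_mult)
    then show ?thesis using H q by (simp add: field_simps)
   qed
   also have "... <= cmod (ch (z l) - 1)" unfolding cz
   proof (rule ch_far)
    show "real w / real q <= r / real q" by (rule divide_right_mono) (use r(1) in linarith, simp)
    have "of_int r <= real q - real w" using r(2) by linarith
    then have "r / real q <= (real q - real w) / real q" by (rule divide_right_mono) simp
    then show "r / real q <= 1 - real w / real q" using q by (simp add: diff_divide_distrib)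
   qed simp
   finally have "cmod (G l) <= real H / 2" unfolding G_def by (rule ch_geometric[OF _ H])
   then show ?thesis using complex_Re_le_cmod[of "G l"] True by simp
  next
   case False
   have "cmod (G l) <= (\<Sum>s<H. cmod (ch (real s * z l)))" unfolding G_def by (rule norm_sum)
   then have "cmod (G l) <= real H" by simp
   then show ?thesis using complex_Re_le_cmod[of "G l"] False by simp
  qed
 qed
 also have "... = (\<Sum>l\<in>I. a l) * real H - (\<Sum>l\<in>I. if l \<in> F then a l * (real H / 2) else 0)"
  unfolding sum_distrib_right sum_subtractf[symmetric] by (rule sum.cong) (auto simp: right_diff_distrib)
 also have "(\<Sum>l\<in>I. if l \<in> F then a l * (real H / 2) else 0) = (\<Sum>l\<in>F. a l) * (real H / 2)"
  unfolding sum_distrib_right F_def sum.inter_filter[OF finI] by (rule sum.cong) simp_all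
 finally have "real H * (R * (1 - \<tau>)) <= R * real H - (\<Sum>l\<in>F. a l) * (real H / 2)" unfolding sumI .
 then have "(real H / 2) * (\<Sum>l\<in>F. a l) <= (real H / 2) * (2 * \<tau> * R)" by (simp add: algebra_simps)
 then have "(\<Sum>l\<in>F. a l) <= 2 * \<tau> * R" using H by simp
 then show ?thesis unfolding F_def a_def .
qed

lemma tail: "(\<Sum>l\<in>{l \<in> I. \<not> near i l}. (cmod (k (%t. l t - i t)))^2) <= 2 * real d * \<tau> * R"
proof -
 define a where "a l = (cmod (k (%t. l t - i t)))^2" for l
 have a0: "a l \<ge> 0" for l unfolding a_def by simp
 have "(\<Sum>l\<in>{l \<in> I. \<not> near i l}. a l) <= (\<Sum>l\<in>I. \<Sum>t<d. if farc (l t - i t) then a l else 0)"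
  unfolding sum.inter_filter[OF finI]
 proof (rule sum_mono)
  fix l
  have s0: "(\<Sum>t<d. if farc (l t - i t) then a l else 0) \<ge> 0" by (rule sum_nonneg) (simp add: a0)
  show "(if \<not> near i l then a l else 0) <= (\<Sum>t<d. if farc (l t - i t) then a l else 0)"
  proof (cases "near i l")
   case False
   then obtain t where t: "t < d" "farc (l t - i t)" unfolding near_def by blast
   have "a l = (if farc (l t - i t) then a l else 0)" using t by simp
   also have "... <= (\<Sum>t<d. if farc (l t - i t) then a l else 0)"
    by (rule member_le_sum) (use t a0 in auto)
   finally show ?thesis using False by simp
  qed (use s0 in simp)
 qed
 also have "... = (\<Sum>t<d. \<Sum>l\<in>{l \<in> I. farc (l t - i t)}. a l)"
  unfolding sum.inter_filter[OF finI] by (rule sum.swap)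
 also have "... <= (\<Sum>t<d. 2 * \<tau> * R)" by (rule sum_mono) (use far_sum in \<open>auto simp: a_def\<close>)
 also have "... = 2 * real d * \<tau> * R" by simp
 finally show ?thesis unfolding a_def .
qed

text \<open>By \<open>tail\<close> every u l has at least half of its mass R on frequencies near l.
  Summing over l in T and exchanging the sums, the upper frame bound tested on the vectors u i with
  i in Tp bounds the number of l. So L has density O(1/R) among the frequencies.\<close>

lemma frame_count:
 assumes L: "L \<subseteq> I" and C: "C \<ge> 0" and up: "\<And>f. fsum J L u f <= C * nsq J f"
  and T: "Tp \<subseteq> I" "\<And>l i. l \<in> T ==> i \<in> I ==> near l i ==> i \<in> Tp"
 shows "real (card (L \<inter> T)) <= 2 * C * real (card Tp) / R"
proof -
 have fL: "finite L" using L finI by (rule finite_subset)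
 have "real (card (L \<inter> T)) * (R / 2) = (\<Sum>l\<in>L \<inter> T. R / 2)" by simp
 also have "... <= (\<Sum>l\<in>L \<inter> T. \<Sum>i\<in>Tp. (cmod (ip J (u l) (u i)))^2)"
 proof (rule sum_mono)
  fix l assume l: "l \<in> L \<inter> T"
  have "R = (\<Sum>i\<in>{i \<in> I. \<not> near l i}. (cmod (k (%t. i t - l t)))^2) + (\<Sum>i\<in>{i \<in> I. near l i}. (cmod (k (%t. i t - l t)))^2)"
   unfolding parseval[of l, symmetric] by (subst sum.union_disjoint[symmetric]) (use finI in \<open>auto intro: sum.cong\<close>)
  also have "(\<Sum>i\<in>{i \<in> I. \<not> near l i}. (cmod (k (%t. i t - l t)))^2) <= R / 2"
  proof -
   have "4 * real d * \<tau> * R <= 1 * R" by (rule mult_right_mono[OF tau(2)]) (use R_pos in simp)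
   then show ?thesis using tail[of l] by linarith
  qed
  also have "(\<Sum>i\<in>{i \<in> I. near l i}. (cmod (k (%t. i t - l t)))^2) <= (\<Sum>i\<in>Tp. (cmod (k (%t. i t - l t)))^2)"
   by (rule sum_mono2) (use T l finite_subset[OF T(1) finI] in auto)
  finally show "R / 2 <= (\<Sum>i\<in>Tp. (cmod (ip J (u l) (u i)))^2)" unfolding ip_u by simp
 qed
 also have "... <= (\<Sum>l\<in>L. \<Sum>i\<in>Tp. (cmod (ip J (u l) (u i)))^2)"
  by (rule sum_mono2) (use fL in \<open>auto intro: sum_nonneg\<close>)
 also have "... = (\<Sum>i\<in>Tp. fsum J L u (u i))" unfolding fsum_def by (rule sum.swap)
 also have "... <= (\<Sum>i\<in>Tp. C * nsq J (u i))" by (rule sum_mono) (rule up)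
 also have "... = C * real (card Tp)" unfolding nsq_u by simp
 finally show ?thesis using R_pos by (simp add: field_simps)
qed

text \<open>The box consists of integer points not reduced modulo q, so it may wrap around the
  torus; this is the form needed for translated boxes. A near i is the residue of y + v with all |v
  t| < w, hence an image of a box of side s + 2 w.\<close>

lemma near_box_card:
 "real (card {i \<in> I. \<exists>y. (\<forall>t<d. a t <= y t \<and> y t < a t + int s) \<and> near y i}) <= (real s + 2 * real w) ^ d"
proof -
 define Y where "Y = {..<d} \<rightarrow>\<^sub>E {0..<int (s + 2 * w)}"
 define g where "g y = (\<lambda>t\<in>{..<d}. (a t - int w + y t) mod int q)" for y :: "nat => int"
 have fY: "finite Y" unfolding Y_def by (intro finite_PiE) auto
 have sub: "{i \<in> I. \<exists>y. (\<forall>t<d. a t <= y t \<and> y t < a t + int s) \<and> near y i} \<subseteq> g ` Y"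
 proof
  fix i assume "i \<in> {i \<in> I. \<exists>y. (\<forall>t<d. a t <= y t \<and> y t < a t + int s) \<and> near y i}"
  then obtain y where i: "i \<in> I" and y: "\<And>t. t < d ==> a t <= y t \<and> y t < a t + int s"
   and nr: "\<And>t. t < d ==> \<not> farc (i t - y t)" unfolding near_def by blast
  define r where "r t = (i t - y t) mod int q" for t
  define v where "v t = (if r t < int w then r t else r t - int q)" for t
  have rq: "0 <= r t" "r t < int q" for t unfolding r_def using q by auto
  have v: "- int w < v t" "v t < int w" if "t < d" for t
   using nr[OF that] rq[of t] w unfolding farc_def r_def[symmetric] v_def by auto
  have vm: "(y t + v t) mod int q = i t" if "t < d" for t
  proof -
   have it: "0 <= i t" "i t < int q" using I_mem[OF i that] by auto
   have "(y t + v t) mod int q = (y t + r t) mod int q"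
   proof (cases "r t < int w")
    case False
    have e: "y t + v t = (y t + r t) + int q * (- 1)" using False unfolding v_def by simp
    show ?thesis unfolding e by (rule mod_mult_self2)
   qed (simp add: v_def)
   also have "... = i t mod int q" unfolding r_def by (simp add: mod_add_right_eq)
   finally show ?thesis using it by simp
  qed
  define x where "x = (\<lambda>t\<in>{..<d}. y t + v t - a t + int w)"
  have "x \<in> Y" unfolding x_def Y_def using y v by (auto simp: PiE_iff) (smt (verit))+
  moreover have "g x = i"
  proof (rule extensionalityI[of _ "{..<d}"])
   show "g x \<in> extensional {..<d}" unfolding g_def by simp
   show "i \<in> extensional {..<d}" by (rule I_ext[OF i])
   show "g x t = i t" if t: "t \<in> {..<d}" for t
   proof -
    have "g x t = (a t - int w + x t) mod int q" unfolding g_def restrict_apply'[OF t] ..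
    also have "a t - int w + x t = y t + v t" unfolding x_def restrict_apply'[OF t] by linarith
    also have "(y t + v t) mod int q = i t" by (rule vm) (use t in blast)
    finally show ?thesis .
   qed
  qed
  ultimately show "i \<in> g ` Y" by blast
 qed
 have "card {i \<in> I. \<exists>y. (\<forall>t<d. a t <= y t \<and> y t < a t + int s) \<and> near y i} <= card Y"
  using card_mono[OF finite_imageI[OF fY] sub] card_image_le[OF fY, of g] by linarith
 also have "... = (s + 2 * w) ^ d" unfolding Y_def by (simp add: card_PiE del: of_nat_add of_nat_mult)
 finally have "real (card {i \<in> I. \<exists>y. (\<forall>t<d. a t <= y t \<and> y t < a t + int s) \<and> near y i}) <= real ((s + 2 * w) ^ d)"
  by (simp only: of_nat_le_iff)
 then show ?thesis by simp
qed

lemma k_periodic: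
 assumes "\<And>t. t < d ==> x t mod int q = y t mod int q"
 shows "k x = k y"
proof -
 have "ch (dt d x j / q) = ch (dt d y j / q)" for j
 proof -
  have "int q dvd dt d x j - dt d y j" unfolding dt_diff[symmetric] unfolding dt_def
   by (rule dvd_sum) (use assms in \<open>auto simp: mod_eq_dvd_iff\<close>)
  then have "ch (of_int (dt d x j - dt d y j) / q) = 1" by (rule ch_div_dvd)
  moreover have "of_int (dt d x j) / real q = of_int (dt d x j - dt d y j) / q + dt d y j / q"
   by (simp add: diff_divide_distrib)
  ultimately show ?thesis by (simp only: ch_add mult_1)
 qed
 then show ?thesis unfolding k_def by simp
qed

lemma farc_cong: "x mod int q = y mod int q ==> farc x = farc y"
 unfolding farc_def by simp

text \<open>Summing the tail bound over i in b alone would lose a factor R; the sparsity of L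
  restores it. The double sum is ordered by the displacement \<eta> = l - i: for near \<eta> there
  are no pairs at all, and for every \<eta> the number of pairs is at most D by
  \<open>frame_count\<close>. What remains is D times the far mass of |k|^2.\<close>

lemma leak:
 assumes L: "L \<subseteq> I" and C: "C \<ge> 0" and up: "\<And>f. fsum J L u f <= C * nsq J f"
  and b: "b = {i \<in> I. \<forall>t<d. a t <= i t \<and> i t < a t + int s}"
  and B: "\<And>i l. i \<in> b ==> l \<in> I - B ==> \<not> near i l"
 shows "(\<Sum>l\<in>L - B. \<Sum>i\<in>b. (cmod (ip J (u i) (u l)))^2) <= 4 * real d * \<tau> * C * (real s + 2 * real w) ^ d"
proof -
 have fL: "finite L" using L finI by (rule finite_subset)
 have fb: "finite b" unfolding b using finI by simp
 have bI: "b \<subseteq> I" unfolding b by blast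
 define \<sigma> where "\<sigma> i \<eta> = (\<lambda>t\<in>{..<d}. (i t + \<eta> t) mod int q)" for i \<eta> :: "nat => int"
 define \<rho> where "\<rho> i l = (\<lambda>t\<in>{..<d}. (l t - i t) mod int q)" for i l :: "nat => int"
 have II: "0 <= x t \<and> x t < int q" if "x \<in> I" "t < d" for x t using I_mem[OF that] .
 have \<sigma>I: "\<sigma> i \<eta> \<in> I" and \<rho>I: "\<rho> i \<eta> \<in> I" for i \<eta>
  unfolding \<sigma>_def \<rho>_def I_def restrict_PiE_iff using q by simp_all
 have \<sigma>\<rho>: "\<sigma> i (\<rho> i l) = l" if "l \<in> I" for i l
 proof (rule I_eqI[OF \<sigma>I that])
  fix t assume t: "t < d"
  have "\<sigma> i (\<rho> i l) t = (i t + (l t - i t) mod int q) mod int q" unfolding \<sigma>_def \<rho>_def using t by simp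
  also have "... = (i t + (l t - i t)) mod int q" by (rule mod_add_right_eq)
  also have "i t + (l t - i t) = l t" by linarith
  also have "l t mod int q = l t" using II[OF that t] by (intro mod_pos_pos_trivial) auto
  finally show "\<sigma> i (\<rho> i l) t = l t" .
 qed
 have \<rho>\<sigma>: "\<rho> i (\<sigma> i \<eta>) = \<eta>" if "\<eta> \<in> I" for i \<eta>
 proof (rule I_eqI[OF \<rho>I that])
  fix t assume t: "t < d"
  have "\<rho> i (\<sigma> i \<eta>) t = ((i t + \<eta> t) mod int q - i t) mod int q" unfolding \<sigma>_def \<rho>_def using t by simp
  also have "... = (i t + \<eta> t - i t) mod int q" by (rule mod_diff_left_eq)
  also have "i t + \<eta> t - i t = \<eta> t" by linarith
  also have "\<eta> t mod int q = \<eta> t" using II[OF that t] by (intro mod_pos_pos_trivial) auto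
  finally show "\<rho> i (\<sigma> i \<eta>) t = \<eta> t" .
 qed
 define D where "D = 2 * C * (real s + 2 * real w) ^ d / R"
 have D0: "D \<ge> 0" unfolding D_def using C R_pos by simp
 \<comment> \<open>For fixed \<eta> the points i + \<eta> fill a translate of b modulo q, and L has
   few points in it.\<close>
 have cnt: "real (card {i \<in> b. \<sigma> i \<eta> \<in> L - B}) <= D" for \<eta>
 proof -
  define T where "T = (%i. \<sigma> i \<eta>) ` b"
  define Tp where "Tp = {i \<in> I. \<exists>y. (\<forall>t<d. a t + \<eta> t <= y t \<and> y t < a t + \<eta> t + int s) \<and> near y i}"
  have inj: "inj_on (%i. \<sigma> i \<eta>) b"
  proof (rule inj_onI)
   fix i i' assume i: "i \<in> b" "i' \<in> b" and e: "\<sigma> i \<eta> = \<sigma> i' \<eta>"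
   show "i = i'"
   proof (rule I_eqI)
    show "i \<in> I" "i' \<in> I" using i bI by auto
    fix t assume t: "t < d"
    have "(i t + \<eta> t) mod int q = (i' t + \<eta> t) mod int q" using fun_cong[OF e, of t] t unfolding \<sigma>_def by simp
    then have "int q dvd i t - i' t" by (simp add: mod_eq_dvd_iff)
    then have "i t mod int q = i' t mod int q" by (simp add: mod_eq_dvd_iff)
    moreover have "i t mod int q = i t" "i' t mod int q = i' t"
     using II[OF subsetD[OF bI i(1)] t] II[OF subsetD[OF bI i(2)] t] by (simp_all add: mod_pos_pos_trivial)
    ultimately show "i t = i' t" by simp
   qed
  qed
  have "card {i \<in> b. \<sigma> i \<eta> \<in> L - B} = card ((%i. \<sigma> i \<eta>) ` {i \<in> b. \<sigma> i \<eta> \<in> L - B})"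
   by (rule card_image[symmetric], rule inj_on_subset[OF inj]) auto
  also have "... <= card (L \<inter> T)" by (rule card_mono) (use fL in \<open>auto simp: T_def\<close>)
  finally have "real (card {i \<in> b. \<sigma> i \<eta> \<in> L - B}) <= real (card (L \<inter> T))" by simp
  also have "... <= 2 * C * real (card Tp) / R"
  proof (rule frame_count[OF L C up])
   show "Tp \<subseteq> I" unfolding Tp_def by blast
   fix l i' assume "l \<in> T" and i': "i' \<in> I" "near l i'"
   then obtain i where i: "i \<in> b" "l = \<sigma> i \<eta>" unfolding T_def by (elim imageE)
   have n1: "near (%t. i t + \<eta> t) i'"
    unfolding near_def
   proof (intro allI impI)
    fix t assume t: "t < d"
    have "\<not> farc (i' t - l t)" using i'(2) t unfolding near_def by blast
    moreover have "(i' t - l t) mod int q = (i' t - (i t + \<eta> t)) mod int q"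
     unfolding i(2) \<sigma>_def restrict_apply'[OF lessThan_iff[THEN iffD2, OF t]] by (rule mod_diff_right_eq)
    ultimately show "\<not> farc (i' t - (i t + \<eta> t))" using farc_cong by blast
   qed
   have n2: "\<forall>t<d. a t + \<eta> t <= i t + \<eta> t \<and> i t + \<eta> t < a t + \<eta> t + int s" using i(1) unfolding b by auto
   show "i' \<in> Tp" unfolding Tp_def
    by (rule CollectI, rule conjI[OF i'(1)], rule exI[of _ "%t. i t + \<eta> t"]) (intro conjI n1 n2)
  qed
  also have "... <= D" unfolding D_def Tp_def
   by (intro divide_right_mono mult_left_mono near_box_card) (use C R_pos in auto)
  finally show ?thesis .
 qed
 \<comment> \<open>A displacement inside the window cannot carry a point of b out of B.\<close>
 have zero: "card {i \<in> b. \<sigma> i \<eta> \<in> L - B} = 0" if nr: "near (%_. 0) \<eta>" and \<eta>: "\<eta> \<in> I" for \<eta>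
 proof -
  have "\<sigma> i \<eta> \<notin> L - B" if i: "i \<in> b" for i
  proof
   assume "\<sigma> i \<eta> \<in> L - B"
   then have "\<not> near i (\<sigma> i \<eta>)" using B[OF i] L by blast
   then obtain t where t: "t < d" "farc (\<sigma> i \<eta> t - i t)" unfolding near_def by blast
   have "(\<sigma> i \<eta> t - i t) mod int q = (i t + \<eta> t - i t) mod int q"
    unfolding \<sigma>_def restrict_apply'[OF lessThan_iff[THEN iffD2, OF t(1)]] by (rule mod_diff_left_eq)
   also have "i t + \<eta> t - i t = \<eta> t - 0" by linarith
   finally have "(\<sigma> i \<eta> t - i t) mod int q = (\<eta> t - 0) mod int q" .
   then have "farc (\<eta> t - 0)" using t(2) farc_cong by blast
   then show False using nr t(1) unfolding near_def by blast
  qed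
  then have "{i \<in> b. \<sigma> i \<eta> \<in> L - B} = {}" by blast
  then show ?thesis by (simp only: card.empty)
 qed
 have "(\<Sum>l\<in>L - B. \<Sum>i\<in>b. (cmod (ip J (u i) (u l)))^2) = (\<Sum>i\<in>b. \<Sum>l\<in>L - B. (cmod (k (%t. l t - i t)))^2)"
  unfolding ip_u by (rule sum.swap)
 also have "... = (\<Sum>i\<in>b. \<Sum>\<eta>\<in>I. if \<sigma> i \<eta> \<in> L - B then (cmod (k \<eta>))^2 else 0)"
 proof (rule sum.cong[OF refl])
  fix i assume "i \<in> b"
  have "(\<Sum>l\<in>L - B. (cmod (k (%t. l t - i t)))^2) = (\<Sum>\<eta>\<in>{\<eta> \<in> I. \<sigma> i \<eta> \<in> L - B}. (cmod (k \<eta>))^2)"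
  proof (rule sum.reindex_bij_witness[of _ "\<sigma> i" "\<rho> i"])
   show e: "\<sigma> i (\<rho> i l) = l" if l: "l \<in> L - B" for l
    by (rule \<sigma>\<rho>[OF subsetD[OF L DiffD1[OF l]]])
   show "\<rho> i l \<in> {\<eta> \<in> I. \<sigma> i \<eta> \<in> L - B}" if l: "l \<in> L - B" for l
    by (rule CollectI, rule conjI[OF \<rho>I], unfold e[OF l]) (rule l)
   show "\<rho> i (\<sigma> i \<eta>) = \<eta>" if \<eta>: "\<eta> \<in> {\<eta> \<in> I. \<sigma> i \<eta> \<in> L - B}" for \<eta>
    by (rule \<rho>\<sigma>[OF CollectD[OF \<eta>, THEN conjunct1]])
   show "\<sigma> i \<eta> \<in> L - B" if \<eta>: "\<eta> \<in> {\<eta> \<in> I. \<sigma> i \<eta> \<in> L - B}" for \<eta>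
    by (rule CollectD[OF \<eta>, THEN conjunct2])
   show "(cmod (k (\<rho> i l)))^2 = (cmod (k (%t. l t - i t)))^2" if "l \<in> L - B" for l
   proof -
    have "k (\<rho> i l) = k (%t. l t - i t)" by (rule k_periodic) (simp only: \<rho>_def restrict_apply' lessThan_iff mod_mod_trivial)
    then show ?thesis by simp
   qed
  qed
  then show "(\<Sum>l\<in>L - B. (cmod (k (%t. l t - i t)))^2) = (\<Sum>\<eta>\<in>I. if \<sigma> i \<eta> \<in> L - B then (cmod (k \<eta>))^2 else 0)"
   unfolding sum.inter_filter[OF finI] .
 qed
 also have "... = (\<Sum>\<eta>\<in>I. \<Sum>i\<in>b. if \<sigma> i \<eta> \<in> L - B then (cmod (k \<eta>))^2 else 0)" by (rule sum.swap)
 also have "... = (\<Sum>\<eta>\<in>I. real (card {i \<in> b. \<sigma> i \<eta> \<in> L - B}) * (cmod (k \<eta>))^2)"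
  unfolding sum.inter_filter[OF fb, symmetric] by simp
 also have "... <= (\<Sum>\<eta>\<in>I. if \<not> near (%_. 0) \<eta> then D * (cmod (k \<eta>))^2 else 0)"
 proof (rule sum_mono)
  fix \<eta> assume \<eta>: "\<eta> \<in> I"
  show "real (card {i \<in> b. \<sigma> i \<eta> \<in> L - B}) * (cmod (k \<eta>))^2 <= (if \<not> near (%_. 0) \<eta> then D * (cmod (k \<eta>))^2 else 0)"
  proof (cases "near (%_. 0) \<eta>")
   case True
   show ?thesis unfolding zero[OF True \<eta>] using True by simp
  next
   case False
   then show ?thesis using mult_right_mono[OF cnt, of "(cmod (k \<eta>))^2" \<eta>] by simp
  qed
 qed
 also have "... = D * (\<Sum>l\<in>{l \<in> I. \<not> near (%_. 0) l}. (cmod (k (%t. l t - 0)))^2)"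
  unfolding sum.inter_filter[OF finI, symmetric] sum_distrib_left by simp
 also have "... <= D * (2 * real d * \<tau> * R)" by (rule mult_left_mono[OF tail D0])
 also have "... = 4 * real d * \<tau> * C * (real s + 2 * real w) ^ d" unfolding D_def using R_pos by simp
 finally show ?thesis .
qed

definition tile :: "nat => (nat => int) => (nat => int) set" where
 "tile r a = {i \<in> I. \<forall>t<d. a t <= i t \<and> i t < a t + int r}"

lemma tile_card:
 assumes "\<And>t. t < d ==> 0 <= a t \<and> a t + int r <= int q"
 shows "card (tile r a) = r ^ d"
proof -
 have "tile r a = PiE {..<d} (%t. {a t..<a t + int r})"
  unfolding tile_def I_def PiE_def Pi_def using assms by (auto) (smt (verit))+
 then show ?thesis by (simp add: card_PiE)
qed

text \<open>The tile lies in the middle half of the period and 4 w <= q, so also the way around the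
  torus from the shrunken tile to the complement has length at least w.\<close>

lemma middle_far:
 assumes a: "\<And>t. t < d ==> int q <= 4 * a t \<and> 4 * (a t + int r) <= 3 * int q" and w: "4 * w <= q" "2 * w <= r"
  and i: "i \<in> tile (r - 2 * w) (%t. a t + int w)" and l: "l \<in> I - tile r a"
 shows "\<not> near i l"
proof -
 obtain t where t: "t < d" "\<not> (a t <= l t \<and> l t < a t + int r)" using l unfolding tile_def by blast
 have lt: "0 <= l t" "l t < int q" using I_mem[of l t] l t by auto
 have it: "a t + int w <= i t" "i t < a t + int w + int (r - 2 * w)" using i t unfolding tile_def by auto
 have it2: "i t < a t + int r - int w" using it w by simp
 have aa: "int q <= 4 * a t" "4 * (a t + int r) <= 3 * int q" "4 * int w <= int q" "int w \<ge> 0"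
  using a[OF t(1)] w(1) by auto
 have w0: "int w > 0" using dft_reg_axioms unfolding dft_reg_def dft_reg_axioms_def by simp
 have "farc (l t - i t)"
 proof (cases "l t < a t")
  case True
  have "(l t - i t) mod int q = (l t - i t + int q) mod int q" by (rule mod_add_self2[symmetric])
  also have "... = l t - i t + int q"
  proof (rule mod_pos_pos_trivial)
   show "0 <= l t - i t + int q" using it2 lt(1) aa by (smt (verit))
   show "l t - i t + int q < int q" using True it(1) aa w0 by (smt (verit))
  qed
  finally have "(l t - i t) mod int q = l t - i t + int q" .
  then show ?thesis unfolding farc_def using True it(1) it2 lt aa by (smt (verit))
 next
  case False
  then have "l t \<ge> a t + int r" using t(2) by simp
  moreover have "(l t - i t) mod int q = l t - i t"
  proof (rule mod_pos_pos_trivial)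
   show "0 <= l t - i t" using calculation it2 aa by (smt (verit))
   show "l t - i t < int q" using it(1) lt(2) aa by (smt (verit))
  qed
  ultimately show ?thesis unfolding farc_def using it(1) it2 lt aa by (smt (verit))
 qed
 then show ?thesis unfolding near_def using t(1) by blast
qed

text \<open>With V the expected number per tile, three losses of \<epsilon>/8 V reduce the count of
  S: shrinking the tile, the leakage, and the residual 2 e card (L \<inter> B). The last one uses
  card (L \<inter> B) <= 80000 V, which dictates e = \<epsilon>/1280000. Thinning costs a further
  factor 1 - \<epsilon>/8 and the additive 1; \<gamma> is the largest value that thinning
  allows.\<close>

lemma discrete:
 assumes eps: "0 < \<epsilon>" "\<epsilon> < 1" and e: "e = \<epsilon> / 1280000" and l: "1 / 2 ^ l <= \<epsilon> / 8" and g: "\<gamma> = e / (50 * 4 ^ l)"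
  and tau': "(1 + 40000 / \<gamma>) * (80000 * real d * \<tau>) <= \<epsilon> / 8"
  and w: "4 * w <= q" "2 * w <= r"
  and r1: "(1 - \<epsilon> / 8) * real r ^ d <= (real r - 2 * real w) ^ d" and r2: "(real r + 2 * real w) ^ d <= 2 * real r ^ d"
  and A: "finite A" "disjoint (tile r ` A)"
  and mid: "\<And>a t. a \<in> A ==> t < d ==> int q <= 4 * a t \<and> 4 * (a t + int r) <= 3 * int q"
 shows "\<exists>S\<subseteq>I. (\<forall>c. \<gamma> / 4 ^ l * nsq S c <= nsq J (syn S u c)) \<and> (\<forall>c. nsq J (syn S u c) <= 20000 * nsq S c) \<and>
  (\<forall>a\<in>A. (1 - \<epsilon> / 2) * (real r ^ d / R) - 1 <= real (card (S \<inter> tile r a)))"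
proof -
 have e0: "e > 0" using eps e by simp
 have g0: "\<gamma> > 0" unfolding g using e0 by simp
 have "(4::real) ^ l \<ge> 1" by simp
 then have "50 * (4::real) ^ l \<ge> 1" by linarith
 then have ge: "\<gamma> <= e" unfolding g using e0 by (simp add: divide_le_eq)
 have gl: "\<gamma> / e * 4 ^ l <= 1 / 50" unfolding g using e0 by simp
 obtain L S S' where SS: "S' \<subseteq> S" "S \<subseteq> L" "L \<subseteq> I"
  and up: "\<forall>f. fsum J L u f <= 20000 * nsq J f"
  and lowS: "\<forall>c. \<gamma> / 4 ^ l * nsq S' c <= nsq J (syn S' u c)" and upS: "\<forall>c. nsq J (syn S' u c) <= 20000 * nsq S' c"
  and cS: "\<forall>B\<in>tile r ` A. real (card (S \<inter> B)) * (1 - 1 / 2 ^ l) - 1 <= real (card (S' \<inter> B))"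
  and cnt: "\<forall>b B. b \<subseteq> B \<longrightarrow> B \<subseteq> I \<longrightarrow> real (card b) / R - real (card (S \<inter> B)) <=
   (1 + 2 * 20000 / \<gamma>) * ((\<Sum>l\<in>L - B. \<Sum>i\<in>b. (cmod (ip J (u i) (u l)))^2) / R) + 2 * e * real (card (L \<inter> B))"
  using selection[OF finI J(1) nsq_u R_ge_1 tight finite_imageI[OF A(1)] A(2) g0 ge gl] by (elim exE conjE)
 define V where "V = real r ^ d / R"
 have V0: "V \<ge> 0" unfolding V_def using R_pos by simp
 have "(1 - \<epsilon> / 2) * V - 1 <= real (card (S' \<inter> tile r a))" if a: "a \<in> A" for a
 proof -
  define B where "B = tile r a"
  define b where "b = tile (r - 2 * w) (%t. a t + int w)"
  have bB: "b \<subseteq> B" unfolding b_def B_def tile_def using w(2) by auto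
  have BI: "B \<subseteq> I" unfolding B_def tile_def by blast
  have rw: "int (r - 2 * w) = int r - 2 * int w" using w(2) by simp
  have "card b = (r - 2 * w) ^ d" unfolding b_def
   by (rule tile_card) (use mid[OF a] rw in \<open>smt (verit) of_nat_0_le_iff\<close>)
  then have cb: "real (card b) = (real r - 2 * real w) ^ d" using w(2) by (simp add: of_nat_diff)
  have "(\<Sum>l\<in>L - B. \<Sum>i\<in>b. (cmod (ip J (u i) (u l)))^2) <= 4 * real d * \<tau> * 20000 * (real (r - 2 * w) + 2 * real w) ^ d"
  proof (rule leak[OF SS(3)])
   show "fsum J L u f <= 20000 * nsq J f" for f using up by blast
   show "b = {i \<in> I. \<forall>t<d. a t + int w <= i t \<and> i t < a t + int w + int (r - 2 * w)}" unfolding b_def tile_def ..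
   show "\<not> near i l" if "i \<in> b" "l \<in> I - B" for i l
    by (rule middle_far[OF mid[OF a] w that[unfolded b_def B_def]])
  qed simp
  also have "real (r - 2 * w) + 2 * real w = real r" using w(2) by (simp add: of_nat_diff)
  finally have lk: "(\<Sum>l\<in>L - B. \<Sum>i\<in>b. (cmod (ip J (u i) (u l)))^2) / R <= 80000 * real d * \<tau> * V"
   unfolding V_def using R_pos by (simp add: divide_right_mono mult_ac)
  have "real (card (L \<inter> B)) <= 2 * 20000 * real (card {i \<in> I. \<exists>y. (\<forall>t<d. a t <= y t \<and> y t < a t + int r) \<and> near y i}) / R"
  proof (rule frame_count[OF SS(3)])
   show "fsum J L u f <= 20000 * nsq J f" for f using up by blast
   show "i \<in> {i \<in> I. \<exists>y. (\<forall>t<d. a t <= y t \<and> y t < a t + int r) \<and> near y i}" if "l \<in> B" "i \<in> I" "near l i" for l i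
    using that unfolding B_def tile_def by blast
  qed auto
  also have "... <= 2 * 20000 * (2 * real r ^ d) / R"
   by (intro divide_right_mono mult_left_mono order_trans[OF near_box_card r2]) (use R_pos in auto)
  finally have cL: "real (card (L \<inter> B)) <= 80000 * V" unfolding V_def by simp
  have "(1 - \<epsilon> / 8) * V <= real (card b) / R" unfolding cb V_def using divide_right_mono[OF r1, of R] R_pos by simp
  moreover have "real (card b) / R - real (card (S \<inter> B)) <=
   (1 + 2 * 20000 / \<gamma>) * ((\<Sum>l\<in>L - B. \<Sum>i\<in>b. (cmod (ip J (u i) (u l)))^2) / R) + 2 * e * real (card (L \<inter> B))"
   by (rule cnt[rule_format, OF bB BI])
  moreover have "(1 + 2 * 20000 / \<gamma>) * ((\<Sum>l\<in>L - B. \<Sum>i\<in>b. (cmod (ip J (u i) (u l)))^2) / R) <= \<epsilon> / 8 * V"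
  proof -
   have "(1 + 2 * 20000 / \<gamma>) * ((\<Sum>l\<in>L - B. \<Sum>i\<in>b. (cmod (ip J (u i) (u l)))^2) / R) <=
     (1 + 2 * 20000 / \<gamma>) * (80000 * real d * \<tau> * V)"
    by (rule mult_left_mono[OF lk]) (use g0 in simp)
   also have "... = (1 + 40000 / \<gamma>) * (80000 * real d * \<tau>) * V" by simp
   also have "... <= \<epsilon> / 8 * V" by (rule mult_right_mono[OF tau' V0])
   finally show ?thesis .
  qed
  moreover have "2 * e * real (card (L \<inter> B)) <= \<epsilon> / 8 * V"
  proof -
   have "2 * e * real (card (L \<inter> B)) <= 2 * e * (80000 * V)" by (rule mult_left_mono[OF cL]) (use e0 in simp)
   then show ?thesis unfolding e by (simp add: mult_ac)
  qed
  moreover have "(1 - 3 * \<epsilon> / 8) * V = (1 - \<epsilon> / 8) * V - \<epsilon> / 8 * V - \<epsilon> / 8 * V"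
   by (simp add: left_diff_distrib)
  ultimately have cSB: "(1 - 3 * \<epsilon> / 8) * V <= real (card (S \<inter> B))" by linarith
  have "(1 - \<epsilon> / 2) * V <= (1 - \<epsilon> / 8) * ((1 - 3 * \<epsilon> / 8) * V)"
  proof -
   have "1 - \<epsilon> / 2 <= (1 - \<epsilon> / 8) * (1 - 3 * \<epsilon> / 8)" using eps by (simp add: algebra_simps)
   from mult_right_mono[OF this V0] show ?thesis by (simp only: mult.assoc)
  qed
  also have "... <= (1 - \<epsilon> / 8) * real (card (S \<inter> B))" by (rule mult_left_mono[OF cSB]) (use eps in simp)
  also have "... <= (1 - 1 / 2 ^ l) * real (card (S \<inter> B))" by (rule mult_right_mono) (use l in auto)
  finally have "(1 - \<epsilon> / 2) * V <= real (card (S \<inter> B)) * (1 - 1 / 2 ^ l)" by (simp only: mult.commute)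
  then show ?thesis using bspec[OF cS, of B] a unfolding B_def by auto
 qed
 then show ?thesis unfolding V_def using SS lowS upS
  by (intro exI[of _ S'] conjI) auto
qed

end

section \<open>Dyadic approximation\<close>

definition Ld :: "nat => (nat => real) measure" where "Ld d = Pi\<^sub>M {..<d} (%_. lborel)"

definition gr :: "nat => nat => (nat => real) => nat => int" where
 "gr d m x = (\<lambda>t\<in>{..<d}. \<lfloor>2 ^ m * x t\<rfloor>)"

text \<open>Union of the half-open dyadic cubes of side 2^(-m) whose lower corners are j / 2^m with
  j in G. The cubes partition the space, so Boolean operations on G and on the sets
  correspond.\<close>

definition gset :: "nat => nat => (nat => int) set => (nat => real) set" where
 "gset d m G = {x \<in> space (Ld d). gr d m x \<in> G}"

definition sd :: "'a set => 'a set => 'a set" where "sd A B = (A - B) \<union> (B - A)"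

lemma space_Ld: "space (Ld d) = vecs d"
 unfolding Ld_def space_PiM by simp

lemma coord_Ld: "t < d ==> (%x. x t) \<in> borel_measurable (Ld d)"
proof -
 assume "t < d"
 then have "(%x. x t) \<in> measurable (Pi\<^sub>M {..<d} (%_. lborel)) (lborel :: real measure)"
  by (intro measurable_component_singleton) simp
 then show ?thesis unfolding Ld_def by simp
qed

lemma gr_PiE: "gr d m x \<in> vecs d"
 unfolding gr_def restrict_PiE_iff by simp

lemma countable_int_PiE: "countable ({..<d::nat} \<rightarrow>\<^sub>E (UNIV :: int set))"
 by (rule countable_PiE) simp_all

lemma gr_eq_iff:
 assumes j: "j \<in> vecs d"
 shows "gr d m x = j \<longleftrightarrow> (\<forall>t\<in>{..<d}. \<lfloor>2 ^ m * x t\<rfloor> = j t)"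
proof
 assume e: "gr d m x = j"
 show "\<forall>t\<in>{..<d}. \<lfloor>2 ^ m * x t\<rfloor> = j t" unfolding e[symmetric] gr_def by simp
next
 assume a: "\<forall>t\<in>{..<d}. \<lfloor>2 ^ m * x t\<rfloor> = j t"
 have "gr d m x t = j t" if "t \<in> {..<d}" for t using a that unfolding gr_def by simp
 then show "gr d m x = j" by (rule PiE_ext[OF gr_PiE j])
qed

lemma gset_sets [measurable]: "gset d m G \<in> sets (Ld d)"
proof -
 define G' where "G' = G \<inter> (vecs d)"
 have c: "countable G'" unfolding G'_def by (rule countable_subset[OF _ countable_int_PiE]) blast
 have "gset d m G = (\<Union>j\<in>G'. {x \<in> space (Ld d). \<forall>t\<in>{..<d}. \<lfloor>2 ^ m * x t\<rfloor> = j t})"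
 proof (rule Set.set_eqI)
  fix x
  have "gr d m x \<in> G \<longleftrightarrow> (\<exists>j\<in>G'. gr d m x = j)"
  proof
   assume "gr d m x \<in> G"
   then show "\<exists>j\<in>G'. gr d m x = j"
    unfolding G'_def by (intro bexI[of _ "gr d m x"] IntI gr_PiE refl)
  next
   assume "\<exists>j\<in>G'. gr d m x = j"
   then obtain j where "j \<in> G'" "gr d m x = j" by (elim bexE)
   then show "gr d m x \<in> G" unfolding G'_def by simp
  qed
  also have "... \<longleftrightarrow> (\<exists>j\<in>G'. \<forall>t\<in>{..<d}. \<lfloor>2 ^ m * x t\<rfloor> = j t)"
   by (rule bex_cong[OF refl], rule gr_eq_iff) (simp add: G'_def)
  finally show "x \<in> gset d m G \<longleftrightarrow> x \<in> (\<Union>j\<in>G'. {x \<in> space (Ld d). \<forall>t\<in>{..<d}. \<lfloor>2 ^ m * x t\<rfloor> = j t})"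
   unfolding gset_def by (simp only: UN_iff mem_Collect_eq bex_simps)
 qed
 also have "... \<in> sets (Ld d)"
 proof (rule sets.countable_UN''[OF c])
  fix j assume "j \<in> G'"
  show "{x \<in> space (Ld d). \<forall>t\<in>{..<d}. \<lfloor>2 ^ m * x t\<rfloor> = j t} \<in> sets (Ld d)"
  proof (rule sets.sets_Collect_finite_All)
   fix t assume "t \<in> {..<d}"
   then have [measurable]: "(%x. x t) \<in> borel_measurable (Ld d)" by (simp add: coord_Ld)
   show "{x \<in> space (Ld d). \<lfloor>2 ^ m * x t\<rfloor> = j t} \<in> sets (Ld d)" by measurable
  qed simp
 qed
 finally show ?thesis .
qed

lemma gr_refine: "gr d m x = (\<lambda>t\<in>{..<d}. gr d (m + k) x t div 2 ^ k)"
proof -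
 have "\<lfloor>2 ^ m * y\<rfloor> = \<lfloor>2 ^ (m + k) * y\<rfloor> div 2 ^ k" for y :: real
 proof -
  have "\<lfloor>(2 ^ (m + k) * y) / real_of_int (2 ^ k)\<rfloor> = \<lfloor>2 ^ (m + k) * y\<rfloor> div 2 ^ k"
   by (rule floor_divide_real_eq_div) simp
  then show ?thesis by (simp add: power_add)
 qed
 then show ?thesis unfolding gr_def by (intro restrict_ext) simp
qed

definition refine :: "nat => nat => (nat => int) set => (nat => int) set" where
 "refine d k G = {j \<in> vecs d. (\<lambda>t\<in>{..<d}. j t div 2 ^ k) \<in> G}"

lemma gset_refine: "gset d m G = gset d (m + k) (refine d k G)"
proof -
 have "gr d m x \<in> G \<longleftrightarrow> gr d (m + k) x \<in> refine d k G" for x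
  unfolding refine_def gr_refine[of d m x k] using gr_PiE[of d "m + k" x] by simp
 then show ?thesis unfolding gset_def by simp
qed

lemma gset_ge: "m0 <= m ==> \<exists>G'. gset d m0 G = gset d m G'"
 using gset_refine[of d m0 G "m - m0"] by auto

text \<open>Approximants are demanded at every sufficiently fine level, so that two sets can be
  approximated at a common level and unions are covered. Refinement provides this for a single grid
  set.\<close>

definition apx :: "nat => (nat => real) measure => (nat => real) set => bool" where
 "apx d \<mu> A \<longleftrightarrow> A \<in> sets \<mu> \<and> (\<forall>e>0. \<exists>m0. \<forall>m\<ge>m0. \<exists>G. measure \<mu> (sd A (gset d m G)) < e)"

context
 fixes d :: nat and \<mu> :: "(nat => real) measure"
 assumes fin: "finite_measure \<mu>" and sets_mu: "sets \<mu> = sets (Ld d)"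
begin

lemma space_mu: "space \<mu> = space (Ld d)"
 using sets_mu by (rule sets_eq_imp_space_eq)

lemma gset_mu: "gset d m G \<in> sets \<mu>"
 unfolding sets_mu by (rule gset_sets)

lemma sd_mu: "A \<in> sets \<mu> ==> B \<in> sets \<mu> ==> sd A B \<in> sets \<mu>"
 unfolding sd_def by auto

lemma apx_gset: "apx d \<mu> (gset d m0 G)"
 unfolding apx_def
proof (intro conjI allI impI)
 show "gset d m0 G \<in> sets \<mu>" by (rule gset_mu)
 fix e :: real assume e: "e > 0"
 show "\<exists>m1. \<forall>m\<ge>m1. \<exists>G'. measure \<mu> (sd (gset d m0 G) (gset d m G')) < e"
 proof (intro exI[of _ m0] allI impI)
  fix m assume "m0 <= m"
  then obtain G' where "gset d m0 G = gset d m G'" using gset_ge by blast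
  then have "sd (gset d m0 G) (gset d m G') = {}" unfolding sd_def by simp
  then show "\<exists>G'. measure \<mu> (sd (gset d m0 G) (gset d m G')) < e" using e by (intro exI[of _ G']) simp
 qed
qed

lemma apx_compl: "apx d \<mu> A ==> apx d \<mu> (space \<mu> - A)"
 unfolding apx_def
proof (elim conjE, intro conjI allI impI)
 assume A: "A \<in> sets \<mu>" and a: "\<forall>e>0. \<exists>m0. \<forall>m\<ge>m0. \<exists>G. measure \<mu> (sd A (gset d m G)) < e"
 show "space \<mu> - A \<in> sets \<mu>" using A by simp
 fix e :: real assume "e > 0"
 then obtain m0 where m0: "\<forall>m\<ge>m0. \<exists>G. measure \<mu> (sd A (gset d m G)) < e" using a by blast
 have e: "sd (space \<mu> - A) (gset d m (- G)) = sd A (gset d m G)" for m G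
  unfolding sd_def gset_def using sets.sets_into_space[OF A] space_mu by auto
 show "\<exists>m0. \<forall>m\<ge>m0. \<exists>G. measure \<mu> (sd (space \<mu> - A) (gset d m G)) < e"
 proof (intro exI[of _ m0] allI impI)
  fix m assume "m0 <= m"
  then obtain G where "measure \<mu> (sd A (gset d m G)) < e" using m0 by blast
  then show "\<exists>G. measure \<mu> (sd (space \<mu> - A) (gset d m G)) < e" using e by (intro exI[of _ "- G"]) simp
 qed
qed

lemma apx_close:
 assumes U: "U \<in> sets \<mu>" and "\<And>e. e > 0 ==> \<exists>V. apx d \<mu> V \<and> measure \<mu> (sd U V) < e"
 shows "apx d \<mu> U"
 unfolding apx_def
proof (intro conjI allI impI)
 show "U \<in> sets \<mu>" by (rule U)
 fix e :: real assume e: "e > 0"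
 then obtain V where V: "apx d \<mu> V" "measure \<mu> (sd U V) < e / 2" using assms(2)[of "e / 2"] by auto
 have Vs: "V \<in> sets \<mu>" using V(1) unfolding apx_def by blast
 obtain m0 where m0: "\<forall>m\<ge>m0. \<exists>G. measure \<mu> (sd V (gset d m G)) < e / 2"
  using V(1) e unfolding apx_def by (meson half_gt_zero)
 show "\<exists>m0. \<forall>m\<ge>m0. \<exists>G. measure \<mu> (sd U (gset d m G)) < e"
 proof (intro exI[of _ m0] allI impI)
  fix m assume "m0 <= m"
  then obtain G where G: "measure \<mu> (sd V (gset d m G)) < e / 2" using m0 by blast
  have "measure \<mu> (sd U (gset d m G)) <= measure \<mu> (sd U V \<union> sd V (gset d m G))"
   by (rule finite_measure.finite_measure_mono[OF fin]) (use sd_mu U Vs gset_mu in \<open>auto simp: sd_def\<close>)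
  also have "... <= measure \<mu> (sd U V) + measure \<mu> (sd V (gset d m G))"
   by (rule measure_Un_le) (auto intro: sd_mu U Vs gset_mu)
  finally have "measure \<mu> (sd U (gset d m G)) < e" using V(2) G by linarith
  then show "\<exists>G. measure \<mu> (sd U (gset d m G)) < e" by blast
 qed
qed

lemma apx_Un:
 assumes A: "apx d \<mu> A" and B: "apx d \<mu> B"
 shows "apx d \<mu> (A \<union> B)"
 unfolding apx_def
proof (intro conjI allI impI)
 have AB: "A \<in> sets \<mu>" "B \<in> sets \<mu>" using A B unfolding apx_def by auto
 then show "A \<union> B \<in> sets \<mu>" by simp
 fix e :: real assume e: "e > 0"
 obtain m1 where m1: "\<forall>m\<ge>m1. \<exists>G. measure \<mu> (sd A (gset d m G)) < e / 2"
  using A e unfolding apx_def by (meson half_gt_zero)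
 obtain m2 where m2: "\<forall>m\<ge>m2. \<exists>G. measure \<mu> (sd B (gset d m G)) < e / 2"
  using B e unfolding apx_def by (meson half_gt_zero)
 show "\<exists>m0. \<forall>m\<ge>m0. \<exists>G. measure \<mu> (sd (A \<union> B) (gset d m G)) < e"
 proof (intro exI[of _ "max m1 m2"] allI impI)
  fix m assume "max m1 m2 <= m"
  then obtain G1 G2 where G: "measure \<mu> (sd A (gset d m G1)) < e / 2" "measure \<mu> (sd B (gset d m G2)) < e / 2"
   using m1 m2 by (meson max.boundedE)
  have "measure \<mu> (sd (A \<union> B) (gset d m (G1 \<union> G2))) <= measure \<mu> (sd A (gset d m G1) \<union> sd B (gset d m G2))"
   by (rule finite_measure.finite_measure_mono[OF fin]) (use sd_mu AB gset_mu in \<open>auto simp: sd_def gset_def\<close>)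
  also have "... <= measure \<mu> (sd A (gset d m G1)) + measure \<mu> (sd B (gset d m G2))"
   by (rule measure_Un_le) (auto intro: sd_mu AB gset_mu)
  finally have "measure \<mu> (sd (A \<union> B) (gset d m (G1 \<union> G2))) < e" using G by linarith
  then show "\<exists>G. measure \<mu> (sd (A \<union> B) (gset d m G)) < e" by blast
 qed
qed

lemma apx_empty: "apx d \<mu> {}"
proof -
 have "gset d 0 {} = {}" unfolding gset_def by simp
 then show ?thesis using apx_gset[of 0 "{}"] by simp
qed

lemma apx_UN:
 fixes A :: "nat => _"
 assumes A: "\<And>i. apx d \<mu> (A i)"
 shows "apx d \<mu> (\<Union>i. A i)"
proof (rule apx_close)
 have As: "A i \<in> sets \<mu>" for i using A[of i] unfolding apx_def by blast
 then show Us: "(\<Union>i. A i) \<in> sets \<mu>" by (intro sets.countable_UN) auto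
 fix e :: real assume e: "e > 0"
 define V where "V n = (\<Union>i<n. A i)" for n :: nat
 have Vs: "V n \<in> sets \<mu>" for n unfolding V_def using As by (intro sets.finite_UN) auto
 have aV: "apx d \<mu> (V n)" for n
 proof (induction n)
  case 0
  show ?case unfolding V_def using apx_empty by simp
 next
  case (Suc n)
  have "V (Suc n) = V n \<union> A n" unfolding V_def by (auto simp: less_Suc_eq)
  then show ?case using apx_Un[OF Suc A[of n]] by simp
 qed
 have UV: "(\<Union>n. V n) = (\<Union>i. A i)" unfolding V_def by auto
 have inc: "incseq V" unfolding incseq_def V_def by (intro allI impI UN_mono) auto
 have "(%n. measure \<mu> (V n)) \<longlonglongrightarrow> measure \<mu> (\<Union>n. V n)"
  by (rule finite_measure.finite_Lim_measure_incseq[OF fin _ inc]) (use Vs in blast)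
 from tendstoD[OF this e] obtain N where "\<forall>n\<ge>N. dist (measure \<mu> (V n)) (measure \<mu> (\<Union>i. A i)) < e"
  unfolding UV eventually_sequentially by (elim exE)
 then obtain n where n: "dist (measure \<mu> (V n)) (measure \<mu> (\<Union>i. A i)) < e" by (metis order_refl)
 have sub: "V n \<subseteq> (\<Union>i. A i)" unfolding V_def by auto
 have "sd (\<Union>i. A i) (V n) = (\<Union>i. A i) - V n" unfolding sd_def using sub by blast
 then have "measure \<mu> (sd (\<Union>i. A i) (V n)) = measure \<mu> (\<Union>i. A i) - measure \<mu> (V n)"
  using finite_measure.finite_measure_Diff[OF fin Us Vs[of n] sub] by simp
 then have "measure \<mu> (sd (\<Union>i. A i) (V n)) < e" using n unfolding dist_real_def by linarith
 then show "\<exists>V. apx d \<mu> V \<and> measure \<mu> (sd (\<Union>i. A i) V) < e" using aV by (intro exI[of _ "V n"]) simp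
qed

text \<open>x t < a is detected at a level where a full cell fits between x t and a. So the half
  space is a countable union of grid sets; half spaces in turn generate all measurable sets.\<close>

lemma apx_halfspace:
 assumes t: "t < d"
 shows "apx d \<mu> {x \<in> space (Ld d). x t < a}"
proof -
 have "{x \<in> space (Ld d). x t < a} = (\<Union>m. gset d m {j. j t < \<lfloor>2 ^ m * a\<rfloor>})"
 proof (rule Set.set_eqI)
  fix x
  show "x \<in> {x \<in> space (Ld d). x t < a} \<longleftrightarrow> x \<in> (\<Union>m. gset d m {j. j t < \<lfloor>2 ^ m * a\<rfloor>})"
  proof
   assume x: "x \<in> {x \<in> space (Ld d). x t < a}"
   then have p: "a - x t > 0" by simp
   obtain m :: nat where "1 / (a - x t) < 2 ^ m" using real_arch_pow[of 2 "1 / (a - x t)"] by auto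
   then have "2 ^ m * x t + 1 <= 2 ^ m * a" using p by (simp add: field_simps)
   then have "\<lfloor>2 ^ m * x t\<rfloor> < \<lfloor>2 ^ m * a\<rfloor>" by linarith
   then have "x \<in> gset d m {j. j t < \<lfloor>2 ^ m * a\<rfloor>}" using x t unfolding gset_def gr_def by simp
   then show "x \<in> (\<Union>m. gset d m {j. j t < \<lfloor>2 ^ m * a\<rfloor>})" by blast
  next
   assume "x \<in> (\<Union>m. gset d m {j. j t < \<lfloor>2 ^ m * a\<rfloor>})"
   then obtain m where x: "x \<in> space (Ld d)" "\<lfloor>2 ^ m * x t\<rfloor> < \<lfloor>2 ^ m * a\<rfloor>" using t unfolding gset_def gr_def by auto
   then have "2 ^ m * x t < 2 ^ m * a" by linarith
   then show "x \<in> {x \<in> space (Ld d). x t < a}" using x by simp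
  qed
 qed
 moreover have "apx d \<mu> (\<Union>m. gset d m {j. j t < \<lfloor>2 ^ m * a\<rfloor>})"
  by (rule apx_UN) (rule apx_gset)
 ultimately show ?thesis by simp
qed

lemma apx_cylinder:
 assumes t: "t < d" and A: "A \<in> sets (borel :: real measure)"
 shows "apx d \<mu> {x \<in> space (Ld d). x t \<in> A}"
proof -
 have "A \<in> sigma_sets UNIV (range lessThan)"
  using A unfolding borel_Iio by simp
 then show ?thesis
 proof (induction rule: sigma_sets.induct)
  case (Basic a)
  then obtain c where "a = {..<c}" by blast
  then show ?case using apx_halfspace[OF t, of c] by simp
 next
  case Empty
  show ?case using apx_empty by simp
 next
  case (Compl a)
  have "{x \<in> space (Ld d). x t \<in> UNIV - a} = space \<mu> - {x \<in> space (Ld d). x t \<in> a}" unfolding space_mu by auto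
  then show ?case using apx_compl[OF Compl.IH] by simp
 next
  case (Union a)
  have "{x \<in> space (Ld d). x t \<in> \<Union> (range a)} = (\<Union>i. {x \<in> space (Ld d). x t \<in> a i})" by auto
  then show ?case using apx_UN[OF Union.IH] by simp
 qed
qed

lemma apx_sets:
 assumes A: "A \<in> sets (Ld d)"
 shows "apx d \<mu> A"
proof -
 have "A \<in> sigma_sets (\<Pi>\<^sub>E i\<in>{..<d}. space lborel) {{f \<in> \<Pi>\<^sub>E i\<in>{..<d}. space lborel. f i \<in> A} | i A. i \<in> {..<d} \<and> A \<in> sets (lborel :: real measure)}"
  using A unfolding Ld_def sets_PiM_single .
 then show ?thesis
 proof (induction rule: sigma_sets.induct)
  case (Basic a)
  then obtain i B where "a = {f \<in> \<Pi>\<^sub>E i\<in>{..<d}. space lborel. f i \<in> B}" "i < d" "B \<in> sets (borel :: real measure)" by auto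
  then show ?case using apx_cylinder[of i B] unfolding space_Ld by simp
 next
  case Empty
  show ?case by (rule apx_empty)
 next
  case (Compl a)
  have "(\<Pi>\<^sub>E i\<in>{..<d}. space lborel) = space \<mu>" unfolding space_mu space_Ld by simp
  then show ?case using apx_compl[OF Compl.IH] by simp
 next
  case (Union a)
  show ?case by (rule apx_UN) (rule Union.IH)
 qed
qed

end

section \<open>Volumes of grid sets and approximation of sets of finite measure\<close>

lemma emeasure_cell:
 assumes j: "j \<in> vecs d"
 shows "emeasure (Ld d) (gset d m {j}) = ennreal (1 / 2 ^ (m * d))"
proof -
 interpret product_sigma_finite "%_::nat. lborel :: real measure" ..
 have fl: "\<lfloor>2 ^ m * y\<rfloor> = c \<longleftrightarrow> y \<in> {of_int c / 2 ^ m ..< (of_int c + 1) / 2 ^ m}" for y :: real and c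
  by (simp add: floor_eq_iff field_simps)
 have "gset d m {j} = PiE {..<d} (%t. {of_int (j t) / 2 ^ m ..< (of_int (j t) + 1) / 2 ^ m})"
 proof (rule Set.set_eqI)
  fix x
  have "gr d m x = j \<longleftrightarrow> (\<forall>t\<in>{..<d}. \<lfloor>2 ^ m * x t\<rfloor> = j t)" by (rule gr_eq_iff[OF j])
  then show "x \<in> gset d m {j} \<longleftrightarrow> x \<in> PiE {..<d} (%t. {of_int (j t) / 2 ^ m ..< (of_int (j t) + 1) / 2 ^ m})"
   unfolding gset_def space_Ld PiE_iff fl by auto
 qed
 also have "emeasure (Ld d) ... = (\<Prod>t<d. emeasure lborel {of_int (j t) / 2 ^ m ..< (of_int (j t) + 1) / 2 ^ m :: real})"
  unfolding Ld_def by (rule emeasure_PiM) auto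
 also have "... = (\<Prod>t<d. ennreal (1 / 2 ^ m))"
  by (intro prod.cong refl, subst emeasure_lborel_Ico) (auto simp: divide_right_mono add_divide_distrib)
 also have "... = ennreal (1 / 2 ^ (m * d))"
  by (simp add: ennreal_power power_divide power_mult)
 finally show ?thesis .
qed

lemma gset_UN: "gset d m G = (\<Union>j\<in>G. gset d m {j})"
 unfolding gset_def by auto

lemma emeasure_gset:
 assumes G: "finite G" "G \<subseteq> vecs d"
 shows "emeasure (Ld d) (gset d m G) = ennreal (real (card G) / 2 ^ (m * d))"
proof -
 have "emeasure (Ld d) (gset d m G) = (\<Sum>j\<in>G. emeasure (Ld d) (gset d m {j}))"
  unfolding gset_UN[of d m G]
 proof (rule sum_emeasure[symmetric])
  show "(%j. gset d m {j}) ` G \<subseteq> sets (Ld d)" using gset_sets by blast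
  show "disjoint_family_on (%j. gset d m {j}) G" unfolding disjoint_family_on_def gset_def by auto
 qed (rule G(1))
 also have "... = (\<Sum>j\<in>G. ennreal (1 / 2 ^ (m * d)))" by (rule sum.cong) (use G emeasure_cell in auto)
 also have "... = ennreal (real (card G) / 2 ^ (m * d))"
  by (simp add: ennreal_of_nat_eq_real_of_nat ennreal_mult[symmetric])
 finally show ?thesis .
qed

lemma measure_gset:
 assumes "finite G" "G \<subseteq> vecs d"
 shows "measure (Ld d) (gset d m G) = real (card G) / 2 ^ (m * d)"
 unfolding measure_def emeasure_gset[OF assms] by simp

definition ibox :: "nat => nat => (nat => int) set" where
 "ibox d c = {..<d} \<rightarrow>\<^sub>E {- int c..<int c}"

lemma finite_ibox: "finite (ibox d c)"
 unfolding ibox_def by (intro finite_PiE) auto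

lemma ibox_PiE: "ibox d c \<subseteq> vecs d"
 unfolding ibox_def by (rule PiE_mono) simp

lemma gr_ibox: "gr d m x \<in> ibox d (b * 2 ^ m) \<longleftrightarrow> (\<forall>t\<in>{..<d}. - real b <= x t \<and> x t < real b)"
proof -
 have "- int (b * 2 ^ m) <= \<lfloor>2 ^ m * y\<rfloor> \<and> \<lfloor>2 ^ m * y\<rfloor> < int (b * 2 ^ m) \<longleftrightarrow> - real b <= y \<and> y < real b" for y :: real
 proof -
  have "- int (b * 2 ^ m) <= \<lfloor>2 ^ m * y\<rfloor> \<longleftrightarrow> 2 ^ m * (- real b) <= 2 ^ m * y"
   unfolding le_floor_iff by (simp add: mult.commute)
  moreover have "\<lfloor>2 ^ m * y\<rfloor> < int (b * 2 ^ m) \<longleftrightarrow> 2 ^ m * y < 2 ^ m * real b"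
   unfolding floor_less_iff by (simp add: mult.commute)
  moreover have "2 ^ m * (- real b) <= 2 ^ m * y \<longleftrightarrow> - real b <= y" by (rule mult_le_cancel_left_pos) simp
  moreover have "2 ^ m * y < 2 ^ m * real b \<longleftrightarrow> y < real b" by (rule mult_less_cancel_left_pos) simp
  ultimately show ?thesis by (simp only:)
 qed
 then show ?thesis unfolding gr_def ibox_def restrict_PiE_iff by simp
qed

lemma gset_ibox: "gset d m (ibox d (b * 2 ^ m)) = gset d 0 (ibox d b)"
 unfolding gset_def gr_ibox using gr_ibox[of d 0 _ b] by simp

lemma gset_Int: "gset d m (G \<inter> H) = gset d m G \<inter> gset d m H"
 unfolding gset_def by auto

lemma gset_sd: "gset d m (sd G H) = sd (gset d m G) (gset d m H)"
 unfolding gset_def sd_def by auto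

lemma gset_fm: "finite G ==> G \<subseteq> vecs d ==> gset d m G \<in> fmeasurable (Ld d)"
 by (rule fmeasurableI[OF gset_sets]) (simp add: emeasure_gset)

lemma sd_fm: "A \<in> fmeasurable M ==> B \<in> fmeasurable M ==> sd A B \<in> fmeasurable M"
 unfolding sd_def by (intro fmeasurable.Un fmeasurable.Diff)

lemma measure_sd_tri:
 assumes "A \<in> fmeasurable M" "B \<in> fmeasurable M" "C \<in> fmeasurable M"
 shows "measure M (sd A C) <= measure M (sd A B) + measure M (sd B C)"
proof -
 have s: "sd A B \<in> fmeasurable M" "sd B C \<in> fmeasurable M" "sd A C \<in> fmeasurable M" using assms sd_fm by blast+
 have "measure M (sd A C) <= measure M (sd A B \<union> sd B C)"
  by (rule measure_mono_fmeasurable) (use s in \<open>auto simp: sd_def\<close>)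
 also have "... <= measure M (sd A B) + measure M (sd B C)"
  by (rule measure_Un_le) (use s in auto)
 finally show ?thesis .
qed

lemma measure_le_sd:
 assumes "A \<in> fmeasurable M" "B \<in> fmeasurable M"
 shows "measure M A <= measure M B + measure M (sd A B)"
proof -
 have s: "sd A B \<in> fmeasurable M" using assms sd_fm by blast
 have "measure M A <= measure M (B \<union> sd A B)"
  by (rule measure_mono_fmeasurable) (use s assms in \<open>auto simp: sd_def\<close>)
 also have "... <= measure M B + measure M (sd A B)"
  by (rule measure_Un_le) (use s assms in auto)
 finally show ?thesis .
qed

lemma sd_commute: "sd A B = sd B A"
 unfolding sd_def by blast

text \<open>\<open>apx\<close> is developed for finite measures, so it is applied to the restriction
  to a large box, chosen such that \<Omega> has little mass outside. Cutting G to the box makes it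
  finite, as the discrete frame requires.\<close>

lemma approx_finite:
 assumes W: "\<Omega> \<in> fmeasurable (Ld d)" and e: "e > 0"
 shows "\<exists>b>0. \<exists>m0. \<forall>m\<ge>m0. \<exists>G\<subseteq>ibox d (b * 2 ^ m). measure (Ld d) (sd \<Omega> (gset d m G)) < e"
proof -
 define Q where "Q b = gset d 0 (ibox d b)" for b
 have Qs: "Q b \<in> sets (Ld d)" for b unfolding Q_def by (rule gset_sets)
 have Qi: "x \<in> Q b \<longleftrightarrow> x \<in> space (Ld d) \<and> (\<forall>t\<in>{..<d}. - real b <= x t \<and> x t < real b)" for x b
  unfolding Q_def gset_def using gr_ibox[of d 0 x b] by simp
 have Ws: "\<Omega> \<in> sets (Ld d)" using W by blast
 define \<mu> where "\<mu> = density (Ld d) (indicator \<Omega>)"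
 have fmu: "finite_measure \<mu>"
  by (rule finite_measureI) (use W in \<open>auto simp: \<mu>_def emeasure_restricted fmeasurable_def\<close>)
 have inc: "incseq Q"
 proof (rule incseq_SucI, rule subsetI)
  fix b x assume x: "x \<in> Q b"
  show "x \<in> Q (Suc b)" unfolding Qi
  proof (intro conjI ballI)
   show "x \<in> space (Ld d)" using x unfolding Qi by (rule conjunct1)
   fix t assume "t \<in> {..<d}"
   then have "- real b <= x t \<and> x t < real b" using x unfolding Qi by (elim conjE) (rule bspec)
   then show "- real (Suc b) <= x t" "x t < real (Suc b)" by auto
  qed
 qed
 have UQ: "(\<Union>b. Q b) = space (Ld d)"
 proof (rule equalityI; rule subsetI)
  fix x assume x: "x \<in> space (Ld d)"
  obtain b :: nat where b: "(\<Sum>t<d. \<bar>x t\<bar>) < real b" using reals_Archimedean2 by blast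
  have "x \<in> Q b" unfolding Qi
  proof (intro conjI x ballI)
   fix t assume t: "t \<in> {..<d}"
   have "\<bar>x t\<bar> <= (\<Sum>t<d. \<bar>x t\<bar>)" by (rule member_le_sum[OF t]) auto
   then show "- real b <= x t" "x t < real b" using b by linarith+
  qed
  then show "x \<in> (\<Union>b. Q b)" by blast
 qed (use Qi in blast)
 have "(%b. measure \<mu> (Q b)) \<longlonglongrightarrow> measure \<mu> (\<Union>b. Q b)"
  by (rule finite_measure.finite_Lim_measure_incseq[OF fmu _ inc]) (use Qs in \<open>auto simp: \<mu>_def\<close>)
 then have lim: "(%b. measure (Ld d) (\<Omega> \<inter> Q b)) \<longlonglongrightarrow> measure (Ld d) \<Omega>"
  unfolding UQ \<mu>_def using sets.sets_into_space[OF Ws] by (simp add: measure_restricted[OF Ws] Qs Int_absorb2)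
 from tendstoD[OF this, of "e / 2"] e obtain B where B: "\<forall>b\<ge>B. dist (measure (Ld d) (\<Omega> \<inter> Q b)) (measure (Ld d) \<Omega>) < e / 2"
  unfolding eventually_sequentially by auto
 define b where "b = Suc B"
 have b: "dist (measure (Ld d) (\<Omega> \<inter> Q b)) (measure (Ld d) \<Omega>) < e / 2" using B unfolding b_def by simp
 have "measure (Ld d) (\<Omega> - \<Omega> \<inter> Q b) = measure (Ld d) \<Omega> - measure (Ld d) (\<Omega> \<inter> Q b)"
  by (rule measurable_measure_Diff) (use W Qs in auto)
 moreover have eqs: "\<Omega> - Q b = \<Omega> - \<Omega> \<inter> Q b" by blast
 ultimately have out: "measure (Ld d) (\<Omega> - Q b) < e / 2" using b unfolding dist_real_def eqs by linarith
 define \<nu> where "\<nu> = density (Ld d) (indicator (Q b))"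
 have Qfm: "Q b \<in> fmeasurable (Ld d)" unfolding Q_def by (rule gset_fm[OF finite_ibox ibox_PiE])
 have fnu: "finite_measure \<nu>"
  by (rule finite_measureI) (use Qfm Qs in \<open>auto simp: \<nu>_def emeasure_restricted fmeasurable_def\<close>)
 have "apx d \<nu> \<Omega>" by (rule apx_sets[OF fnu _ Ws]) (simp add: \<nu>_def)
 then obtain m0 where m0: "\<forall>m\<ge>m0. \<exists>G. measure \<nu> (sd \<Omega> (gset d m G)) < e / 2"
  using e unfolding apx_def by (meson half_gt_zero)
 show ?thesis
 proof (rule exI[of _ b], rule conjI, simp add: b_def, rule exI[of _ m0], intro allI impI)
  fix m assume "m0 <= m"
  then obtain G where G: "measure \<nu> (sd \<Omega> (gset d m G)) < e / 2" using m0 by blast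
  define G' where "G' = G \<inter> ibox d (b * 2 ^ m)"
  have g: "gset d m G' = gset d m G \<inter> Q b" unfolding G'_def gset_Int gset_ibox Q_def ..
  have sds: "sd \<Omega> (gset d m G) \<in> sets (Ld d)" unfolding sd_def using Ws gset_sets by auto
  have "measure (Ld d) (sd \<Omega> (gset d m G')) <= measure (Ld d) ((\<Omega> - Q b) \<union> (Q b \<inter> sd \<Omega> (gset d m G)))"
  proof (rule measure_mono_fmeasurable)
   show "sd \<Omega> (gset d m G') \<subseteq> (\<Omega> - Q b) \<union> (Q b \<inter> sd \<Omega> (gset d m G))" unfolding g sd_def by blast
   show "sd \<Omega> (gset d m G') \<in> sets (Ld d)" unfolding sd_def using Ws gset_sets by auto
   show "(\<Omega> - Q b) \<union> (Q b \<inter> sd \<Omega> (gset d m G)) \<in> fmeasurable (Ld d)"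
    by (intro fmeasurable.Un fmeasurable.Diff W fmeasurable_Int_fmeasurable Qfm Qs sds)
  qed
  also have "... <= measure (Ld d) (\<Omega> - Q b) + measure (Ld d) (Q b \<inter> sd \<Omega> (gset d m G))"
   by (rule measure_Un_le) (use Ws Qs sds in auto)
  also have "measure (Ld d) (Q b \<inter> sd \<Omega> (gset d m G)) = measure \<nu> (sd \<Omega> (gset d m G))"
   unfolding \<nu>_def by (rule measure_restricted[OF Qs sds, symmetric])
  finally have "measure (Ld d) (sd \<Omega> (gset d m G')) < e" using G out by linarith
  then show "\<exists>G\<subseteq>ibox d (b * 2 ^ m). measure (Ld d) (sd \<Omega> (gset d m G)) < e"
   by (intro exI[of _ G']) (simp add: G'_def)
 qed
qed

section \<open>Grid sets under short translations\<close>

text \<open>Quotient and remainder modulo 2^k identify the refinement with a product of G and a cube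
  of subcells. The s layers of subcells below the upper face in direction t make up at most the
  fraction s / 2^k.\<close>

lemma refine_card:
 assumes G: "finite G" "G \<subseteq> vecs d" and t: "t < d"
 shows "finite (refine d k G)"
  and "real (card {j \<in> refine d k G. 2 ^ k - int s <= j t mod 2 ^ k}) * 2 ^ k <= real s * (real (card G) * 2 ^ (k * d))"
proof -
 define f where "f j = ((\<lambda>r\<in>{..<d}. j r div 2 ^ k), (\<lambda>r\<in>{..<d}. j r mod 2 ^ k))" for j :: "nat => int"
 have inj: "inj_on f (vecs d)"
 proof (rule inj_onI)
  fix i j assume i: "i \<in> {..<d} \<rightarrow>\<^sub>E (UNIV :: int set)" and j: "j \<in> {..<d} \<rightarrow>\<^sub>E (UNIV :: int set)" and e: "f i = f j"
  show "i = j"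
  proof (rule PiE_ext[OF i j])
   fix r assume r: "r \<in> {..<d}"
   have "i r div 2 ^ k = j r div 2 ^ k" using fun_cong[OF arg_cong[OF e, of fst], of r] r unfolding f_def by simp
   moreover have "i r mod 2 ^ k = j r mod 2 ^ k" using fun_cong[OF arg_cong[OF e, of snd], of r] r unfolding f_def by simp
   ultimately show "i r = j r" by (metis div_mult_mod_eq)
  qed
 qed
 define Y where "Y = {..<d} \<rightarrow>\<^sub>E {0..<2 ^ k :: int}"
 have fY: "finite Y" unfolding Y_def by (intro finite_PiE) auto
 have sub: "refine d k G \<subseteq> vecs d" unfolding refine_def by blast
 have md: "0 <= z mod 2 ^ k \<and> z mod 2 ^ k < 2 ^ k" for z :: int by simp
 have dG: "(\<lambda>r\<in>{..<d}. j r div 2 ^ k) \<in> G" if "j \<in> refine d k G" for j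
  using that unfolding refine_def mem_Collect_eq by (rule conjunct2)
 have "f ` refine d k G \<subseteq> G \<times> Y"
 proof (rule image_subsetI)
  fix j assume j: "j \<in> refine d k G"
  show "f j \<in> G \<times> Y" unfolding f_def Y_def
   by (rule SigmaI[OF dG[OF j]]) (simp add: restrict_PiE_iff)
 qed
 then have "finite (f ` refine d k G)" by (rule finite_subset) (use G fY in simp)
 then show fr: "finite (refine d k G)" using finite_imageD[OF _ inj_on_subset[OF inj sub]] by blast
 define A where "A r = (if r = t then {2 ^ k - int s..<2 ^ k} else {0..<2 ^ k :: int})" for r
 define E where "E = {j \<in> refine d k G. 2 ^ k - int s <= j t mod 2 ^ k}"
 have "f ` E \<subseteq> G \<times> PiE {..<d} A"
 proof (rule image_subsetI)
  fix j assume "j \<in> E"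
  then have j: "j \<in> refine d k G" "2 ^ k - int s <= j t mod 2 ^ k" unfolding E_def by simp_all
  have "j r mod 2 ^ k \<in> A r" for r
  proof (cases "r = t")
   case True
   have "A t = {2 ^ k - int s..<2 ^ k}" unfolding A_def by simp
   then show ?thesis unfolding True using j(2) md[of "j t"] by simp
  next
   case False
   show ?thesis unfolding A_def if_not_P[OF False] atLeastLessThan_iff by (rule md)
  qed
  then show "f j \<in> G \<times> PiE {..<d} A" unfolding f_def
   by (intro SigmaI dG[OF j(1)]) (simp add: restrict_PiE_iff)
 qed
 moreover have "finite (G \<times> PiE {..<d} A)" by (intro finite_cartesian_product G finite_PiE) (auto simp: A_def)
 ultimately have "card (f ` E) <= card (G \<times> PiE {..<d} A)" by (intro card_mono)
 moreover have "card (f ` E) = card E"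
  by (rule card_image, rule inj_on_subset[OF inj]) (use sub in \<open>auto simp: E_def\<close>)
 moreover have "card (G \<times> PiE {..<d} A) = card G * (s * (2 ^ k) ^ (d - 1))"
 proof -
  have "card (PiE {..<d} A) = (\<Prod>r<d. card (A r))" by (rule card_PiE) simp
  also have "... = card (A t) * (\<Prod>r\<in>{..<d} - {t}. card (A r))" by (rule prod.remove) (use t in auto)
  also have "(\<Prod>r\<in>{..<d} - {t}. card (A r)) = (\<Prod>r\<in>{..<d} - {t}. 2 ^ k)"
   by (rule prod.cong) (auto simp: A_def nat_power_eq)
  also have "... = (2 ^ k) ^ (d - 1)" using t by simp
  also have "card (A t) = s" by (simp add: A_def)
  finally show ?thesis by (simp add: card_cartesian_product)
 qed
 ultimately have "card E <= card G * (s * (2 ^ k) ^ (d - 1))" by simp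
 then have "card E * 2 ^ k <= card G * (s * (2 ^ k) ^ (d - 1)) * 2 ^ k" by simp
 also have "... = s * (card G * ((2 ^ k) ^ (d - 1) * 2 ^ k))" by simp
 also have "(2 ^ k) ^ (d - 1) * 2 ^ k = (2::nat) ^ (k * d)"
  unfolding power_mult by (rule power_minus_mult) (use t in simp)
 finally have "real (card E * 2 ^ k) <= real (s * (card G * 2 ^ (k * d)))" by (simp only: of_nat_le_iff)
 then show "real (card {j \<in> refine d k G. 2 ^ k - int s <= j t mod 2 ^ k}) * 2 ^ k <= real s * (real (card G) * 2 ^ (k * d))"
  unfolding E_def by simp
qed

text \<open>No carry occurs, so the shifted subcell has the same parent cell.\<close>

lemma refine_shift:
 assumes j: "j \<in> refine d k G" and t: "t < d" and s: "j t mod 2 ^ k < 2 ^ k - int s"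
 shows "j(t := j t + int s) \<in> refine d k G"
proof -
 have "(j t + int s) div 2 ^ k = j t div 2 ^ k"
 proof -
  have "j t + int s = 2 ^ k * (j t div 2 ^ k) + (j t mod 2 ^ k + int s)" by simp
  then show ?thesis by (rule int_div_pos_eq) (use s in simp_all)
 qed
 then have "(\<lambda>r\<in>{..<d}. (j(t := j t + int s)) r div 2 ^ k) = (\<lambda>r\<in>{..<d}. j r div 2 ^ k)"
  by (intro restrict_ext) simp
 moreover have "j(t := j t + int s) \<in> vecs d"
  using j t unfolding refine_def by (auto simp: PiE_iff extensional_def)
 ultimately show ?thesis using j unfolding refine_def by simp
qed

text \<open>\<Omega> is compared with a single grid set G at a fixed level m0. Seen at level m, a
  shift moves only subcells close to upper faces out of their cell, and J differs from the refined G
  by few cells. The point of the statement is that \<delta> and \<rho> do not depend on m: the shift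
  has true length s / 2^m, about 1/\<rho> at most.\<close>

lemma translation_regular:
 assumes W: "\<Omega> \<in> fmeasurable (Ld d)" and D: "measure (Ld d) \<Omega> > 0" and tau: "0 < \<tau>" "\<tau> <= 1"
 shows "\<exists>\<delta>>0. \<exists>\<rho>>0. \<exists>m1. \<forall>m\<ge>m1. \<forall>J. finite J \<longrightarrow> J \<subseteq> vecs d \<longrightarrow> measure (Ld d) (sd \<Omega> (gset d m J)) < \<delta> \<longrightarrow>
  (\<forall>t<d. \<forall>s. s * \<rho> <= 2 ^ m + \<rho> \<longrightarrow> (1 - \<tau>) * real (card J) <= real (card {j \<in> J. j(t := j t + int s) \<in> J}))"
proof -
 define D' where "D' = measure (Ld d) \<Omega>"
 \<comment> \<open>The losses 2 \<delta> from replacing J and (\<tau>/4) (D' + \<delta>) from cell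
   faces have to fit into \<tau> (D' - \<delta>).\<close>
 define \<delta> where "\<delta> = D' * \<tau> / 16"
 have d0: "\<delta> > 0" unfolding \<delta>_def D'_def using D tau by simp
 obtain b m0 where "b > 0" and m0: "\<forall>m\<ge>m0. \<exists>G\<subseteq>ibox d (b * 2 ^ m). measure (Ld d) (sd \<Omega> (gset d m G)) < \<delta>"
  using approx_finite[OF W d0] by (elim exE conjE)
 obtain G where Gb: "G \<subseteq> ibox d (b * 2 ^ m0)" and Gd: "measure (Ld d) (sd \<Omega> (gset d m0 G)) < \<delta>"
  using m0[rule_format, OF order_refl] by (elim exE conjE)
 have G: "finite G" "G \<subseteq> vecs d" using finite_subset[OF Gb finite_ibox] Gb ibox_PiE by blast+
 \<comment> \<open>The fraction s / 2^k is at most 2^m0 / \<rho> + 1 / 2^k. This \<rho> makes the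
   first term at most \<tau>/8; k1 below does so for the second, which comes from the extra \<rho>
   in the range of s.\<close>
 obtain \<rho> :: nat where r: "8 * 2 ^ m0 / \<tau> < real \<rho>" using reals_Archimedean2 by blast
 have r0: "\<rho> > 0"
 proof (rule ccontr)
  assume "\<not> \<rho> > 0"
  then have "8 * 2 ^ m0 / \<tau> < 0" using r by simp
  then show False using tau by (simp add: divide_less_0_iff)
 qed
 obtain k1 :: nat where k1: "8 / \<tau> < 2 ^ k1" using real_arch_pow[of 2 "8 / \<tau>"] by auto
 show ?thesis
 proof (rule exI[of _ \<delta>], rule conjI[OF d0], rule exI[of _ \<rho>], rule conjI[OF r0], rule exI[of _ "m0 + k1"], intro allI impI)
  fix m J t s assume m: "m0 + k1 <= m" and J: "finite J" "J \<subseteq> vecs d"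
   and Jd: "measure (Ld d) (sd \<Omega> (gset d m J)) < \<delta>" and t: "t < d" and s: "s * \<rho> <= 2 ^ m + \<rho>"
  define k where "k = m - m0"
  have mk: "m = m0 + k" and kk: "k1 <= k" unfolding k_def using m by auto
  define J0 where "J0 = refine d k G"
  have fJ0: "finite J0" unfolding J0_def by (rule refine_card(1)[OF G t])
  have sJ0: "J0 \<subseteq> vecs d" unfolding J0_def refine_def by blast
  have gJ0: "gset d m0 G = gset d m J0" unfolding J0_def mk by (rule gset_refine)
  define K :: real where "K = 2 ^ (m * d)"
  have K: "K > 0" unfolding K_def by simp
  have fm: "gset d m J \<in> fmeasurable (Ld d)" "gset d m J0 \<in> fmeasurable (Ld d)"
   by (rule gset_fm[OF J], rule gset_fm[OF fJ0 sJ0])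
  have cJ: "measure (Ld d) (gset d m J) = real (card J) / K" unfolding K_def by (rule measure_gset[OF J])
  have cJ0: "measure (Ld d) (gset d m J0) = real (card J0) / K" unfolding K_def by (rule measure_gset[OF fJ0 sJ0])
  have csd: "real (card (sd J J0)) / K < 2 * \<delta>"
  proof -
   have "real (card (sd J J0)) / K = measure (Ld d) (sd (gset d m J) (gset d m J0))"
    unfolding K_def gset_sd[symmetric] by (rule measure_gset[symmetric]) (use J fJ0 sJ0 in \<open>auto simp: sd_def\<close>)
   also have "... <= measure (Ld d) (sd (gset d m J) \<Omega>) + measure (Ld d) (sd \<Omega> (gset d m J0))"
    by (rule measure_sd_tri[OF fm(1) W fm(2)])
   also have "... < 2 * \<delta>" using Jd Gd unfolding gJ0 sd_commute[of _ \<Omega>] by linarith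
   finally show ?thesis .
  qed
  have lowJ: "D' - \<delta> <= real (card J) / K"
   using measure_le_sd[OF W fm(1)] Jd unfolding cJ D'_def by linarith
  have upJ0: "real (card J0) / K <= D' + \<delta>"
   using measure_le_sd[OF fm(2) W] Gd unfolding gJ0 sd_commute[of _ \<Omega>] cJ0 D'_def by linarith
  define sh where "sh j = j(t := j t + int s)" for j :: "nat => int"
  define Bd where "Bd = {j \<in> J0. sh j \<notin> J0}"
  have cBd: "real (card Bd) / K <= \<tau> / 4 * (D' + \<delta>)"
  proof -
   have "Bd \<subseteq> {j \<in> J0. 2 ^ k - int s <= j t mod 2 ^ k}"
   proof
    fix j assume j: "j \<in> Bd"
    then have "\<not> j t mod 2 ^ k < 2 ^ k - int s"
     using refine_shift[of j d k G t s] t unfolding Bd_def sh_def J0_def by blast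
    then show "j \<in> {j \<in> J0. 2 ^ k - int s <= j t mod 2 ^ k}" using j unfolding Bd_def by simp
   qed
   then have "card Bd <= card {j \<in> J0. 2 ^ k - int s <= j t mod 2 ^ k}" by (rule card_mono[rotated]) (use fJ0 in simp)
   then have "real (card Bd) * 2 ^ k <= real (card {j \<in> J0. 2 ^ k - int s <= j t mod 2 ^ k}) * 2 ^ k" by simp
   also have "... <= real s * (real (card G) * 2 ^ (k * d))" unfolding J0_def by (rule refine_card(2)[OF G t])
   also have "real (card G) * 2 ^ (k * d) = real (card J0)"
   proof -
    have "real (card G) / 2 ^ (m0 * d) = real (card J0) / K"
     unfolding cJ0[symmetric] gJ0[symmetric] by (rule measure_gset[OF G, symmetric])
    then show ?thesis unfolding K_def mk by (simp add: field_simps power_add)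
   qed
   finally have 1: "real (card Bd) <= real s / 2 ^ k * real (card J0)" by (simp add: field_simps)
   have "real s / 2 ^ k <= \<tau> / 4"
   proof -
    have "real (s * \<rho>) <= real (2 ^ m + \<rho>)" using s by (simp only: of_nat_le_iff)
    then have "real s * real \<rho> <= 2 ^ m0 * 2 ^ k + real \<rho>" unfolding mk by (simp add: power_add)
    then have "real s <= 2 ^ m0 * 2 ^ k / real \<rho> + 1" using r0 by (simp add: field_simps)
    then have "real s / 2 ^ k <= (2 ^ m0 * 2 ^ k / real \<rho> + 1) / 2 ^ k" by (rule divide_right_mono) simp
    also have "... = 2 ^ m0 / real \<rho> + 1 / 2 ^ k" by (simp add: add_divide_distrib)
    also have "2 ^ m0 / real \<rho> <= \<tau> / 8" using r r0 tau by (simp add: field_simps)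
    also have "1 / 2 ^ k <= \<tau> / 8"
    proof -
     have "(2::real) ^ k1 <= 2 ^ k" by (rule power_increasing[OF kk]) simp
     then have "8 / \<tau> <= 2 ^ k" using k1 by linarith
     then show ?thesis using tau by (simp add: field_simps)
    qed
    finally show ?thesis by simp
   qed
   then have "real (card Bd) <= \<tau> / 4 * real (card J0)" using 1 by (meson mult_right_mono of_nat_0_le_iff order_trans)
   then have "real (card Bd) / K <= \<tau> / 4 * real (card J0) / K" using K by (intro divide_right_mono) auto
   also have "... = \<tau> / 4 * (real (card J0) / K)" by simp
   also have "... <= \<tau> / 4 * (D' + \<delta>)" by (rule mult_left_mono[OF upJ0]) (use tau in simp)
   finally show ?thesis .
  qed
  define good where "good = {j \<in> J. sh j \<in> J}"
  have inj: "inj sh"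
  proof (rule injI)
   fix x y assume "sh x = sh y"
   then have "\<And>r. (x(t := x t + int s)) r = (y(t := y t + int s)) r" unfolding sh_def by simp
   then have "x r = y r" for r by (cases "r = t") (metis add_right_cancel fun_upd_same, metis fun_upd_other)
   then show "x = y" by (rule ext)
  qed
  \<comment> \<open>A point is bad if it is outside the model set J0, or the shift takes it out of
    J0, or it lands in J0 but outside J.\<close>
  have "J - good \<subseteq> (J - J0) \<union> Bd \<union> sh -` (J0 - J)" unfolding good_def Bd_def by blast
  moreover have fin: "finite (sh -` (J0 - J))" by (rule finite_vimageI[OF _ inj]) (use fJ0 in simp)
  moreover have fB: "finite Bd" unfolding Bd_def using fJ0 by simp
  ultimately have "card (J - good) <= card ((J - J0) \<union> Bd \<union> sh -` (J0 - J))" using J by (intro card_mono) auto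
  also have "... <= card (J - J0) + card Bd + card (sh -` (J0 - J))"
   using card_Un_le[of "(J - J0) \<union> Bd" "sh -` (J0 - J)"] card_Un_le[of "J - J0" Bd] by linarith
  also have "card (sh -` (J0 - J)) <= card (J0 - J)"
   by (rule card_inj_on_le[OF inj_on_subset[OF inj subset_UNIV]]) (use fJ0 in auto)
  finally have "card (J - good) <= (card (J - J0) + card (J0 - J)) + card Bd" by simp
  also have "card (J - J0) + card (J0 - J) = card (sd J J0)"
   unfolding sd_def by (rule card_Un_disjoint[symmetric]) (use J fJ0 in auto)
  finally have "real (card (J - good)) <= real (card (sd J J0)) + real (card Bd)" by linarith
  then have "real (card (J - good)) / K <= (real (card (sd J J0)) + real (card Bd)) / K" using K by (intro divide_right_mono) auto
  then have "real (card (J - good)) / K <= 2 * \<delta> + \<tau> / 4 * (D' + \<delta>)" using csd cBd unfolding add_divide_distrib by linarith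
  also have "... <= \<tau> * (D' - \<delta>)"
  proof -
   have dd: "\<delta> * 16 = D' * \<tau>" unfolding \<delta>_def by simp
   have "\<tau> * \<delta> <= 1 * \<delta>" by (rule mult_right_mono) (use tau d0 in auto)
   moreover have "2 * \<delta> + \<tau> / 4 * (D' + \<delta>) = 2 * \<delta> + (D' * \<tau>) / 4 + (\<tau> * \<delta>) / 4" by (simp add: field_simps)
   moreover have "\<tau> * (D' - \<delta>) = D' * \<tau> - \<tau> * \<delta>" by (simp add: algebra_simps)
   moreover have "A <= 1 * x ==> L = 2 * x + B / 4 + A / 4 ==> R = B - A ==> x * 16 = B ==> 0 < x ==> L <= R"
    for A B L R x :: real by linarith
   ultimately show ?thesis using dd d0 by blast
  qed
  also have "... <= \<tau> * (real (card J) / K)" by (rule mult_left_mono[OF lowJ]) (use tau in simp)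
  finally have "real (card (J - good)) <= \<tau> * real (card J)" using K by (simp add: field_simps)
  moreover have "card (J - good) = card J - card good"
   by (rule card_Diff_subset) (use J in \<open>auto simp: good_def\<close>)
  moreover have "card good <= card J" by (rule card_mono) (use J in \<open>auto simp: good_def\<close>)
  ultimately show "(1 - \<tau>) * real (card J) <= real (card {j \<in> J. j(t := j t + int s) \<in> J})"
   unfolding good_def sh_def by (simp add: algebra_simps of_nat_diff)
 qed
qed

section \<open>Passage to the limit\<close>

text \<open>The Fourier transform of the indicator of \<Omega>, up to the sign of the frequency. At
  differences of frequencies it gives the Gram matrix of the exponentials.\<close>

definition kO :: "nat => (nat => real) set => (nat => real) => complex" where
 "kO d \<Omega> \<xi> = (\<integral>x. indicator \<Omega> x *\<^sub>R ch (\<Sum>t<d. \<xi> t * x t) \<partial>Ld d)"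

lemma continuous_ch: "continuous_on UNIV ch"
 unfolding ch_def[abs_def] cis_conv_exp by (intro continuous_intros)

lemma ch_measurable [measurable]: "ch \<in> borel_measurable borel"
 by (rule borel_measurable_continuous_onI[OF continuous_ch])

lemma ch_tendsto: "(f \<longlongrightarrow> l) F ==> ((%x. ch (f x)) \<longlongrightarrow> ch l) F"
 using continuous_on_tendsto_compose[OF continuous_ch, of f l F] by simp

lemma gr_coord_measurable:
 assumes "t < d"
 shows "(%x. real_of_int (gr d m x t)) \<in> borel_measurable (Ld d)"
proof -
 have "(%y::real. real_of_int \<lfloor>2 ^ m * y\<rfloor>) \<in> borel_measurable borel" by measurable
 from measurable_compose[OF coord_Ld[OF assms] this]
 have "(%x. real_of_int \<lfloor>2 ^ m * x t\<rfloor>) \<in> borel_measurable (Ld d)" .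
 then show ?thesis using assms unfolding gr_def by simp
qed

lemma phase_measurable:
 "(%x. ch (\<Sum>t<d. \<xi> t * (real_of_int (gr d m x t) / 2 ^ m))) \<in> borel_measurable (Ld d)"
proof -
 have "(%x. \<Sum>t<d. \<xi> t * (real_of_int (gr d m x t) / 2 ^ m)) \<in> borel_measurable (Ld d)"
  by (intro borel_measurable_sum borel_measurable_times borel_measurable_divide gr_coord_measurable) auto
 then show ?thesis by (rule measurable_compose[OF _ ch_measurable])
qed

lemma phase_measurable':
 "(%x. ch (\<Sum>t<d. \<xi> t * x t)) \<in> borel_measurable (Ld d)"
proof -
 have "(%x. \<Sum>t<d. \<xi> t * x t) \<in> borel_measurable (Ld d)"
  by (intro borel_measurable_sum borel_measurable_times coord_Ld) auto
 then show ?thesis by (rule measurable_compose[OF _ ch_measurable])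
qed

lemma integrable_ind:
 assumes "A \<in> fmeasurable M" "g \<in> borel_measurable M" "\<And>x. norm (g x :: complex) <= 1"
 shows "integrable M (%x. indicator A x *\<^sub>R g x)"
proof (rule Bochner_Integration.integrable_bound)
 show "integrable M (indicator A :: _ => real)" using assms(1) by (intro integrable_real_indicator) (auto simp: fmeasurable_def)
 show "(%x. indicator A x *\<^sub>R g x) \<in> borel_measurable M" using assms by (intro borel_measurable_scaleR borel_measurable_indicator) auto
 show "AE x in M. norm (indicator A x *\<^sub>R g x) <= norm (indicator A x :: real)"
  using assms(3) by (intro AE_I2) (auto simp: indicator_def)
qed

text \<open>With x rounded down to the grid the integrand is constant on each cell, so the discrete
  sum is an honest integral and can be compared with \<open>kO\<close>.\<close>

lemma grid_kernel:
 assumes J: "finite J" "J \<subseteq> vecs d"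
 shows "(\<integral>x. indicator (gset d m J) x *\<^sub>R ch (\<Sum>t<d. \<xi> t * (real_of_int (gr d m x t) / 2 ^ m)) \<partial>Ld d) =
  of_real (1 / 2 ^ (m * d)) * (\<Sum>j\<in>J. ch (\<Sum>t<d. \<xi> t * (real_of_int (j t) / 2 ^ m)))"
proof -
 define c where "c j = ch (\<Sum>t<d. \<xi> t * (real_of_int (j t) / 2 ^ m))" for j
 have "has_bochner_integral (Ld d) (%x. \<Sum>j\<in>J. indicator (gset d m {j}) x *\<^sub>R c j)
   (\<Sum>j\<in>J. measure (Ld d) (gset d m {j}) *\<^sub>R c j)"
  by (intro has_bochner_integral_sum has_bochner_integral_indicator gset_sets)
   (use J emeasure_cell in auto)
 then have "(\<integral>x. (\<Sum>j\<in>J. indicator (gset d m {j}) x *\<^sub>R c j) \<partial>Ld d) = (\<Sum>j\<in>J. measure (Ld d) (gset d m {j}) *\<^sub>R c j)"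
  by (rule has_bochner_integral_integral_eq)
 also have "... = (\<Sum>j\<in>J. of_real (1 / 2 ^ (m * d)) * c j)"
 proof (rule sum.cong[OF refl])
  fix j assume "j \<in> J"
  then have "measure (Ld d) (gset d m {j}) = 1 / 2 ^ (m * d)" using measure_gset[of "{j}" d m] J by auto
  then show "measure (Ld d) (gset d m {j}) *\<^sub>R c j = of_real (1 / 2 ^ (m * d)) * c j" by (simp add: scaleR_conv_of_real)
 qed
 also have "... = of_real (1 / 2 ^ (m * d)) * (\<Sum>j\<in>J. c j)" by (rule sum_distrib_left[symmetric])
 also have "(\<integral>x. (\<Sum>j\<in>J. indicator (gset d m {j}) x *\<^sub>R c j) \<partial>Ld d) =
   (\<integral>x. indicator (gset d m J) x *\<^sub>R c (gr d m x) \<partial>Ld d)"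
 proof (rule Bochner_Integration.integral_cong[OF refl])
  fix x assume x: "x \<in> space (Ld d)"
  have "(\<Sum>j\<in>J. indicator (gset d m {j}) x *\<^sub>R c j) = (\<Sum>j\<in>J. if gr d m x = j then c j else 0)"
   by (rule sum.cong) (use x in \<open>auto simp: gset_def indicator_def\<close>)
  also have "... = indicator (gset d m J) x *\<^sub>R c (gr d m x)"
   using J(1) x by (simp add: gset_def indicator_def)
  finally show "(\<Sum>j\<in>J. indicator (gset d m {j}) x *\<^sub>R c j) = indicator (gset d m J) x *\<^sub>R c (gr d m x)" .
 qed
 finally show ?thesis unfolding c_def .
qed

lemma floor_tendsto:
 assumes m: "filterlim m at_top sequentially"
 shows "(%P. real_of_int \<lfloor>2 ^ m P * y\<rfloor> / 2 ^ m P) \<longlonglongrightarrow> y"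
proof -
 have z: "(%P. (1 / 2) ^ m P :: real) \<longlonglongrightarrow> 0"
  using filterlim_compose[OF LIMSEQ_power_zero[of "1/2::real"] m] by simp
 have "(%P. real_of_int \<lfloor>2 ^ m P * y\<rfloor> / 2 ^ m P - y) \<longlonglongrightarrow> 0"
 proof (rule Lim_null_comparison[OF _ z], rule always_eventually, rule allI)
  fix P
  define K :: real where "K = 2 ^ m P"
  have K: "K > 0" unfolding K_def by simp
  have 1: "real_of_int \<lfloor>K * y\<rfloor> <= K * y" "K * y < real_of_int \<lfloor>K * y\<rfloor> + 1" by linarith+
  have "norm (real_of_int \<lfloor>K * y\<rfloor> / K - y) = \<bar>real_of_int \<lfloor>K * y\<rfloor> - K * y\<bar> / K"
   using K by (simp add: diff_divide_distrib abs_divide[symmetric] del: abs_divide) (simp add: field_simps)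
  also have "... <= 1 / K" by (rule divide_right_mono) (use 1 K in linarith)+
  finally show "norm (real_of_int \<lfloor>2 ^ m P * y\<rfloor> / 2 ^ m P - y) <= (1 / 2) ^ m P"
   unfolding K_def by (simp add: power_divide)
 qed
 then show ?thesis by (rule LIM_zero_cancel)
qed

text \<open>Rounding of x and convergence of the frequencies are absorbed by dominated convergence
  over \<Omega>; exchanging \<Omega> for the grid set costs at most the measure of the symmetric
  difference.\<close>

lemma kernel_conv:
 assumes W: "\<Omega> \<in> fmeasurable (Ld d)" and m: "filterlim m at_top sequentially"
  and J: "\<And>P. finite (J P)" "\<And>P. J P \<subseteq> vecs d"
  and sdl: "(%P. measure (Ld d) (sd \<Omega> (gset d (m P) (J P)))) \<longlonglongrightarrow> 0"
  and xi: "\<And>t. t < d ==> (%P. \<xi> P t) \<longlonglongrightarrow> \<eta> t"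
 shows "(%P. of_real (1 / 2 ^ (m P * d)) * (\<Sum>j\<in>J P. ch (\<Sum>t<d. \<xi> P t * (real_of_int (j t) / 2 ^ m P)))) \<longlonglongrightarrow> kO d \<Omega> \<eta>"
proof -
 define p where "p P x = ch (\<Sum>t<d. \<xi> P t * (real_of_int (gr d (m P) x t) / 2 ^ m P))" for P x
 have pm: "p P \<in> borel_measurable (Ld d)" for P unfolding p_def[abs_def] by (rule phase_measurable)
 have pn: "norm (p P x) <= 1" for P x unfolding p_def by simp
 define g where "g P = gset d (m P) (J P)" for P
 have gfm: "g P \<in> fmeasurable (Ld d)" for P unfolding g_def by (rule gset_fm[OF J])
 have Ws: "\<Omega> \<in> sets (Ld d)" using W by (simp add: fmeasurable_def)
 have 1: "(%P. \<integral>x. indicator \<Omega> x *\<^sub>R p P x \<partial>Ld d) \<longlonglongrightarrow> kO d \<Omega> \<eta>"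
  unfolding kO_def
 proof (rule integral_dominated_convergence[where w = "indicator \<Omega>"])
  show "(%x. indicator \<Omega> x *\<^sub>R ch (\<Sum>t<d. \<eta> t * x t)) \<in> borel_measurable (Ld d)"
   by (intro borel_measurable_scaleR borel_measurable_indicator Ws phase_measurable')
  show "(%x. indicator \<Omega> x *\<^sub>R p P x) \<in> borel_measurable (Ld d)" for P
   by (intro borel_measurable_scaleR borel_measurable_indicator Ws pm)
  show "integrable (Ld d) (indicator \<Omega> :: _ => real)" using W by (intro integrable_real_indicator) (auto simp: fmeasurable_def)
  show "AE x in Ld d. norm (indicator \<Omega> x *\<^sub>R p P x) <= indicator \<Omega> x" for P
   using pn by (intro AE_I2) (auto simp: indicator_def)
  show "AE x in Ld d. (%P. indicator \<Omega> x *\<^sub>R p P x) \<longlonglongrightarrow> indicator \<Omega> x *\<^sub>R ch (\<Sum>t<d. \<eta> t * x t)"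
  proof (intro AE_I2 tendsto_scaleR tendsto_const)
   fix x
   show "(%P. p P x) \<longlonglongrightarrow> ch (\<Sum>t<d. \<eta> t * x t)" unfolding p_def
   proof (intro ch_tendsto tendsto_sum tendsto_mult xi)
    fix t assume t: "t \<in> {..<d}"
    then show "t < d" by simp
    show "(%P. real_of_int (gr d (m P) x t) / 2 ^ m P) \<longlonglongrightarrow> x t"
     using floor_tendsto[OF m, of "x t"] t unfolding gr_def by simp
   qed
  qed
 qed
 have 2: "(%P. (\<integral>x. indicator (g P) x *\<^sub>R p P x \<partial>Ld d) - (\<integral>x. indicator \<Omega> x *\<^sub>R p P x \<partial>Ld d)) \<longlonglongrightarrow> 0"
 proof (rule Lim_null_comparison[OF _ sdl], rule always_eventually, rule allI)
  fix P
  have i: "integrable (Ld d) (%x. indicator (g P) x *\<^sub>R p P x)" "integrable (Ld d) (%x. indicator \<Omega> x *\<^sub>R p P x)"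
   by (rule integrable_ind[OF gfm pm pn], rule integrable_ind[OF W pm pn])
  have s: "sd \<Omega> (g P) \<in> fmeasurable (Ld d)" by (rule sd_fm[OF W gfm])
  have "norm ((\<integral>x. indicator (g P) x *\<^sub>R p P x \<partial>Ld d) - (\<integral>x. indicator \<Omega> x *\<^sub>R p P x \<partial>Ld d)) =
    norm (\<integral>x. indicator (g P) x *\<^sub>R p P x - indicator \<Omega> x *\<^sub>R p P x \<partial>Ld d)"
   by (subst Bochner_Integration.integral_diff[OF i]) (rule refl)
  also have "... <= (\<integral>x. norm (indicator (g P) x *\<^sub>R p P x - indicator \<Omega> x *\<^sub>R p P x) \<partial>Ld d)"
   by (rule integral_norm_bound)
  also have "... <= (\<integral>x. indicator (sd \<Omega> (g P)) x \<partial>Ld d)"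
  proof (rule integral_mono)
   show "integrable (Ld d) (%x. norm (indicator (g P) x *\<^sub>R p P x - indicator \<Omega> x *\<^sub>R p P x))"
    by (intro integrable_norm Bochner_Integration.integrable_diff i)
   show "integrable (Ld d) (indicator (sd \<Omega> (g P)) :: _ => real)" using s by (intro integrable_real_indicator) (auto simp: fmeasurable_def)
   show "norm (indicator (g P) x *\<^sub>R p P x - indicator \<Omega> x *\<^sub>R p P x) <= indicator (sd \<Omega> (g P)) x" for x
    using pn[of P x] by (auto simp: indicator_def sd_def)
  qed
  also have "... = measure (Ld d) (sd \<Omega> (g P))" using s by (simp add: fmeasurable_def)
  finally show "norm ((\<integral>x. indicator (g P) x *\<^sub>R p P x \<partial>Ld d) - (\<integral>x. indicator \<Omega> x *\<^sub>R p P x \<partial>Ld d)) <=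
    measure (Ld d) (sd \<Omega> (gset d (m P) (J P)))" unfolding g_def .
 qed
 have "(%P. \<integral>x. indicator (g P) x *\<^sub>R p P x \<partial>Ld d) \<longlonglongrightarrow> 0 + kO d \<Omega> \<eta>"
  using tendsto_add[OF 2 1] by simp
 then show ?thesis unfolding g_def p_def grid_kernel[OF J] by simp
qed

section \<open>Discrete frequencies in physical units\<close>

definition Kn :: "nat => nat => (nat => int) set => (nat => real) => complex" where
 "Kn d m J \<xi> = of_real (1 / card J) * (\<Sum>j\<in>J. ch (\<Sum>t<d. \<xi> t * (real_of_int (j t) / 2 ^ m)))"

text \<open>The squared norm of the combination with coefficients c, for any family of vectors whose
  inner products are K at the differences of the points X.\<close>

definition QF :: "((nat => real) => complex) => ('i => nat => real) => 'i set => ('i => complex) => real" where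
 "QF K X F c = Re (\<Sum>a\<in>F. \<Sum>b\<in>F. cnj (c a) * c b * K (%t. X b t - X a t))"

text \<open>
  The tiles \<open>\<kappa>\<close> that stay within the frequency box when the grid has mesh \<open>2 ^ - m\<close>; they exhaust
  all tiles as \<open>m\<close> grows.
\<close>

definition valid :: "nat => nat => nat => (nat => int) set" where
 "valid d r m = {\<kappa> \<in> vecs d. \<forall>t<d. 4 * int r * (\<bar>\<kappa> t\<bar> + 1) <= 2 ^ m}"

lemma finite_valid: "r > 0 ==> finite (valid d r m)"
proof (rule finite_subset[OF _ finite_ibox[of d "2 ^ m"]], rule subsetI)
 fix \<kappa> assume r: "r > 0" and k: "\<kappa> \<in> valid d r m"
 have "\<kappa> t \<in> {- int (2 ^ m)..<int (2 ^ m)}" if "t \<in> {..<d}" for t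
 proof -
  have 1: "4 * int r * (\<bar>\<kappa> t\<bar> + 1) <= 2 ^ m" using k that unfolding valid_def by simp
  have "1 * (\<bar>\<kappa> t\<bar> + 1) <= 4 * int r * (\<bar>\<kappa> t\<bar> + 1)" by (rule mult_right_mono) (use r in auto)
  from order.trans[OF this 1] have 2: "1 * (\<bar>\<kappa> t\<bar> + 1) <= int (2 ^ m)" by simp
  have "1 * (\<bar>x\<bar> + 1) <= z ==> - z <= x \<and> x < z" for x z :: int by arith
  from this[OF 2] show ?thesis unfolding atLeastLessThan_iff .
 qed
 moreover have "\<kappa> \<in> extensional {..<d}" using k unfolding valid_def PiE_def by blast
 ultimately show "\<kappa> \<in> ibox d (2 ^ m)" unfolding ibox_def PiE_iff by blast
qed

text \<open>The period is q = 2^m N with N = 4 b, twice the side of the box around J, so J embeds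
  modulo q. An index \<nu> stands for the frequency X = (\<nu> - h) / N, because \<nu> j / q =
  (\<nu> / N) (j / 2^m); h = q / 2 puts the origin in the middle of the period and cancels in
  differences. Discrete lengths are physical ones times N: window \<rho> N, tile side r N.\<close>

lemma level:
 fixes \<epsilon> :: real and d l m M r b \<rho> :: nat
 assumes d: "d \<ge> 1" and eps: "0 < \<epsilon>" "\<epsilon> < 1" and e: "e = \<epsilon> / 1280000" and l: "1 / 2 ^ l <= \<epsilon> / 8" and g: "\<gamma> = e / (50 * 4 ^ l)"
  and tau: "0 <= \<tau>" "4 * real d * \<tau> <= 1" and tau': "(1 + 40000 / \<gamma>) * (80000 * real d * \<tau>) <= \<epsilon> / 8"
  and r: "2 * \<rho> <= r" "\<rho> > 0"
  and r1: "(1 - \<epsilon> / 8) * real r ^ d <= (real r - 2 * real \<rho>) ^ d" and r2: "(real r + 2 * real \<rho>) ^ d <= 2 * real r ^ d"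
  and b: "b > 0" and J: "J \<subseteq> ibox d (b * 2 ^ m)" "J \<noteq> {}" and m: "4 * \<rho> <= 2 ^ m"
  and reg: "\<And>t s. t < d ==> s * \<rho> <= 2 ^ m + \<rho> ==> (1 - \<tau>) * real (card J) <= real (card {j \<in> J. j(t := j t + int s) \<in> J})"
  and M: "real M <= (1 - \<epsilon> / 2) * (real r ^ d * (real (card J) / 2 ^ (m * d))) - 1"
 shows "\<exists>X. (\<forall>\<kappa>\<in>valid d r m. \<forall>j<M. \<forall>t<d. real r * \<kappa> t <= X (\<kappa>, j) t \<and> X (\<kappa>, j) t <= real r * (\<kappa> t + 1)) \<and>
  (\<forall>F c. F \<subseteq> valid d r m \<times> {..<M} \<longrightarrow> \<gamma> / 4 ^ l * (\<Sum>a\<in>F. (cmod (c a))^2) <= QF (Kn d m J) X F c \<and>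
   QF (Kn d m J) X F c <= 20000 * (\<Sum>a\<in>F. (cmod (c a))^2))"
proof -
 define N where "N = 4 * b"
 define q where "q = 2 ^ m * N"
 define w where "w = \<rho> * N"
 \<comment> \<open>One more than the quotient, so that H \<rho> >= 2^m and therefore q <= H
   w.\<close>
 define H where "H = 2 ^ m div \<rho> + 1"
 have N0: "N > 0" unfolding N_def using b by simp
 have q0: "q > 0" unfolding q_def using N0 by simp
 have fJ: "finite J" using J(1) finite_ibox by (rule finite_subset)
 interpret D0: dft d q J
 proof (unfold_locales)
  show "0 < q" "finite J" "J \<noteq> {}" by (fact q0 fJ J(2))+
  show "J \<subseteq> extensional {..<d}" using J(1) unfolding ibox_def PiE_def by blast
  show "\<bar>j t - j' t\<bar> < int q" if "j \<in> J" "j' \<in> J" "t < d" for j j' t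
  proof -
   have "j t \<in> {- int (b * 2 ^ m)..<int (b * 2 ^ m)}" "j' t \<in> {- int (b * 2 ^ m)..<int (b * 2 ^ m)}"
    using PiE_mem[OF subsetD[OF J(1)[unfolded ibox_def] that(1)], of t]
     PiE_mem[OF subsetD[OF J(1)[unfolded ibox_def] that(2)], of t] that(3) by blast+
   then have 1: "- int (b * 2 ^ m) <= j t \<and> j t < int (b * 2 ^ m)" "- int (b * 2 ^ m) <= j' t \<and> j' t < int (b * 2 ^ m)"
    unfolding atLeastLessThan_iff by blast+
   have 2: "int q = 4 * int (b * 2 ^ m)" unfolding q_def N_def by simp
   have "- z <= x \<and> x < z ==> - z <= y \<and> y < z ==> \<bar>x - y\<bar> < 4 * z" for x y z :: int by linarith
   from this[OF 1] show ?thesis unfolding 2 .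
  qed
 qed
 interpret D: dft_reg d q J \<tau> H w
 proof (unfold_locales)
  show "0 < H" unfolding H_def by simp
  show "0 < w" unfolding w_def using r N0 by simp
  have "2 ^ m <= H * \<rho>"
  proof -
   have "(2::nat) ^ m < \<rho> + \<rho> * (2 ^ m div \<rho>)" by (rule dividend_less_times_div) (use r in simp)
   moreover have "H * \<rho> = \<rho> + \<rho> * (2 ^ m div \<rho>)" unfolding H_def by (simp add: algebra_simps)
   ultimately show ?thesis by simp
  qed
  then have "2 ^ m * N <= H * \<rho> * N" by simp
  then show "q <= H * w" unfolding q_def w_def by (simp add: mult.assoc)
  show "0 <= \<tau>" "4 * real d * \<tau> <= 1" by (fact tau)+
  show "(1 - \<tau>) * real D0.n <= real (card {j \<in> J. j(t := j t + int s) \<in> J})" if "t < d" "s < H" for t s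
  proof -
   have "s <= 2 ^ m div \<rho>" using that(2) unfolding H_def by simp
   then have "s * \<rho> <= 2 ^ m div \<rho> * \<rho>" by simp
   also have "... <= 2 ^ m" by simp
   finally have "s * \<rho> <= 2 ^ m + \<rho>" by simp
   then show ?thesis unfolding D0.n_def by (rule reg[OF that(1)])
  qed
 qed
 define h where "h = 2 * b * 2 ^ m"
 define s where "s = r * N"
 have r0: "r > 0" using r by simp
 have s0: "s > 0" unfolding s_def using r0 N0 by simp
 define corner where "corner \<kappa> t = int h + \<kappa> t * int s" for \<kappa> :: "nat => int" and t :: nat
 define V where "V = valid d r m"
 have fV: "finite V" unfolding V_def by (rule finite_valid[OF r0])
 have mid: "int q <= 4 * corner \<kappa> t \<and> 4 * (corner \<kappa> t + int s) <= 3 * int q" if k: "\<kappa> \<in> V" and t: "t < d" for \<kappa> t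
 proof -
  have "4 * int r * (\<bar>\<kappa> t\<bar> + 1) <= 2 ^ m" using k t unfolding V_def valid_def by blast
  then have "int b * (4 * int r * (\<bar>\<kappa> t\<bar> + 1)) <= int b * 2 ^ m" by (rule mult_left_mono) simp
  then have 1: "(\<bar>\<kappa> t\<bar> + 1) * int s <= int b * 2 ^ m" unfolding s_def N_def by (simp add: mult_ac)
  have "\<bar>\<kappa> t * int s\<bar> = \<bar>\<kappa> t\<bar> * int s" by (simp add: abs_mult)
  then have 2: "\<bar>\<kappa> t * int s\<bar> + int s <= int b * 2 ^ m" using 1 by (simp add: algebra_simps)
  have q4: "int q = 4 * (int b * 2 ^ m)" "int h = 2 * (int b * 2 ^ m)" unfolding q_def N_def h_def by simp_all
  have gen: "\<bar>x\<bar> + y <= z ==> 0 <= y ==> 4 * z <= 4 * (2 * z + x) \<and> 4 * (2 * z + x + y) <= 3 * (4 * z)" for x y z :: int by arith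
  show ?thesis unfolding corner_def q4 by (rule gen[OF 2]) simp
 qed
 have disj: "D.tile s (corner \<kappa>) \<inter> D.tile s (corner \<kappa>') = {}" if k: "\<kappa> \<in> V" "\<kappa>' \<in> V" "\<kappa> \<noteq> \<kappa>'" for \<kappa> \<kappa>'
 proof (rule ccontr)
  assume "\<not> ?thesis"
  then obtain i where i: "i \<in> D.tile s (corner \<kappa>)" "i \<in> D.tile s (corner \<kappa>')" by blast
  have "\<kappa> = \<kappa>'"
  proof (rule PiE_ext)
   show "\<kappa> \<in> vecs d" "\<kappa>' \<in> vecs d" using k unfolding V_def valid_def by blast+
   fix t assume "t \<in> {..<d}"
   then have t: "t < d" by simp
   have a: "int h + \<kappa> t * int s <= i t" "i t < int h + \<kappa> t * int s + int s"
    "int h + \<kappa>' t * int s <= i t" "i t < int h + \<kappa>' t * int s + int s"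
    using i t unfolding D.tile_def corner_def by blast+
   have "\<kappa> t * int s < (\<kappa>' t + 1) * int s" using a(1,4) by (simp add: distrib_right)
   moreover have "\<kappa>' t * int s < (\<kappa> t + 1) * int s" using a(2,3) by (simp add: distrib_right)
   ultimately show "\<kappa> t = \<kappa>' t" using s0 by simp
  qed
  then show False using k(3) by blast
 qed
 have "\<exists>S\<subseteq>D0.I. (\<forall>c. \<gamma> / 4 ^ l * nsq S c <= nsq J (syn S D0.u c)) \<and> (\<forall>c. nsq J (syn S D0.u c) <= 20000 * nsq S c) \<and>
  (\<forall>a\<in>corner ` V. (1 - \<epsilon> / 2) * (real s ^ d / D0.R) - 1 <= real (card (S \<inter> D.tile s a)))"
 proof (rule D.discrete[OF eps e l g tau'])
  have "4 * \<rho> * N <= 2 ^ m * N" using m by simp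
  then show "4 * w <= q" unfolding w_def q_def by simp
  have "2 * \<rho> * N <= r * N" using r by simp
  then show "2 * w <= s" unfolding w_def s_def by simp
  have p1: "(real s - 2 * real w) ^ d = (real r - 2 * real \<rho>) ^ d * real N ^ d"
   unfolding s_def w_def power_mult_distrib[symmetric] by (simp add: algebra_simps)
  have p2: "(real s + 2 * real w) ^ d = (real r + 2 * real \<rho>) ^ d * real N ^ d"
   unfolding s_def w_def power_mult_distrib[symmetric] by (simp add: algebra_simps)
  have p3: "real s ^ d = real r ^ d * real N ^ d" unfolding s_def by (simp add: power_mult_distrib)
  show "(1 - \<epsilon> / 8) * real s ^ d <= (real s - 2 * real w) ^ d"
   unfolding p1 p3 using mult_right_mono[OF r1, of "real N ^ d"] by (simp only: mult.assoc) simp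
  show "(real s + 2 * real w) ^ d <= 2 * real s ^ d"
   unfolding p2 p3 using mult_right_mono[OF r2, of "real N ^ d"] by (simp only: mult.assoc) simp
  show "finite (corner ` V)" using fV by simp
  show "disjoint (D.tile s ` corner ` V)"
  proof (rule disjointI)
   fix A B assume "A \<in> D.tile s ` corner ` V" "B \<in> D.tile s ` corner ` V" and ne: "A \<noteq> B"
   then obtain \<kappa> \<kappa>' where k: "\<kappa> \<in> V" "\<kappa>' \<in> V" "A = D.tile s (corner \<kappa>)" "B = D.tile s (corner \<kappa>')" by blast
   then have "\<kappa> \<noteq> \<kappa>'" using ne by blast
   then show "A \<inter> B = {}" unfolding k(3,4) by (rule disj[OF k(1,2)])
  qed
  show "int q <= 4 * a t \<and> 4 * (a t + int s) <= 3 * int q" if "a \<in> corner ` V" "t < d" for a t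
   using that mid by blast
 qed
 then obtain S where SI: "S \<subseteq> D0.I" and low: "\<forall>c. \<gamma> / 4 ^ l * nsq S c <= nsq J (syn S D0.u c)"
  and up: "\<forall>c. nsq J (syn S D0.u c) <= 20000 * nsq S c"
  and cnt: "\<forall>a\<in>corner ` V. (1 - \<epsilon> / 2) * (real s ^ d / D0.R) - 1 <= real (card (S \<inter> D.tile s a))"
  by (elim exE conjE)
 have fS: "finite S" using SI D0.finI by (rule finite_subset)
 have dens: "real s ^ d / D0.R = real r ^ d * (real (card J) / 2 ^ (m * d))"
 proof -
  have "real q ^ d = 2 ^ (m * d) * real N ^ d" unfolding q_def by (simp add: power_mult_distrib power_mult)
  then show ?thesis unfolding D0.R_def D0.n_def s_def using N0 by (simp add: power_mult_distrib)
 qed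
 have "\<exists>f. inj_on f {..<M} \<and> f ` {..<M} \<subseteq> S \<inter> D.tile s (corner \<kappa>)" if k: "\<kappa> \<in> V" for \<kappa>
 proof -
  have "real M <= real (card (S \<inter> D.tile s (corner \<kappa>)))"
   using M bspec[OF cnt, of "corner \<kappa>"] k unfolding dens by auto
  then have "card {..<M} <= card (S \<inter> D.tile s (corner \<kappa>))" by simp
  from card_le_inj[OF finite_lessThan _ this] fS show ?thesis by blast
 qed
 then have "\<forall>\<kappa>\<in>V. \<exists>f. inj_on f {..<M} \<and> f ` {..<M} \<subseteq> S \<inter> D.tile s (corner \<kappa>)" by blast
 from bchoice[OF this] obtain \<nu>0 where \<nu>0: "\<forall>\<kappa>\<in>V. inj_on (\<nu>0 \<kappa>) {..<M} \<and> \<nu>0 \<kappa> ` {..<M} \<subseteq> S \<inter> D.tile s (corner \<kappa>)"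
  by (elim exE)
 define \<nu> where "\<nu> a = \<nu>0 (fst a) (snd a)" for a
 define X where "X a t = (real_of_int (\<nu> a t) - real h) / real N" for a t
 have \<nu>S: "\<nu> a \<in> S \<inter> D.tile s (corner (fst a))" if a: "a \<in> V \<times> {..<M}" for a
 proof -
  have "fst a \<in> V" "snd a \<in> {..<M}" using a by (simp_all add: mem_Times_iff)
  from subsetD[OF conjunct2[OF bspec[OF \<nu>0 this(1)]] imageI[OF this(2)]] show ?thesis unfolding \<nu>_def .
 qed
 have inj: "inj_on \<nu> (V \<times> {..<M})"
 proof (rule inj_onI)
  fix a a' assume a: "a \<in> V \<times> {..<M}" "a' \<in> V \<times> {..<M}" "\<nu> a = \<nu> a'"
  have V: "fst a \<in> V" "fst a' \<in> V" "snd a \<in> {..<M}" "snd a' \<in> {..<M}" using a(1,2) by (simp_all add: mem_Times_iff)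
  have f: "fst a = fst a'"
  proof (rule ccontr)
   assume "fst a \<noteq> fst a'"
   from disj[OF V(1,2) this] show False using \<nu>S[OF a(1)] \<nu>S[OF a(2)] a(3) by auto
  qed
  have i: "inj_on (\<nu>0 (fst a)) {..<M}" by (rule conjunct1[OF bspec[OF \<nu>0 V(1)]])
  have "\<nu>0 (fst a) (snd a) = \<nu>0 (fst a) (snd a')" using a(3) unfolding \<nu>_def f .
  from inj_onD[OF i this V(3,4)] have "snd a = snd a'" .
  then show "a = a'" using f by (rule prod_eqI[rotated])
 qed
 have ku: "D0.k (%t. \<nu> b t - \<nu> a t) = Kn d m J (%t. X b t - X a t)" for a b
 proof -
  have "of_int (dt d (%t. \<nu> b t - \<nu> a t) j) / real q = (\<Sum>t<d. (X b t - X a t) * (real_of_int (j t) / 2 ^ m))" for j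
   unfolding dt_def of_int_sum sum_divide_distrib
  proof (rule sum.cong[OF refl])
   fix t
   have "X b t - X a t = real_of_int (\<nu> b t - \<nu> a t) / real N" unfolding X_def by (simp add: diff_divide_distrib)
   then show "real_of_int ((\<nu> b t - \<nu> a t) * j t) / real q = (X b t - X a t) * (real_of_int (j t) / 2 ^ m)"
    unfolding q_def by simp
  qed
  then show ?thesis unfolding D0.k_def Kn_def D0.n_def by simp
 qed
 show ?thesis
 proof (rule exI[of _ X], intro conjI ballI allI impI)
  fix \<kappa> j t assume k: "\<kappa> \<in> valid d r m" and j: "j < M" and t: "t < d"
  have "\<nu> (\<kappa>, j) \<in> D.tile s (corner \<kappa>)" using \<nu>S[of "(\<kappa>, j)"] k j unfolding V_def by simp
  then have "corner \<kappa> t <= \<nu> (\<kappa>, j) t" "\<nu> (\<kappa>, j) t < corner \<kappa> t + int s" using t unfolding D.tile_def by blast+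
  then have "real_of_int (\<kappa> t * int s) <= real_of_int (\<nu> (\<kappa>, j) t) - real h"
   and "real_of_int (\<nu> (\<kappa>, j) t) - real h <= real_of_int ((\<kappa> t + 1) * int s)"
   unfolding corner_def by (simp_all add: distrib_right of_int_le_iff[symmetric, where 'a = real] of_int_less_iff[symmetric, where 'a = real] del: of_int_le_iff of_int_less_iff)
  then have "real_of_int (\<kappa> t * int s) / real N <= X (\<kappa>, j) t" "X (\<kappa>, j) t <= real_of_int ((\<kappa> t + 1) * int s) / real N"
   unfolding X_def by (simp_all add: divide_right_mono)
  then show "real r * \<kappa> t <= X (\<kappa>, j) t" "X (\<kappa>, j) t <= real r * (\<kappa> t + 1)"
   unfolding s_def using N0 by (simp_all add: mult_ac)
 next
  fix F and c :: "(nat => int) \<times> nat => complex" assume F: "F \<subseteq> valid d r m \<times> {..<M}"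
  have fF: "finite F" using finite_subset[OF F] fV unfolding V_def by simp
  have injF: "inj_on \<nu> F" using inj F unfolding V_def by (rule inj_on_subset)
  have FS: "\<nu> ` F \<subseteq> S" using \<nu>S F unfolding V_def by blast
  define c' where "c' \<mu> = (if \<mu> \<in> \<nu> ` F then c (inv_into F \<nu> \<mu>) else 0)" for \<mu>
  have c': "c' (\<nu> a) = c a" if "a \<in> F" for a unfolding c'_def using that injF by simp
  have n: "nsq S c' = (\<Sum>a\<in>F. (cmod (c a))^2)"
  proof -
   have "nsq S c' = (\<Sum>\<mu>\<in>\<nu> ` F. (cmod (c' \<mu>))^2)" unfolding nsq_def
    by (rule sum.mono_neutral_right[OF fS FS]) (auto simp: c'_def)
   also have "... = (\<Sum>a\<in>F. (cmod (c a))^2)" unfolding sum.reindex[OF injF] by (rule sum.cong) (auto simp: c')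
   finally show ?thesis .
  qed
  have sy: "syn S D0.u c' = (%j. \<Sum>a\<in>F. c a * D0.u (\<nu> a) j)"
  proof
   fix j
   have "syn S D0.u c' j = (\<Sum>\<mu>\<in>\<nu> ` F. c' \<mu> * D0.u \<mu> j)" unfolding syn_def
    by (rule sum.mono_neutral_right[OF fS FS]) (auto simp: c'_def)
   also have "... = (\<Sum>a\<in>F. c a * D0.u (\<nu> a) j)" unfolding sum.reindex[OF injF] by (rule sum.cong) (auto simp: c')
   finally show "syn S D0.u c' j = (\<Sum>a\<in>F. c a * D0.u (\<nu> a) j)" .
  qed
  have "complex_of_real (nsq J (syn S D0.u c')) = (\<Sum>a\<in>F. \<Sum>b\<in>F. cnj (c a) * c b * Kn d m J (%t. X b t - X a t))"
   unfolding ip_self[symmetric] sy ip_sum_left ip_sum_right ip_scale_left ip_scale_right D0.ip_u ku by (simp only: sum_distrib_left mult.assoc)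
  from arg_cong[OF this, of Re] have q: "nsq J (syn S D0.u c') = QF (Kn d m J) X F c"
   unfolding QF_def Re_complex_of_real .
  show "\<gamma> / 4 ^ l * (\<Sum>a\<in>F. (cmod (c a))^2) <= QF (Kn d m J) X F c" using spec[OF low, of c'] unfolding n q .
  show "QF (Kn d m J) X F c <= 20000 * (\<Sum>a\<in>F. (cmod (c a))^2)" using spec[OF up, of c'] unfolding n q .
 qed
qed

section \<open>Extraction of limit points\<close>

text \<open>Bolzano-Weierstrass for countably many real sequences, combined by a diagonal
  subsequence.\<close>

lemma diag_bounded:
 fixes f :: "nat => 'a => real"
 assumes A: "countable A" and bd: "\<And>a. a \<in> A ==> \<exists>B. \<forall>P. \<bar>f P a\<bar> <= B"
 shows "\<exists>\<phi>. strict_mono \<phi> \<and> (\<forall>a\<in>A. convergent (%P. f (\<phi> P) a))"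
proof (cases "A = {}")
 case True
 then show ?thesis by (intro exI[of _ id]) (simp add: strict_mono_id)
next
 case False
 define g where "g = from_nat_into A"
 have gA: "g n \<in> A" for n unfolding g_def by (rule from_nat_into[OF False])
 interpret subseqs "%n s. convergent (%i. f (s i) (g n))"
 proof
  fix n and s :: "nat => nat"
  obtain B where B: "\<forall>P. \<bar>f P (g n)\<bar> <= B" using bd[OF gA[of n]] by (elim exE)
  have "bounded (range (%i. f (s i) (g n)))"
   unfolding bounded_iff using B by (intro exI[of _ B]) auto
  from bounded_imp_convergent_subsequence[OF this] obtain l r where "strict_mono (r :: nat => nat)" "((%i. f (s i) (g n)) \<circ> r) \<longlonglongrightarrow> l"
   by (elim exE conjE)
  then show "\<exists>r'. strict_mono r' \<and> convergent (%i. f ((s \<circ> r') i) (g n))"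
   unfolding convergent_def by (intro exI[of _ r] conjI exI[of _ l]) (simp_all add: o_def)
 qed
 have "convergent (%P. f (diagseq P) a)" if a: "a \<in> A" for a
 proof -
  obtain k where k: "g k = a" using from_nat_into_surj[OF A a] unfolding g_def by (elim exE)
  have "convergent (%i. f ((diagseq \<circ> (+) (Suc k)) i) (g k))"
  proof (rule diagseq_holds)
   fix r s :: "nat => nat" and n
   assume "strict_mono r" "convergent (%i. f (s i) (g n))"
   from convergent_subseq_convergent[OF this(2,1)] show "convergent (%i. f ((s \<circ> r) i) (g n))" by (simp add: o_def)
  qed
  then have "convergent (%i. f (diagseq (i + Suc k)) a)" unfolding k o_def add.commute[of "Suc k"] .
  then show ?thesis unfolding convergent_ignore_initial_segment[of "%i. f (diagseq i) a" "Suc k"] .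
 qed
 then show ?thesis using subseq_diagseq by (intro exI[of _ diagseq]) blast
qed

lemma valid_mono: "m <= m' ==> valid d r m \<subseteq> valid d r m'"
proof
 fix \<kappa> assume "m <= m'" and k: "\<kappa> \<in> valid d r m"
 then have "(2::int) ^ m <= 2 ^ m'" by (intro power_increasing) auto
 moreover have "4 * int r * (\<bar>\<kappa> t\<bar> + 1) <= 2 ^ m" if "t < d" for t using k that unfolding valid_def by blast
 ultimately have "4 * int r * (\<bar>\<kappa> t\<bar> + 1) <= 2 ^ m'" if "t < d" for t using that order.trans by blast
 then show "\<kappa> \<in> valid d r m'" using k unfolding valid_def by blast
qed

lemma ev_valid:
 assumes k: "\<kappa> \<in> vecs d"
 shows "\<exists>m. \<kappa> \<in> valid d r m"
proof -
 define K where "K = 4 * int r * ((\<Sum>t<d. \<bar>\<kappa> t\<bar>) + 1)"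
 obtain m :: nat where m: "real_of_int K < 2 ^ m" using real_arch_pow[of 2 "real_of_int K"] by auto
 then have "real_of_int K < real_of_int (2 ^ m)" by simp
 then have Km: "K <= 2 ^ m" by (simp only: of_int_less_iff less_imp_le)
 have "4 * int r * (\<bar>\<kappa> t\<bar> + 1) <= 2 ^ m" if t: "t < d" for t
 proof -
  have "\<bar>\<kappa> t\<bar> <= (\<Sum>t<d. \<bar>\<kappa> t\<bar>)" by (rule member_le_sum) (use t in auto)
  then have "4 * int r * (\<bar>\<kappa> t\<bar> + 1) <= K" unfolding K_def by (intro mult_left_mono) auto
  then show ?thesis using Km by (rule order.trans)
 qed
 then show ?thesis using k unfolding valid_def by blast
qed

text \<open>Put x = 2 \<rho> / r, so that d x <= \<epsilon>/8. Bernoulli bounds (1 - x)^d below, and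
  (1 + x)^d (1 - x)^d <= 1 converts this into the bound 2 for (1 + x)^d.\<close>

lemma bernoulli_box:
 fixes r \<rho> d :: nat and \<epsilon> :: real
 assumes d: "d \<ge> 1" and eps: "0 < \<epsilon>" "\<epsilon> < 1" and r: "16 * real \<rho> * real d / \<epsilon> <= real r" "r > 0"
 shows "(1 - \<epsilon> / 8) * real r ^ d <= (real r - 2 * real \<rho>) ^ d" "(real r + 2 * real \<rho>) ^ d <= 2 * real r ^ d" "2 * \<rho> <= r"
proof -
 define x where "x = 2 * real \<rho> / real r"
 have x0: "x \<ge> 0" unfolding x_def by simp
 have "16 * real \<rho> * real d <= \<epsilon> * real r" using r(1) eps by (simp add: field_simps)
 then have dx: "real d * x <= \<epsilon> / 8" unfolding x_def using r(2) by (simp add: field_simps)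
 have "1 * x <= real d * x" by (rule mult_right_mono) (use d x0 in auto)
 then have x1: "x <= 1 / 8" using dx eps by simp
 have "1 + real d * (- x) <= (1 + - x) ^ d" by (rule Bernoulli_inequality) (use x1 in simp)
 then have b1: "1 - \<epsilon> / 8 <= (1 - x) ^ d" using dx by simp
 have e1: "(1 - x) ^ d * real r ^ d = (real r - 2 * real \<rho>) ^ d"
  unfolding x_def power_mult_distrib[symmetric] using r(2) by (simp add: left_diff_distrib)
 have e2: "(1 + x) ^ d * real r ^ d = (real r + 2 * real \<rho>) ^ d"
  unfolding x_def power_mult_distrib[symmetric] using r(2) by (simp add: distrib_right)
 show "(1 - \<epsilon> / 8) * real r ^ d <= (real r - 2 * real \<rho>) ^ d"
  unfolding e1[symmetric] by (rule mult_right_mono[OF b1]) simp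
 have "(1 + x) ^ d * (1 - x) ^ d = (1 - x * x) ^ d" unfolding power_mult_distrib[symmetric] by (simp add: algebra_simps)
 also have "... <= 1"
 proof (rule power_le_one)
  have "x * x <= 1 * 1" by (rule mult_mono) (use x0 x1 in auto)
  then show "0 <= 1 - x * x" by simp
 qed simp
 finally have p: "(1 + x) ^ d * (1 - x) ^ d <= 1" .
 have "(1 + x) ^ d * (1 / 2) <= (1 + x) ^ d * (1 - x) ^ d"
  by (rule mult_left_mono) (use b1 eps x0 in auto)
 then have "(1 + x) ^ d <= 2" using p by linarith
 then show "(real r + 2 * real \<rho>) ^ d <= 2 * real r ^ d" unfolding e2[symmetric] by (rule mult_right_mono) simp
 have "2 * real \<rho> <= real r" using x1 r(2) unfolding x_def by (simp add: field_simps)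
 then show "2 * \<rho> <= r" by linarith
qed

lemma grid_sequence:
 assumes W: "\<Omega> \<in> fmeasurable (Ld d)" and e: "\<delta> > 0"
 shows "\<exists>b m J. \<forall>P. b P > 0 \<and> m P \<ge> P \<and> m P \<ge> m1 \<and> J P \<subseteq> ibox d (b P * 2 ^ m P) \<and>
  measure (Ld d) (sd \<Omega> (gset d (m P) (J P))) < min \<delta> (1 / real (Suc P))"
proof -
 have "\<exists>T. fst T > 0 \<and> fst (snd T) \<ge> P \<and> fst (snd T) \<ge> m1 \<and> snd (snd T) \<subseteq> ibox d (fst T * 2 ^ fst (snd T)) \<and>
   measure (Ld d) (sd \<Omega> (gset d (fst (snd T)) (snd (snd T)))) < min \<delta> (1 / real (Suc P))" for P
 proof -
  have "min \<delta> (1 / real (Suc P)) > 0" using e by simp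
  from approx_finite[OF W this] obtain b m0 where b: "b > 0"
   and m0: "\<forall>m\<ge>m0. \<exists>G\<subseteq>ibox d (b * 2 ^ m). measure (Ld d) (sd \<Omega> (gset d m G)) < min \<delta> (1 / real (Suc P))"
   by (elim exE conjE)
  define m where "m = max m0 (max P m1)"
  have mm: "P <= m" "m1 <= m" unfolding m_def by (simp_all add: le_max_iff_disj)
  have "m0 <= m" unfolding m_def by simp
  from m0[rule_format, OF this] obtain G where "G \<subseteq> ibox d (b * 2 ^ m)" "measure (Ld d) (sd \<Omega> (gset d m G)) < min \<delta> (1 / real (Suc P))"
   by (elim exE conjE)
  then show ?thesis using b mm by (intro exI[of _ "(b, m, G)"]) simp
 qed
 then have "\<forall>P. \<exists>T. fst T > 0 \<and> fst (snd T) \<ge> P \<and> fst (snd T) \<ge> m1 \<and> snd (snd T) \<subseteq> ibox d (fst T * 2 ^ fst (snd T)) \<and>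
   measure (Ld d) (sd \<Omega> (gset d (fst (snd T)) (snd (snd T)))) < min \<delta> (1 / real (Suc P))" by (rule allI)
 from choice[OF this] obtain T where T: "\<forall>P. fst (T P) > 0 \<and> fst (snd (T P)) \<ge> P \<and> fst (snd (T P)) \<ge> m1 \<and>
   snd (snd (T P)) \<subseteq> ibox d (fst (T P) * 2 ^ fst (snd (T P))) \<and>
   measure (Ld d) (sd \<Omega> (gset d (fst (snd (T P))) (snd (snd (T P))))) < min \<delta> (1 / real (Suc P))" by (elim exE)
 show ?thesis
  by (rule exI[of _ "%P. fst (T P)"], rule exI[of _ "%P. fst (snd (T P))"], rule exI[of _ "%P. snd (snd (T P))"]) (rule T)
qed

text \<open>All parameters, in the order \<tau>, then \<delta> and \<rho>, then r and M, are fixed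
  before the mesh, so \<open>level\<close> applies with the same tiles and counts along the whole
  sequence of grids. The factor D appears in the limit because 1 / card J is 2^(-m d) divided by the
  volume of the grid set, and these volumes tend to D.\<close>

lemma limit_points:
 fixes \<epsilon> :: real and d l :: nat
 assumes d: "d \<ge> 1" and eps: "0 < \<epsilon>" "\<epsilon> < 1" and e: "e = \<epsilon> / 1280000" and l: "1 / 2 ^ l <= \<epsilon> / 8" and g: "\<gamma> = e / (50 * 4 ^ l)"
  and W: "\<Omega> \<in> fmeasurable (Ld d)" and D: "D = measure (Ld d) \<Omega>" "D > 0"
 shows "\<exists>(r::nat) (M::nat) y. r > 0 \<and> (1 - \<epsilon>) * (real r ^ d * D) <= real M \<and>
  (\<forall>\<kappa>\<in>vecs d. \<forall>j<M. y (\<kappa>, j) \<in> vecs d \<and> (\<forall>t<d. real r * of_int (\<kappa> t) <= y (\<kappa>, j) t \<and> y (\<kappa>, j) t <= real r * (of_int (\<kappa> t) + 1))) \<and>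
  (\<forall>F c. finite F \<longrightarrow> F \<subseteq> vecs d \<times> {..<M} \<longrightarrow> \<gamma> / 4 ^ l * D * (\<Sum>a\<in>F. (cmod (c a))^2) <= QF (kO d \<Omega>) y F c \<and>
   QF (kO d \<Omega>) y F c <= 20000 * D * (\<Sum>a\<in>F. (cmod (c a))^2))"
proof -
 have g0: "\<gamma> > 0" unfolding g e using eps by simp
 \<comment> \<open>The largest leakage that \<open>discrete\<close> tolerates. The bounds \<tau> <=
   1 and 4 d \<tau> <= 1 follow since the factor 80000 d is so large.\<close>
 define \<tau> where "\<tau> = \<epsilon> / (8 * ((1 + 40000 / \<gamma>) * (80000 * real d)))"
 define Z where "Z = 1 + 40000 / \<gamma>"
 have Z1: "Z \<ge> 1" unfolding Z_def using g0 by simp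
 have dd: "real d \<ge> 1" using d by simp
 have Zd: "Z * (80000 * real d) \<ge> 1 * (80000 * real d)" by (rule mult_right_mono[OF Z1]) simp
 have tau0: "\<tau> > 0" unfolding \<tau>_def Z_def[symmetric] using eps Z1 dd by simp
 have tz: "Z * (80000 * real d) * \<tau> = \<epsilon> / 8" unfolding \<tau>_def Z_def[symmetric] using Z1 dd by simp
 have "1 * (80000 * real d) * \<tau> <= Z * (80000 * real d) * \<tau>" by (rule mult_right_mono[OF Zd]) (use tau0 in simp)
 then have dt: "80000 * (real d * \<tau>) <= 1 / 8" unfolding tz using eps by simp
 have "1 * \<tau> <= real d * \<tau>" by (rule mult_right_mono[OF dd]) (use tau0 in simp)
 then have tau1: "\<tau> <= 1" using dt by simp
 have tau4: "4 * real d * \<tau> <= 1" using dt by simp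
 have tau': "(1 + 40000 / \<gamma>) * (80000 * real d * \<tau>) <= \<epsilon> / 8" using tz unfolding Z_def by simp
 obtain \<delta> \<rho> m1 where \<delta>: "\<delta> > 0" and \<rho>: "(\<rho>::nat) > 0"
  and reg: "\<forall>m\<ge>m1. \<forall>J. finite J \<longrightarrow> J \<subseteq> vecs d \<longrightarrow> measure (Ld d) (sd \<Omega> (gset d m J)) < \<delta> \<longrightarrow>
   (\<forall>t<d. \<forall>s. s * \<rho> <= 2 ^ m + \<rho> \<longrightarrow> (1 - \<tau>) * real (card J) <= real (card {j \<in> J. j(t := j t + int s) \<in> J}))"
  using translation_regular[OF W D(2)[unfolded D(1)] tau0 tau1] by (elim exE conjE)
 \<comment> \<open>The first summand makes tile boundaries negligible. The second gives V D
   \<epsilon> > 6, which leaves room for the integer M between (1 - \<epsilon>) V D and (1 -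
   \<epsilon>/2) V D - 1.\<close>
 obtain r :: nat where r: "16 * real \<rho> * real d / \<epsilon> + 6 / (D * \<epsilon>) < real r" using reals_Archimedean2 by blast
 have p6: "6 / (D * \<epsilon>) > 0" using D(2) eps by simp
 have p16: "16 * real \<rho> * real d / \<epsilon> \<ge> 0" using eps by simp
 have r0: "r > 0" using r p6 p16 by (cases r) auto
 have rr: "16 * real \<rho> * real d / \<epsilon> <= real r" "6 / (D * \<epsilon>) < real r" using r p6 p16 by linarith+
 note bb = bernoulli_box[OF d eps rr(1) r0]
 define V where "V = real r ^ d"
 have Vr: "V \<ge> real r" unfolding V_def using power_increasing[of 1 d "real r"] d r0 by simp
 have VD: "V * D * \<epsilon> > 6"
 proof -
  have "6 < real r * (D * \<epsilon>)" using rr(2) D(2) eps by (simp add: field_simps)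
  also have "... <= V * (D * \<epsilon>)" by (rule mult_right_mono[OF Vr]) (use D(2) eps in simp)
  finally show ?thesis by (simp add: mult.assoc)
 qed
 define M where "M = nat \<lceil>(1 - \<epsilon>) * (V * D)\<rceil>"
 have "(1 - \<epsilon>) * (V * D) \<ge> 0" unfolding V_def using eps D(2) by simp
 then have M: "(1 - \<epsilon>) * (V * D) <= real M" "real M < (1 - \<epsilon>) * (V * D) + 1"
  unfolding M_def using ceiling_correct[of "(1 - \<epsilon>) * (V * D)"] by (simp_all add: of_nat_nat)
 obtain m2 :: nat where m2: "real (4 * \<rho>) < 2 ^ m2" using real_arch_pow[of 2 "real (4 * \<rho>)"] by auto
 obtain b m J where T: "\<forall>P. b P > 0 \<and> m P \<ge> P \<and> m P \<ge> max m1 m2 \<and> J P \<subseteq> ibox d (b P * 2 ^ m P) \<and>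
  measure (Ld d) (sd \<Omega> (gset d (m P) (J P))) < min \<delta> (1 / real (Suc P))"
  using grid_sequence[OF W \<delta>, of "max m1 m2"] by (elim exE)
 have b0: "b P > 0" and mP: "m P \<ge> P" and mm1: "m P \<ge> m1" and mm2: "m P \<ge> m2" and Jb: "J P \<subseteq> ibox d (b P * 2 ^ m P)"
  and sdd: "measure (Ld d) (sd \<Omega> (gset d (m P) (J P))) < \<delta>"
  and sdP: "measure (Ld d) (sd \<Omega> (gset d (m P) (J P))) < 1 / real (Suc P)" for P
  using spec[OF T, of P] by auto
 have fJ: "finite (J P)" for P using Jb finite_ibox by (rule finite_subset)
 have JE: "J P \<subseteq> vecs d" for P using Jb ibox_PiE by (rule subset_trans)
 have m\<rho>: "4 * \<rho> <= 2 ^ m P" for P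
 proof -
  have "real (4 * \<rho>) < real (2 ^ m2)" using m2 by simp
  then have "4 * \<rho> < 2 ^ m2" by (simp only: of_nat_less_iff)
  also have "... <= 2 ^ m P" by (rule power_increasing[OF mm2]) simp
  finally show ?thesis by simp
 qed
 define DP where "DP P = real (card (J P)) / 2 ^ (m P * d)" for P
 have DPm: "DP P = measure (Ld d) (gset d (m P) (J P))" for P unfolding DP_def by (rule measure_gset[OF fJ JE, symmetric])
 have sd0: "(%P. measure (Ld d) (sd \<Omega> (gset d (m P) (J P)))) \<longlonglongrightarrow> 0"
 proof (rule Lim_null_comparison[OF _ LIMSEQ_inverse_real_of_nat], rule always_eventually, rule allI)
  show "norm (measure (Ld d) (sd \<Omega> (gset d (m P) (J P)))) <= inverse (real (Suc P))" for P
   using sdP[of P] by (simp add: inverse_eq_divide)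
 qed
 have DPl: "DP \<longlonglongrightarrow> D"
 proof (rule LIM_zero_cancel, rule Lim_null_comparison[OF _ sd0], rule always_eventually, rule allI)
  fix P
  have fm: "gset d (m P) (J P) \<in> fmeasurable (Ld d)" by (rule gset_fm[OF fJ JE])
  show "norm (DP P - D) <= measure (Ld d) (sd \<Omega> (gset d (m P) (J P)))"
   using measure_le_sd[OF W fm] measure_le_sd[OF fm W] unfolding DPm D(1) sd_commute[of _ \<Omega>] real_norm_def by linarith
 qed
 have "(%P. (1 - \<epsilon> / 2) * (V * DP P) - 1) \<longlonglongrightarrow> (1 - \<epsilon> / 2) * (V * D) - 1"
  by (intro tendsto_intros DPl)
 moreover have "real M < (1 - \<epsilon> / 2) * (V * D) - 1"
 proof -
  have "(1 - \<epsilon> / 2) * (V * D) = (1 - \<epsilon>) * (V * D) + (V * D * \<epsilon>) / 2" by (simp add: algebra_simps)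
  then show ?thesis using M(2) VD by linarith
 qed
 ultimately have ev1: "\<forall>\<^sub>F P in sequentially. real M < (1 - \<epsilon> / 2) * (V * DP P) - 1" by (rule order_tendstoD(1))
 have ev2: "\<forall>\<^sub>F P in sequentially. 0 < DP P" by (rule order_tendstoD(1)[OF DPl D(2)])
 from eventually_conj[OF ev1 ev2] obtain P0 where P0: "\<forall>P\<ge>P0. real M < (1 - \<epsilon> / 2) * (V * DP P) - 1 \<and> 0 < DP P"
  unfolding eventually_sequentially by (elim exE)
 define Lev where "Lev P X \<longleftrightarrow> (\<forall>\<kappa>\<in>valid d r (m P). \<forall>j<M. \<forall>t<d. real r * of_int (\<kappa> t) <= X (\<kappa>, j) t \<and> X (\<kappa>, j) t <= real r * of_int (\<kappa> t + 1)) \<and>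
  (\<forall>F c. F \<subseteq> valid d r (m P) \<times> {..<M} \<longrightarrow> \<gamma> / 4 ^ l * (\<Sum>a\<in>F. (cmod (c a))^2) <= QF (Kn d (m P) (J P)) X F c \<and>
   QF (Kn d (m P) (J P)) X F c <= 20000 * (\<Sum>a\<in>F. (cmod (c a))^2))" for P and X :: "(nat => int) \<times> nat => nat => real"
 have "\<exists>X. Lev P X" if P: "P \<ge> P0" for P
 proof -
  have Jn: "J P \<noteq> {}"
  proof
   assume "J P = {}"
   then have "DP P = 0" unfolding DP_def by simp
   then show False using P0 P by auto
  qed
  have "real M <= (1 - \<epsilon> / 2) * (real r ^ d * (real (card (J P)) / 2 ^ (m P * d))) - 1"
   using P0[rule_format, OF P] unfolding DP_def V_def by (elim conjE) (rule less_imp_le)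
  then show ?thesis unfolding Lev_def
   by (intro level[OF d eps e l g less_imp_le[OF tau0] tau4 tau' bb(3) \<rho> bb(1,2) b0 Jb Jn m\<rho>])
    (rule reg[rule_format, OF mm1 fJ JE sdd])
 qed
 then have "\<forall>P. \<exists>X. Lev (P0 + P) X" by simp
 from choice[OF this] obtain X where X: "\<forall>P. Lev (P0 + P) (X P)" by (elim exE)
 have Xb: "real r * of_int (\<kappa> t) <= X P (\<kappa>, j) t \<and> X P (\<kappa>, j) t <= real r * (of_int (\<kappa> t) + 1)"
  if "\<kappa> \<in> valid d r (m (P0 + P))" "j < M" "t < d" for P \<kappa> j t
  using spec[OF X, of P, unfolded Lev_def, THEN conjunct1, rule_format, OF that] by (simp only: of_int_add of_int_1)
 have XF: "\<gamma> / 4 ^ l * (\<Sum>a\<in>F. (cmod (c a))^2) <= QF (Kn d (m (P0 + P)) (J (P0 + P))) (X P) F c \<and>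
   QF (Kn d (m (P0 + P)) (J (P0 + P))) (X P) F c <= 20000 * (\<Sum>a\<in>F. (cmod (c a))^2)"
  if "F \<subseteq> valid d r (m (P0 + P)) \<times> {..<M}" for P F c
  by (rule spec[OF X, of P, unfolded Lev_def, THEN conjunct2, THEN spec, THEN spec, THEN mp, OF that])
 define E where "E = {..<d} \<rightarrow>\<^sub>E (UNIV :: int set)"
 \<comment> \<open>The default 0 on tiles that are not yet valid keeps every coordinate sequence
   bounded from the start; each single tile is eventually valid.\<close>
 define Y where "Y P a t = (if fst a \<in> valid d r (m (P0 + P)) then X P a t else 0)" for P a t
 define A where "A = (E \<times> {..<M}) \<times> {..<d}"
 have cA: "countable A" unfolding A_def E_def
  by (intro countable_SIGMA countable_int_PiE) auto
 have bdd: "\<exists>B. \<forall>P. \<bar>Y P (fst z) (snd z)\<bar> <= B" if z: "z \<in> A" for z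
 proof -
  obtain \<kappa> j t where zz: "z = ((\<kappa>, j), t)" "j < M" "t < d" using z unfolding A_def by auto
  define k where "k = real_of_int (\<kappa> t)"
  have "\<bar>Y P (\<kappa>, j) t\<bar> <= real r * (\<bar>k\<bar> + 1)" for P
  proof (cases "\<kappa> \<in> valid d r (m (P0 + P))")
   case True
   have "real r * k <= X P (\<kappa>, j) t \<and> X P (\<kappa>, j) t <= real r * (k + 1)"
    using Xb[OF True zz(2,3)] unfolding k_def .
   moreover have "real r * (k + 1) <= real r * (\<bar>k\<bar> + 1)" "real r * (- \<bar>k\<bar> - 1) <= real r * k"
    by (rule mult_left_mono; simp)+
   moreover have "real r * (- \<bar>k\<bar> - 1) = - (real r * (\<bar>k\<bar> + 1))" by (simp add: algebra_simps)
   ultimately show ?thesis using True unfolding Y_def by (simp add: abs_le_iff)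
  qed (simp add: Y_def)
  then show ?thesis unfolding zz by (intro exI[of _ "real r * (\<bar>k\<bar> + 1)"]) simp
 qed
 have "\<exists>\<phi>. strict_mono \<phi> \<and> (\<forall>z\<in>A. convergent (%P. Y (\<phi> P) (fst z) (snd z)))"
  by (rule diag_bounded[OF cA, of "%P z. Y P (fst z) (snd z)"]) (rule bdd)
 then obtain \<phi> where \<phi>: "strict_mono \<phi>" and conv: "\<forall>z\<in>A. convergent (%P. Y (\<phi> P) (fst z) (snd z))" by (elim exE conjE)
 let ?m = "%P. m (P0 + \<phi> P)" and ?K = "%P. Kn d (m (P0 + \<phi> P)) (J (P0 + \<phi> P))"
 define y where "y a = (\<lambda>t\<in>{..<d}. lim (%P. Y (\<phi> P) a t))" for a
 have Yl: "(%P. Y (\<phi> P) a t) \<longlonglongrightarrow> y a t" if "a \<in> E \<times> {..<M}" "t < d" for a t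
 proof -
  have "(a, t) \<in> A" using that unfolding A_def by simp
  from bspec[OF conv this] have "convergent (%P. Y (\<phi> P) a t)" by simp
  then show ?thesis using that(2) unfolding y_def convergent_LIMSEQ_iff by simp
 qed
 have evv: "\<forall>\<^sub>F P in sequentially. \<kappa> \<in> valid d r (?m P)" if k: "\<kappa> \<in> E" for \<kappa>
 proof -
  obtain m' where m': "\<kappa> \<in> valid d r m'" using ev_valid[OF k[unfolded E_def], of r] by (elim exE)
  show ?thesis unfolding eventually_sequentially
  proof (intro exI[of _ m'] allI impI)
   fix P assume "m' <= P"
   also have "P <= \<phi> P" by (rule seq_suble[OF \<phi>])
   also have "\<phi> P <= P0 + \<phi> P" by simp
   also have "... <= ?m P" by (rule mP)
   finally have "m' <= ?m P" .
   from subsetD[OF valid_mono[OF this] m'] show "\<kappa> \<in> valid d r (?m P)" .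
  qed
 qed
 have mlim: "filterlim (%P. ?m P) at_top sequentially"
 proof (rule filterlim_at_top_mono[OF filterlim_ident], rule always_eventually, rule allI)
  fix P
  have "P <= \<phi> P" by (rule seq_suble[OF \<phi>])
  then show "P <= ?m P" using mP[of "P0 + \<phi> P"] by simp
 qed
 have sub: "(%P. f (P0 + \<phi> P)) \<longlonglongrightarrow> L" if "f \<longlonglongrightarrow> L" for f :: "nat => real" and L
 proof -
  have "strict_mono (%P. P0 + \<phi> P)" using \<phi> unfolding strict_mono_def by simp
  from LIMSEQ_subseq_LIMSEQ[OF that this] show ?thesis by (simp add: o_def)
 qed
 have klim: "(%P. ?K P (%t. Y (\<phi> P) b t - Y (\<phi> P) a t)) \<longlonglongrightarrow>
   of_real (1 / D) * kO d \<Omega> (%t. y b t - y a t)" if a: "a \<in> E \<times> {..<M}" and b: "b \<in> E \<times> {..<M}" for a b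
 proof -
  have 1: "(%P. of_real (1 / 2 ^ (?m P * d)) * (\<Sum>j\<in>J (P0 + \<phi> P). ch (\<Sum>t<d. (Y (\<phi> P) b t - Y (\<phi> P) a t) * (real_of_int (j t) / 2 ^ ?m P))))
    \<longlonglongrightarrow> kO d \<Omega> (%t. y b t - y a t)"
   by (rule kernel_conv[OF W mlim fJ JE sub[OF sd0]]) (intro tendsto_diff Yl a b)
  have 2: "(%P. complex_of_real (1 / DP (P0 + \<phi> P))) \<longlonglongrightarrow> of_real (1 / D)"
   by (intro tendsto_of_real tendsto_divide tendsto_const sub[OF DPl]) (use D(2) in simp)
  have e: "complex_of_real (1 / DP Q) * (of_real (1 / 2 ^ (m Q * d)) * z) = of_real (1 / card (J Q)) * z" for Q z
   unfolding DP_def by simp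
  from tendsto_mult[OF 2 1] show ?thesis unfolding e Kn_def .
 qed
 have QFlim: "(%P. QF (?K P) (Y (\<phi> P)) F c) \<longlonglongrightarrow> 1 / D * QF (kO d \<Omega>) y F c"
  if F: "F \<subseteq> E \<times> {..<M}" for F c
 proof -
  have "(%P. QF (?K P) (Y (\<phi> P)) F c) \<longlonglongrightarrow>
    Re (\<Sum>a\<in>F. \<Sum>b\<in>F. cnj (c a) * c b * (of_real (1 / D) * kO d \<Omega> (%t. y b t - y a t)))"
   unfolding QF_def by (intro tendsto_Re tendsto_sum tendsto_mult tendsto_const klim) (use F in blast)+
  also have "(\<Sum>a\<in>F. \<Sum>b\<in>F. cnj (c a) * c b * (of_real (1 / D) * kO d \<Omega> (%t. y b t - y a t))) =
    of_real (1 / D) * (\<Sum>a\<in>F. \<Sum>b\<in>F. cnj (c a) * c b * kO d \<Omega> (%t. y b t - y a t))"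
   unfolding sum_distrib_left by (simp only: mult_ac)
  finally show ?thesis unfolding QF_def by simp
 qed
 have fin: "\<gamma> / 4 ^ l * D * (\<Sum>a\<in>F. (cmod (c a))^2) <= QF (kO d \<Omega>) y F c \<and> QF (kO d \<Omega>) y F c <= 20000 * D * (\<Sum>a\<in>F. (cmod (c a))^2)"
  if fF: "finite F" and F: "F \<subseteq> E \<times> {..<M}" for F c
 proof -
  define N where "N = (\<Sum>a\<in>F. (cmod (c a))^2)"
  have "\<forall>\<^sub>F P in sequentially. \<forall>a\<in>F. fst a \<in> valid d r (?m P)"
   by (rule eventually_ball_finite[OF fF]) (use F evv in auto)
  then have ev: "\<forall>\<^sub>F P in sequentially. \<gamma> / 4 ^ l * N <= QF (?K P) (Y (\<phi> P)) F c \<and>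
    QF (?K P) (Y (\<phi> P)) F c <= 20000 * N"
  proof (rule eventually_mono)
   fix P assume v: "\<forall>a\<in>F. fst a \<in> valid d r (?m P)"
   have e: "QF (?K P) (Y (\<phi> P)) F c = QF (?K P) (X (\<phi> P)) F c"
    unfolding QF_def Y_def using v by (intro arg_cong[where f = Re] sum.cong refl) simp
   have "F \<subseteq> valid d r (?m P) \<times> {..<M}"
   proof
    fix a assume "a \<in> F"
    then show "a \<in> valid d r (?m P) \<times> {..<M}" using v F by (auto simp: mem_Times_iff)
   qed
   from XF[OF this] show "\<gamma> / 4 ^ l * N <= QF (?K P) (Y (\<phi> P)) F c \<and>
    QF (?K P) (Y (\<phi> P)) F c <= 20000 * N" unfolding e N_def .
  qed
  have 1: "\<gamma> / 4 ^ l * N <= 1 / D * QF (kO d \<Omega>) y F c"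
   by (rule tendsto_lowerbound[OF QFlim[OF F]]) (use ev in \<open>auto elim: eventually_mono\<close>)
  have 2: "1 / D * QF (kO d \<Omega>) y F c <= 20000 * N"
   by (rule tendsto_upperbound[OF QFlim[OF F]]) (use ev in \<open>auto elim: eventually_mono\<close>)
  show ?thesis using 1 2 D(2) unfolding N_def[symmetric] by (simp add: field_simps)
 qed
 have box: "real r * of_int (\<kappa> t) <= y (\<kappa>, j) t \<and> y (\<kappa>, j) t <= real r * (of_int (\<kappa> t) + 1)"
  if k: "\<kappa> \<in> E" and j: "j < M" and t: "t < d" for \<kappa> j t
 proof -
  have l: "(%P. Y (\<phi> P) (\<kappa>, j) t) \<longlonglongrightarrow> y (\<kappa>, j) t" by (rule Yl) (use k j t in auto)
  have ev: "\<forall>\<^sub>F P in sequentially. real r * of_int (\<kappa> t) <= Y (\<phi> P) (\<kappa>, j) t \<and> Y (\<phi> P) (\<kappa>, j) t <= real r * (of_int (\<kappa> t) + 1)"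
   using evv[OF k] by (rule eventually_mono) (use Xb[OF _ j t] in \<open>simp add: Y_def\<close>)
  show ?thesis
  proof
   show "real r * of_int (\<kappa> t) <= y (\<kappa>, j) t" by (rule tendsto_lowerbound[OF l]) (use ev in \<open>auto elim: eventually_mono\<close>)
   show "y (\<kappa>, j) t <= real r * (of_int (\<kappa> t) + 1)" by (rule tendsto_upperbound[OF l]) (use ev in \<open>auto elim: eventually_mono\<close>)
  qed
 qed
 have yE: "y a \<in> vecs d" for a unfolding y_def restrict_PiE_iff by simp
 show ?thesis
  by (rule exI[of _ r], rule exI[of _ M], rule exI[of _ y])
   (intro conjI allI ballI impI r0 M(1)[unfolded V_def] yE box[unfolded E_def, THEN conjunct1] box[unfolded E_def, THEN conjunct2]
    fin[unfolded E_def, THEN conjunct1] fin[unfolded E_def, THEN conjunct2])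
qed

section \<open>From finite Riesz inequalities to Riesz sequences\<close>

lemma L2_norm_sq: "(L2_norm M f)^2 = (\<integral>x. (cmod (f x))^2 \<partial>M)"
 unfolding L2_norm_def by (rule real_sqrt_pow2) (rule integral_nonneg_AE, simp)

lemma cmod_sq_add:
 assumes t: "t > 0"
 shows "(cmod (x + y))^2 <= (1 + t) * (cmod x)^2 + (1 + 1 / t) * (cmod y)^2"
proof -
 have s: "0 <= (sqrt t * cmod x - cmod y / sqrt t)^2" by simp
 have e: "(sqrt t * cmod x - cmod y / sqrt t)^2 = t * (cmod x)^2 - 2 * (cmod x * cmod y) + 1 / t * (cmod y)^2"
  using t by (simp add: power2_diff power_mult_distrib power_divide)
 have "(cmod (x + y))^2 <= (cmod x + cmod y)^2" by (rule power_mono[OF norm_triangle_ineq norm_ge_zero])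
 also have "... = (cmod x)^2 + (cmod y)^2 + 2 * (cmod x * cmod y)" by (simp add: power2_sum)
 also have "... <= (1 + t) * (cmod x)^2 + (1 + 1 / t) * (cmod y)^2"
  using s unfolding e by (simp add: distrib_right)
 finally show ?thesis .
qed

lemma L2_add:
 assumes f: "f \<in> L2_space M" and g: "g \<in> L2_space M"
 shows "(%x. f x + g x) \<in> L2_space M"
  and "t > 0 ==> (L2_norm M (%x. f x + g x))^2 <= (1 + t) * (L2_norm M f)^2 + (1 + 1 / t) * (L2_norm M g)^2"
proof -
 have m: "f \<in> borel_measurable M" "g \<in> borel_measurable M" and i: "integrable M (%x. (cmod (f x))^2)" "integrable M (%x. (cmod (g x))^2)"
  using f g unfolding L2_space_def by auto
 have i2: "integrable M (%x. (1 + t) * (cmod (f x))^2 + (1 + 1 / t) * (cmod (g x))^2)" for t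
  by (intro Bochner_Integration.integrable_add integrable_mult_right i)
 have mm: "(%x. (cmod (f x + g x))^2) \<in> borel_measurable M" using m by measurable
 have i3: "integrable M (%x. (cmod (f x + g x))^2)"
 proof (rule Bochner_Integration.integrable_bound[OF i2[of 1] mm], rule AE_I2)
  fix x
  show "norm ((cmod (f x + g x))^2) <= norm ((1 + 1) * (cmod (f x))^2 + (1 + 1 / 1) * (cmod (g x))^2)"
   using cmod_sq_add[of 1 "f x" "g x"] by simp
 qed
 show "(%x. f x + g x) \<in> L2_space M" unfolding L2_space_def using m i3 by simp
 assume t: "t > 0"
 have "(\<integral>x. (cmod (f x + g x))^2 \<partial>M) <= (\<integral>x. (1 + t) * (cmod (f x))^2 + (1 + 1 / t) * (cmod (g x))^2 \<partial>M)"
  by (rule integral_mono[OF i3 i2]) (rule cmod_sq_add[OF t])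
 also have "... = (1 + t) * (\<integral>x. (cmod (f x))^2 \<partial>M) + (1 + 1 / t) * (\<integral>x. (cmod (g x))^2 \<partial>M)"
  by (subst Bochner_Integration.integral_add) (auto intro: i integrable_mult_right)
 finally show "(L2_norm M (%x. f x + g x))^2 <= (1 + t) * (L2_norm M f)^2 + (1 + 1 / t) * (L2_norm M g)^2"
  unfolding L2_norm_sq .
qed

lemma L2_scale: "f \<in> L2_space M ==> (%x. c * f x) \<in> L2_space M"
 unfolding L2_space_def by (auto simp: norm_mult power_mult_distrib)

lemma L2_zero: "(%x. 0) \<in> L2_space M"
 unfolding L2_space_def by simp

lemma L2_sum: "finite F ==> (\<And>i. i \<in> F ==> g i \<in> L2_space M) ==> (%x. \<Sum>i\<in>F. c i * g i x) \<in> L2_space M"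
proof (induction F rule: finite_induct)
 case empty
 show ?case using L2_zero by simp
next
 case (insert i F)
 have "(%x. c i * g i x + (\<Sum>i\<in>F. c i * g i x)) \<in> L2_space M"
  by (rule L2_add(1)[OF L2_scale]) (use insert in auto)
 then show ?case using insert.hyps by simp
qed

text \<open>Finite sets F n exhaust the coefficients up to 4^(-n), so the partial sums S n are
  Cauchy in L2. Their limit f is taken pointwise: the increments are summable in L1, which gives
  convergence almost everywhere, and Fatou then bounds the L2 distance of S n to f. The bounds and
  unconditional convergence follow with errors governed by 4^(-n).\<close>

lemma riesz_bounds_finite:
 fixes M :: "'a measure" and g :: "'i => 'a => complex"
 assumes fM: "finite_measure M" and I: "countable I" and g: "\<And>i. i \<in> I ==> g i \<in> L2_space M"
  and A: "A \<ge> 0" and B: "B \<ge> 0"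
  and low: "\<And>F c. finite F ==> F \<subseteq> I ==> A * (\<Sum>i\<in>F. (cmod (c i))^2) <= (L2_norm M (%x. \<Sum>i\<in>F. c i * g i x))^2"
  and up: "\<And>F c. finite F ==> F \<subseteq> I ==> (L2_norm M (%x. \<Sum>i\<in>F. c i * g i x))^2 <= B * (\<Sum>i\<in>F. (cmod (c i))^2)"
 shows "riesz_bounds M g I A B"
 unfolding riesz_bounds_def
proof (intro conjI ballI allI impI)
 show "countable I" by (rule I)
 show "g i \<in> L2_space M" if "i \<in> I" for i by (rule g[OF that])
 fix c :: "'i => complex" assume c: "(%i. (cmod (c i))^2) summable_on I"
 define s where "s = (\<Sum>\<^sub>\<infinity>i\<in>I. (cmod (c i))^2)"
 have le_s: "(\<Sum>i\<in>F. (cmod (c i))^2) <= s" if "finite F" "F \<subseteq> I" for F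
  unfolding s_def by (rule finite_sum_le_infsum[OF c that]) simp
 have "\<exists>F. finite F \<and> F \<subseteq> I \<and> s - (1/4) ^ n < (\<Sum>i\<in>F. (cmod (c i))^2)" for n :: nat
 proof -
  have "(sum (%i. (cmod (c i))^2) \<longlongrightarrow> s) (finite_subsets_at_top I)"
   using has_sum_infsum[OF c] unfolding has_sum_def s_def .
  then have "\<forall>\<^sub>F F in finite_subsets_at_top I. s - (1/4) ^ n < (\<Sum>i\<in>F. (cmod (c i))^2)"
   by (rule order_tendstoD(1)) simp
  then show ?thesis unfolding eventually_finite_subsets_at_top by blast
 qed
 then have "\<forall>n. \<exists>F. finite F \<and> F \<subseteq> I \<and> s - (1/4) ^ n < (\<Sum>i\<in>F. (cmod (c i))^2)" by blast
 from choice[OF this] obtain F where F: "\<forall>n. finite (F n) \<and> F n \<subseteq> I \<and> s - (1/4) ^ n < (\<Sum>i\<in>F n. (cmod (c i))^2)"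
  by (elim exE)
 have fF: "finite (F n)" and FI: "F n \<subseteq> I" and Fs: "s - (1/4) ^ n < (\<Sum>i\<in>F n. (cmod (c i))^2)" for n
  using spec[OF F, of n] by auto
 have tail: "(\<Sum>i\<in>G. (cmod (c i))^2) <= (1/4) ^ n" if "finite G" "G \<subseteq> I" "G \<inter> F n = {}" for G n
 proof -
  have "(\<Sum>i\<in>F n \<union> G. (cmod (c i))^2) = (\<Sum>i\<in>F n. (cmod (c i))^2) + (\<Sum>i\<in>G. (cmod (c i))^2)"
   by (rule sum.union_disjoint) (use fF that in auto)
  moreover have "(\<Sum>i\<in>F n \<union> G. (cmod (c i))^2) <= s" by (rule le_s) (use fF FI that in auto)
  ultimately show ?thesis using Fs[of n] by linarith
 qed
 define T where "T G x = (\<Sum>i\<in>G. c i * g i x)" for G x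
 have TL: "T G \<in> L2_space M" if "finite G" "G \<subseteq> I" for G
  unfolding T_def[abs_def] by (rule L2_sum) (use that g in auto)
 have Tm: "T G \<in> borel_measurable M" if "finite G" "G \<subseteq> I" for G using TL[OF that] unfolding L2_space_def by blast
 have Td: "T G x - T H x = (\<Sum>i\<in>(G - H) \<union> (H - G). (if i \<in> G then c i else - c i) * g i x)" if "finite G" "finite H" for G H x
 proof -
  have "T G x = T (G \<inter> H) x + T (G - H) x" unfolding T_def by (rule sum.Int_Diff[OF that(1)])
  moreover have "T H x = T (H \<inter> G) x + T (H - G) x" unfolding T_def by (rule sum.Int_Diff[OF that(2)])
  moreover have "(\<Sum>i\<in>(G - H) \<union> (H - G). (if i \<in> G then c i else - c i) * g i x) = T (G - H) x - T (H - G) x"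
   unfolding T_def by (subst sum.union_disjoint) (use that in \<open>auto simp: sum_negf[symmetric] intro!: sum.cong\<close>)
  ultimately show ?thesis by (simp add: Int_commute)
 qed
 have dist2: "(L2_norm M (%x. T (F m) x - T (F n) x))^2 <= B * ((1/4) ^ n + (1/4) ^ m)" for m n
 proof -
  have "(L2_norm M (%x. T (F m) x - T (F n) x))^2 <= B * (\<Sum>i\<in>(F m - F n) \<union> (F n - F m). (cmod (if i \<in> F m then c i else - c i))^2)"
   unfolding Td[OF fF fF] by (rule up) (use fF FI in auto)
  also have "(\<Sum>i\<in>(F m - F n) \<union> (F n - F m). (cmod (if i \<in> F m then c i else - c i))^2) =
    (\<Sum>i\<in>F m - F n. (cmod (c i))^2) + (\<Sum>i\<in>F n - F m. (cmod (c i))^2)"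
   by (subst sum.union_disjoint) (use fF in \<open>auto intro!: arg_cong2[where f = "(+)"] sum.cong\<close>)
  also have "... <= (1/4) ^ n + (1/4) ^ m"
   by (rule add_mono; rule tail) (use fF FI in auto)
  finally show ?thesis using B by (simp add: mult_left_mono)
 qed
 define S where "S n x = T (F n) x" for n x
 have SL: "S n \<in> L2_space M" for n unfolding S_def[abs_def] by (rule TL[OF fF FI])
 have Sm: "S n \<in> borel_measurable M" for n unfolding S_def[abs_def] by (rule Tm[OF fF FI])
 have SdL: "(%x. S m x - S n x) \<in> L2_space M" for m n
  using L2_add(1)[OF SL[of m] L2_scale[OF SL[of n], of "-1"]] by simp
 have nnS: "(\<integral>\<^sup>+x. ennreal ((cmod (S m x - S n x))^2) \<partial>M) <= ennreal (B * ((1/4) ^ n + (1/4) ^ m))" for m n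
 proof -
  have "(\<integral>\<^sup>+x. ennreal ((cmod (S m x - S n x))^2) \<partial>M) = ennreal (\<integral>x. (cmod (S m x - S n x))^2 \<partial>M)"
   by (rule nn_integral_eq_integral) (use SdL in \<open>auto simp: L2_space_def\<close>)
  then show ?thesis using dist2[of m n] unfolding L2_norm_sq S_def by (simp add: ennreal_leI)
 qed
 have AEconv: "AE x in M. convergent (%n. S n x)"
 proof -
  define v where "v n x = cmod (S (Suc n) x - S n x)" for n x
  have vm: "v n \<in> borel_measurable M" for n unfolding v_def[abs_def] using Sm by measurable
  define K where "K = measure M (space M) + 2 * B"
  have vi: "(\<integral>\<^sup>+x. ennreal (v n x) \<partial>M) <= ennreal (K * (1/2) ^ n)" for n
  proof -
   have "(\<integral>\<^sup>+x. ennreal (v n x) \<partial>M) <= (\<integral>\<^sup>+x. ennreal ((1/2) ^ n) + ennreal (2 ^ n) * ennreal ((v n x)^2) \<partial>M)"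
   proof (rule nn_integral_mono)
    fix x
    \<comment> \<open>Arithmetic-geometric mean with weight 2^n: on a finite measure space it trades
      L2 increments of order 4^(-n) for L1 increments of order 2^(-n).\<close>
    have "0 <= (1/2) ^ n * (1 - 2 ^ n * v n x)^2" by simp
    also have "... = (1/2) ^ n + 2 ^ n * (v n x)^2 - 2 * v n x"
     by (simp add: power2_diff power_mult_distrib power_divide field_simps power2_eq_square)
    finally have "v n x <= (1/2) ^ n + 2 ^ n * (v n x)^2" unfolding v_def using norm_ge_zero[of "S (Suc n) x - S n x"] by linarith
    then have "ennreal (v n x) <= ennreal ((1/2) ^ n + 2 ^ n * (v n x)^2)" by (rule ennreal_leI)
    then show "ennreal (v n x) <= ennreal ((1/2) ^ n) + ennreal (2 ^ n) * ennreal ((v n x)^2)"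
     by (simp add: ennreal_plus ennreal_mult)
   qed
   also have "... = ennreal ((1/2) ^ n) * emeasure M (space M) + ennreal (2 ^ n) * (\<integral>\<^sup>+x. ennreal ((v n x)^2) \<partial>M)"
    using vm by (subst nn_integral_add) (auto simp: nn_integral_cmult)
   also have "... <= ennreal ((1/2) ^ n) * ennreal (measure M (space M)) + ennreal (2 ^ n) * ennreal (B * ((1/4) ^ n + (1/4) ^ Suc n))"
    unfolding finite_measure.emeasure_eq_measure[OF fM] v_def
    by (intro add_mono mult_left_mono nnS) auto
   also have "... = ennreal ((1/2) ^ n * measure M (space M) + 2 ^ n * (B * ((1/4) ^ n + (1/4) ^ Suc n)))"
    using B by (simp add: ennreal_mult[symmetric] ennreal_plus[symmetric] del: ennreal_plus)
   also have "... <= ennreal (K * (1/2) ^ n)"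
   proof (rule ennreal_leI)
    have "2 ^ n * (B * ((1/4) ^ n + (1/4) ^ Suc n)) = B * (5/4) * (2 ^ n * (1/4) ^ n)" by (simp add: field_simps)
    also have "(2::real) ^ n * (1/4) ^ n = (1/2) ^ n" unfolding power_mult_distrib[symmetric] by simp
    finally have "2 ^ n * (B * ((1/4) ^ n + (1/4) ^ Suc n)) = (5/4) * (B * (1/2) ^ n)" by simp
    moreover have "B * (1/2) ^ n \<ge> 0" using B by simp
    ultimately have "2 ^ n * (B * ((1/4) ^ n + (1/4) ^ Suc n)) <= 2 * (B * (1/2) ^ n)" by linarith
    then show "(1/2) ^ n * measure M (space M) + 2 ^ n * (B * ((1/4) ^ n + (1/4) ^ Suc n)) <= K * (1/2) ^ n"
     unfolding K_def by (simp add: distrib_right)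
   qed
   finally show ?thesis .
  qed
  have K0: "K \<ge> 0" unfolding K_def using B by simp
  have "(\<integral>\<^sup>+x. (\<Sum>n. ennreal (v n x)) \<partial>M) = (\<Sum>n. \<integral>\<^sup>+x. ennreal (v n x) \<partial>M)"
   by (rule nn_integral_suminf) (use vm in measurable)
  also have "... <= (\<Sum>n. ennreal (K * (1/2) ^ n))" by (rule suminf_le[OF vi]) auto
  also have "... = ennreal (\<Sum>n. K * (1/2) ^ n)"
   by (rule suminf_ennreal2) (use K0 in \<open>auto intro!: summable_mult\<close>)
  also have "... < \<infinity>" by simp
  finally have fin: "(\<integral>\<^sup>+x. (\<Sum>n. ennreal (v n x)) \<partial>M) \<noteq> \<infinity>" by simp
  have "AE x in M. (\<Sum>n. ennreal (v n x)) \<noteq> \<infinity>"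
   by (rule nn_integral_PInf_AE[OF _ fin]) (use vm in measurable)
  then show ?thesis
  proof (rule AE_mp, intro AE_I2 impI)
   fix x assume "(\<Sum>n. ennreal (v n x)) \<noteq> \<infinity>"
   then have "summable (%n. v n x)" by (intro summable_suminf_not_top) (auto simp: v_def)
   then have "summable (%n. S (Suc n) x - S n x)" unfolding v_def by (rule summable_norm_cancel)
   then have "convergent (%n. \<Sum>k<n. S (Suc k) x - S k x)" unfolding summable_iff_convergent .
   then have "convergent (%n. S n x - S 0 x)" unfolding sum_lessThan_telescope[of "%n. S n x"] .
   then have "convergent (%n. (S n x - S 0 x) + S 0 x)" by (rule convergent_add[OF _ convergent_const])
   then show "convergent (%n. S n x)" by simp
  qed
 qed
 define f where "f x = lim (%n. S n x)" for x
 have fm: "f \<in> borel_measurable M" unfolding f_def[abs_def] by (rule borel_measurable_lim_metric) (rule Sm)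
 have fat: "(\<integral>\<^sup>+x. ennreal ((cmod (S n x - f x))^2) \<partial>M) <= ennreal (2 * B * (1/4) ^ n)" for n
 proof -
  have "(\<integral>\<^sup>+x. ennreal ((cmod (S n x - f x))^2) \<partial>M) = (\<integral>\<^sup>+x. liminf (%m. ennreal ((cmod (S m x - S n x))^2)) \<partial>M)"
  proof (rule nn_integral_cong_AE)
   show "AE x in M. ennreal ((cmod (S n x - f x))^2) = liminf (%m. ennreal ((cmod (S m x - S n x))^2))"
    using AEconv
   proof (rule AE_mp, intro AE_I2 impI)
    fix x assume "convergent (%n. S n x)"
    then have "(%m. S m x) \<longlonglongrightarrow> f x" unfolding f_def convergent_LIMSEQ_iff .
    then have "(%m. ennreal ((cmod (S m x - S n x))^2)) \<longlonglongrightarrow> ennreal ((cmod (f x - S n x))^2)"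
     by (intro tendsto_ennrealI tendsto_intros)
    from lim_imp_Liminf[OF sequentially_bot this]
    show "ennreal ((cmod (S n x - f x))^2) = liminf (%m. ennreal ((cmod (S m x - S n x))^2))"
     by (simp add: norm_minus_commute)
   qed
  qed
  also have "... <= liminf (%m. \<integral>\<^sup>+x. ennreal ((cmod (S m x - S n x))^2) \<partial>M)"
   by (rule nn_integral_liminf) (use Sm in measurable)
  also have "... <= liminf (%m. ennreal (2 * B * (1/4) ^ n))"
  proof (rule Liminf_mono, unfold eventually_sequentially, intro exI[of _ n] allI impI)
   fix m assume "n <= m"
   then have "(1/4::real) ^ m <= (1/4) ^ n" by (intro power_decreasing) auto
   then have "B * ((1/4) ^ n + (1/4) ^ m) <= B * ((1/4) ^ n + (1/4) ^ n)" using B by (intro mult_left_mono) auto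
   then have "ennreal (B * ((1/4) ^ n + (1/4) ^ m)) <= ennreal (2 * B * (1/4) ^ n)" by (intro ennreal_leI) simp
   then show "(\<integral>\<^sup>+x. ennreal ((cmod (S m x - S n x))^2) \<partial>M) <= ennreal (2 * B * (1/4) ^ n)"
    using nnS[of m n] by (rule order.trans[rotated])
  qed
  also have "... = ennreal (2 * B * (1/4) ^ n)" by (simp add: Liminf_const)
  finally show ?thesis .
 qed
 have fdL: "(%x. S n x - f x) \<in> L2_space M" for n
 proof -
  have "integrable M (%x. (cmod (S n x - f x))^2)"
  proof (rule integrableI_bounded)
   show "(%x. (cmod (S n x - f x))^2) \<in> borel_measurable M" using Sm fm by measurable
   have "(\<integral>\<^sup>+x. ennreal (norm ((cmod (S n x - f x))^2)) \<partial>M) <= ennreal (2 * B * (1/4) ^ n)" using fat[of n] by simp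
   also have "... < \<infinity>" by simp
   finally show "(\<integral>\<^sup>+x. ennreal (norm ((cmod (S n x - f x))^2)) \<partial>M) < \<infinity>" .
  qed
  moreover have "(%x. S n x - f x) \<in> borel_measurable M" using Sm fm by measurable
  ultimately show ?thesis unfolding L2_space_def by simp
 qed
 have fd: "(L2_norm M (%x. S n x - f x))^2 <= 2 * B * (1/4) ^ n" for n
 proof -
  have "ennreal (\<integral>x. (cmod (S n x - f x))^2 \<partial>M) = (\<integral>\<^sup>+x. ennreal ((cmod (S n x - f x))^2) \<partial>M)"
   by (rule nn_integral_eq_integral[symmetric]) (use fdL[of n] in \<open>auto simp: L2_space_def\<close>)
  also have "... <= ennreal (2 * B * (1/4) ^ n)" by (rule fat)
  finally show ?thesis unfolding L2_norm_sq using B by (simp add: ennreal_le_iff)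
 qed
 have fL: "f \<in> L2_space M"
  using L2_add(1)[OF SL[of 0] L2_scale[OF fdL[of 0], of "-1"]] by simp
 have fd': "(L2_norm M (%x. f x - S n x))^2 <= 2 * B * (1/4) ^ n" for n
  using fd[of n] unfolding L2_norm_def by (simp add: norm_minus_commute)
 have fdL': "(%x. f x - S n x) \<in> L2_space M" for n
  using L2_scale[OF fdL[of n], of "-1"] by simp
 have z: "(%n. (1/2::real) ^ n) \<longlonglongrightarrow> 0" by (rule LIMSEQ_power_zero) simp
 have q: "(1/4::real) ^ n = (1/2) ^ n * (1/2) ^ n" for n unfolding power_mult_distrib[symmetric] by simp
 \<comment> \<open>The squared triangle inequality is used with parameter 2^(-n): the main term then
   has a factor tending to 1, and the error factor 1 + 2^n is harmless against 4^(-n).\<close>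
 have key: "X <= Y" if XY: "\<And>n. X - U * ((1/2) ^ n * (1/2) ^ n) <= (1 + (1/2) ^ n) * Y + (1 + 1 / (1/2) ^ n) * (2 * B * (1/4) ^ n)" for X Y U :: real
 proof -
  have eq: "(1 + (1/2) ^ n) * Y + (1 + 1 / (1/2) ^ n) * (2 * B * (1/4) ^ n) = (1 + (1/2) ^ n) * Y + 2 * B * ((1/2) ^ n * (1/2) ^ n + (1/2) ^ n)" for n
   unfolding q by (simp add: field_simps)
  have le: "X - U * ((1/2) ^ n * (1/2) ^ n) <= (1 + (1/2) ^ n) * Y + 2 * B * ((1/2) ^ n * (1/2) ^ n + (1/2) ^ n)" for n
   using XY[of n] unfolding eq .
  have l1: "(%n. X - U * ((1/2) ^ n * (1/2) ^ n)) \<longlonglongrightarrow> X - U * (0 * 0)" by (intro tendsto_intros z)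
  have l2: "(%n. (1 + (1/2) ^ n) * Y + 2 * B * ((1/2) ^ n * (1/2) ^ n + (1/2) ^ n)) \<longlonglongrightarrow> (1 + 0) * Y + 2 * B * (0 * 0 + 0)"
   by (intro tendsto_intros z)
  have "X - U * (0 * 0) <= (1 + 0) * Y + 2 * B * (0 * 0 + 0)"
   by (rule LIMSEQ_le[OF l1 l2]) (use le in blast)
  then show ?thesis by simp
 qed
 show "\<exists>f. has_L2_sum M (%i x. c i * g i x) I f \<and> A * (\<Sum>\<^sub>\<infinity>i\<in>I. (cmod (c i))^2) <= (L2_norm M f)^2 \<and>
   (L2_norm M f)^2 <= B * (\<Sum>\<^sub>\<infinity>i\<in>I. (cmod (c i))^2)"
  unfolding s_def[symmetric]
 proof (rule exI[of _ f], intro conjI)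
  show "A * s <= (L2_norm M f)^2"
  proof (rule key[where U = A])
   fix n
   have "A * (s - (1/4) ^ n) <= A * (\<Sum>i\<in>F n. (cmod (c i))^2)" by (rule mult_left_mono[OF less_imp_le[OF Fs] A])
   also have "... <= (L2_norm M (S n))^2" unfolding S_def T_def by (rule low[OF fF FI])
   also have "S n = (%x. f x + (S n x - f x))" by simp
   also have "(L2_norm M ...)^2 <= (1 + (1/2) ^ n) * (L2_norm M f)^2 + (1 + 1 / (1/2) ^ n) * (L2_norm M (%x. S n x - f x))^2"
    by (rule L2_add(2)[OF fL fdL]) simp
   also have "... <= (1 + (1/2) ^ n) * (L2_norm M f)^2 + (1 + 1 / (1/2) ^ n) * (2 * B * (1/4) ^ n)"
    by (intro add_left_mono mult_left_mono fd) simp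
   finally show "A * s - A * ((1/2) ^ n * (1/2) ^ n) <= (1 + (1/2) ^ n) * (L2_norm M f)^2 + (1 + 1 / (1/2) ^ n) * (2 * B * (1/4) ^ n)"
    unfolding q[symmetric] right_diff_distrib .
  qed
  show "(L2_norm M f)^2 <= B * s"
  proof (rule key[where U = 0])
   fix n
   have "f = (%x. S n x + (f x - S n x))" by simp
   then have "(L2_norm M f)^2 = (L2_norm M (%x. S n x + (f x - S n x)))^2" by (rule arg_cong)
   also have "... <= (1 + (1/2) ^ n) * (L2_norm M (S n))^2 + (1 + 1 / (1/2) ^ n) * (L2_norm M (%x. f x - S n x))^2"
    by (rule L2_add(2)[OF SL fdL']) simp
   also have "... <= (1 + (1/2) ^ n) * (B * s) + (1 + 1 / (1/2) ^ n) * (2 * B * (1/4) ^ n)"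
   proof (intro add_mono mult_left_mono fd')
    have "(L2_norm M (S n))^2 <= B * (\<Sum>i\<in>F n. (cmod (c i))^2)" unfolding S_def T_def by (rule up[OF fF FI])
    also have "... <= B * s" by (rule mult_left_mono[OF le_s[OF fF FI] B])
    finally show "(L2_norm M (S n))^2 <= B * s" .
   qed auto
   finally show "(L2_norm M f)^2 - 0 * ((1/2) ^ n * (1/2) ^ n) <= (1 + (1/2) ^ n) * (B * s) + (1 + 1 / (1/2) ^ n) * (2 * B * (1/4) ^ n)"
    by simp
  qed
  show "has_L2_sum M (%i x. c i * g i x) I f" unfolding has_L2_sum_def
  proof (intro conjI fL)
   show "((%G. L2_norm M (%x. (\<Sum>i\<in>G. c i * g i x) - f x)) \<longlongrightarrow> 0) (finite_subsets_at_top I)"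
   proof (rule tendstoI)
    fix e :: real assume e: "e > 0"
    \<comment> \<open>2 B 4^(-n) comes from the terms of G outside F n, and 4 B 4^(-n) from the
      distance of S n to f.\<close>
    have "(%n. 6 * B * ((1/2) ^ n * (1/2) ^ n)) \<longlonglongrightarrow> 6 * B * (0 * 0)" by (intro tendsto_intros z)
    then have "\<forall>\<^sub>F n in sequentially. 6 * B * ((1/2) ^ n * (1/2) ^ n) < e^2"
     by (rule order_tendstoD(2)) (use e in simp)
    then obtain n where n: "6 * B * (1/4) ^ n < e^2" unfolding q eventually_sequentially by blast
    show "\<forall>\<^sub>F G in finite_subsets_at_top I. dist (L2_norm M (%x. (\<Sum>i\<in>G. c i * g i x) - f x)) 0 < e"
     unfolding eventually_finite_subsets_at_top
    proof (intro exI[of _ "F n"] conjI fF FI allI impI)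
     fix G assume G: "finite G \<and> F n \<subseteq> G \<and> G \<subseteq> I"
     have e1: "(%x. (\<Sum>i\<in>G. c i * g i x) - f x) = (%x. T (G - F n) x + (S n x - f x))"
     proof
      fix x
      have "T G x = T (G \<inter> F n) x + T (G - F n) x" unfolding T_def by (rule sum.Int_Diff) (use G in simp)
      moreover have "G \<inter> F n = F n" using G by blast
      ultimately show "(\<Sum>i\<in>G. c i * g i x) - f x = T (G - F n) x + (S n x - f x)" unfolding S_def T_def by simp
     qed
     have fG: "finite (G - F n)" "G - F n \<subseteq> I" using G by auto
     have "(L2_norm M (%x. (\<Sum>i\<in>G. c i * g i x) - f x))^2 <= (1 + 1) * (L2_norm M (T (G - F n)))^2 + (1 + 1 / 1) * (L2_norm M (%x. S n x - f x))^2"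
      unfolding e1 by (rule L2_add(2)[OF TL[OF fG] fdL]) simp
     also have "... <= (1 + 1) * (B * (1/4) ^ n) + (1 + 1 / 1) * (2 * B * (1/4) ^ n)"
     proof (intro add_mono mult_left_mono fd)
      have "(L2_norm M (T (G - F n)))^2 <= B * (\<Sum>i\<in>G - F n. (cmod (c i))^2)" unfolding T_def by (rule up[OF fG])
      also have "... <= B * (1/4) ^ n" by (rule mult_left_mono[OF tail[OF fG] B]) blast
      finally show "(L2_norm M (T (G - F n)))^2 <= B * (1/4) ^ n" .
     qed auto
     also have "... = 6 * B * (1/4) ^ n" by simp
     also have "... < e^2" by (rule n)
     finally have "L2_norm M (%x. (\<Sum>i\<in>G. c i * g i x) - f x) < e" by (rule power2_less_imp_less) (use e in simp)
     moreover have "L2_norm M (%x. (\<Sum>i\<in>G. c i * g i x) - f x) \<ge> 0" unfolding L2_norm_def by simp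
     ultimately show "dist (L2_norm M (%x. (\<Sum>i\<in>G. c i * g i x) - f x)) 0 < e" by simp
    qed
   qed
  qed
 qed
qed

section \<open>Density\<close>

lemma Ld_translate:
 assumes x: "x \<in> {..<d} \<rightarrow>\<^sub>E (UNIV :: real set)"
 shows "distr (Ld d) (Ld d) (%f. \<lambda>t\<in>{..<d}. x t + f t) = Ld d"
proof -
 interpret product_sigma_finite "%_::nat. lborel :: real measure" ..
 have m: "(%f. \<lambda>t\<in>{..<d}. x t + f t) \<in> measurable (Ld d) (Ld d)"
  unfolding Ld_def by measurable
 have "Pi\<^sub>M {..<d} (%_. lborel) = distr (Ld d) (Ld d) (%f. \<lambda>t\<in>{..<d}. x t + f t)"
 proof (rule PiM_eqI[symmetric])
  show "sets (distr (Ld d) (Ld d) (%f. \<lambda>t\<in>{..<d}. x t + f t)) = sets (Pi\<^sub>M {..<d} (%_. lborel))"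
   unfolding Ld_def by simp
  fix A assume A: "\<And>i. i \<in> {..<d} ==> A i \<in> sets (lborel :: real measure)"
  have As: "PiE {..<d} A \<in> sets (Ld d)" unfolding Ld_def by (rule sets_PiM_I_finite) (use A in auto)
  have v: "(%y. x i + y) -` A i \<in> sets (lborel :: real measure)" if "i \<in> {..<d}" for i
  proof -
   have "(%y. x i + y) \<in> measurable borel (borel :: real measure)" by measurable
   from measurable_sets[OF this, of "A i"] show ?thesis using A[OF that] by simp
  qed
  have "emeasure (distr (Ld d) (Ld d) (%f. \<lambda>t\<in>{..<d}. x t + f t)) (PiE {..<d} A) =
    emeasure (Ld d) ((%f. \<lambda>t\<in>{..<d}. x t + f t) -` (PiE {..<d} A) \<inter> space (Ld d))"
   by (rule emeasure_distr[OF m As])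
  also have "(%f. \<lambda>t\<in>{..<d}. x t + f t) -` (PiE {..<d} A) \<inter> space (Ld d) = PiE {..<d} (%i. (%y. x i + y) -` A i)"
  proof (rule Set.set_eqI)
   fix f
   show "f \<in> (%f. \<lambda>t\<in>{..<d}. x t + f t) -` (PiE {..<d} A) \<inter> space (Ld d) \<longleftrightarrow> f \<in> PiE {..<d} (%i. (%y. x i + y) -` A i)"
    unfolding space_Ld vimage_def Int_iff mem_Collect_eq restrict_PiE_iff PiE_iff by simp
  qed
  also have "emeasure (Ld d) ... = (\<Prod>i<d. emeasure lborel ((%y. x i + y) -` A i))"
   unfolding Ld_def by (rule emeasure_PiM) (use v in auto)
  also have "... = (\<Prod>i<d. emeasure lborel (A i))"
  proof (rule prod.cong[OF refl])
   fix i assume i: "i \<in> {..<d}"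
   have "emeasure lborel (A i) = emeasure (distr lborel borel (%y. x i + y)) (A i)" by (simp add: lborel_distr_plus)
   also have "... = emeasure lborel ((%y. x i + y) -` A i \<inter> space lborel)"
    by (rule emeasure_distr) (use A[OF i] in auto)
   finally show "emeasure lborel ((%y. x i + y) -` A i) = emeasure lborel (A i)" by simp
  qed
  finally show "emeasure (distr (Ld d) (Ld d) (%f. \<lambda>t\<in>{..<d}. x t + f t)) (PiE {..<d} A) = (\<Prod>i<d. emeasure lborel (A i))" .
 qed simp
 then show ?thesis unfolding Ld_def by simp
qed

definition cb :: "nat => (nat => real) => real => (nat => real) set" where
 "cb d x r = {y \<in> vecs d. L2_set (%i. y i - x i) {..<d} <= r}"

lemma L2_set_measurable:
 "(%y. L2_set (%i. y i - x i) {..<d}) \<in> borel_measurable (Ld d)"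
 unfolding L2_set_def
 by (intro borel_measurable_sqrt borel_measurable_sum borel_measurable_power borel_measurable_diff borel_measurable_const coord_Ld
   measurable_compose[OF _ borel_measurable_sqrt]) auto

lemma cb_sets: "cb d x r \<in> sets (Ld d)"
proof -
 have "cb d x r = {y \<in> space (Ld d). L2_set (%i. y i - x i) {..<d} <= r}" unfolding cb_def space_Ld ..
 then show ?thesis using L2_set_measurable[of x d] by simp
qed

lemma ball_sets: "ball_dim d x r \<in> sets (Ld d)"
proof -
 have "ball_dim d x r = {y \<in> space (Ld d). L2_set (%i. y i - x i) {..<d} < r}" unfolding ball_dim_def space_Ld ..
 then show ?thesis using L2_set_measurable[of x d] by simp
qed

text \<open>Translation invariance moves the centre to 0, where the ball volume in product
  coordinates is available.\<close>

lemma emeasure_cb: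
 assumes x: "x \<in> vecs d" and r: "r > 0"
 shows "emeasure (Ld d) (cb d x r) = ennreal (unit_ball_vol (real d) * r ^ d)"
proof -
 have m: "(%f. \<lambda>t\<in>{..<d}. x t + f t) \<in> measurable (Ld d) (Ld d)"
  unfolding Ld_def by measurable
 have "emeasure (Ld d) (cb d x r) = emeasure (distr (Ld d) (Ld d) (%f. \<lambda>t\<in>{..<d}. x t + f t)) (cb d x r)"
  unfolding Ld_translate[OF x] ..
 also have "... = emeasure (Ld d) ((%f. \<lambda>t\<in>{..<d}. x t + f t) -` cb d x r \<inter> space (Ld d))"
  by (rule emeasure_distr[OF m cb_sets])
 also have "(%f. \<lambda>t\<in>{..<d}. x t + f t) -` cb d x r \<inter> space (Ld d) = {f. sqrt (\<Sum>i<d. (f i)^2) <= r} \<inter> space (Pi\<^sub>M {..<d} (%_. lborel))"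
 proof (rule Set.set_eqI)
  fix f
  have "L2_set (%i. (\<lambda>t\<in>{..<d}. x t + f t) i - x i) {..<d} = sqrt (\<Sum>i<d. (f i)^2)"
   unfolding L2_set_def by (intro arg_cong[where f = sqrt] sum.cong) auto
  moreover have "(\<lambda>t\<in>{..<d}. x t + f t) \<in> vecs d" unfolding restrict_PiE_iff by simp
  ultimately show "f \<in> (%f. \<lambda>t\<in>{..<d}. x t + f t) -` cb d x r \<inter> space (Ld d) \<longleftrightarrow> f \<in> {f. sqrt (\<Sum>i<d. (f i)^2) <= r} \<inter> space (Pi\<^sub>M {..<d} (%_. lborel))"
   unfolding cb_def Ld_def vimage_def by simp
 qed
 also have "emeasure (Ld d) ... = ennreal (unit_ball_vol (real (card {..<d})) * r ^ card {..<d})"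
  unfolding Ld_def by (rule emeasure_cball_aux) (use r in auto)
 finally show ?thesis by simp
qed

lemma emeasure_leb: "A \<in> sets (Ld d) ==> emeasure (lebesgue_dim d) A = emeasure (Ld d) A"
 unfolding lebesgue_dim_def Ld_def by simp

lemma ennreal_inverse_antimono: "a <= b ==> inverse b <= inverse (a::ennreal)"
 including ennreal.lifting
 by transfer (rule ereal_inverse_antimono)

text \<open>\<delta> = d r bounds the diameter of a tile, so every tile meeting the ball of radius s
  - 2 \<delta> has its M points inside the ball of radius s around the same centre. These tiles
  cover the smaller ball, hence their number is at least its volume over r^d. The resulting factor
  (1 - 2 \<delta>/s)^d tends to 1 independently of the centre.\<close>

lemma density_bound:
 assumes d: "d \<ge> 1" and r: "(r::nat) > 0"
  and yE: "\<And>\<kappa> j. \<kappa> \<in> vecs d ==> j < M ==> y (\<kappa>, j) \<in> vecs d"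
  and box: "\<And>\<kappa> j t. \<kappa> \<in> vecs d ==> j < M ==> t < d ==> real r * of_int (\<kappa> t) <= y (\<kappa>, j) t \<and> y (\<kappa>, j) t <= real r * (of_int (\<kappa> t) + 1)"
  and inj: "inj_on y (vecs d \<times> {..<M})"
 shows "ennreal (real M / real r ^ d) <= lower_beurling_density d (y ` (vecs d \<times> {..<M}))"
proof -
 define E where "E = {..<d} \<rightarrow>\<^sub>E (UNIV :: int set)"
 define \<Lambda> where "\<Lambda> = y ` (E \<times> {..<M})"
 define C where "C = unit_ball_vol (real d)"
 have C: "C > 0" unfolding C_def by simp
 define \<delta> where "\<delta> = real d * real r"
 have \<delta>: "\<delta> > 0" unfolding \<delta>_def using d r by simp
 define qq where "qq s = real M / real r ^ d * (1 - 2 * \<delta> / s) ^ d" for s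
 have main: "ennreal (qq s) <= emeasure (count_space UNIV) (\<Lambda> \<inter> ball_dim d x s) / emeasure (lebesgue_dim d) (ball_dim d x s)"
  if s: "s > 2 * \<delta>" and x: "x \<in> vecs d" for s x
 proof -
  have s0: "s > 0" using s \<delta> by linarith
  define fl where "fl z = (\<lambda>t\<in>{..<d}. \<lfloor>z t / real r\<rfloor>)" for z :: "nat => real"
  define B where "B = cb d x (s - 2 * \<delta>)"
  define T where "T = fl ` B"
  have coord: "\<bar>z t - x t\<bar> <= L2_set (%i. z i - x i) {..<d}" if "t < d" for z t
  proof -
   have "\<bar>z t - x t\<bar> = sqrt ((z t - x t)^2)" by simp
   also have "... <= L2_set (%i. z i - x i) {..<d}" unfolding L2_set_def
    by (rule real_sqrt_le_mono, rule member_le_sum) (use that in auto)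
   finally show ?thesis .
  qed
  have TE: "T \<subseteq> E" unfolding T_def E_def fl_def by (rule image_subsetI) (simp add: restrict_PiE_iff)
  have finT: "finite T"
  proof (rule finite_subset)
   show "T \<subseteq> PiE {..<d} (%t. {\<lfloor>(x t - s) / real r\<rfloor>..\<lfloor>(x t + s) / real r\<rfloor>})"
    unfolding T_def
   proof (rule image_subsetI)
    fix z assume z: "z \<in> B"
    show "fl z \<in> PiE {..<d} (%t. {\<lfloor>(x t - s) / real r\<rfloor>..\<lfloor>(x t + s) / real r\<rfloor>})"
     unfolding fl_def restrict_PiE_iff
    proof
     fix t assume "t \<in> {..<d}"
     then have "\<bar>z t - x t\<bar> <= s - 2 * \<delta>" using coord[of t z] z unfolding B_def cb_def by force
     then have "x t - s <= z t" "z t <= x t + s" using \<delta> by linarith+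
     then show "\<lfloor>z t / real r\<rfloor> \<in> {\<lfloor>(x t - s) / real r\<rfloor>..\<lfloor>(x t + s) / real r\<rfloor>}"
      by (auto intro!: floor_mono divide_right_mono)
    qed
   qed
   show "finite (PiE {..<d} (%t. {\<lfloor>(x t - s) / real r\<rfloor>..\<lfloor>(x t + s) / real r\<rfloor>}))" by (intro finite_PiE) auto
  qed
  have near: "y (\<kappa>, j) \<in> ball_dim d x s" if k: "\<kappa> \<in> T" and j: "j < M" for \<kappa> j
  proof -
   obtain z where z: "z \<in> B" "\<kappa> = fl z" using k unfolding T_def by (elim imageE)
   have kE: "\<kappa> \<in> vecs d" using TE k unfolding E_def by blast
   have zc: "\<bar>y (\<kappa>, j) t - z t\<bar> <= real r" if t: "t < d" for t
   proof -
    define k' where "k' = real_of_int (\<kappa> t)"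
    have "\<kappa> t = \<lfloor>z t / real r\<rfloor>" unfolding z(2) fl_def using t by simp
    then have "k' <= z t / real r" "z t / real r < k' + 1" unfolding k'_def by linarith+
    then have "real r * k' <= z t" "z t <= real r * (k' + 1)" using r by (simp_all add: field_simps)
    moreover have "real r * k' <= y (\<kappa>, j) t" "y (\<kappa>, j) t <= real r * (k' + 1)" using box[OF kE j t] unfolding k'_def by auto
    moreover have "real r * (k' + 1) = real r * k' + real r" by (simp add: algebra_simps)
    moreover have "a <= p ==> p <= b ==> a <= q ==> q <= b ==> b = a + c ==> \<bar>q - p\<bar> <= c" for a b c p q :: real by linarith
    ultimately show ?thesis by blast
   qed
   have "L2_set (%i. y (\<kappa>, j) i - z i) {..<d} <= (\<Sum>i<d. \<bar>y (\<kappa>, j) i - z i\<bar>)" by (rule L2_set_le_sum_abs)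
   also have "... <= (\<Sum>i<d. real r)" by (rule sum_mono) (use zc in auto)
   finally have 1: "L2_set (%i. y (\<kappa>, j) i - z i) {..<d} <= \<delta>" unfolding \<delta>_def by simp
   have "L2_set (%i. y (\<kappa>, j) i - x i) {..<d} = L2_set (%i. (y (\<kappa>, j) i - z i) + (z i - x i)) {..<d}" by simp
   also have "... <= L2_set (%i. y (\<kappa>, j) i - z i) {..<d} + L2_set (%i. z i - x i) {..<d}" by (rule L2_set_triangle_ineq)
   also have "L2_set (%i. z i - x i) {..<d} <= s - 2 * \<delta>" using z unfolding B_def cb_def by simp
   finally have "L2_set (%i. y (\<kappa>, j) i - x i) {..<d} < s" using 1 \<delta> by linarith
   then show ?thesis unfolding ball_dim_def using yE[OF kE j] by simp
  qed
  have sub: "y ` (T \<times> {..<M}) \<subseteq> \<Lambda> \<inter> ball_dim d x s" unfolding \<Lambda>_def using TE near by auto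
  have cardT: "card (y ` (T \<times> {..<M})) = card T * M"
   by (subst card_image, rule inj_on_subset[OF inj]) (use TE in \<open>auto simp: E_def card_cartesian_product\<close>)
  have "ennreal (real (card T * M)) = emeasure (count_space UNIV) (y ` (T \<times> {..<M}))"
   unfolding cardT[symmetric] by (subst emeasure_count_space_finite) (use finT in \<open>auto simp: ennreal_of_nat_eq_real_of_nat\<close>)
  also have "... <= emeasure (count_space UNIV) (\<Lambda> \<inter> ball_dim d x s)" by (rule emeasure_mono[OF sub]) simp
  finally have cnt: "ennreal (real (card T * M)) <= emeasure (count_space UNIV) (\<Lambda> \<inter> ball_dim d x s)" .
  have vol: "C * (s - 2 * \<delta>) ^ d <= real (card T) * real r ^ d"
  proof -
   interpret product_sigma_finite "%_::nat. lborel :: real measure" ..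
   define cube where "cube \<kappa> = PiE {..<d} (%t. {real r * of_int (\<kappa> t)..real r * (of_int (\<kappa> t) + 1)})" for \<kappa> :: "nat => int"
   have cs: "cube \<kappa> \<in> sets (Ld d)" for \<kappa> unfolding cube_def Ld_def by (rule sets_PiM_I_finite) auto
   have cm: "emeasure (Ld d) (cube \<kappa>) = ennreal (real r ^ d)" for \<kappa>
   proof -
    have "emeasure (Ld d) (cube \<kappa>) = (\<Prod>t<d. emeasure lborel {real r * of_int (\<kappa> t)..real r * (of_int (\<kappa> t) + 1)})"
     unfolding cube_def Ld_def by (rule emeasure_PiM) auto
    also have "... = (\<Prod>t<d. ennreal (real r))"
    proof (rule prod.cong[OF refl])
     fix t
     have "real r * of_int (\<kappa> t) <= real r * (of_int (\<kappa> t) + 1)" by (rule mult_left_mono) auto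
     then show "emeasure lborel {real r * of_int (\<kappa> t)..real r * (of_int (\<kappa> t) + 1)} = ennreal (real r)"
      by (subst emeasure_lborel_Icc) (simp_all add: algebra_simps)
    qed
    also have "... = ennreal (real r ^ d)" by (simp add: ennreal_power)
    finally show ?thesis .
   qed
   have BU: "B \<subseteq> (\<Union>\<kappa>\<in>T. cube \<kappa>)"
   proof
    fix z assume z: "z \<in> B"
    have zE: "z \<in> vecs d" using z unfolding B_def cb_def by simp
    have "z t \<in> {real r * of_int (fl z t)..real r * (of_int (fl z t) + 1)}" if t: "t \<in> {..<d}" for t
    proof -
     have "fl z t = \<lfloor>z t / real r\<rfloor>" unfolding fl_def using t by simp
     then have "of_int (fl z t) <= z t / real r" "z t / real r < of_int (fl z t) + 1" by linarith+
     then show ?thesis using r by (simp add: field_simps)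
    qed
    then have "z \<in> cube (fl z)" unfolding cube_def using zE by (simp add: PiE_iff)
    then show "z \<in> (\<Union>\<kappa>\<in>T. cube \<kappa>)" using z unfolding T_def by blast
   qed
   have "ennreal (C * (s - 2 * \<delta>) ^ d) = emeasure (Ld d) B" unfolding B_def C_def
    by (rule emeasure_cb[symmetric, OF x]) (use s in simp)
   also have "... <= emeasure (Ld d) (\<Union>\<kappa>\<in>T. cube \<kappa>)" by (rule emeasure_mono[OF BU]) (use cs finT in auto)
   also have "... <= (\<Sum>\<kappa>\<in>T. emeasure (Ld d) (cube \<kappa>))" by (rule emeasure_subadditive_finite[OF finT]) (use cs in auto)
   also have "... = ennreal (real (card T) * real r ^ d)" unfolding cm
    by (simp add: ennreal_of_nat_eq_real_of_nat ennreal_mult)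
   finally show ?thesis by (subst (asm) ennreal_le_iff) auto
  qed
  have qle: "qq s <= real (card T * M) / (C * s ^ d)"
  proof -
   have "(1 - 2 * \<delta> / s) ^ d = (s - 2 * \<delta>) ^ d / s ^ d"
    unfolding power_divide[symmetric] using s0 by (simp add: diff_divide_distrib)
   then have "qq s = real M * (C * (s - 2 * \<delta>) ^ d) / (real r ^ d * (C * s ^ d))" unfolding qq_def using C by simp
   also have "... <= real M * (real (card T) * real r ^ d) / (real r ^ d * (C * s ^ d))"
    by (intro divide_right_mono mult_left_mono vol) (use C s0 in auto)
   also have "... = real (card T * M) / (C * s ^ d)" using r by simp
   finally show ?thesis .
  qed
  have bl: "emeasure (lebesgue_dim d) (ball_dim d x s) <= ennreal (C * s ^ d)"
  proof -
   have sub_cb: "ball_dim d x s \<subseteq> cb d x s"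
   proof
    fix z assume "z \<in> ball_dim d x s"
    then have z: "z \<in> vecs d" "L2_set (%i. z i - x i) {..<d} < s" unfolding ball_dim_def by simp_all
    show "z \<in> cb d x s" unfolding cb_def by (rule CollectI, rule conjI[OF z(1) less_imp_le[OF z(2)]])
   qed
   have "emeasure (lebesgue_dim d) (ball_dim d x s) = emeasure (Ld d) (ball_dim d x s)" by (rule emeasure_leb[OF ball_sets])
   also have "... <= emeasure (Ld d) (cb d x s)" by (rule emeasure_mono[OF sub_cb cb_sets])
   finally show ?thesis unfolding emeasure_cb[OF x s0] C_def .
  qed
  have "ennreal (qq s) <= ennreal (real (card T * M) / (C * s ^ d))" by (rule ennreal_leI[OF qle])
  also have "... = ennreal (real (card T * M)) / ennreal (C * s ^ d)" by (rule divide_ennreal[symmetric]) (use C s0 in auto)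
  also have "... <= emeasure (count_space UNIV) (\<Lambda> \<inter> ball_dim d x s) / ennreal (C * s ^ d)" by (rule divide_right_mono_ennreal[OF cnt])
  also have "... <= emeasure (count_space UNIV) (\<Lambda> \<inter> ball_dim d x s) / emeasure (lebesgue_dim d) (ball_dim d x s)"
   unfolding divide_ennreal_def by (intro mult_left_mono ennreal_inverse_antimono bl) simp
  finally show ?thesis .
 qed
 have lim: "(qq \<longlongrightarrow> real M / real r ^ d * (1 - 0) ^ d) at_top"
  unfolding qq_def[abs_def]
  by (intro tendsto_mult tendsto_const tendsto_power tendsto_diff tendsto_divide_0[OF tendsto_const] filterlim_at_top_imp_at_infinity filterlim_ident)
 then have "((%s. ennreal (qq s)) \<longlongrightarrow> ennreal (real M / real r ^ d)) at_top" by (intro tendsto_ennrealI) simp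
 from lim_imp_Liminf[OF _ this] have "ennreal (real M / real r ^ d) = Liminf at_top (%s. ennreal (qq s))" by simp
 also have "... <= lower_beurling_density d \<Lambda>" unfolding lower_beurling_density_def
 proof (rule Liminf_mono)
  show "\<forall>\<^sub>F s in at_top. ennreal (qq s) <= (INF x\<in>vecs d. emeasure (count_space UNIV) (\<Lambda> \<inter> ball_dim d x s) / emeasure (lebesgue_dim d) (ball_dim d x s))"
   using eventually_gt_at_top[of "2 * \<delta>"] by (rule eventually_mono) (intro INF_greatest main)
 qed
 finally show ?thesis unfolding \<Lambda>_def E_def .
qed

section \<open>Exponentials on a Lebesgue measurable set and the conclusion\<close>

abbreviation leb_on :: "nat => (nat => real) set => (nat => real) measure" where
 "leb_on d \<Omega> \<equiv> restrict_space (lebesgue_dim d) \<Omega>"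

lemma exponential_on_eq: "exponential_on d \<Omega> \<xi> x = indicator \<Omega> x *\<^sub>R ch (\<Sum>t<d. \<xi> t * x t)"
 unfolding exponential_on_def inner_dim_def ch_def cis_conv_exp by (simp add: indicator_def mult_ac)

lemma phase_leb: "(%x. ch (\<Sum>t<d. \<xi> t * x t)) \<in> borel_measurable (lebesgue_dim d)"
 unfolding lebesgue_dim_def Ld_def[symmetric] by (rule measurable_completion[OF phase_measurable'])

lemma exponential_on_measurable:
 assumes "\<Omega> \<in> sets (lebesgue_dim d)"
 shows "exponential_on d \<Omega> \<xi> \<in> borel_measurable (leb_on d \<Omega>)"
 unfolding exponential_on_eq[abs_def]
 by (intro measurable_restrict_space1 borel_measurable_scaleR borel_measurable_indicator phase_leb assms)

lemma finite_measure_restrict_leb: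
 assumes "\<Omega> \<in> sets (lebesgue_dim d)" "emeasure (lebesgue_dim d) \<Omega> < \<infinity>"
 shows "finite_measure (leb_on d \<Omega>)"
proof (rule finite_measureI)
 have "\<Omega> \<subseteq> space (lebesgue_dim d)" using sets.sets_into_space[OF assms(1)] .
 then have s: "space (leb_on d \<Omega>) = \<Omega>" unfolding space_restrict_space by (rule Int_absorb2)
 have "emeasure (leb_on d \<Omega>) \<Omega> = emeasure (lebesgue_dim d) \<Omega>"
  by (rule emeasure_restrict_space) (use assms(1) in auto)
 then show "emeasure (leb_on d \<Omega>) (space (leb_on d \<Omega>)) \<noteq> \<infinity>"
  unfolding s using assms(2) by simp
qed

lemma exponential_on_L2:
 assumes "\<Omega> \<in> sets (lebesgue_dim d)" "emeasure (lebesgue_dim d) \<Omega> < \<infinity>"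
 shows "exponential_on d \<Omega> \<xi> \<in> L2_space (leb_on d \<Omega>)"
 unfolding L2_space_def
proof (rule CollectI, rule conjI)
 interpret finite_measure "leb_on d \<Omega>" by (rule finite_measure_restrict_leb[OF assms])
 show m: "exponential_on d \<Omega> \<xi> \<in> borel_measurable (leb_on d \<Omega>)"
  by (rule exponential_on_measurable[OF assms(1)])
 have "norm ((cmod (exponential_on d \<Omega> \<xi> x))^2) <= 1" for x
  unfolding exponential_on_eq by (simp add: norm_ch indicator_def)
 then show "integrable (leb_on d \<Omega>) (%x. (cmod (exponential_on d \<Omega> \<xi> x))^2)"
  by (intro integrable_const_bound[of _ 1] AE_I2 borel_measurable_power measurable_compose[OF m borel_measurable_norm])
qed

text \<open>Grid approximation takes place in the uncompleted product space. A Lebesgue set agrees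
  with a set of that space up to a null set, which affects neither the measure nor L2 norms.\<close>

lemma leb_main_part:
 assumes "\<Omega> \<in> sets (lebesgue_dim d)" "emeasure (lebesgue_dim d) \<Omega> < \<infinity>"
 obtains S where "S \<in> fmeasurable (Ld d)" "measure (Ld d) S = measure (lebesgue_dim d) \<Omega>"
  "AE x in lebesgue_dim d. x \<in> \<Omega> \<longleftrightarrow> x \<in> S"
proof -
 from assms(1) have "\<Omega> \<in> sets (completion (Ld d))" unfolding lebesgue_dim_def Ld_def .
 then obtain S N N' where S: "\<Omega> = S \<union> N" "N \<subseteq> N'" "N' \<in> null_sets (Ld d)" "S \<in> sets (Ld d)" by (rule sets_completionE)
 have "AE x in Ld d. x \<notin> N'" by (rule AE_not_in[OF S(3)])
 then have "AE x in lebesgue_dim d. x \<notin> N'" unfolding lebesgue_dim_def Ld_def[symmetric] by (rule AE_completion)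
 then have ae: "AE x in lebesgue_dim d. x \<in> \<Omega> \<longleftrightarrow> x \<in> S" by (rule AE_mp) (use S(1,2) in \<open>intro AE_I2, blast\<close>)
 have S': "S \<in> sets (lebesgue_dim d)" using S(4) unfolding lebesgue_dim_def Ld_def by simp
 have e: "emeasure (lebesgue_dim d) \<Omega> = emeasure (Ld d) S"
  unfolding emeasure_leb[OF S(4), symmetric] by (rule emeasure_eq_AE[OF ae assms(1) S'])
 show ?thesis
 proof (rule that[OF _ _ ae])
  show "S \<in> fmeasurable (Ld d)" using S(4) assms(2) unfolding e by (rule fmeasurableI)
  show "measure (Ld d) S = measure (lebesgue_dim d) \<Omega>" unfolding measure_def e ..
 qed
qed

text \<open>Expanding the square produces the kernel at the differences b - a. Frequencies label
  themselves here, hence the identity as the family of points.\<close>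

lemma L2_norm_exponentials:
 assumes W: "\<Omega> \<in> sets (lebesgue_dim d)"
  and S: "S \<in> fmeasurable (Ld d)" and ae: "AE x in lebesgue_dim d. x \<in> \<Omega> \<longleftrightarrow> x \<in> S"
 shows "(L2_norm (leb_on d \<Omega>) (%x. \<Sum>a\<in>F. c a * exponential_on d \<Omega> a x))^2 = QF (kO d S) (%a. a) F c"
proof -
 define h where "h x = (\<Sum>a\<in>F. c a * ch (\<Sum>t<d. a t * x t))" for x
 have hm: "h \<in> borel_measurable (Ld d)" unfolding h_def[abs_def]
  by (intro borel_measurable_sum borel_measurable_times borel_measurable_const phase_measurable')
 have hl: "h \<in> borel_measurable (lebesgue_dim d)" unfolding lebesgue_dim_def Ld_def[symmetric] by (rule measurable_completion[OF hm])
 have Ss: "S \<in> sets (Ld d)" using S by (rule fmeasurableD)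
 then have Sl: "S \<in> sets (lebesgue_dim d)" unfolding lebesgue_dim_def Ld_def by simp
 have sub: "\<Omega> \<subseteq> space (lebesgue_dim d)" using sets.sets_into_space[OF W] .
 have "(L2_norm (leb_on d \<Omega>) (%x. \<Sum>a\<in>F. c a * exponential_on d \<Omega> a x))^2
   = (\<integral>x. indicator \<Omega> x *\<^sub>R (cmod (\<Sum>a\<in>F. c a * exponential_on d \<Omega> a x))^2 \<partial>lebesgue_dim d)"
  unfolding L2_norm_sq by (rule integral_restrict_space) (use W sub in \<open>simp add: Int_absorb2\<close>)
 also have "... = (\<integral>x. indicator \<Omega> x *\<^sub>R (cmod (h x))^2 \<partial>lebesgue_dim d)"
  by (rule Bochner_Integration.integral_cong[OF refl]) (simp add: indicator_def exponential_on_eq h_def)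
 also have "... = (\<integral>x. indicator S x *\<^sub>R (cmod (h x))^2 \<partial>lebesgue_dim d)"
 proof (rule integral_cong_AE)
  show "AE x in lebesgue_dim d. indicator \<Omega> x *\<^sub>R (cmod (h x))^2 = indicator S x *\<^sub>R (cmod (h x))^2"
   using ae by (rule AE_mp) (intro AE_I2, simp add: indicator_def)
 qed (intro borel_measurable_scaleR borel_measurable_indicator borel_measurable_power measurable_compose[OF hl borel_measurable_norm] W Sl)+
 also have "... = (\<integral>x. indicator S x *\<^sub>R (cmod (h x))^2 \<partial>Ld d)"
  unfolding lebesgue_dim_def Ld_def[symmetric]
  by (rule integral_completion) (intro borel_measurable_scaleR borel_measurable_indicator borel_measurable_power measurable_compose[OF hm borel_measurable_norm] Ss)
 finally have 1: "(L2_norm (leb_on d \<Omega>) (%x. \<Sum>a\<in>F. c a * exponential_on d \<Omega> a x))^2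
   = (\<integral>x. indicator S x *\<^sub>R (cmod (h x))^2 \<partial>Ld d)" .
 define k where "k a b x = indicator S x *\<^sub>R ch (\<Sum>t<d. (b t - a t) * x t)" for a b x :: "nat => real"
 have ki: "integrable (Ld d) (k a b)" for a b unfolding k_def[abs_def]
  by (rule integrable_ind[OF S phase_measurable']) (simp add: norm_ch)
 have pw: "complex_of_real (indicator S x *\<^sub>R (cmod (h x))^2) = (\<Sum>a\<in>F. \<Sum>b\<in>F. cnj (c a) * c b * k a b x)" for x
 proof -
  have e: "cnj (ch (\<Sum>t<d. a t * x t)) * ch (\<Sum>t<d. b t * x t) = ch (\<Sum>t<d. (b t - a t) * x t)" for a b :: "nat => real"
   unfolding ch_cnj ch_add[symmetric] by (simp add: left_diff_distrib sum_subtractf)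
  have "complex_of_real ((cmod (h x))^2) = cnj (h x) * h x" unfolding complex_norm_square by (rule mult.commute)
  also have "... = (\<Sum>a\<in>F. \<Sum>b\<in>F. cnj (c a * ch (\<Sum>t<d. a t * x t)) * (c b * ch (\<Sum>t<d. b t * x t)))"
   unfolding h_def cnj_sum by (rule sum_product)
  also have "... = (\<Sum>a\<in>F. \<Sum>b\<in>F. cnj (c a) * c b * ch (\<Sum>t<d. (b t - a t) * x t))"
   unfolding e[symmetric] by (simp add: mult_ac)
  finally show ?thesis unfolding k_def by (simp add: indicator_def)
 qed
 have "complex_of_real (\<integral>x. indicator S x *\<^sub>R (cmod (h x))^2 \<partial>Ld d) = (\<integral>x. (\<Sum>a\<in>F. \<Sum>b\<in>F. cnj (c a) * c b * k a b x) \<partial>Ld d)"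
  unfolding pw[symmetric] by (rule integral_complex_of_real[symmetric])
 also have "... = (\<Sum>a\<in>F. \<integral>x. (\<Sum>b\<in>F. cnj (c a) * c b * k a b x) \<partial>Ld d)"
  by (rule Bochner_Integration.integral_sum) (intro Bochner_Integration.integrable_sum integrable_mult_right ki)
 also have "... = (\<Sum>a\<in>F. \<Sum>b\<in>F. \<integral>x. cnj (c a) * c b * k a b x \<partial>Ld d)"
  by (intro sum.cong[OF refl] Bochner_Integration.integral_sum integrable_mult_right ki)
 also have "... = (\<Sum>a\<in>F. \<Sum>b\<in>F. cnj (c a) * c b * kO d S (%t. b t - a t))"
  unfolding kO_def k_def[symmetric] by (simp only: integral_mult_right_zero)
 finally have 2: "complex_of_real (\<integral>x. indicator S x *\<^sub>R (cmod (h x))^2 \<partial>Ld d) = (\<Sum>a\<in>F. \<Sum>b\<in>F. cnj (c a) * c b * kO d S (%t. b t - a t))" .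
 show ?thesis unfolding 1 QF_def 2[symmetric] by (rule Re_complex_of_real[symmetric])
qed

lemma riesz_empty:
 assumes W: "\<Omega> \<in> sets (lebesgue_dim d)" "emeasure (lebesgue_dim d) \<Omega> < \<infinity>" and "A \<ge> 0" "B \<ge> 0"
 shows "riesz_bounds (leb_on d \<Omega>) g {} A B"
 by (rule riesz_bounds_finite[OF finite_measure_restrict_leb[OF W] _ _ assms(3,4)]) (auto simp: L2_norm_def)

text \<open>The labels (\<kappa>, j) are traded for points. If two labels had the same point, the
  coefficients 1 and -1 on them would give the form the value 0, against the lower bound 2 \<gamma>
  D / 4^l. So y is injective, which justifies both counting its image for the density and reindexing
  the Riesz inequalities.\<close>

lemma main_case:
 fixes \<epsilon> :: real and d l :: nat
 assumes d: "d \<ge> 1" and eps: "0 < \<epsilon>" "\<epsilon> < 1" and l: "1 / 2 ^ l <= \<epsilon> / 8" and g: "\<gamma> = \<epsilon> / 1280000 / (50 * 4 ^ l)"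
  and W: "\<Omega> \<in> sets (lebesgue_dim d)" "emeasure (lebesgue_dim d) \<Omega> < \<infinity>" and D: "D = measure (lebesgue_dim d) \<Omega>" "D > 0"
 shows "\<exists>\<Lambda> \<subseteq> vecs d. countable \<Lambda> \<and> enn2ereal (lower_beurling_density d \<Lambda>) \<ge> ereal ((1 - \<epsilon>) * D) \<and>
  riesz_sequence (leb_on d \<Omega>) (exponential_on d \<Omega>) \<Lambda> \<and>
  riesz_bounds (leb_on d \<Omega>) (exponential_on d \<Omega>) \<Lambda> (\<gamma> / 4 ^ l * D) (20000 * D)"
proof -
 obtain S where S: "S \<in> fmeasurable (Ld d)" "measure (Ld d) S = measure (lebesgue_dim d) \<Omega>"
  and ae: "AE x in lebesgue_dim d. x \<in> \<Omega> \<longleftrightarrow> x \<in> S" by (rule leb_main_part[OF W])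
 have D': "D = measure (Ld d) S" unfolding S(2) by (rule D(1))
 define E where "E = ({..<d} \<rightarrow>\<^sub>E (UNIV::int set))"
 have "\<exists>(r::nat) (M::nat) y. r > 0 \<and> (1 - \<epsilon>) * (real r ^ d * D) <= real M \<and>
  (\<forall>\<kappa>\<in>E. \<forall>j<M. y (\<kappa>, j) \<in> vecs d \<and> (\<forall>t<d. real r * of_int (\<kappa> t) <= y (\<kappa>, j) t \<and> y (\<kappa>, j) t <= real r * (of_int (\<kappa> t) + 1))) \<and>
  (\<forall>F c. finite F \<longrightarrow> F \<subseteq> E \<times> {..<M} \<longrightarrow> \<gamma> / 4 ^ l * D * (\<Sum>a\<in>F. (cmod (c a))^2) <= QF (kO d S) y F c \<and>
   QF (kO d S) y F c <= 20000 * D * (\<Sum>a\<in>F. (cmod (c a))^2))"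
  unfolding E_def by (rule limit_points[OF d eps refl l g S(1) D' D(2)])
 then obtain r M :: nat and y where r: "r > 0" and rM: "(1 - \<epsilon>) * (real r ^ d * D) <= real M"
  and y: "\<forall>\<kappa>\<in>E. \<forall>j<M. y (\<kappa>, j) \<in> vecs d \<and> (\<forall>t<d. real r * of_int (\<kappa> t) <= y (\<kappa>, j) t \<and> y (\<kappa>, j) t <= real r * (of_int (\<kappa> t) + 1))"
  and Q: "\<forall>F c. finite F \<longrightarrow> F \<subseteq> E \<times> {..<M} \<longrightarrow> \<gamma> / 4 ^ l * D * (\<Sum>a\<in>F. (cmod (c a))^2) <= QF (kO d S) y F c \<and>
   QF (kO d S) y F c <= 20000 * D * (\<Sum>a\<in>F. (cmod (c a))^2)"
  by (elim exE conjE)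
 define P where "P = E \<times> {..<M}"
 have g0: "\<gamma> / 4 ^ l * D > 0" unfolding g using eps D(2) by simp
 have inj: "inj_on y P"
 proof (rule inj_onI, rule ccontr)
  fix a b assume ab: "a \<in> P" "b \<in> P" and e: "y a = y b" and n: "a \<noteq> b"
  define c where "c i = (if i = a then 1 else -1 :: complex)" for i
  have z: "QF (kO d S) y {a, b} c = 0" unfolding QF_def c_def using n e by simp
  have "\<gamma> / 4 ^ l * D * (\<Sum>i\<in>{a, b}. (cmod (c i))^2) <= QF (kO d S) y {a, b} c"
   using Q[THEN spec, THEN spec, of "{a, b}" c] ab unfolding P_def[symmetric] by simp
  moreover have "(\<Sum>i\<in>{a, b}. (cmod (c i))^2) = 2" unfolding c_def using n by simp
  ultimately have le: "\<gamma> / 4 ^ l * D * 2 <= 0" unfolding z by (simp only:)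
  have "\<gamma> / 4 ^ l * D * 2 > 0" by (rule mult_pos_pos[OF g0]) simp
  with leD[OF le] show False by (rule notE)
 qed
 define \<Lambda> where "\<Lambda> = y ` P"
 have cP: "countable P" unfolding P_def E_def by (rule countable_SIGMA[OF countable_int_PiE]) simp
 have cL: "countable \<Lambda>" unfolding \<Lambda>_def by (rule countable_image[OF cP])
 have sub: "\<Lambda> \<subseteq> vecs d"
 proof
  fix z assume "z \<in> \<Lambda>"
  then obtain \<kappa> j where "\<kappa> \<in> E" "j < M" "z = y (\<kappa>, j)" unfolding \<Lambda>_def P_def by (elim imageE SigmaE) simp
  then show "z \<in> vecs d" using y by simp
 qed
 have tr: "\<gamma> / 4 ^ l * D * (\<Sum>a\<in>F. (cmod (c a))^2) <= QF (kO d S) (%a. a) F c \<and> QF (kO d S) (%a. a) F c <= 20000 * D * (\<Sum>a\<in>F. (cmod (c a))^2)"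
  if F: "finite F" "F \<subseteq> \<Lambda>" for F c
 proof -
  obtain G where G: "G \<subseteq> P" "F = y ` G" using F(2) unfolding \<Lambda>_def subset_image_iff by (elim exE conjE)
  have iG: "inj_on y G" by (rule inj_on_subset[OF inj G(1)])
  have fG: "finite G" using F(1) unfolding G(2) by (rule finite_imageD[OF _ iG])
  have 1: "(\<Sum>a\<in>F. (cmod (c a))^2) = (\<Sum>a\<in>G. (cmod ((c \<circ> y) a))^2)" unfolding G(2) sum.reindex[OF iG] by simp
  have 2: "QF (kO d S) (%a. a) F c = QF (kO d S) y G (c \<circ> y)" unfolding QF_def G(2) sum.reindex[OF iG] by simp
  have GP: "G \<subseteq> E \<times> {..<M}" using G(1) unfolding P_def .
  show ?thesis unfolding 1 2 by (rule Q[THEN spec, THEN spec, THEN mp, THEN mp, OF fG GP])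
 qed
 have rb: "riesz_bounds (leb_on d \<Omega>) (exponential_on d \<Omega>) \<Lambda> (\<gamma> / 4 ^ l * D) (20000 * D)"
 proof (rule riesz_bounds_finite[OF finite_measure_restrict_leb[OF W] cL exponential_on_L2[OF W]])
  show "0 <= \<gamma> / 4 ^ l * D" using g0 by (rule less_imp_le)
  show "0 <= 20000 * D" using D(2) by simp
 next
  fix F c assume F: "finite F" "F \<subseteq> \<Lambda>"
  show "\<gamma> / 4 ^ l * D * (\<Sum>i\<in>F. (cmod (c i))^2) <= (L2_norm (leb_on d \<Omega>) (%x. \<Sum>i\<in>F. c i * exponential_on d \<Omega> i x))^2"
   unfolding L2_norm_exponentials[OF W(1) S(1) ae] by (rule conjunct1[OF tr[OF F]])
  show "(L2_norm (leb_on d \<Omega>) (%x. \<Sum>i\<in>F. c i * exponential_on d \<Omega> i x))^2 <= 20000 * D * (\<Sum>i\<in>F. (cmod (c i))^2)"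
   unfolding L2_norm_exponentials[OF W(1) S(1) ae] by (rule conjunct2[OF tr[OF F]])
 qed
 have D20: "20000 * D > 0" using D(2) by simp
 have rs: "riesz_sequence (leb_on d \<Omega>) (exponential_on d \<Omega>) \<Lambda>"
  unfolding riesz_sequence_def by (rule exI, rule conjI[OF g0], rule exI, rule conjI[OF D20 rb])
 have db: "ennreal (real M / real r ^ d) <= lower_beurling_density d \<Lambda>"
  unfolding \<Lambda>_def P_def E_def
 proof (rule density_bound[OF d r])
  show "y (\<kappa>, j) \<in> vecs d" if "\<kappa> \<in> vecs d" "j < M" for \<kappa> j
   using y that unfolding E_def by simp
  show "real r * of_int (\<kappa> t) <= y (\<kappa>, j) t \<and> y (\<kappa>, j) t <= real r * (of_int (\<kappa> t) + 1)" if "\<kappa> \<in> vecs d" "j < M" "t < d" for \<kappa> j t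
   using y that unfolding E_def by simp
  show "inj_on y (vecs d \<times> {..<M})" using inj unfolding P_def E_def .
 qed
 have "(1 - \<epsilon>) * D <= real M / real r ^ d" using rM r by (simp add: field_simps)
 then have "ereal ((1 - \<epsilon>) * D) <= ereal (real M / real r ^ d)" by simp
 also have "... = enn2ereal (ennreal (real M / real r ^ d))" by (rule enn2ereal_ennreal[symmetric]) simp
 also have "... <= enn2ereal (lower_beurling_density d \<Lambda>)" using db unfolding less_eq_ennreal.rep_eq .
 finally have dens: "ereal ((1 - \<epsilon>) * D) <= enn2ereal (lower_beurling_density d \<Lambda>)" .
 show ?thesis by (rule exI[of _ \<Lambda>], intro conjI sub cL dens rs rb)
qed

theorem theorem5p1:
  "\<exists>(c1 :: real \<Rightarrow> real) (c2 :: real).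
     (\<forall>\<epsilon>>0. c1 \<epsilon> > 0) \<and> c2 > 0 \<and>
     (\<forall>(d::nat) (\<Omega> :: (nat \<Rightarrow> real) set) (\<epsilon>::real).
        d \<ge> 1 \<longrightarrow> \<Omega> \<in> sets (lebesgue_dim d) \<longrightarrow> emeasure (lebesgue_dim d) \<Omega> < \<infinity> \<longrightarrow> \<epsilon> > 0 \<longrightarrow>
        (\<exists>\<Lambda> \<subseteq> {..<d} \<rightarrow>\<^sub>E UNIV.
           countable \<Lambda> \<and>
           enn2ereal (lower_beurling_density d \<Lambda>) \<ge> ereal ((1 - \<epsilon>) * measure (lebesgue_dim d) \<Omega>) \<and>
           riesz_sequence (restrict_space (lebesgue_dim d) \<Omega>) (exponential_on d \<Omega>) \<Lambda> \<and>
           riesz_bounds (restrict_space (lebesgue_dim d) \<Omega>) (exponential_on d \<Omega>) \<Lambda>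
             (c1 \<epsilon> * measure (lebesgue_dim d) \<Omega>) (c2 * measure (lebesgue_dim d) \<Omega>)))"
proof -
 \<comment> \<open>A choice depending on \<epsilon> alone; 2^l >= l >= 8 / \<epsilon> is more than
   enough.\<close>
 define l where "l \<epsilon> = nat \<lceil>8 / \<epsilon>\<rceil>" for \<epsilon> :: real
 define \<gamma> where "\<gamma> \<epsilon> = \<epsilon> / 1280000 / (50 * 4 ^ l \<epsilon>)" for \<epsilon> :: real
 have l: "1 / 2 ^ l \<epsilon> <= \<epsilon> / 8" if "\<epsilon> > 0" for \<epsilon>
 proof -
  have "8 / \<epsilon> <= real (l \<epsilon>)" unfolding l_def by (rule real_nat_ceiling_ge)
  also have "... <= 2 ^ l \<epsilon>" by (rule less_imp_le[OF of_nat_less_two_power])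
  finally show ?thesis using that by (simp add: field_simps)
 qed
 have c1: "\<gamma> \<epsilon> / 4 ^ l \<epsilon> > 0" if "\<epsilon> > 0" for \<epsilon> unfolding \<gamma>_def using that by simp
 show ?thesis
 proof (rule exI[of _ "%\<epsilon>. \<gamma> \<epsilon> / 4 ^ l \<epsilon>"], rule exI[of _ 20000], intro conjI allI impI)
  show "0 < \<gamma> \<epsilon> / 4 ^ l \<epsilon>" if "0 < \<epsilon>" for \<epsilon> by (rule c1[OF that])
  show "(0::real) < 20000" by simp
  fix d :: nat and \<Omega> :: "(nat => real) set" and \<epsilon> :: real
  assume d: "d \<ge> 1" and W: "\<Omega> \<in> sets (lebesgue_dim d)" "emeasure (lebesgue_dim d) \<Omega> < \<infinity>" and eps: "\<epsilon> > 0"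
  define D where "D = measure (lebesgue_dim d) \<Omega>"
  have D0: "D \<ge> 0" unfolding D_def by simp
  show "\<exists>\<Lambda> \<subseteq> vecs d. countable \<Lambda> \<and>
      enn2ereal (lower_beurling_density d \<Lambda>) \<ge> ereal ((1 - \<epsilon>) * measure (lebesgue_dim d) \<Omega>) \<and>
      riesz_sequence (leb_on d \<Omega>) (exponential_on d \<Omega>) \<Lambda> \<and>
      riesz_bounds (leb_on d \<Omega>) (exponential_on d \<Omega>) \<Lambda>
       (\<gamma> \<epsilon> / 4 ^ l \<epsilon> * measure (lebesgue_dim d) \<Omega>) (20000 * measure (lebesgue_dim d) \<Omega>)"
   unfolding D_def[symmetric]
  proof (cases "\<epsilon> < 1 \<and> D > 0")
   case True
   then have t: "\<epsilon> < 1" "D > 0" by simp_all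
   show "\<exists>\<Lambda> \<subseteq> vecs d. countable \<Lambda> \<and> enn2ereal (lower_beurling_density d \<Lambda>) \<ge> ereal ((1 - \<epsilon>) * D) \<and>
      riesz_sequence (leb_on d \<Omega>) (exponential_on d \<Omega>) \<Lambda> \<and>
      riesz_bounds (leb_on d \<Omega>) (exponential_on d \<Omega>) \<Lambda> (\<gamma> \<epsilon> / 4 ^ l \<epsilon> * D) (20000 * D)"
    by (rule main_case[OF d eps t(1) l[OF eps] \<gamma>_def W D_def t(2)])
  next
   case False
   \<comment> \<open>For \<epsilon> >= 1 or a null set the required density is not positive, so the
     empty set of frequencies qualifies: its only combination is 0, and the bounds 1 and 1 witness
     \<open>riesz_sequence\<close>.\<close>
   then have "(1 - \<epsilon>) * D <= 0" using D0 by (cases "D = 0") (simp_all add: mult_nonpos_nonneg)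
   then have "ereal ((1 - \<epsilon>) * D) <= 0" by simp
   also have "0 <= enn2ereal (lower_beurling_density d {})" by simp
   finally have dens: "ereal ((1 - \<epsilon>) * D) <= enn2ereal (lower_beurling_density d {})" .
   have c1D: "0 <= \<gamma> \<epsilon> / 4 ^ l \<epsilon> * D" by (rule mult_nonneg_nonneg[OF less_imp_le[OF c1[OF eps]] D0])
   have one: "(1::real) > 0" by simp
   have rs: "riesz_sequence (leb_on d \<Omega>) (exponential_on d \<Omega>) {}"
    unfolding riesz_sequence_def
    by (rule exI, rule conjI[OF one], rule exI, rule conjI[OF one riesz_empty[OF W]]) simp_all
   have D20: "0 <= 20000 * D" using D0 by simp
   show "\<exists>\<Lambda> \<subseteq> vecs d. countable \<Lambda> \<and> enn2ereal (lower_beurling_density d \<Lambda>) \<ge> ereal ((1 - \<epsilon>) * D) \<and>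
      riesz_sequence (leb_on d \<Omega>) (exponential_on d \<Omega>) \<Lambda> \<and>
      riesz_bounds (leb_on d \<Omega>) (exponential_on d \<Omega>) \<Lambda> (\<gamma> \<epsilon> / 4 ^ l \<epsilon> * D) (20000 * D)"
    by (rule exI[of _ "{}"], intro conjI empty_subsetI countable_empty dens rs riesz_empty[OF W c1D D20])
  qed
 qed
qed

end
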